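(* Let $(W,H,\mu)$ be a complex abstract Wiener space, $\mathbf{C}$ a finite dimensional complex inner product space, $\omega:W\times W\to\mathbf{C}$ a continuous skew-symmetric complex bilinear form, and $G_{CM}=H\times\mathbf{C}$ the associated Cameron–Martin group. Let $T>0$. If $f\in\mathcal{H}_T^2(G_{CM})$, then for all $g\in G_{CM}$ $$|f(g)|\le\|f\|_{\mathcal{H}_T^2(G_{CM})}\,e^{d_{G_{CM}}^2(\mathbf{e},g)/(2T)},$$ where $d_{G_{CM}}$ is the left-invariant Riemannian distance on $G_{CM}$.
   Context: Complex abstract Wiener space $(W,H,\mu)$: $W$ is a complex separable Banach space, $W_{\mathrm{Re}}$ is $W$ viewed as a real Banach space, $\mu$ is a Borel probability measure on $W$ with $\int_W e^{iu(w)}d\mu(w)=e^{-q(u,u)/2}$ for all $u\in W_{\mathrm{Re}}^*$, where $q$ is an inner product on $W_{\mathrm{Re}}^*$, and $\mu$ is invariant under $w\mapsto iw$. Put $\|w\|_H:=\sup_{u\in W_{\mathrm{Re}}^*\setminus\{0\}}|u(w)|/\sqrt{q(u,u)}$ and $H:=\{h\in W:\|h\|_H<\infty\}$; $H$ is a dense complex subspace of $W$, and $\|\cdot\|_H$ comes from a unique complex inner product $\langle\cdot,\cdot\rangle_H$ making $H$ a separable complex Hilbert space continuously embedded in $W$. Groups: $G_{CM}=H\times\mathbf{C}$ with $(w_1,c_1)\cdot(w_2,c_2)=(w_1+w_2,c_1+c_2+\frac12\omega(w_1,w_2))$, identity $\mathbf{e}=(0,0)$, and Lie algebra $\mathfrak{g}_{CM}=H\times\mathbf{C}$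 with inner product $\langle(A,a),(B,b)\rangle_{\mathfrak{g}_{CM}}=\langle A,B\rangle_H+\langle a,b\rangle_{\mathbf{C}}$ (also defining the topology of $G_{CM}$). Distance: for a $C^1$ path $\sigma=(w,c):[0,1]\to G_{CM}$, $\ell_{G_{CM}}(\sigma)=\int_0^1\|l_{\sigma(s)^{-1}*}\sigma'(s)\|_{\mathfrak{g}_{CM}}ds$, where $l_g$ is left translation (explicitly $l_{\sigma^{-1}*}\sigma'=(w',c'-\frac12\omega(w,w'))$); $d_{G_{CM}}(x,y)$ is the infimum of $\ell_{G_{CM}}(\sigma)$ over $C^1$ paths from $x$ to $y$. $\mathrm{Proj}(W)$: finite rank continuous complex linear maps $P:W\to H$ with $P|_H$ an orthogonal projection. $G_P:=PW\times\mathbf{C}\subset G_{CM}$. Brownian motion: $b(t)=(B(t),B_0(t))$ is a Brownian motion on $W\times\mathbf{C}$ with $\mathbb{E}[\mathrm{Re}\langle b(s),h\rangle_{\mathfrak{g}_{CM}}\mathrm{Re}\langle b(t),k\rangle_{\mathfrak{g}_{CM}}]=\frac12\mathrm{Re}\langle h,k\rangle_{\mathfrak{g}_{CM}}\,s\wedge t$ for all $h,k\in H_*\times\mathbf{C}$, where $H_*$ is the set of $h\in H$ for which $\langle\cdot,h\rangle_H$ extends continuously to $W$. For $P\in\mathrm{Proj}(W)$, $g_P(t)=(PB(t),B_0(t)+\frac12\int_0^t\omega(PB(\tau),dPB(\tau)))$ and $\nu_t^P:=\mathrm{Law}(g_P(t))$ on $G_P$. $\mathcal{H}(G_{CM})$: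 holomorphic functions $f:G_{CM}\to\mathbb{C}$ (locally bounded and complex Gâteaux differentiable on the Hilbert space $H\times\mathbf{C}$). $\|f\|_{\mathcal{H}_T^2(G_{CM})}:=\sup_{P\in\mathrm{Proj}(W)}\|f|_{G_P}\|_{L^2(G_P,\nu_T^P)}$ and $\mathcal{H}_T^2(G_{CM}):=\{f\in\mathcal{H}(G_{CM}):\|f\|_{\mathcal{H}_T^2(G_{CM})}<\infty\}$. *)

theory Defs
  imports "HOL-Probability.Probability"
begin

section \<open>Complex normed and inner product spaces\<close>

class complex_normed_vector = real_normed_vector +
  fixes scaleC :: "complex \<Rightarrow> 'a \<Rightarrow> 'a" (infixr "*\<^sub>C" 75)
  assumes scaleC_add_right: "a *\<^sub>C (x + y) = a *\<^sub>C x + a *\<^sub>C y"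
    and scaleC_add_left: "(a + b) *\<^sub>C x = a *\<^sub>C x + b *\<^sub>C x"
    and scaleC_scaleC: "a *\<^sub>C b *\<^sub>C x = (a * b) *\<^sub>C x"
    and scaleC_of_real: "complex_of_real r *\<^sub>C x = r *\<^sub>R x"
    and norm_scaleC: "norm (a *\<^sub>C x) = cmod a * norm x"

text \<open>Complex inner products are linear in the first argument throughout.\<close>

class complex_inner_space = complex_normed_vector +
  fixes cinner :: "'a \<Rightarrow> 'a \<Rightarrow> complex"
  assumes cinner_commute: "cinner x y = cnj (cinner y x)"
    and cinner_add_left: "cinner (x + y) z = cinner x z + cinner y z"
    and cinner_scaleC_left: "cinner (a *\<^sub>C x) y = a * cinner x y"
    and norm_eq_sqrt_cinner: "norm x = sqrt (Re (cinner x x))"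

text \<open>Unlike \<^class>\<open>euclidean_space\<close>, this class also allows dimension 0.\<close>

class fin_dim_complex_inner_space = complex_inner_space +
  assumes ex_finite_spanning:
    "\<exists>B. finite B \<and> (\<forall>x. \<exists>a :: 'a \<Rightarrow> complex. x = (\<Sum>b\<in>B. a b *\<^sub>C b))"

lemma scaleC_minus_left:
  "(a - b) *\<^sub>C x = a *\<^sub>C x - b *\<^sub>C (x :: 'a :: complex_normed_vector)"
  by (metis add_diff_cancel diff_add_cancel scaleC_add_left)

instance fin_dim_complex_inner_space \<subseteq> second_countable_topology
proof
  obtain B :: "'a set" where B: "finite B"
    and span: "\<And>x. \<exists>a :: 'a \<Rightarrow> complex. x = (\<Sum>b\<in>B. a b *\<^sub>C b)"
    using ex_finite_spanning by blast
  obtain D0 :: "complex set" where D0: "countable D0"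
    and dense0: "\<And>X. open X \<Longrightarrow> X \<noteq> {} \<Longrightarrow> \<exists>d\<in>D0. d \<in> X"
    using countable_dense_exists by blast
  define D where "D = (\<lambda>a. \<Sum>b\<in>B. a b *\<^sub>C b) ` (B \<rightarrow>\<^sub>E D0)"
  have cD: "countable D"
    unfolding D_def using B D0 by (intro countable_image countable_PiE) auto
  have dense: "\<exists>d\<in>D. dist d x < e" if "e > 0" for x :: 'a and e :: real
  proof -
    define S where "S = 1 + (\<Sum>b\<in>B. norm b)"
    have S: "S > 0" unfolding S_def by (simp add: add_pos_nonneg sum_nonneg)
    obtain a where a: "x = (\<Sum>b\<in>B. a b *\<^sub>C b)" using span by blast
    have "\<forall>b. \<exists>d\<in>D0. d \<in> ball (a b) (e / S)"
      using divide_pos_pos[OF that S] by (intro allI dense0) auto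
    then obtain a' where a': "\<And>b. a' b \<in> D0" "\<And>b. dist (a b) (a' b) < e / S"
      unfolding mem_ball by metis
    define d where "d = (\<Sum>b\<in>B. restrict a' B b *\<^sub>C b)"
    have "d \<in> D" unfolding D_def d_def using a'(1) by (intro imageI) auto
    moreover have "dist d x < e"
    proof -
      have "d - x = (\<Sum>b\<in>B. (a' b - a b) *\<^sub>C b)"
        unfolding d_def a by (simp add: sum_subtractf scaleC_minus_left)
      then have "dist d x \<le> (\<Sum>b\<in>B. norm ((a' b - a b) *\<^sub>C b))"
        by (simp add: dist_norm norm_sum)
      also have "\<dots> \<le> (\<Sum>b\<in>B. e / S * norm b)"
      proof (rule sum_mono)
        fix b
        have "cmod (a' b - a b) \<le> e / S"
          using a'(2)[of b] by (simp only: dist_norm norm_minus_commute less_imp_le)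
        then show "norm ((a' b - a b) *\<^sub>C b) \<le> e / S * norm b"
          unfolding norm_scaleC by (rule mult_right_mono) simp
      qed
      also have "\<dots> = e / S * (S - 1)" by (simp add: S_def sum_distrib_left)
      also have "\<dots> < e" using S that by (simp add: field_simps)
      finally show ?thesis .
    qed
    ultimately show ?thesis by blast
  qed
  let ?B = "(\<lambda>(d, n). ball d (1 / real (Suc n))) ` (D \<times> (UNIV :: nat set))"
  have "topological_basis ?B"
  proof (rule topological_basisI)
    show "open U" if "U \<in> ?B" for U using that by auto
  next
    fix U :: "'a set" and x assume U: "open U" "x \<in> U"
    then obtain e where e: "e > 0" "ball x e \<subseteq> U" using open_contains_ball by blast
    obtain n where n: "1 / real (Suc n) < e / 2"
      using e nat_approx_posE[of "e / 2"] by (metis half_gt_zero)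
    obtain d where d: "d \<in> D" "dist d x < 1 / real (Suc n)"
      using dense[of "1 / real (Suc n)" x] by auto
    have "ball d (1 / real (Suc n)) \<subseteq> ball x e"
    proof
      fix y assume "y \<in> ball d (1 / real (Suc n))"
      then have "dist d y < 1 / real (Suc n)" by simp
      moreover have "dist x y \<le> dist d x + dist d y" by (simp add: dist_triangle3 dist_commute)
      ultimately have "dist x y < e" using d(2) n by linarith
      then show "y \<in> ball x e" by simp
    qed
    then have "x \<in> ball d (1 / real (Suc n)) \<and> ball d (1 / real (Suc n)) \<subseteq> U"
      using d e by auto
    then show "\<exists>V\<in>?B. x \<in> V \<and> V \<subseteq> U" using d(1) by force
  qed
  then have "open = generate_topology ?B" by (rule topological_basis_imp_subbasis)
  moreover have "countable ?B" using cD by auto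
  ultimately show "\<exists>B :: 'a set set. countable B \<and> open = generate_topology B" by blast
qed

instantiation prod :: (complex_normed_vector, complex_normed_vector) complex_normed_vector
begin

definition scaleC_prod_def: "a *\<^sub>C x = (a *\<^sub>C fst x, a *\<^sub>C snd x)"

instance
proof
  fix a b :: complex and r :: real and x y :: "'a \<times> 'b"
  show "norm (a *\<^sub>C x) = cmod a * norm x"
    by (simp add: scaleC_prod_def norm_prod_def norm_scaleC power_mult_distrib
        distrib_left[symmetric] real_sqrt_mult)
qed (simp_all add: scaleC_prod_def prod_eq_iff scaleC_add_right scaleC_add_left
    scaleC_scaleC scaleC_of_real)

end

definition complex_linear ::
    "('a::complex_normed_vector \<Rightarrow> 'b::complex_normed_vector) \<Rightarrow> bool" where
  "complex_linear f \<longleftrightarrow>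
     (\<forall>x y. f (x + y) = f x + f y) \<and> (\<forall>a x. f (a *\<^sub>C x) = a *\<^sub>C f x)"


section \<open>Complex abstract Wiener spaces\<close>

text \<open>The real dual of \<open>W\<close> is the type \<open>'w \<Rightarrow>\<^sub>L real\<close>.\<close>

definition real_inner_product :: "('v::real_vector \<Rightarrow> 'v \<Rightarrow> real) \<Rightarrow> bool" where
  "real_inner_product q \<longleftrightarrow>
     (\<forall>u v. q u v = q v u) \<and>
     (\<forall>u v w. q (u + v) w = q u w + q v w) \<and>
     (\<forall>r u v. q (r *\<^sub>R u) v = r * q u v) \<and>
     (\<forall>u. u \<noteq> 0 \<longrightarrow> 0 < q u u)"

definition complex_wiener_space ::
    "'w::{complex_normed_vector, banach, second_countable_topology} measure \<Rightarrow>
     (('w \<Rightarrow>\<^sub>L real) \<Rightarrow> ('w \<Rightarrow>\<^sub>L real) \<Rightarrow> real) \<Rightarrow> bool" where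
  "complex_wiener_space \<mu> q \<longleftrightarrow>
     sets \<mu> = sets borel \<and> prob_space \<mu> \<and> real_inner_product q \<and>
     (\<forall>u. (CLINT w|\<mu>. iexp (blinfun_apply u w)) = complex_of_real (exp (- q u u / 2))) \<and>
     distr \<mu> borel (\<lambda>w. \<i> *\<^sub>C w) = \<mu>"

definition cm_ennnorm ::
    "(('w::complex_normed_vector \<Rightarrow>\<^sub>L real) \<Rightarrow> ('w \<Rightarrow>\<^sub>L real) \<Rightarrow> real) \<Rightarrow> 'w \<Rightarrow> ennreal" where
  "cm_ennnorm q w = (SUP u \<in> UNIV - {0}. ennreal (\<bar>blinfun_apply u w\<bar> / sqrt (q u u)))"

definition cm_space ::
    "(('w::complex_normed_vector \<Rightarrow>\<^sub>L real) \<Rightarrow> ('w \<Rightarrow>\<^sub>L real) \<Rightarrow> real) \<Rightarrow> 'w set" where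
  "cm_space q = {h. cm_ennnorm q h < \<infinity>}"

definition cm_norm ::
    "(('w::complex_normed_vector \<Rightarrow>\<^sub>L real) \<Rightarrow> ('w \<Rightarrow>\<^sub>L real) \<Rightarrow> real) \<Rightarrow> 'w \<Rightarrow> real" where
  "cm_norm q h = enn2real (cm_ennnorm q h)"

text \<open>The unique complex inner product (linear in the first argument) inducing
  \<^const>\<open>cm_norm\<close> on \<^const>\<open>cm_space\<close>, obtained by polarization.\<close>

definition cm_cinner ::
    "(('w::complex_normed_vector \<Rightarrow>\<^sub>L real) \<Rightarrow> ('w \<Rightarrow>\<^sub>L real) \<Rightarrow> real) \<Rightarrow> 'w \<Rightarrow> 'w \<Rightarrow> complex" where
  "cm_cinner q h k =
     (\<Sum>j<4. \<i> ^ j * complex_of_real ((cm_norm q (h + \<i> ^ j *\<^sub>C k))\<^sup>2)) / 4"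

definition cm_ext_prop ::
    "(('w::complex_normed_vector \<Rightarrow>\<^sub>L real) \<Rightarrow> ('w \<Rightarrow>\<^sub>L real) \<Rightarrow> real) \<Rightarrow> 'w \<Rightarrow> ('w \<Rightarrow> complex) \<Rightarrow> bool" where
  "cm_ext_prop q h \<phi> \<longleftrightarrow> continuous_on UNIV \<phi> \<and> (\<forall>x\<in>cm_space q. \<phi> x = cm_cinner q x h)"

definition cm_star ::
    "(('w::complex_normed_vector \<Rightarrow>\<^sub>L real) \<Rightarrow> ('w \<Rightarrow>\<^sub>L real) \<Rightarrow> real) \<Rightarrow> 'w set" where
  "cm_star q = {h \<in> cm_space q. \<exists>\<phi>. cm_ext_prop q h \<phi>}"

text \<open>The continuous extension is unique because \<^const>\<open>cm_space\<close> is dense.\<close>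

definition cm_ext ::
    "(('w::complex_normed_vector \<Rightarrow>\<^sub>L real) \<Rightarrow> ('w \<Rightarrow>\<^sub>L real) \<Rightarrow> real) \<Rightarrow> 'w \<Rightarrow> 'w \<Rightarrow> complex" where
  "cm_ext q h = (THE \<phi>. cm_ext_prop q h \<phi>)"

definition cm_proj ::
    "(('w::complex_normed_vector \<Rightarrow>\<^sub>L real) \<Rightarrow> ('w \<Rightarrow>\<^sub>L real) \<Rightarrow> real) \<Rightarrow> ('w \<Rightarrow> 'w) set" where
  "cm_proj q = {P. complex_linear P \<and> range P \<subseteq> cm_space q \<and>
     (\<exists>B. finite B \<and> range P \<subseteq> span B) \<and>
     (\<exists>K. \<forall>w. cm_norm q (P w) \<le> K * norm w) \<and>
     (\<forall>h\<in>cm_space q. P (P h) = P h) \<and>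
     (\<forall>h\<in>cm_space q. \<forall>k\<in>cm_space q. cm_cinner q (P h) k = cm_cinner q h (P k))}"


section \<open>The Cameron--Martin group and its Riemannian distance\<close>

definition heis_form ::
    "('w::complex_normed_vector \<Rightarrow> 'w \<Rightarrow> 'c::complex_normed_vector) \<Rightarrow> bool" where
  "heis_form \<omega> \<longleftrightarrow> bounded_bilinear \<omega> \<and>
     (\<forall>a x y. \<omega> (a *\<^sub>C x) y = a *\<^sub>C \<omega> x y) \<and>
     (\<forall>a x y. \<omega> x (a *\<^sub>C y) = a *\<^sub>C \<omega> x y) \<and>
     (\<forall>x y. \<omega> x y = - \<omega> y x)"

definition heis_mult ::
    "('w::real_normed_vector \<Rightarrow> 'w \<Rightarrow> 'c::real_normed_vector) \<Rightarrow> 'w \<times> 'c \<Rightarrow> 'w \<times> 'c \<Rightarrow> 'w \<times> 'c" where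
  "heis_mult \<omega> x y = (fst x + fst y, snd x + snd y + (1/2) *\<^sub>R \<omega> (fst x) (fst y))"

definition heis_inv :: "'w::real_normed_vector \<times> 'c::real_normed_vector \<Rightarrow> 'w \<times> 'c" where
  "heis_inv x = - x"

definition heis_velocity ::
    "('w::real_normed_vector \<Rightarrow> 'w \<Rightarrow> 'c::real_normed_vector) \<Rightarrow> 'w \<times> 'c \<Rightarrow> 'w \<times> 'c \<Rightarrow> 'w \<times> 'c" where
  "heis_velocity \<omega> x v = (fst v, snd v - (1/2) *\<^sub>R \<omega> (fst x) (fst v))"

text \<open>This is the differential at \<open>x\<close> of left translation by the inverse of \<open>x\<close>.\<close>

lemma heis_velocity_derivative:
  assumes "bounded_bilinear \<omega>" and skew: "\<And>x y. \<omega> x y = - \<omega> y x"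
  shows "heis_mult \<omega> x (heis_inv x) = 0"
    and "(heis_mult \<omega> (heis_inv x) has_derivative heis_velocity \<omega> x) (at x)"
proof -
  interpret bounded_bilinear \<omega> by fact
  have diag: "\<omega> z z = 0" for z
  proof -
    have "\<omega> z z + \<omega> z z = 0" using skew[of z z] by (metis add.right_inverse)
    then have "2 *\<^sub>R \<omega> z z = 0" by (simp add: scaleR_2)
    then show ?thesis by simp
  qed
  show "heis_mult \<omega> x (heis_inv x) = 0"
    by (simp add: heis_mult_def heis_inv_def zero_prod_def minus_right diag)
  have eq: "heis_mult \<omega> (heis_inv x) =
      (\<lambda>y. (- fst x + fst y, - snd x + snd y + (1/2) *\<^sub>R \<omega> (- fst x) (fst y)))"
    by (simp add: heis_mult_def heis_inv_def fun_eq_iff)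
  have "((\<lambda>y. (- fst x + fst y, - snd x + snd y + (1/2) *\<^sub>R \<omega> (- fst x) (fst y)))
      has_derivative (\<lambda>v. (fst v, snd v + (1/2) *\<^sub>R \<omega> (- fst x) (fst v)))) (at x)"
    by (auto intro!: derivative_eq_intros bounded_linear.has_derivative[OF bounded_linear_right])
  then show "(heis_mult \<omega> (heis_inv x) has_derivative heis_velocity \<omega> x) (at x)"
    by (simp add: eq heis_velocity_def[abs_def] minus_left)
qed

definition cm_group ::
    "(('w::complex_normed_vector \<Rightarrow>\<^sub>L real) \<Rightarrow> ('w \<Rightarrow>\<^sub>L real) \<Rightarrow> real) \<Rightarrow>
     ('w \<times> 'c::complex_normed_vector) set" where
  "cm_group q = cm_space q \<times> UNIV"

definition cm_group_cinner ::
    "(('w::complex_normed_vector \<Rightarrow>\<^sub>L real) \<Rightarrow> ('w \<Rightarrow>\<^sub>L real) \<Rightarrow> real) \<Rightarrow>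
     'w \<times> 'c::complex_inner_space \<Rightarrow> 'w \<times> 'c \<Rightarrow> complex" where
  "cm_group_cinner q x y = cm_cinner q (fst x) (fst y) + cinner (snd x) (snd y)"

definition cm_group_norm ::
    "(('w::complex_normed_vector \<Rightarrow>\<^sub>L real) \<Rightarrow> ('w \<Rightarrow>\<^sub>L real) \<Rightarrow> real) \<Rightarrow>
     'w \<times> 'c::complex_inner_space \<Rightarrow> real" where
  "cm_group_norm q x = sqrt (Re (cm_group_cinner q x x))"

text \<open>\<open>\<sigma>\<close> is a \<open>C\<^sup>1\<close> path with derivative \<open>\<sigma>'\<close>, for the Hilbert norm
  \<^const>\<open>cm_group_norm\<close> rather than the norm of the ambient type.\<close>

definition cm_C1_path ::
    "(('w::complex_normed_vector \<Rightarrow>\<^sub>L real) \<Rightarrow> ('w \<Rightarrow>\<^sub>L real) \<Rightarrow> real) \<Rightarrow>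
     (real \<Rightarrow> 'w \<times> 'c::complex_inner_space) \<Rightarrow> (real \<Rightarrow> 'w \<times> 'c) \<Rightarrow> bool" where
  "cm_C1_path q \<sigma> \<sigma>' \<longleftrightarrow>
     (\<forall>s\<in>{0..1}. \<sigma> s \<in> cm_group q \<and> \<sigma>' s \<in> cm_group q \<and>
        ((\<lambda>r. cm_group_norm q ((\<sigma> r - \<sigma> s) /\<^sub>R (r - s) - \<sigma>' s)) \<longlongrightarrow> 0) (at s within {0..1}) \<and>
        ((\<lambda>r. cm_group_norm q (\<sigma>' r - \<sigma>' s)) \<longlongrightarrow> 0) (at s within {0..1}))"

definition cm_length ::
    "(('w::complex_normed_vector \<Rightarrow>\<^sub>L real) \<Rightarrow> ('w \<Rightarrow>\<^sub>L real) \<Rightarrow> real) \<Rightarrow>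
     ('w \<Rightarrow> 'w \<Rightarrow> 'c::complex_inner_space) \<Rightarrow>
     (real \<Rightarrow> 'w \<times> 'c) \<Rightarrow> (real \<Rightarrow> 'w \<times> 'c) \<Rightarrow> real" where
  "cm_length q \<omega> \<sigma> \<sigma>' =
     integral {0..1} (\<lambda>s. cm_group_norm q (heis_velocity \<omega> (\<sigma> s) (\<sigma>' s)))"

definition cm_dist ::
    "(('w::complex_normed_vector \<Rightarrow>\<^sub>L real) \<Rightarrow> ('w \<Rightarrow>\<^sub>L real) \<Rightarrow> real) \<Rightarrow>
     ('w \<Rightarrow> 'w \<Rightarrow> 'c::complex_inner_space) \<Rightarrow> 'w \<times> 'c \<Rightarrow> 'w \<times> 'c \<Rightarrow> real" where
  "cm_dist q \<omega> x y =
     Inf {cm_length q \<omega> \<sigma> \<sigma>' | \<sigma> \<sigma>'. cm_C1_path q \<sigma> \<sigma>' \<and> \<sigma> 0 = x \<and> \<sigma> 1 = y}"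

definition cm_holomorphic ::
    "(('w::complex_normed_vector \<Rightarrow>\<^sub>L real) \<Rightarrow> ('w \<Rightarrow>\<^sub>L real) \<Rightarrow> real) \<Rightarrow>
     ('w \<times> 'c::complex_inner_space \<Rightarrow> complex) \<Rightarrow> bool" where
  "cm_holomorphic q f \<longleftrightarrow>
     (\<forall>x\<in>cm_group q. \<exists>r>0. \<exists>K. \<forall>y\<in>cm_group q. cm_group_norm q (y - x) < r \<longrightarrow> cmod (f y) \<le> K) \<and>
     (\<forall>x\<in>cm_group q. \<forall>v\<in>cm_group q.
        (\<lambda>z::complex. f (x + z *\<^sub>C v)) field_differentiable (at 0))"


section \<open>Brownian motion and the Ito integral\<close>

definition past :: "'a measure \<Rightarrow> (real \<Rightarrow> 'a \<Rightarrow> 'v::topological_space) \<Rightarrow> real \<Rightarrow> 'a measure" where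
  "past M b s =
     sigma (space M) (\<Union>r\<in>{0..s}. {b r -` A \<inter> space M | A. A \<in> sets borel})"

text \<open>\<open>V u\<close> is the variance of \<open>u (b 1)\<close>; formulating Gaussianity by the characteristic
  function \<^const>\<open>char\<close> includes the degenerate case \<open>V u = 0\<close>.\<close>

definition brownian_motion ::
    "'a measure \<Rightarrow> (real \<Rightarrow> 'a \<Rightarrow> 'v::real_normed_vector) \<Rightarrow> bool" where
  "brownian_motion M b \<longleftrightarrow> prob_space M \<and>
     (\<forall>t\<ge>0. b t \<in> borel_measurable M) \<and>
     (AE x in M. b 0 x = 0) \<and>
     (AE x in M. continuous_on {0..} (\<lambda>t. b t x)) \<and>
     (\<forall>s t. 0 \<le> s \<and> s \<le> t \<longrightarrow>
        prob_space.indep_set M (sets (past M b s))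
          {(\<lambda>x. b t x - b s x) -` A \<inter> space M | A. A \<in> sets borel}) \<and>
     (\<exists>V :: ('v \<Rightarrow>\<^sub>L real) \<Rightarrow> real. \<forall>u s t y. 0 \<le> V u \<and>
        (0 \<le> s \<and> s \<le> t \<longrightarrow>
           char (distr M borel (\<lambda>x. blinfun_apply u (b t x - b s x))) y =
             complex_of_real (exp (- (t - s) * V u * y\<^sup>2 / 2))))"

definition cm_pairing ::
    "(('w::complex_normed_vector \<Rightarrow>\<^sub>L real) \<Rightarrow> ('w \<Rightarrow>\<^sub>L real) \<Rightarrow> real) \<Rightarrow>
     'w \<times> 'c::complex_inner_space \<Rightarrow> 'w \<times> 'c \<Rightarrow> complex" where
  "cm_pairing q x h = cm_ext q (fst h) (fst x) + cinner (snd x) (snd h)"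

definition cm_brownian_motion ::
    "(('w::complex_normed_vector \<Rightarrow>\<^sub>L real) \<Rightarrow> ('w \<Rightarrow>\<^sub>L real) \<Rightarrow> real) \<Rightarrow>
     'a measure \<Rightarrow> (real \<Rightarrow> 'a \<Rightarrow> 'w \<times> 'c::complex_inner_space) \<Rightarrow> bool" where
  "cm_brownian_motion q M b \<longleftrightarrow> brownian_motion M b \<and>
     (\<forall>h \<in> cm_star q \<times> UNIV. \<forall>k \<in> cm_star q \<times> UNIV. \<forall>s\<ge>0. \<forall>t\<ge>0.
        (LINT x|M. Re (cm_pairing q (b s x) h) * Re (cm_pairing q (b t x) k)) =
          1/2 * Re (cm_group_cinner q h k) * min s t)"

definition simple_process ::
    "nat \<Rightarrow> (nat \<Rightarrow> real) \<Rightarrow> (nat \<Rightarrow> 'a \<Rightarrow> 'v::real_vector) \<Rightarrow> real \<Rightarrow> 'a \<Rightarrow> 'v" where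
  "simple_process n s \<xi> \<tau> x = (\<Sum>i<n. indicator {s i<..s (Suc i)} \<tau> *\<^sub>R \<xi> i x)"

definition simple_integral ::
    "('v \<Rightarrow> 'w \<Rightarrow> 'c::comm_monoid_add) \<Rightarrow> (real \<Rightarrow> 'a \<Rightarrow> 'w::minus) \<Rightarrow>
     nat \<Rightarrow> (nat \<Rightarrow> real) \<Rightarrow> (nat \<Rightarrow> 'a \<Rightarrow> 'v) \<Rightarrow> 'a \<Rightarrow> 'c" where
  "simple_integral \<beta> X n s \<xi> x = (\<Sum>i<n. \<beta> (\<xi> i x) (X (s (Suc i)) x - X (s i) x))"

text \<open>\<open>I\<close> is a version of the Ito integral of \<open>\<beta>(Y(\<tau>), dX(\<tau>))\<close> over \<open>[0,t]\<close> with respect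
  to the filtration \<open>F\<close>: it is the mean square limit of the elementary integrals of simple
  \<open>F\<close>-adapted square integrable processes converging to \<open>Y\<close> in mean square on
  \<open>[0,t] \<times> \<Omega>\<close>.\<close>

definition has_ito_integral ::
    "'a measure \<Rightarrow> (real \<Rightarrow> 'a measure) \<Rightarrow>
     ('v::real_normed_vector \<Rightarrow> 'w::real_normed_vector \<Rightarrow> 'c::real_normed_vector) \<Rightarrow>
     (real \<Rightarrow> 'a \<Rightarrow> 'v) \<Rightarrow> (real \<Rightarrow> 'a \<Rightarrow> 'w) \<Rightarrow> real \<Rightarrow> ('a \<Rightarrow> 'c) \<Rightarrow> bool" where
  "has_ito_integral M F \<beta> Y X t I \<longleftrightarrow> I \<in> borel_measurable M \<and>
     (\<exists>(n :: nat \<Rightarrow> nat) (s :: nat \<Rightarrow> nat \<Rightarrow> real) (\<xi> :: nat \<Rightarrow> nat \<Rightarrow> 'a \<Rightarrow> 'v).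
        (\<forall>k. s k 0 = 0 \<and> s k (n k) = t \<and>
           (\<forall>i<n k. s k i < s k (Suc i) \<and>
              \<xi> k i \<in> borel_measurable (F (s k i)) \<and>
              (\<integral>\<^sup>+x. ennreal ((norm (\<xi> k i x))\<^sup>2) \<partial>M) < \<infinity>)) \<and>
        (\<lambda>k. \<integral>\<^sup>+\<tau>\<in>{0..t}. (\<integral>\<^sup>+x. ennreal ((norm (simple_process (n k) (s k) (\<xi> k) \<tau> x - Y \<tau> x))\<^sup>2) \<partial>M)
            \<partial>lborel) \<longlonglongrightarrow> 0 \<and>
        (\<lambda>k. \<integral>\<^sup>+x. ennreal ((norm (simple_integral \<beta> X (n k) (s k) (\<xi> k) x - I x))\<^sup>2) \<partial>M)
          \<longlonglongrightarrow> 0)"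

text \<open>Versions of the integral agree almost surely, so the choice does not affect laws.\<close>

definition ito_integral ::
    "'a measure \<Rightarrow> (real \<Rightarrow> 'a measure) \<Rightarrow>
     ('v::real_normed_vector \<Rightarrow> 'w::real_normed_vector \<Rightarrow> 'c::real_normed_vector) \<Rightarrow>
     (real \<Rightarrow> 'a \<Rightarrow> 'v) \<Rightarrow> (real \<Rightarrow> 'a \<Rightarrow> 'w) \<Rightarrow> real \<Rightarrow> 'a \<Rightarrow> 'c" where
  "ito_integral M F \<beta> Y X t = (SOME I. has_ito_integral M F \<beta> Y X t I)"


section \<open>Heat kernel measures and square integrable holomorphic functions\<close>

definition heis_brownian_motion ::
    "'a measure \<Rightarrow> (real \<Rightarrow> 'a \<Rightarrow> 'w::complex_normed_vector \<times> 'c::complex_inner_space) \<Rightarrow>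
     ('w \<Rightarrow> 'w \<Rightarrow> 'c) \<Rightarrow> ('w \<Rightarrow> 'w) \<Rightarrow> real \<Rightarrow> 'a \<Rightarrow> 'w \<times> 'c" where
  "heis_brownian_motion M b \<omega> P t x =
     (let PB = (\<lambda>\<tau> y. P (fst (b \<tau> y)))
      in (PB t x, snd (b t x) + (1/2) *\<^sub>R ito_integral M (past M b) \<omega> PB PB t x))"

text \<open>A measure on \<open>G\<^sub>P\<close> with its Borel sets; restricting the space matters because a
  holomorphic function on \<^const>\<open>cm_group\<close> is arbitrary outside it.\<close>

definition heat_measure ::
    "'a measure \<Rightarrow> (real \<Rightarrow> 'a \<Rightarrow> 'w::complex_normed_vector \<times> 'c::complex_inner_space) \<Rightarrow>
     ('w \<Rightarrow> 'w \<Rightarrow> 'c) \<Rightarrow> ('w \<Rightarrow> 'w) \<Rightarrow> real \<Rightarrow> ('w \<times> 'c) measure" where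
  "heat_measure M b \<omega> P t =
     distr M (restrict_space borel (range P \<times> UNIV)) (heis_brownian_motion M b \<omega> P t)"

definition L2_ennnorm :: "'a measure \<Rightarrow> ('a \<Rightarrow> complex) \<Rightarrow> ennreal" where
  "L2_ennnorm N f =
     (let I = (\<integral>\<^sup>+x. ennreal ((cmod (f x))\<^sup>2) \<partial>N)
      in if I = \<infinity> then \<infinity> else ennreal (sqrt (enn2real I)))"

definition hol_L2_norm ::
    "(('w::complex_normed_vector \<Rightarrow>\<^sub>L real) \<Rightarrow> ('w \<Rightarrow>\<^sub>L real) \<Rightarrow> real) \<Rightarrow>
     ('w \<Rightarrow> 'w \<Rightarrow> 'c::complex_inner_space) \<Rightarrow>
     'a measure \<Rightarrow> (real \<Rightarrow> 'a \<Rightarrow> 'w \<times> 'c) \<Rightarrow> real \<Rightarrow> ('w \<times> 'c \<Rightarrow> complex) \<Rightarrow> ennreal" where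
  "hol_L2_norm q \<omega> M b T f = (SUP P \<in> cm_proj q. L2_ennnorm (heat_measure M b \<omega> P T) f)"

definition hol_L2 ::
    "(('w::complex_normed_vector \<Rightarrow>\<^sub>L real) \<Rightarrow> ('w \<Rightarrow>\<^sub>L real) \<Rightarrow> real) \<Rightarrow>
     ('w \<Rightarrow> 'w \<Rightarrow> 'c::complex_inner_space) \<Rightarrow>
     'a measure \<Rightarrow> (real \<Rightarrow> 'a \<Rightarrow> 'w \<times> 'c) \<Rightarrow> real \<Rightarrow> ('w \<times> 'c \<Rightarrow> complex) set" where
  "hol_L2 q \<omega> M b T = {f. cm_holomorphic q f \<and> hol_L2_norm q \<omega> M b T f < \<infinity>}"

end

theory Submission
  imports Defs "HOL-Complex_Analysis.Complex_Analysis"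
begin

text \<open>
  Why the bound holds. A curve from the identity to \<open>g\<close> of length close to \<open>d = cm_dist q \<omega> (0, 0) g\<close>
  is approximated by a product \<open>g = y\<^sub>1 \<cdots> y\<^sub>N\<close> of \<open>N\<close> group elements of equal small norm with
  \<open>N (\<bar>y\<^sub>1\<bar>\<^sup>2 + \<dots> + \<bar>y\<^sub>N\<bar>\<^sup>2)\<close> close to \<open>d\<^sup>2\<close>. The variable \<open>g\<^sub>P(T)\<close> is in the same way a limit of products
  \<open>\<xi>\<^sub>1 \<cdots> \<xi>\<^sub>N\<close> of independent Gaussian increments, each of variance \<open>T / (2 N)\<close> in every real direction.
  Translating \<open>\<xi>\<^sub>i\<close> into \<open>\<xi>\<^sub>i + y\<^sub>i\<close> turns the Gaussian law into one with a Cameron--Martin density, and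
  at the centre \<open>\<xi> = 0\<close> the translated product is \<open>g\<close>. Since \<open>f\<close> is holomorphic and the Gaussian law is
  invariant under \<open>\<xi> \<mapsto> z \<xi>\<close> for \<open>\<bar>z\<bar> = 1\<close>, the submean value inequality in \<open>z\<close> gives
  \<open>\<bar>f g\<bar>\<^sup>2 exp (- N \<Sum> \<bar>y\<^sub>i\<bar>\<^sup>2 / T) \<le> E \<bar>f (\<xi>\<^sub>1 \<cdots> \<xi>\<^sub>N)\<bar>\<^sup>2\<close>, and in the limit
  \<open>\<bar>f g\<bar>\<^sup>2 exp (- d\<^sup>2 / T) \<le> E \<bar>f (g\<^sub>P(T))\<bar>\<^sup>2\<close>, which is the square of the claim. No analysis of the heat
  kernel of the group enters: the whole estimate takes place on finite products of Gaussian lines.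

  Making this precise requires the following.

  \<^item> The finite dimensional estimate is \<open>gaussian_shift_estimate\<close>. It is localized to a rotation
    invariant event, because integrability of \<open>f\<close> is known only for the limit and not for the products;
    \<open>gaussian_estimate_for_grid\<close> then involves \<open>f\<close> only on a bounded set.

  \<^item> A product of increments equals, up to a null set, the projected Brownian motion together with a
    Riemann sum for the Ito integral (\<open>heis_prod_inc\<close>). The Ito isometry, with a constant in place of
    equality, yields existence of the integral and convergence of the Riemann sums in mean square
    (\<open>ito_integral_exists\<close>, \<open>ito_integral_limit\<close>), and the uniform probability bound \<open>good_event_uniform\<close>.
    Together they give \<open>holomorphic_bound_along_refining_products\<close>.

  \<^item> Splitting the factors of a product into equal pieces, in numbers proportional to their norms,
    replaces the energy by the square of the sum of the norms (\<open>holomorphic_bound_at_product\<close>).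

  \<^item> Elements of the infinite dimensional group are reached through the vectors \<open>rep u\<close> that represent
    the covariance with a functional \<open>u\<close>. They are dense in the Cameron--Martin space (\<open>rep_dense\<close>), any
    finite set of them lies in the range of one of the finite rank projections (\<open>frame_containing\<close>),
    and \<open>f\<close> is continuous (\<open>holomorphic_continuous\<close>).

  \<^item> Along a \<open>C\<^sup>1\<close> curve the increments of the group are to first order the left translated velocity, so
    bisection produces products with sum of norms close to the length (\<open>path_product\<close>).
\<close>

section \<open>Sublinear functionals and the Hahn--Banach theorem\<close>

definition sublinear :: "('v::real_vector \<Rightarrow> real) \<Rightarrow> bool" where
  "sublinear p \<longleftrightarrow> (\<forall>x y. p (x + y) \<le> p x + p y) \<and> (\<forall>c\<ge>0. \<forall>x. p (c *\<^sub>R x) = c * p x)"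

lemma sublinear_zero: "sublinear p \<Longrightarrow> p 0 = 0"
  unfolding sublinear_def by (metis mult_zero_left order_refl scaleR_zero_left)

lemma sublinear_neg: "sublinear p \<Longrightarrow> - p (- x) \<le> p x"
  using sublinear_zero[of p] unfolding sublinear_def
  by (metis add.right_inverse add_le_same_cancel2 add_uminus_conv_diff diff_ge_0_iff_ge minus_add_cancel add.commute)

text \<open>Zorn's lemma applies because the pointwise infimum of a chain of sublinear functionals below \<open>p\<close>
  stays above \<open>x \<mapsto> - p (- x)\<close> and is again sublinear.\<close>

lemma minimal_sublinear_exists:
  fixes p :: "'v::real_vector \<Rightarrow> real"
  assumes p: "sublinear p"
  obtains m where "sublinear m" "m \<le> p" "\<And>m'. sublinear m' \<Longrightarrow> m' \<le> m \<Longrightarrow> m' = m"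
proof -
  let ?A = "{m. sublinear m \<and> m \<le> p}"
  have low: "- p (- x) \<le> c x" if "c \<in> ?A" for c x
    using sublinear_neg[of c x] that le_funD[of c p "- x"] by auto
  have "\<exists>m\<in>?A. \<forall>a\<in>?A. a \<le> m \<longrightarrow> a = m"
  proof (rule predicate_Zorn[where P = "\<lambda>x y. y \<le> x"])
    show "partial_order_on ?A (relation_of (\<lambda>x y. y \<le> x) ?A)"
      by (auto simp: partial_order_on_def preorder_on_def refl_on_def trans_def antisym_def relation_of_def)
  next
    fix C assume "C \<in> Chains (relation_of (\<lambda>x y. y \<le> x) ?A)"
    then have CA: "C \<subseteq> ?A" and chain: "\<And>c d. c \<in> C \<Longrightarrow> d \<in> C \<Longrightarrow> c \<le> d \<or> d \<le> c"
      unfolding Chains_def relation_of_def by blast+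
    show "\<exists>u\<in>?A. \<forall>a\<in>C. u \<le> a"
    proof (cases "C = {}")
      case True
      then show ?thesis using p by auto
    next
      case ne: False
      define u where "u x = (INF c\<in>C. c x)" for x
      have bdd: "bdd_below ((\<lambda>c. c x) ` C)" for x
        using CA low by (intro bdd_belowI[of _ "- p (- x)"]) blast
      have u_le: "u x \<le> c x" if "c \<in> C" for c x
        unfolding u_def using that bdd by (intro cINF_lower) auto
      have u_ge: "a \<le> u x" if "\<And>c. c \<in> C \<Longrightarrow> a \<le> c x" for a x
        unfolding u_def using ne that by (intro cINF_greatest) auto
      have "u (x + y) \<le> u x + u y" for x y
      proof -
        have "u (x + y) \<le> c x + d y" if cd: "c \<in> C" "d \<in> C" for c d
        proof -
          obtain e where e: "e \<in> C" "e \<le> c" "e \<le> d" using chain[OF cd] cd by blast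
          have "u (x + y) \<le> e (x + y)" using u_le[OF e(1)] .
          also have "\<dots> \<le> e x + e y" using e CA by (auto simp: sublinear_def)
          also have "\<dots> \<le> c x + d y" using e by (intro add_mono) (auto simp: le_fun_def)
          finally show ?thesis .
        qed
        then have "u (x + y) - d y \<le> u x" if "d \<in> C" for d
          using that by (intro u_ge) (simp add: diff_le_eq)
        then have "u (x + y) - u x \<le> u y"
          by (intro u_ge) (auto simp: diff_le_eq add.commute)
        then show ?thesis by simp
      qed
      moreover have "u (c *\<^sub>R x) = c * u x" if "0 \<le> c" for c x
      proof (cases "c = 0")
        case True
        have "c' 0 = 0" if "c' \<in> C" for c' using CA that sublinear_zero by blast
        then have "(INF c\<in>C. c 0) = (INF c\<in>C. 0)" by (rule INF_cong[OF refl])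
        then show ?thesis using True ne by (simp add: u_def)
      next
        case False
        then have c: "0 < c" using that by simp
        show ?thesis
        proof (rule antisym)
          have "u (c *\<^sub>R x) / c \<le> u x"
          proof (rule u_ge)
            fix d assume d: "d \<in> C"
            have "u (c *\<^sub>R x) \<le> d (c *\<^sub>R x)" using d u_le by blast
            also have "\<dots> = c * d x" using CA c d by (auto simp: sublinear_def)
            finally show "u (c *\<^sub>R x) / c \<le> d x" using c by (simp add: field_simps)
          qed
          then show "u (c *\<^sub>R x) \<le> c * u x" using c by (simp add: field_simps)
          show "c * u x \<le> u (c *\<^sub>R x)"
          proof (rule u_ge)
            fix d assume d: "d \<in> C"
            have "c * u x \<le> c * d x" using c d u_le by auto
            also have "\<dots> = d (c *\<^sub>R x)" using CA c d by (auto simp: sublinear_def)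
            finally show "c * u x \<le> d (c *\<^sub>R x)" .
          qed
        qed
      qed
      moreover have "u \<le> p"
      proof -
        obtain c where c: "c \<in> C" using ne by blast
        have "u \<le> c" using u_le[OF c] by (simp add: le_fun_def)
        also have "c \<le> p" using c CA by blast
        finally show ?thesis .
      qed
      ultimately show ?thesis using u_le by (intro bexI[of _ u]) (auto simp: sublinear_def le_fun_def)
    qed
  qed
  then obtain m where m: "sublinear m" "m \<le> p" "\<And>a. a \<in> ?A \<Longrightarrow> a \<le> m \<Longrightarrow> a = m" by auto
  show ?thesis
  proof (rule that[OF m(1,2)])
    fix m' assume m': "sublinear m'" "m' \<le> m"
    then have "m' \<in> ?A" using order_trans[OF m'(2) m(2)] by blast
    then show "m' = m" using m(3) m'(2) by blast
  qed
qed

text \<open>The largest sublinear functional below \<open>p\<close> whose value at \<open>- z\<close> is at most \<open>- p z\<close>.\<close>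

definition tilt :: "('v::real_vector \<Rightarrow> real) \<Rightarrow> 'v \<Rightarrow> 'v \<Rightarrow> real" where
  "tilt p z x = (INF t\<in>{0..}. p (x + t *\<^sub>R z) - t * p z)"

lemma tilt_sublinear:
  assumes p: "sublinear p"
  shows "sublinear (tilt p z)" "tilt p z \<le> p" "tilt p z (- z) \<le> - p z"
proof -
  have add: "p (x + y) \<le> p x + p y" and sc: "0 \<le> c \<Longrightarrow> p (c *\<^sub>R x) = c * p x" for x y c
    using p by (auto simp: sublinear_def)
  have low: "- p (- x) \<le> p (x + t *\<^sub>R z) - t * p z" if "0 \<le> t" for x t
    using add[of "x + t *\<^sub>R z" "- x"] sc[OF that, of z] by simp
  have bdd: "bdd_below ((\<lambda>t. p (x + t *\<^sub>R z) - t * p z) ` {0..})" for x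
    using low by (intro bdd_belowI[of _ "- p (- x)"]) auto
  have le: "tilt p z x \<le> p (x + t *\<^sub>R z) - t * p z" if "0 \<le> t" for x t
    unfolding tilt_def using that bdd by (intro cINF_lower) auto
  have ge: "a \<le> tilt p z x" if "\<And>t. 0 \<le> t \<Longrightarrow> a \<le> p (x + t *\<^sub>R z) - t * p z" for a x
    unfolding tilt_def using that by (intro cINF_greatest) auto
  show "tilt p z \<le> p" using le[of 0] by (simp add: le_fun_def)
  show "tilt p z (- z) \<le> - p z" using le[of 1 "- z"] sublinear_zero[OF p] by simp
  have "tilt p z (x + y) \<le> tilt p z x + tilt p z y" for x y
  proof -
    have "tilt p z (x + y) \<le> (p (x + s *\<^sub>R z) - s * p z) + (p (y + t *\<^sub>R z) - t * p z)"
      if "0 \<le> s" "0 \<le> t" for s t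
      using le[of "s + t" "x + y"] that add[of "x + s *\<^sub>R z" "y + t *\<^sub>R z"]
      by (simp add: algebra_simps)
    then have "tilt p z (x + y) - (p (y + t *\<^sub>R z) - t * p z) \<le> tilt p z x" if "0 \<le> t" for t
      using that by (intro ge) (simp add: diff_le_eq)
    then have "tilt p z (x + y) - tilt p z x \<le> tilt p z y"
      by (intro ge) (simp add: algebra_simps)
    then show ?thesis by simp
  qed
  moreover have "tilt p z (c *\<^sub>R x) = c * tilt p z x" if "0 \<le> c" for c x
  proof (cases "c = 0")
    case True
    have "p (0 + t *\<^sub>R z) - t * p z = 0" if "t \<in> {0..}" for t using sc that by simp
    then have "tilt p z 0 = (INF t\<in>{0::real..}. 0::real)"
      unfolding tilt_def by (rule INF_cong[OF refl])
    then show ?thesis using True by simp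
  next
    case False
    then have c: "0 < c" using that by simp
    have eq: "p (c *\<^sub>R x + (c * t) *\<^sub>R z) - (c * t) * p z = c * (p (x + t *\<^sub>R z) - t * p z)" for t
      using sc[OF that, of "x + t *\<^sub>R z"] by (simp add: algebra_simps)
    show ?thesis
    proof (rule antisym)
      have "tilt p z (c *\<^sub>R x) / c \<le> tilt p z x"
        using le[of "c * _" "c *\<^sub>R x"] c eq by (intro ge) (simp add: field_simps)
      then show "tilt p z (c *\<^sub>R x) \<le> c * tilt p z x" using c by (simp add: field_simps)
      show "c * tilt p z x \<le> tilt p z (c *\<^sub>R x)"
      proof (rule ge)
        fix t :: real assume t: "0 \<le> t"
        have "c * tilt p z x \<le> c * (p (x + (t / c) *\<^sub>R z) - (t / c) * p z)"
          using le[of "t / c" x] t c by simp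
        also have "\<dots> = p (c *\<^sub>R x + t *\<^sub>R z) - t * p z" using eq[of "t / c"] c by simp
        finally show "c * tilt p z x \<le> p (c *\<^sub>R x + t *\<^sub>R z) - t * p z" .
      qed
    qed
  qed
  ultimately show "sublinear (tilt p z)" by (auto simp: sublinear_def)
qed

text \<open>A minimal sublinear functional equals its own tilt in every direction, so it is odd and therefore
  linear. Starting below the tilt at \<open>z\<close> forces the value \<open>p z\<close> at \<open>z\<close>.\<close>

theorem Hahn_Banach_sublinear:
  fixes p :: "'v::real_vector \<Rightarrow> real"
  assumes p: "sublinear p"
  obtains u where "linear u" "\<And>x. u x \<le> p x" "u z = p z"
proof -
  obtain m where m: "sublinear m" "m \<le> tilt p z" and min: "\<And>m'. sublinear m' \<Longrightarrow> m' \<le> m \<Longrightarrow> m' = m"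
    using minimal_sublinear_exists[OF tilt_sublinear(1)[OF p]] by metis
  have odd: "m (- x) = - m x" for x
  proof (rule antisym)
    have "tilt m x = m" using tilt_sublinear[OF m(1)] min by blast
    then show "m (- x) \<le> - m x" using tilt_sublinear(3)[OF m(1), of x] by simp
    show "- m x \<le> m (- x)" using sublinear_neg[OF m(1), of "- x"] by simp
  qed
  have add: "m (x + y) \<le> m x + m y" and sc: "0 \<le> c \<Longrightarrow> m (c *\<^sub>R x) = c * m x" for x y c
    using m(1) by (auto simp: sublinear_def)
  have "linear m"
  proof (rule linearI)
    show "m (x + y) = m x + m y" for x y
      using add[of x y] add[of "- x" "- y"] odd[of "x + y"] by (simp add: odd)
    show "m (c *\<^sub>R x) = c *\<^sub>R m x" for c x
      using sc[of c x] sc[of "- c" x] odd[of "(- c) *\<^sub>R x"] by (cases "0 \<le> c") auto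
  qed
  moreover have mp: "m x \<le> p x" for x
    using m(2) tilt_sublinear(2)[OF p, of z] by (auto simp: le_fun_def intro: order_trans)
  moreover have "m z = p z"
    using mp[of z] le_funD[OF m(2), of "- z"] tilt_sublinear(3)[OF p, of z] odd[of z] by simp
  ultimately show ?thesis using that by blast
qed

lemma norm_attained_by_functional:
  fixes x :: "'w::real_normed_vector"
  obtains u :: "'w \<Rightarrow>\<^sub>L real" where "norm u \<le> 1" "blinfun_apply u x = norm x"
proof -
  have "sublinear (norm :: 'w \<Rightarrow> real)" by (simp add: sublinear_def norm_triangle_ineq)
  then obtain v where v: "linear v" "\<And>y. v y \<le> norm (y::'w)" "v x = norm x"
    using Hahn_Banach_sublinear by blast
  have abs: "\<bar>v y\<bar> \<le> norm y" for y
    using v(2)[of y] v(2)[of "- y"] linear_neg[OF v(1), of y] by simp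
  have bl: "bounded_linear v"
    using v(1) abs by (intro bounded_linear_intro[where K=1]) (auto simp: linear_add linear_cmul)
  show ?thesis
  proof (rule that)
    show "norm (Blinfun v) \<le> 1"
      using abs by (intro norm_blinfun_bound) (auto simp: bounded_linear_Blinfun_apply[OF bl])
    show "blinfun_apply (Blinfun v) x = norm x" by (simp add: bounded_linear_Blinfun_apply[OF bl] v)
  qed
qed

text \<open>The distance to \<open>H\<close> is sublinear because \<open>H\<close> is a subspace; a linear functional below it vanishes
  on \<open>H\<close>.\<close>

lemma functional_separating_subspace:
  fixes H :: "'w::real_normed_vector set"
  assumes H: "subspace H" and x: "x \<notin> closure H"
  obtains u :: "'w \<Rightarrow>\<^sub>L real" where "\<And>h. h \<in> H \<Longrightarrow> blinfun_apply u h = 0" "blinfun_apply u x \<noteq> 0"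
proof -
  have ne: "H \<noteq> {}" using subspace_0[OF H] by auto
  let ?p = "\<lambda>y. infdist y H"
  have le: "?p y \<le> norm (y - h)" if "h \<in> H" for y h
    using infdist_le[OF that, of y] by (simp add: dist_norm)
  have ge: "a \<le> ?p y" if "\<And>h. h \<in> H \<Longrightarrow> a \<le> norm (y - h)" for a y
    unfolding infdist_def using ne that by (auto intro!: cINF_greatest simp: dist_norm)
  have add: "?p (y + z) \<le> ?p y + ?p z" for y z
  proof -
    have "?p (y + z) \<le> norm (y - h) + norm (z - k)" if "h \<in> H" "k \<in> H" for h k
      using le[OF subspace_add[OF H that], of "y + z"] norm_triangle_ineq[of "y - h" "z - k"]
      by (simp add: algebra_simps)
    then have "?p (y + z) - norm (z - k) \<le> ?p y" if "k \<in> H" for k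
      using that by (intro ge) (simp add: diff_le_eq)
    then have "?p (y + z) - ?p y \<le> ?p z" by (intro ge) (simp add: algebra_simps)
    then show ?thesis by simp
  qed
  have sc: "?p (c *\<^sub>R y) = c * ?p y" if "0 \<le> c" for c y
  proof (cases "c = 0")
    case True
    then show ?thesis using subspace_0[OF H] by simp
  next
    case False
    then have c: "0 < c" using that by simp
    show ?thesis
    proof (rule antisym)
      have "?p (c *\<^sub>R y) / c \<le> ?p y"
      proof (rule ge)
        fix h assume "h \<in> H"
        then have "?p (c *\<^sub>R y) \<le> norm (c *\<^sub>R (y - h))"
          using le[OF subspace_scale[OF H, of h c], of "c *\<^sub>R y"] by (simp add: scaleR_diff_right)
        then have "?p (c *\<^sub>R y) \<le> c * norm (y - h)" using c by (simp only: norm_scaleR abs_of_pos)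
        then show "?p (c *\<^sub>R y) / c \<le> norm (y - h)" using c by (simp add: divide_le_eq mult.commute)
      qed
      then show "?p (c *\<^sub>R y) \<le> c * ?p y" using c by (simp add: field_simps)
      show "c * ?p y \<le> ?p (c *\<^sub>R y)"
      proof (rule ge)
        fix h assume "h \<in> H"
        then have "c * ?p y \<le> c * norm (y - h /\<^sub>R c)"
          using le[OF subspace_scale[OF H, of h "inverse c"], of y] c by simp
        also have "\<dots> = norm (c *\<^sub>R (y - h /\<^sub>R c))" using c by simp
        also have "\<dots> = norm (c *\<^sub>R y - h)" using c by (simp add: scaleR_diff_right)
        finally show "c * ?p y \<le> norm (c *\<^sub>R y - h)" .
      qed
    qed
  qed
  have "sublinear ?p" using add sc by (simp add: sublinear_def)
  then obtain v where v: "linear v" "\<And>y. v y \<le> ?p y" "v x = ?p x"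
    using Hahn_Banach_sublinear by blast
  have pn: "?p y \<le> norm y" for y using le[OF subspace_0[OF H], of y] by simp
  have abs: "\<bar>v y\<bar> \<le> norm y" for y
    using v(2)[of y] v(2)[of "- y"] pn[of y] pn[of "- y"] linear_neg[OF v(1), of y] by simp
  have bl: "bounded_linear v"
    using v(1) abs by (intro bounded_linear_intro[where K=1]) (auto simp: linear_add linear_cmul)
  show ?thesis
  proof (rule that[of "Blinfun v"])
    fix h assume h: "h \<in> H"
    show "blinfun_apply (Blinfun v) h = 0"
      using v(2)[of h] v(2)[of "- h"] h subspace_neg[OF H h] linear_neg[OF v(1), of h]
      by (simp add: bounded_linear_Blinfun_apply[OF bl])
  next
    have "?p x \<noteq> 0" using x ne in_closure_iff_infdist_zero by blast
    then show "blinfun_apply (Blinfun v) x \<noteq> 0" by (simp add: bounded_linear_Blinfun_apply[OF bl] v)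
  qed
qed

section \<open>Finite dimensional Gaussian measures\<close>

lemma (in prob_space) char_distr_scale:
  assumes [measurable]: "X \<in> borel_measurable M"
  shows "char (distr M borel (\<lambda>x. c * X x)) t = char (distr M borel X) (c * t)"
  by (simp add: char_def integral_distr mult_ac)

text \<open>The characteristic function identifies the law as a normal one. The case \<open>V = 0\<close> is a point mass
  and has no density.\<close>

lemma (in prob_space) gaussian_law_moments:
  fixes X :: "'a \<Rightarrow> real"
  assumes X[measurable]: "X \<in> borel_measurable M" and V: "0 \<le> V"
    and chX: "\<And>y. char (distr M borel X) y = complex_of_real (exp (- V * y\<^sup>2 / 2))"
  shows "integrable M X" "expectation X = 0"
    "integrable M (\<lambda>x. (X x)\<^sup>2)" "expectation (\<lambda>x. (X x)\<^sup>2) = V"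
proof -
  have rdX: "real_distribution (distr M borel Z)" if "Z \<in> borel_measurable M" for Z
    using that by (simp add: real_distribution_def real_distribution_axioms_def prob_space_distr)
  have "integrable M X \<and> expectation X = 0 \<and> integrable M (\<lambda>x. (X x)\<^sup>2) \<and> expectation (\<lambda>x. (X x)\<^sup>2) = V"
  proof (cases "V = 0")
    case True
    have "distr M borel X = return borel 0"
    proof (rule Levy_uniqueness[OF rdX[OF X]])
      show "real_distribution (return borel 0)"
        by (simp add: real_distribution_def real_distribution_axioms_def prob_space_return)
      show "char (distr M borel X) = char (return borel 0)"
      proof
        fix y
        show "char (distr M borel X) y = char (return borel 0) y"
          unfolding chX True by (subst char_def, subst integral_return) auto
      qed
    qed
    then have "AE x in distr M borel X. x = 0" by (simp only:) (subst AE_return, auto)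
    then have ae: "AE x in M. X x = 0" by (simp add: AE_distr_iff)
    have 1: "integrable M X"
      using ae by (subst integrable_cong_AE[where g="\<lambda>_. 0"]) auto
    have 2: "expectation X = 0"
      using ae by (subst integral_cong_AE[where g="\<lambda>_. 0"]) auto
    have 3: "integrable M (\<lambda>x. (X x)\<^sup>2)"
      using ae by (subst integrable_cong_AE[where g="\<lambda>_. 0"]) auto
    have 4: "expectation (\<lambda>x. (X x)\<^sup>2) = 0"
      using ae by (subst integral_cong_AE[where g="\<lambda>_. 0"]) auto
    show ?thesis using 1 2 3 4 True by simp
  next
    case False
    then have V': "0 < V" using V by simp
    define Z where "Z x = (1 / sqrt V) * X x" for x
    have Z[measurable]: "Z \<in> borel_measurable M" unfolding Z_def by measurable
    have XZ: "X x = sqrt V * Z x" for x using V' by (simp add: Z_def)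
    have law: "distr M borel Z = std_normal_distribution"
    proof (rule Levy_uniqueness[OF rdX[OF Z] real_dist_normal_dist], rule ext)
      fix t
      show "char (distr M borel Z) t = char std_normal_distribution t"
        unfolding Z_def[abs_def] char_distr_scale[OF X] chX char_std_normal_distribution
        using V' by (simp add: power_mult_distrib power_divide)
    qed
    have i: "integrable M (\<lambda>x. Z x ^ k)" for k
      using integrable_std_normal_distribution_moment[of k] unfolding law[symmetric]
      by (subst (asm) integrable_distr_eq) auto
    have e: "expectation (\<lambda>x. Z x ^ k) = (LINT x|std_normal_distribution. x ^ k)" for k
      unfolding law[symmetric] by (subst integral_distr) auto
    have m1: "expectation Z = 0"
      using e[of 1] integral_std_normal_distribution_moment_odd[of 1] by simp
    have m2: "expectation (\<lambda>x. (Z x)\<^sup>2) = 1"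
      using e[of 2] std_normal_distribution_even_moments(1)[of 1] by simp
    have sq: "(X x)\<^sup>2 = V * (Z x)\<^sup>2" for x unfolding XZ using V' by (simp add: power_mult_distrib)
    have Xe: "X = (\<lambda>x. sqrt V * Z x)" using XZ by auto
    have "integrable M X" unfolding Xe using i[of 1] by simp
    moreover have "expectation X = 0" unfolding Xe using m1 by simp
    moreover have "integrable M (\<lambda>x. (X x)\<^sup>2)" unfolding sq using i[of 2] by simp
    moreover have "expectation (\<lambda>x. (X x)\<^sup>2) = V" unfolding sq using m2 by simp
    ultimately show ?thesis by blast
  qed
  then show "integrable M X" "expectation X = 0"
    "integrable M (\<lambda>x. (X x)\<^sup>2)" "expectation (\<lambda>x. (X x)\<^sup>2) = V" by auto
qed

text \<open>The weight \<open>Z\<close> may be negative, but \<open>2 + Z\<close> is positive and becomes a probability density after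
  normalization. Under it \<open>X\<close> has the characteristic function of \<open>\<nu>\<close>, hence the law \<open>\<nu>\<close>.\<close>

lemma (in prob_space) weighted_char_unique_real:
  fixes X Z :: "'a \<Rightarrow> real"
  assumes X[measurable]: "X \<in> borel_measurable M" and Z[measurable]: "Z \<in> borel_measurable M"
    and Z1: "\<And>x. \<bar>Z x\<bar> \<le> 1"
    and \<nu>: "real_distribution \<nu>" and chX: "\<And>y. char (distr M borel X) y = char \<nu> y"
    and chZ: "\<And>y. (CLINT x|M. Z x *\<^sub>R iexp (y * X x)) = expectation Z * char \<nu> y"
    and A: "A \<in> sets borel"
  shows "expectation (\<lambda>x. Z x * indicator A (X x)) = expectation Z * measure \<nu> A"
proof -
  interpret N: real_distribution \<nu> by fact
  have iZ: "integrable M Z" using Z1 by (intro integrable_const_bound[where B=1]) auto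
  have "\<bar>expectation Z\<bar> \<le> 1"
  proof -
    have "\<bar>expectation Z\<bar> \<le> expectation (\<lambda>x. \<bar>Z x\<bar>)" by (rule integral_abs_bound)
    also have "\<dots> \<le> expectation (\<lambda>x. 1)" using iZ Z1 by (intro integral_mono) auto
    finally show ?thesis by (simp add: prob_space)
  qed
  define m where "m = 2 + expectation Z"
  have m: "0 < m" using \<open>\<bar>expectation Z\<bar> \<le> 1\<close> by (simp add: m_def)
  define w where "w x = (2 + Z x) / m" for x
  have w[measurable]: "w \<in> borel_measurable M" unfolding w_def by measurable
  have w0: "0 \<le> w x" for x using Z1[of x] m unfolding w_def by (simp add: abs_le_iff)
  have iw: "integrable M w" unfolding w_def using iZ by simp
  have ew: "expectation w = 1" unfolding w_def using iZ m by (simp add: m_def prob_space)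
  define D where "D = density M (\<lambda>x. ennreal (w x))"
  have [measurable_cong]: "sets D = sets M" by (simp add: D_def)
  have "emeasure D (space D) = ennreal (expectation w)"
    unfolding D_def using iw w0 by (simp add: emeasure_density nn_integral_eq_integral)
  then interpret D: prob_space D by (intro prob_spaceI) (simp add: ew)
  have "distr D borel X = \<nu>"
  proof (rule Levy_uniqueness[OF _ \<nu>])
    show "real_distribution (distr D borel X)"
      by (simp add: real_distribution_def real_distribution_axioms_def D.prob_space_distr)
    show "char (distr D borel X) = char \<nu>"
    proof
      fix y
      have ii: "integrable M (\<lambda>x. iexp (y * X x))" "integrable M (\<lambda>x. Z x *\<^sub>R iexp (y * X x))"
        using Z1 by (auto intro!: integrable_const_bound[where B=1])
      have "char (distr D borel X) y = (CLINT x|M. w x *\<^sub>R iexp (y * X x))"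
        unfolding char_def D_def using w0
        by (simp add: integral_distr integral_density)
      also have "\<dots> = (CLINT x|M. (2 *\<^sub>R iexp (y * X x) + Z x *\<^sub>R iexp (y * X x)) /\<^sub>R m)"
        by (simp add: w_def scaleR_add_left[symmetric] divide_inverse mult_ac)
      also have "\<dots> = (2 *\<^sub>R (CLINT x|M. iexp (y * X x)) + (CLINT x|M. Z x *\<^sub>R iexp (y * X x))) /\<^sub>R m"
        using ii by (simp only: integral_scaleR_right Bochner_Integration.integral_add[OF integrable_scaleR_right])
      also have "(CLINT x|M. iexp (y * X x)) = char \<nu> y"
        unfolding chX[symmetric] by (simp add: char_def integral_distr)
      also have "(2 *\<^sub>R char \<nu> y + (CLINT x|M. Z x *\<^sub>R iexp (y * X x))) /\<^sub>R m = char \<nu> y"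
      proof -
        have "(2 *\<^sub>R char \<nu> y + expectation Z * char \<nu> y) /\<^sub>R m = ((complex_of_real m) * char \<nu> y) /\<^sub>R m"
          by (simp add: m_def scaleR_conv_of_real distrib_right)
        then show ?thesis unfolding chZ using m by (simp add: scaleR_conv_of_real)
      qed
      finally show "char (distr D borel X) y = char \<nu> y" .
    qed
  qed
  then have "measure \<nu> A = measure (distr D borel X) A" by simp
  also have "\<dots> = (LINT x|D. indicator A (X x))"
    using A integral_distr[of X D borel "indicator A :: real \<Rightarrow> real"] by simp
  also have "\<dots> = (LINT x|M. w x * indicator A (X x))"
    unfolding D_def using w0 A by (subst integral_density) auto
  also have "\<dots> = (LINT x|M. (2 * indicator A (X x) + Z x * indicator A (X x)) / m)"
    by (simp add: w_def field_simps)
  also have "\<dots> = (2 * (LINT x|M. indicator A (X x)) + (LINT x|M. Z x * indicator A (X x))) / m"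
  proof -
    have "integrable M (\<lambda>x. indicator A (X x) :: real)" "integrable M (\<lambda>x. Z x * indicator A (X x))"
      using Z1 A by (auto intro!: integrable_const_bound[where B=1] simp: indicator_def)
    then show ?thesis by simp
  qed
  also have "(LINT x|M. indicator A (X x)) = measure (distr M borel X) A"
    using A integral_distr[of X M borel "indicator A :: real \<Rightarrow> real"] by simp
  also have "distr M borel X = \<nu>"
    by (rule Levy_uniqueness[OF _ \<nu>])
       (auto simp: real_distribution_def real_distribution_axioms_def prob_space_distr chX)
  finally show ?thesis using m by (simp add: field_simps m_def)
qed

text \<open>Adding and subtracting the conjugate of the hypothesis \<open>chY\<close> gives the corresponding statements for
  the real and the imaginary part of the weight.\<close>

lemma (in prob_space) weighted_char_unique:
  fixes X :: "'a \<Rightarrow> real" and Y :: "'a \<Rightarrow> complex"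
  assumes X[measurable]: "X \<in> borel_measurable M" and Y[measurable]: "Y \<in> borel_measurable M"
    and Y1: "\<And>x. cmod (Y x) \<le> 1"
    and chX: "\<And>y. (CLINT x|M. iexp (y * X x)) = complex_of_real (exp (- y\<^sup>2 / 2))"
    and chY: "\<And>y. (CLINT x|M. Y x * iexp (y * X x)) = (CLINT x|M. Y x) * complex_of_real (exp (- y\<^sup>2 / 2))"
    and A: "A \<in> sets borel"
  shows "(CLINT x|M. Y x * indicator A (X x)) =
    (CLINT x|M. Y x) * complex_of_real (measure std_normal_distribution A)"
proof -
  let ?\<nu> = std_normal_distribution
  have iY: "integrable M Y" using Y1 by (intro integrable_const_bound[where B=1]) auto
  have iYe: "integrable M (\<lambda>x. Y x * iexp (y * X x))" for y
    using Y1 by (intro integrable_const_bound[where B=1]) (auto simp: norm_mult)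
  have iYA: "integrable M (\<lambda>x. Y x * indicator A (X x))"
    using Y1 A by (intro integrable_const_bound[where B=1]) (auto simp: norm_mult indicator_def)
  have ch\<nu>: "char ?\<nu> y = complex_of_real (exp (- y\<^sup>2 / 2))" for y
    by (simp add: char_std_normal_distribution)
  have chX': "char (distr M borel X) y = char ?\<nu> y" for y
    unfolding ch\<nu> chX[symmetric] by (simp add: char_def integral_distr)
  have minus: "(CLINT x|M. cnj (Y x) * iexp (y * X x)) = cnj (CLINT x|M. Y x) * complex_of_real (exp (- y\<^sup>2 / 2))" for y
  proof -
    have "(CLINT x|M. cnj (Y x) * iexp (y * X x)) = (CLINT x|M. cnj (Y x * iexp (- y * X x)))"
      by (simp add: exp_cnj)
    also have "\<dots> = cnj (CLINT x|M. Y x * iexp (- y * X x))" by (rule Bochner_Integration.integral_cnj)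
    finally show ?thesis unfolding chY by simp
  qed
  have cnjm[measurable]: "cnj \<in> borel_measurable borel"
    by (intro borel_measurable_continuous_onI continuous_intros)
  have iYc: "integrable M (\<lambda>x. cnj (Y x) * iexp (y * X x))" for y
    using Y1 by (intro integrable_const_bound[where B=1]) (auto simp: norm_mult)
  have re: "(CLINT x|M. Re (Y x) *\<^sub>R iexp (y * X x)) = expectation (\<lambda>x. Re (Y x)) * char ?\<nu> y" for y
  proof -
    have "(CLINT x|M. Re (Y x) *\<^sub>R iexp (y * X x)) =
        (CLINT x|M. (Y x * iexp (y * X x) + cnj (Y x) * iexp (y * X x)) / 2)"
      by (simp add: distrib_right[symmetric] complex_add_cnj scaleR_conv_of_real)
    also have "\<dots> = ((CLINT x|M. Y x) + cnj (CLINT x|M. Y x)) * complex_of_real (exp (- y\<^sup>2 / 2)) / 2"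
      by (simp only: integral_divide_zero Bochner_Integration.integral_add[OF iYe iYc] chY minus distrib_right)
    also have "\<dots> = expectation (\<lambda>x. Re (Y x)) * char ?\<nu> y"
      unfolding ch\<nu> using iY by (simp add: complex_add_cnj integral_Re)
    finally show ?thesis .
  qed
  have imdiv: "(W - cnj W) * e / (2 * \<i>) = Im W *\<^sub>R e" for W e
    unfolding complex_diff_cnj
    by (subst nonzero_divide_eq_eq) (simp_all add: scaleR_conv_of_real algebra_simps)
  have im: "(CLINT x|M. Im (Y x) *\<^sub>R iexp (y * X x)) = expectation (\<lambda>x. Im (Y x)) * char ?\<nu> y" for y
  proof -
    have "(CLINT x|M. Im (Y x) *\<^sub>R iexp (y * X x)) =
        (CLINT x|M. (Y x * iexp (y * X x) - cnj (Y x) * iexp (y * X x)) / (2 * \<i>))"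
      by (simp only: left_diff_distrib[symmetric] imdiv)
    also have "\<dots> = ((CLINT x|M. Y x) - cnj (CLINT x|M. Y x)) * complex_of_real (exp (- y\<^sup>2 / 2)) / (2 * \<i>)"
      by (simp only: integral_divide_zero Bochner_Integration.integral_diff[OF iYe iYc] chY minus left_diff_distrib)
    also have "\<dots> = expectation (\<lambda>x. Im (Y x)) * char ?\<nu> y"
      unfolding ch\<nu> imdiv using iY by (simp add: scaleR_conv_of_real)
    finally show ?thesis .
  qed
  have Re: "expectation (\<lambda>x. Re (Y x) * indicator A (X x)) = expectation (\<lambda>x. Re (Y x)) * measure ?\<nu> A"
    using re A Y1 by (intro weighted_char_unique_real real_dist_normal_dist chX')
      (auto intro: order_trans[OF abs_Re_le_cmod])
  have Im: "expectation (\<lambda>x. Im (Y x) * indicator A (X x)) = expectation (\<lambda>x. Im (Y x)) * measure ?\<nu> A"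
    using im A Y1 by (intro weighted_char_unique_real real_dist_normal_dist chX')
      (auto intro: order_trans[OF abs_Im_le_cmod])
  have s: "Re (Y x * indicator A (X x)) = Re (Y x) * indicator A (X x)"
      "Im (Y x * indicator A (X x)) = Im (Y x) * indicator A (X x)" for x
    by (auto simp: indicator_def)
  show ?thesis
  proof (rule complex_eqI)
    show "Re (CLINT x|M. Y x * indicator A (X x)) = Re ((CLINT x|M. Y x) * complex_of_real (measure ?\<nu> A))"
    proof -
      have "Re (CLINT x|M. Y x * indicator A (X x)) = expectation (\<lambda>x. Re (Y x * indicator A (X x)))"
        by (rule Bochner_Integration.integral_Re[OF iYA, symmetric])
      also have "\<dots> = expectation (\<lambda>x. Re (Y x)) * measure ?\<nu> A" by (simp only: s Re)
      finally show ?thesis using iY by simp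
    qed
    show "Im (CLINT x|M. Y x * indicator A (X x)) = Im ((CLINT x|M. Y x) * complex_of_real (measure ?\<nu> A))"
    proof -
      have "Im (CLINT x|M. Y x * indicator A (X x)) = expectation (\<lambda>x. Im (Y x * indicator A (X x)))"
        by (rule Bochner_Integration.integral_Im[OF iYA, symmetric])
      also have "\<dots> = expectation (\<lambda>x. Im (Y x)) * measure ?\<nu> A" by (simp only: s Im)
      finally show ?thesis using iY by simp
    qed
  qed
qed

abbreviation gauss_product :: "'i set \<Rightarrow> ('i \<Rightarrow> real) measure" where
  "gauss_product J \<equiv> PiM J (\<lambda>_. std_normal_distribution)"

lemma product_sigma_finite_gauss: "product_sigma_finite (\<lambda>_::'i. std_normal_distribution)"
  using prob_space_normal_density[of 1 0]
  by (simp add: product_sigma_finite_def prob_space_imp_sigma_finite)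

lemma prob_space_gauss_product: "prob_space (gauss_product J)"
  using prob_space_normal_density[of 1 0] by (intro prob_space_PiM) simp

text \<open>The exponentials of the single coordinates are replaced by indicators one at a time, with the
  remaining factors as a weight. This reduces the uniqueness of characteristic functions in several
  dimensions to the one dimensional case.\<close>

theorem (in prob_space) joint_gaussian_law:
  fixes X :: "'i \<Rightarrow> 'a \<Rightarrow> real"
  assumes J: "finite J" and X[measurable]: "\<And>j. j \<in> J \<Longrightarrow> X j \<in> borel_measurable M"
    and ch: "\<And>y. (CLINT x|M. iexp (\<Sum>j\<in>J. y j * X j x)) = complex_of_real (exp (- (\<Sum>j\<in>J. (y j)\<^sup>2) / 2))"
  shows "distr M (PiM J (\<lambda>_. borel)) (\<lambda>x. \<lambda>j\<in>J. X j x) = gauss_product J"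
proof -
  interpret G: product_sigma_finite "\<lambda>_::'i. std_normal_distribution" by (rule product_sigma_finite_gauss)
  let ?m = "\<lambda>A. measure std_normal_distribution A"
  have step: "(CLINT x|M. (\<Prod>j\<in>K. indicator (A j) (X j x)) * iexp (\<Sum>j\<in>J-K. y j * X j x)) =
      complex_of_real ((\<Prod>j\<in>K. ?m (A j)) * exp (- (\<Sum>j\<in>J-K. (y j)\<^sup>2) / 2))"
    if "finite K" "K \<subseteq> J" "\<And>j. j \<in> J \<Longrightarrow> A j \<in> sets borel" for K A y
    using that
  proof (induction K arbitrary: y)
    case empty
    then show ?case using ch[of y] by simp
  next
    case (insert k K)
    have [measurable]: "X k \<in> borel_measurable M" using insert by auto
    define L where "L = J - insert k K"
    have L: "finite L" "k \<notin> L" "J - K = insert k L" "L \<subseteq> J" using insert J by (auto simp: L_def)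
    define Y where "Y x = (\<Prod>j\<in>K. indicator (A j) (X j x)) * iexp (\<Sum>j\<in>L. y j * X j x)" for x
    have [measurable]: "X j \<in> borel_measurable M" if "j \<in> L \<or> j \<in> K" for j using that L insert by auto
    have [measurable]: "A j \<in> sets borel" if "j \<in> K" for j using insert that by auto
    have Ym[measurable]: "Y \<in> borel_measurable M" unfolding Y_def by measurable
    have pr: "cmod (\<Prod>j\<in>K. indicator (A j) (X j x)) \<le> 1" for x
      unfolding prod_norm[symmetric] by (intro prod_le_1) (auto simp: indicator_def)
    have Y1: "cmod (Y x) \<le> 1" for x using pr by (simp add: Y_def norm_mult)
    have IH: "(CLINT x|M. Y x * iexp (t * X k x)) =
        complex_of_real ((\<Prod>j\<in>K. ?m (A j)) * exp (- (\<Sum>j\<in>L. (y j)\<^sup>2) / 2)) * complex_of_real (exp (- t\<^sup>2 / 2))" for t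
    proof -
      have e: "(\<Sum>j\<in>J-K. (y(k := t)) j * X j x) = (\<Sum>j\<in>L. y j * X j x) + t * X k x" for x
        unfolding L(3) using L by (subst sum.insert) (auto intro!: sum.cong)
      have e2: "(\<Sum>j\<in>J-K. ((y(k := t)) j)\<^sup>2) = (\<Sum>j\<in>L. (y j)\<^sup>2) + t\<^sup>2"
        unfolding L(3) using L by (subst sum.insert) (auto intro!: sum.cong)
      have Ye: "Y x * iexp (t * X k x) = (\<Prod>j\<in>K. indicator (A j) (X j x)) * iexp ((\<Sum>j\<in>L. y j * X j x) + t * X k x)" for x
        unfolding Y_def by (simp add: exp_add[symmetric] algebra_simps)
      show ?thesis
        using insert.IH[of "y(k := t)"] insert.prems unfolding Ye e e2
        by (simp add: exp_add[symmetric] add_divide_distrib of_real_mult[symmetric] del: of_real_mult)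
    qed
    have EY: "(CLINT x|M. Y x) = complex_of_real ((\<Prod>j\<in>K. ?m (A j)) * exp (- (\<Sum>j\<in>L. (y j)\<^sup>2) / 2))"
      using IH[of 0] by simp
    have chk: "(CLINT x|M. iexp (t * X k x)) = complex_of_real (exp (- t\<^sup>2 / 2))" for t
    proof -
      have "(\<Sum>j\<in>J. ((\<lambda>_. 0)(k := t)) j * X j x) = t * X k x" for x
        using insert.prems J by (subst sum.remove[of J k]) (auto intro!: sum.neutral)
      moreover have "(\<Sum>j\<in>J. ((\<lambda>_. 0)(k := t)) j ^ 2) = t\<^sup>2"
        using insert.prems J by (subst sum.remove[of J k]) (auto intro!: sum.neutral)
      ultimately show ?thesis using ch[of "(\<lambda>_. 0)(k := t)"] by simp
    qed
    have "(CLINT x|M. Y x * indicator (A k) (X k x)) = (CLINT x|M. Y x) * complex_of_real (?m (A k))"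
    proof (rule weighted_char_unique[OF _ _ Y1 chk])
      show "(CLINT x|M. Y x * iexp (t * X k x)) = (CLINT x|M. Y x) * complex_of_real (exp (- t\<^sup>2 / 2))" for t
        unfolding IH EY ..
    qed (use insert.prems in auto)
    moreover have "(\<Prod>j\<in>insert k K. indicator (A j) (X j x)) * iexp (\<Sum>j\<in>J - insert k K. y j * X j x)
        = Y x * indicator (A k) (X k x)" for x
      using insert by (simp add: Y_def L_def mult_ac)
    ultimately have "(CLINT x|M. (\<Prod>j\<in>insert k K. indicator (A j) (X j x)) * iexp (\<Sum>j\<in>J - insert k K. y j * X j x))
        = (CLINT x|M. Y x) * complex_of_real (?m (A k))" by (simp only:)
    also have "\<dots> = complex_of_real ((\<Prod>j\<in>insert k K. ?m (A j)) * exp (- (\<Sum>j\<in>J - insert k K. (y j)\<^sup>2) / 2))"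
      unfolding EY L_def[symmetric] using insert.hyps by (simp add: mult_ac)
    finally show ?case .
  qed
  show ?thesis
  proof (rule G.PiM_eqI[OF J])
    show "sets (distr M (PiM J (\<lambda>_. borel)) (\<lambda>x. \<lambda>j\<in>J. X j x)) = sets (gauss_product J)"
      by (auto intro!: sets_PiM_cong)
    fix A assume A: "\<And>i. i \<in> J \<Longrightarrow> A i \<in> sets std_normal_distribution"
    then have A': "\<And>i. i \<in> J \<Longrightarrow> A i \<in> sets borel" by simp
    let ?E = "(\<lambda>x. \<lambda>j\<in>J. X j x) -` Pi\<^sub>E J A \<inter> space M"
    have ms: "(\<lambda>x. \<lambda>j\<in>J. X j x) \<in> measurable M (PiM J (\<lambda>_. borel))" by measurable
    have PA: "Pi\<^sub>E J A \<in> sets (PiM J (\<lambda>_. borel))" using A' J by (intro sets_PiM_I_finite) auto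
    have E: "?E \<in> sets M" using measurable_sets[OF ms PA] .
    have ind: "(\<Prod>j\<in>J. indicator (A j) (X j x)) = (indicator ?E x :: complex)" if xM: "x \<in> space M" for x
    proof (cases "x \<in> ?E")
      case True
      then show ?thesis by (auto intro!: prod.neutral simp: PiE_iff indicator_def)
    next
      case False
      then obtain j where "j \<in> J" "X j x \<notin> A j" using xM by (auto simp: PiE_iff)
      then show ?thesis using False J by (auto simp: indicator_def prod_zero_iff)
    qed
    have "(indicator ?E x :: complex) = complex_of_real (indicator ?E x)" for x by (simp add: indicator_def)
    then have "complex_of_real (prob ?E) = (CLINT x|M. indicator ?E x)"
      using E by (simp only: integral_complex_of_real) simp
    also have "\<dots> = (CLINT x|M. (\<Prod>j\<in>J. indicator (A j) (X j x)))"
      by (rule Bochner_Integration.integral_cong[OF refl ind[symmetric]])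
    also have "\<dots> = complex_of_real (\<Prod>j\<in>J. ?m (A j))"
      using step[of J A "\<lambda>_. 0"] J A' by simp
    finally have p: "prob ?E = (\<Prod>j\<in>J. ?m (A j))" using of_real_eq_iff by blast
    interpret S: prob_space std_normal_distribution using prob_space_normal_density[of 1 0] by simp
    have "emeasure (distr M (PiM J (\<lambda>_. borel)) (\<lambda>x. \<lambda>j\<in>J. X j x)) (Pi\<^sub>E J A) = emeasure M ?E"
      by (rule emeasure_distr[OF ms PA])
    also have "\<dots> = ennreal (\<Prod>j\<in>J. ?m (A j))" using p by (simp add: emeasure_eq_measure)
    also have "\<dots> = (\<Prod>j\<in>J. emeasure std_normal_distribution (A j))"
      by (simp add: S.emeasure_eq_measure prod_ennreal)
    finally show "emeasure (distr M (PiM J (\<lambda>_. borel)) (\<lambda>x. \<lambda>j\<in>J. X j x)) (Pi\<^sub>E J A) = (\<Prod>j\<in>J. emeasure std_normal_distribution (A j))" .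
  qed
qed

lemma nn_integral_std_normal_shift:
  fixes h :: "real \<Rightarrow> ennreal"
  assumes [measurable]: "h \<in> borel_measurable borel"
  shows "(\<integral>\<^sup>+x. ennreal (exp (- (x * a) - a\<^sup>2 / 2)) * h (x + a) \<partial>std_normal_distribution)
    = (\<integral>\<^sup>+x. h x \<partial>std_normal_distribution)"
proof -
  have e: "std_normal_density x * exp (- (x * a) - a\<^sup>2 / 2) = std_normal_density (x + a)" for x
    by (simp add: std_normal_density_def exp_add[symmetric] exp_minus_inverse power2_eq_square
        mult_exp_exp field_simps)
  have "(\<integral>\<^sup>+x. ennreal (exp (- (x * a) - a\<^sup>2 / 2)) * h (x + a) \<partial>std_normal_distribution)
      = (\<integral>\<^sup>+x. ennreal (std_normal_density x) * (ennreal (exp (- (x * a) - a\<^sup>2 / 2)) * h (x + a)) \<partial>lborel)"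
    by (subst nn_integral_density) auto
  also have "\<dots> = (\<integral>\<^sup>+x. ennreal (std_normal_density (x + a)) * h (x + a) \<partial>lborel)"
    unfolding e[symmetric] by (simp add: ennreal_mult mult.assoc)
  also have "\<dots> = (\<integral>\<^sup>+x. ennreal (std_normal_density x) * h x \<partial>lborel)"
    using nn_integral_real_affine[of "\<lambda>x. ennreal (std_normal_density x) * h x" 1 a]
    by (simp add: add.commute)
  also have "\<dots> = (\<integral>\<^sup>+x. h x \<partial>std_normal_distribution)"
    by (subst nn_integral_density) auto
  finally show ?thesis .
qed

text \<open>The Cameron--Martin formula in finite dimensions, by induction on the set of coordinates.\<close>

lemma gauss_product_shift:
  fixes k :: "('i \<Rightarrow> real) \<Rightarrow> ennreal"
  assumes J: "finite J" and k[measurable]: "k \<in> borel_measurable (PiM J (\<lambda>_. borel))"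
  shows "(\<integral>\<^sup>+x. ennreal (exp (- (\<Sum>j\<in>J. x j * a j) - (\<Sum>j\<in>J. (a j)\<^sup>2) / 2)) * k (\<lambda>j\<in>J. x j + a j) \<partial>gauss_product J)
    = (\<integral>\<^sup>+x. k x \<partial>gauss_product J)"
proof -
  interpret G: product_sigma_finite "\<lambda>_::'i. std_normal_distribution" by (rule product_sigma_finite_gauss)
  have sets: "sets (gauss_product J) = sets (PiM J (\<lambda>_. borel))" by (auto intro!: sets_PiM_cong)
  note [measurable_cong] = sets
  let ?w = "\<lambda>x. exp (- (\<Sum>j\<in>J. x j * a j) - (\<Sum>j\<in>J. (a j)\<^sup>2) / 2)"
  let ?D = "distr (density (gauss_product J) (\<lambda>x. ennreal (?w x))) (PiM J (\<lambda>_. borel)) (\<lambda>x. \<lambda>j\<in>J. x j + a j)"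
  have wm[measurable]: "?w \<in> borel_measurable (PiM J (\<lambda>_. borel))" using J by measurable
  have sm: "(\<lambda>x. \<lambda>j\<in>J. x j + a j) \<in> measurable (density (gauss_product J) (\<lambda>x. ennreal (?w x))) (PiM J (\<lambda>_. borel))"
    by measurable
  have "?D = gauss_product J"
  proof (rule G.PiM_eqI[OF J])
    show "sets ?D = sets (gauss_product J)" by (simp add: sets)
    fix A assume "\<And>i. i \<in> J \<Longrightarrow> A i \<in> sets std_normal_distribution"
    then have A[measurable]: "\<And>i. i \<in> J \<Longrightarrow> A i \<in> sets borel" by simp
    have PA[measurable]: "Pi\<^sub>E J A \<in> sets (PiM J (\<lambda>_. borel))" using A J by (intro sets_PiM_I_finite) auto
    have "emeasure ?D (Pi\<^sub>E J A) = (\<integral>\<^sup>+y. indicator (Pi\<^sub>E J A) y \<partial>?D)" by simp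
    also have "\<dots> = (\<integral>\<^sup>+x. indicator (Pi\<^sub>E J A) (\<lambda>j\<in>J. x j + a j) \<partial>density (gauss_product J) (\<lambda>x. ennreal (?w x)))"
      by (rule nn_integral_distr[OF sm]) measurable
    also have "\<dots> = (\<integral>\<^sup>+x. ennreal (?w x) * indicator (Pi\<^sub>E J A) (\<lambda>j\<in>J. x j + a j) \<partial>gauss_product J)"
      by (rule nn_integral_density) measurable
    also have "\<dots> = (\<integral>\<^sup>+x. (\<Prod>j\<in>J. ennreal (exp (- (x j * a j) - (a j)\<^sup>2 / 2)) * indicator (A j) (x j + a j)) \<partial>gauss_product J)"
    proof (rule nn_integral_cong)
      fix x
      have "?w x = exp (\<Sum>j\<in>J. - (x j * a j) - (a j)\<^sup>2 / 2)"
        by (simp add: sum_subtractf sum_negf sum_divide_distrib)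
      also have "\<dots> = (\<Prod>j\<in>J. exp (- (x j * a j) - (a j)\<^sup>2 / 2))" using J by (rule exp_sum)
      finally have "ennreal (?w x) = (\<Prod>j\<in>J. ennreal (exp (- (x j * a j) - (a j)\<^sup>2 / 2)))"
        by (simp add: prod_ennreal)
      moreover have "(indicator (Pi\<^sub>E J A) (\<lambda>j\<in>J. x j + a j) :: ennreal) = (\<Prod>j\<in>J. indicator (A j) (x j + a j))"
      proof (cases "\<forall>j\<in>J. x j + a j \<in> A j")
        case True
        then show ?thesis by (auto simp: indicator_def PiE_iff)
      next
        case False
        then obtain j where j: "j \<in> J" "x j + a j \<notin> A j" by auto
        then have "(\<Prod>j\<in>J. indicator (A j) (x j + a j)) = (0::ennreal)" using J by (intro prod_zero) (auto intro!: bexI[of _ j] simp: indicator_def)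
        moreover have "(\<lambda>j\<in>J. x j + a j) \<notin> Pi\<^sub>E J A" using j by (auto simp: PiE_iff)
        ultimately show ?thesis by simp
      qed
      ultimately show "ennreal (?w x) * indicator (Pi\<^sub>E J A) (\<lambda>j\<in>J. x j + a j)
          = (\<Prod>j\<in>J. ennreal (exp (- (x j * a j) - (a j)\<^sup>2 / 2)) * indicator (A j) (x j + a j))"
        by (simp add: prod.distrib)
    qed
    also have "\<dots> = (\<Prod>j\<in>J. (\<integral>\<^sup>+x. ennreal (exp (- (x * a j) - (a j)\<^sup>2 / 2)) * indicator (A j) (x + a j) \<partial>std_normal_distribution))"
      by (rule G.product_nn_integral_prod[OF J]) measurable
    also have "\<dots> = (\<Prod>j\<in>J. emeasure std_normal_distribution (A j))"
      by (intro prod.cong refl, subst nn_integral_std_normal_shift) auto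
    finally show "emeasure ?D (Pi\<^sub>E J A) = (\<Prod>j\<in>J. emeasure std_normal_distribution (A j))" .
  qed
  then have "(\<integral>\<^sup>+x. k x \<partial>gauss_product J) = (\<integral>\<^sup>+x. k x \<partial>?D)" by simp
  also have "\<dots> = (\<integral>\<^sup>+x. k (\<lambda>j\<in>J. x j + a j) \<partial>density (gauss_product J) (\<lambda>x. ennreal (?w x)))"
    by (rule nn_integral_distr[OF sm]) measurable
  also have "\<dots> = (\<integral>\<^sup>+x. ennreal (?w x) * k (\<lambda>j\<in>J. x j + a j) \<partial>gauss_product J)"
    by (rule nn_integral_density) measurable
  finally show ?thesis by simp
qed

lemma char_gauss_product:
  fixes y :: "'i \<Rightarrow> real"
  assumes J: "finite J"
  shows "(CLINT x|gauss_product J. iexp (\<Sum>j\<in>J. y j * x j)) = complex_of_real (exp (- (\<Sum>j\<in>J. (y j)\<^sup>2) / 2))"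
proof -
  interpret G: product_sigma_finite "\<lambda>_::'i. std_normal_distribution" by (rule product_sigma_finite_gauss)
  interpret S: prob_space std_normal_distribution using prob_space_normal_density[of 1 0] by simp
  have "(CLINT x|gauss_product J. iexp (\<Sum>j\<in>J. y j * x j)) = (CLINT x|gauss_product J. (\<Prod>j\<in>J. iexp (y j * x j)))"
    using J by (simp add: exp_sum sum_distrib_left)
  also have "\<dots> = (\<Prod>j\<in>J. (CLINT x|std_normal_distribution. iexp (y j * x)))"
    by (rule G.product_integral_prod[OF J]) (auto intro!: S.integrable_const_bound[where B=1])
  also have "\<dots> = (\<Prod>j\<in>J. complex_of_real (exp (- (y j)\<^sup>2 / 2)))"
    using char_std_normal_distribution by (simp add: char_def fun_eq_iff)
  also have "\<dots> = complex_of_real (exp (- (\<Sum>j\<in>J. (y j)\<^sup>2) / 2))"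
    using J by (simp add: exp_sum[symmetric] sum_negf sum_divide_distrib of_real_prod[symmetric] del: of_real_prod)
  finally show ?thesis .
qed

lemma sum_times_bool: "(\<Sum>p\<in>A \<times> UNIV. h p) = (\<Sum>a\<in>A. h (a, False) + h (a, True))"
  using sum.cartesian_product[of "\<lambda>a b. h (a, b)" UNIV A] by (simp add: UNIV_bool add.commute)

text \<open>Coordinates indexed by \<open>A \<times> UNIV\<close> are read as complex coordinates indexed by \<open>A\<close>, with
  \<open>False\<close> for the real and \<open>True\<close> for the imaginary part.\<close>

definition cpx :: "('i \<times> bool \<Rightarrow> real) \<Rightarrow> 'i \<Rightarrow> complex" where
  "cpx x a = Complex (x (a, False)) (x (a, True))"

definition rot :: "'i set \<Rightarrow> complex \<Rightarrow> ('i \<times> bool \<Rightarrow> real) \<Rightarrow> 'i \<times> bool \<Rightarrow> real" where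
  "rot A z x = (\<lambda>(a, b)\<in>A \<times> UNIV. if b then Im (z * cpx x a) else Re (z * cpx x a))"

lemma cpx_rot: "a \<in> A \<Longrightarrow> cpx (rot A z x) a = z * cpx x a"
  by (simp add: cpx_def rot_def complex_eq_iff)

lemma rot_measurable [measurable]:
  "rot A z \<in> measurable (PiM (A \<times> UNIV) (\<lambda>_. borel)) (PiM (A \<times> UNIV) (\<lambda>_. borel))"
proof -
  have e: "rot A z = (\<lambda>x. \<lambda>p\<in>A \<times> UNIV. if snd p then Re z * x (fst p, True) + Im z * x (fst p, False)
      else Re z * x (fst p, False) - Im z * x (fst p, True))"
    by (auto simp: rot_def cpx_def fun_eq_iff restrict_def)
  show ?thesis
    unfolding e
  proof (rule measurable_restrict)
    fix p assume p: "p \<in> A \<times> (UNIV :: bool set)"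
    have [measurable]: "(\<lambda>x. x (fst p, b)) \<in> borel_measurable (PiM (A \<times> UNIV) (\<lambda>_. borel))" for b
      using p by (intro measurable_component_singleton) auto
    show "(\<lambda>x. if snd p then Re z * x (fst p, True) + Im z * x (fst p, False)
      else Re z * x (fst p, False) - Im z * x (fst p, True)) \<in> borel_measurable (PiM (A \<times> UNIV) (\<lambda>_. borel))"
      by measurable
  qed
qed

text \<open>Multiplication of complex coordinates by \<open>z\<close> is orthogonal, so the characteristic function of the
  image is that of the original measure.\<close>

theorem gauss_product_rotation:
  fixes A :: "'i set"
  assumes A: "finite A" and z: "cmod z = 1"
  shows "distr (gauss_product (A \<times> UNIV)) (PiM (A \<times> UNIV) (\<lambda>_. borel)) (rot A z) = gauss_product (A \<times> UNIV)"
proof -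
  let ?J = "A \<times> (UNIV :: bool set)"
  have J: "finite ?J" using A by simp
  have sets: "sets (gauss_product ?J) = sets (PiM ?J (\<lambda>_. borel))" by (auto intro!: sets_PiM_cong)
  note [measurable_cong] = sets
  interpret prob_space "gauss_product ?J" by (rule prob_space_gauss_product)
  have sJ: "(\<Sum>j\<in>?J. h j) = (\<Sum>a\<in>A. h (a, False) + h (a, True))" for h :: "'i \<times> bool \<Rightarrow> real"
    by (rule sum_times_bool)
  have z2: "(Re z)\<^sup>2 + (Im z)\<^sup>2 = 1" using z cmod_power2[of z] by simp
  have "distr (gauss_product ?J) (PiM ?J (\<lambda>_. borel)) (\<lambda>x. \<lambda>j\<in>?J. rot A z x j) = gauss_product ?J"
  proof (rule joint_gaussian_law[OF J])
    show "(\<lambda>x. rot A z x j) \<in> borel_measurable (gauss_product ?J)" if "j \<in> ?J" for j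
      using that measurable_compose[OF rot_measurable measurable_component_singleton] by measurable
    fix y :: "'i \<times> bool \<Rightarrow> real"
    define y' where "y' = (\<lambda>(a, b). if b then Re z * y (a, True) - Im z * y (a, False)
        else Re z * y (a, False) + Im z * y (a, True))"
    have 1: "(\<Sum>j\<in>?J. y j * rot A z x j) = (\<Sum>j\<in>?J. y' j * x j)" for x
      unfolding sJ by (intro sum.cong refl) (simp add: rot_def y'_def cpx_def algebra_simps)
    have 2: "(\<Sum>j\<in>?J. (y' j)\<^sup>2) = (\<Sum>j\<in>?J. (y j)\<^sup>2)"
      unfolding sJ
    proof (intro sum.cong refl)
      fix a
      have "(y' (a, False))\<^sup>2 + (y' (a, True))\<^sup>2 = ((Re z)\<^sup>2 + (Im z)\<^sup>2) * ((y (a, False))\<^sup>2 + (y (a, True))\<^sup>2)"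
        by (simp add: y'_def power2_eq_square algebra_simps)
      then show "(y' (a, False))\<^sup>2 + (y' (a, True))\<^sup>2 = (y (a, False))\<^sup>2 + (y (a, True))\<^sup>2" using z2 by simp
    qed
    show "(CLINT x|gauss_product ?J. iexp (\<Sum>j\<in>?J. y j * rot A z x j)) = complex_of_real (exp (- (\<Sum>j\<in>?J. (y j)\<^sup>2) / 2))"
      unfolding 1 using char_gauss_product[OF J, of y'] unfolding 2 .
  qed
  moreover have "(\<lambda>x. \<lambda>j\<in>?J. rot A z x j) = rot A z" by (auto simp: rot_def fun_eq_iff)
  ultimately show ?thesis by simp
qed

section \<open>Holomorphic functions of shifted Gaussian variables\<close>

text \<open>Cauchy estimates with explicit constants, so that they hold uniformly over families of functions.\<close>

lemma holomorphic_increment_bounds: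
  assumes g: "g holomorphic_on ball 0 R" and R: "0 < R" and K: "\<And>z. z \<in> ball 0 R \<Longrightarrow> cmod (g z) \<le> K"
    and z: "cmod z \<le> R / 2"
  shows "cmod (g z - g 0) \<le> 4 * K / R * cmod z"
    "cmod (g z - g 0 - z * deriv g 0) \<le> 32 * K / R\<^sup>2 * (cmod z)\<^sup>2"
proof -
  have op: "open (ball (0::complex) R)" by simp
  have bnd: "cmod ((deriv ^^ n) g w) \<le> fact n * K / (R / 4) ^ n" if "w \<in> cball 0 (R / 2)" for w n
  proof (rule Cauchy_inequality)
    have "cball w (R / 4) \<subseteq> ball 0 R"
    proof
      fix v assume "v \<in> cball w (R / 4)"
      then show "v \<in> ball 0 R" using that R norm_triangle_sub[of v w] by (simp add: dist_norm norm_minus_commute)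
    qed
    then show "g holomorphic_on ball w (R / 4)" "continuous_on (cball w (R / 4)) g"
      using g holomorphic_on_subset[OF g] holomorphic_on_imp_continuous_on
      by (meson ball_subset_cball order_trans)+
    show "cmod (g v) \<le> K" if "cmod (w - v) = R / 4" for v
      using K[of v] \<open>cball w (R / 4) \<subseteq> ball 0 R\<close> that by (auto simp: dist_norm subset_iff)
  qed (use R in simp)
  have hd: "((deriv ^^ n) g has_field_derivative (deriv ^^ Suc n) g w) (at w within cball 0 (R / 2))"
    if "w \<in> cball 0 (R / 2)" for w n
  proof -
    have "(deriv ^^ n) g holomorphic_on ball 0 R" by (rule holomorphic_higher_deriv[OF g op])
    then have "((deriv ^^ n) g has_field_derivative deriv ((deriv ^^ n) g) w) (at w)"
      using that R op by (intro holomorphic_derivI[OF _ op]) auto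
    then show ?thesis by (simp add: has_field_derivative_at_within)
  qed
  have z': "z \<in> cball 0 (R / 2)" "0 \<in> cball 0 (R / 2)" using z R by auto
  have "cmod ((deriv ^^ 0) g z - (\<Sum>i\<le>0. (deriv ^^ i) g 0 * (z - 0) ^ i / fact i)) \<le> (4 * K / R) * cmod (z - 0) ^ Suc 0 / fact 0"
  proof (rule complex_Taylor[where f = "\<lambda>i. (deriv ^^ i) g" and S = "cball 0 (R/2)"])
    show "((deriv ^^ i) g has_field_derivative (deriv ^^ Suc i) g w) (at w within cball 0 (R / 2))"
      if "w \<in> cball 0 (R/2)" "i \<le> 0" for i w using hd that by blast
    show "cmod ((deriv ^^ Suc 0) g w) \<le> 4 * K / R" if "w \<in> cball 0 (R/2)" for w
      using bnd[OF that, of 1] by (simp add: field_simps)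
  qed (use z' in auto)
  then show "cmod (g z - g 0) \<le> 4 * K / R * cmod z" by simp
  have "cmod ((deriv ^^ 0) g z - (\<Sum>i\<le>1. (deriv ^^ i) g 0 * (z - 0) ^ i / fact i)) \<le> (32 * K / R\<^sup>2) * cmod (z - 0) ^ Suc 1 / fact 1"
  proof (rule complex_Taylor[where f = "\<lambda>i. (deriv ^^ i) g" and S = "cball 0 (R/2)"])
    show "((deriv ^^ i) g has_field_derivative (deriv ^^ Suc i) g w) (at w within cball 0 (R / 2))"
      if "w \<in> cball 0 (R/2)" "i \<le> 1" for i w using hd that by blast
    show "cmod ((deriv ^^ Suc 1) g w) \<le> 32 * K / R\<^sup>2" if "w \<in> cball 0 (R/2)" for w
      using bnd[OF that, of 2] by (simp add: field_simps numeral_2_eq_2)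
  qed (use z' in auto)
  then show "cmod (g z - g 0 - z * deriv g 0) \<le> 32 * K / R\<^sup>2 * (cmod z)\<^sup>2"
    by (simp add: power2_eq_square algebra_simps)
qed

text \<open>The mean value property of \<open>g\<^sup>2\<close>.\<close>

lemma square_norm_le_circle_mean:
  assumes g: "g holomorphic_on UNIV"
  shows "ennreal ((cmod (g 0))\<^sup>2) \<le>
    (\<integral>\<^sup>+t. indicator {0..1} t * ennreal ((cmod (g (exp (2 * pi * \<i> * complex_of_real t))))\<^sup>2) \<partial>lborel)"
proof -
  define e where "e t = exp (2 * pi * \<i> * complex_of_real t)" for t :: real
  have ce: "continuous_on S e" for S unfolding e_def by (intro continuous_intros)
  have cg: "continuous_on S g" for S
    using holomorphic_on_imp_continuous_on[OF g] continuous_on_subset by blast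
  have cge: "continuous_on S (\<lambda>t. g (e t))" for S
    using continuous_on_compose[OF ce cg] by (simp add: o_def)
  have vd: "vector_derivative (\<lambda>x. exp (2 * of_real pi * \<i> * of_real x)) (at t)
      = 2 * of_real pi * \<i> * exp (2 * of_real pi * \<i> * of_real t)" for t :: real
    using vector_derivative_circlepath[of 0 1 t] by (simp add: circlepath)
  have "((\<lambda>u. (g u)\<^sup>2 / (u - 0)) has_contour_integral 2 * of_real pi * \<i> * (g 0)\<^sup>2) (circlepath 0 1)"
    using g by (intro Cauchy_integral_circlepath_simple)
      (auto intro!: holomorphic_intros intro: holomorphic_on_subset)
  then have "((\<lambda>t. (g (e t))\<^sup>2 / e t * (2 * of_real pi * \<i> * e t)) has_integral 2 * of_real pi * \<i> * (g 0)\<^sup>2) {0..1}"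
    unfolding has_contour_integral
    by (rule has_integral_spike[of "{}", rotated 2])
       (auto simp: circlepath e_def vd)
  then have "((\<lambda>t. (g (e t))\<^sup>2 / e t * (2 * of_real pi * \<i> * e t) / (2 * of_real pi * \<i>)) has_integral
      (2 * of_real pi * \<i> * (g 0)\<^sup>2) / (2 * of_real pi * \<i>)) {0..1}"
    by (rule has_integral_divide)
  then have hi: "((\<lambda>t. (g (e t))\<^sup>2) has_integral (g 0)\<^sup>2) {0..1}"
    by (simp add: e_def)
  have ci: "continuous_on {0..1} (\<lambda>t. (cmod (g (e t)))\<^sup>2)"
    using cge by (intro continuous_intros)
  have "(cmod (g 0))\<^sup>2 = cmod (integral {0..1} (\<lambda>t. (g (e t))\<^sup>2))"
    using integral_unique[OF hi] by (simp add: norm_power)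
  also have "\<dots> \<le> integral {0..1} (\<lambda>t. (cmod (g (e t)))\<^sup>2)"
    using hi integrable_continuous_interval[OF ci]
    by (intro integral_norm_bound_integral) (auto simp: norm_power has_integral_integrable)
  also have "\<dots> = (LBINT t:{0..1}. (cmod (g (e t)))\<^sup>2)"
    by (rule set_borel_integral_eq_integral(2)[symmetric, OF borel_integrable_atLeastAtMost'[OF ci]])
  finally have "ennreal ((cmod (g 0))\<^sup>2) \<le> ennreal (LBINT t:{0..1}. (cmod (g (e t)))\<^sup>2)" by (rule ennreal_leI)
  also have "\<dots> = (\<integral>\<^sup>+t. ennreal (indicator {0..1} t *\<^sub>R (cmod (g (e t)))\<^sup>2) \<partial>lborel)"
    using borel_integrable_atLeastAtMost'[OF ci] unfolding set_lebesgue_integral_def set_integrable_def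
    by (intro nn_integral_eq_integral[symmetric]) auto
  also have "\<dots> = (\<integral>\<^sup>+t. indicator {0..1} t * ennreal ((cmod (g (e t)))\<^sup>2) \<partial>lborel)"
    by (intro nn_integral_cong) (auto simp: indicator_def)
  finally show ?thesis unfolding e_def .
qed

text \<open>By the Cameron--Martin formula the integral of \<open>\<psi>\<close> is at least the integral over \<open>U\<close> of
  \<open>\<bar>F (x + \<alpha>)\<bar>\<^sup>2\<close> times \<open>exp (- \<langle>x, \<alpha>\<rangle> - \<bar>\<alpha>\<bar>\<^sup>2 / 2)\<close>. Since both \<open>U\<close> and the Gaussian measure are invariant
  under rotation, \<open>x\<close> may be replaced by \<open>z x\<close> and averaged over the circle \<open>\<bar>z\<bar> = 1\<close>. For fixed \<open>x\<close> the
  integrand is then the squared modulus of an entire function of \<open>z\<close>, so the average is at least the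
  value at \<open>z = 0\<close>. The event \<open>U\<close> and the majorant \<open>\<psi>\<close> allow \<open>F\<close> to be controlled only where the
  variables are bounded.\<close>

theorem gaussian_shift_estimate:
  fixes F :: "('i \<times> bool \<Rightarrow> real) \<Rightarrow> complex" and \<alpha> :: "'i \<times> bool \<Rightarrow> real"
  defines "J \<equiv> \<lambda>A. A \<times> (UNIV :: bool set)"
  assumes A: "finite A"
    and F[measurable]: "F \<in> borel_measurable (PiM (J A) (\<lambda>_. borel))"
    and \<psi>[measurable]: "\<psi> \<in> borel_measurable (PiM (J A) (\<lambda>_. borel))"
    and U[measurable]: "U \<in> sets (PiM (J A) (\<lambda>_. borel))"
    and U_rot: "\<And>x z. x \<in> U \<Longrightarrow> cmod z = 1 \<Longrightarrow> rot A z x \<in> U"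
    and hol: "\<And>x. x \<in> U \<Longrightarrow> (\<lambda>z. F (\<lambda>j\<in>J A. rot A z x j + \<alpha> j)) holomorphic_on UNIV"
    and bound: "\<And>x. x \<in> U \<Longrightarrow> ennreal ((cmod (F (\<lambda>j\<in>J A. x j + \<alpha> j)))\<^sup>2) \<le> \<psi> (\<lambda>j\<in>J A. x j + \<alpha> j)"
  shows "ennreal ((cmod (F (\<lambda>j\<in>J A. \<alpha> j)))\<^sup>2 * exp (- (\<Sum>j\<in>J A. (\<alpha> j)\<^sup>2) / 2)) * emeasure (gauss_product (J A)) U
    \<le> (\<integral>\<^sup>+x. \<psi> x \<partial>gauss_product (J A))"
proof -
  let ?J = "J A" and ?\<gamma> = "gauss_product (J A)"
  let ?e = "\<lambda>t. exp (2 * pi * \<i> * complex_of_real t)"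
  have fJ: "finite ?J" using A by (simp add: J_def)
  have sets: "sets ?\<gamma> = sets (PiM ?J (\<lambda>_. borel))" by (auto intro!: sets_PiM_cong)
  note [measurable_cong] = sets
  interpret G: prob_space ?\<gamma> by (rule prob_space_gauss_product)
  interpret P: pair_sigma_finite ?\<gamma> lborel
    by (intro pair_sigma_finite.intro G.sigma_finite_measure_axioms) unfold_locales
  define c where "c = (cmod (F (\<lambda>j\<in>?J. \<alpha> j)))\<^sup>2 * exp (- (\<Sum>j\<in>?J. (\<alpha> j)\<^sup>2) / 2)"
  define w where "w x = exp (- (\<Sum>j\<in>?J. x j * \<alpha> j) - (\<Sum>j\<in>?J. (\<alpha> j)\<^sup>2) / 2)" for x
  define h where "h x = ennreal (w x * (cmod (F (\<lambda>j\<in>?J. x j + \<alpha> j)))\<^sup>2)" for x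
  have wm[measurable]: "w \<in> borel_measurable (PiM ?J (\<lambda>_. borel))" unfolding w_def using fJ by measurable
  have Fs[measurable]: "(\<lambda>x. F (\<lambda>j\<in>?J. x j + \<alpha> j)) \<in> borel_measurable (PiM ?J (\<lambda>_. borel))"
    by (rule measurable_compose[OF _ F]) measurable
  have hm[measurable]: "h \<in> borel_measurable (PiM ?J (\<lambda>_. borel))" unfolding h_def by measurable
  have rm[measurable]: "(\<lambda>(x, t). rot A (?e t) x) \<in> measurable (?\<gamma> \<Otimes>\<^sub>M lborel) (PiM ?J (\<lambda>_. borel))"
  proof -
    have e: "rot A z x = (\<lambda>p\<in>?J. if snd p then Re z * x (fst p, True) + Im z * x (fst p, False)
        else Re z * x (fst p, False) - Im z * x (fst p, True))" for x z
      by (auto simp: rot_def cpx_def fun_eq_iff restrict_def J_def)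
    have [measurable]: "(\<lambda>t. Re (?e t)) \<in> borel_measurable borel" "(\<lambda>t. Im (?e t)) \<in> borel_measurable borel"
      by (intro borel_measurable_continuous_onI continuous_intros)+
    show ?thesis
      unfolding e split_beta'
    proof (rule measurable_restrict)
      fix p assume p: "p \<in> ?J"
      have [measurable]: "(\<lambda>x. x (fst p, b)) \<in> borel_measurable ?\<gamma>" for b
        using p unfolding J_def by (subst measurable_cong_sets[OF sets[unfolded J_def] refl]) (intro measurable_component_singleton, auto)
      show "(\<lambda>x. if snd p then Re (?e (snd x)) * fst x (fst p, True) + Im (?e (snd x)) * fst x (fst p, False)
        else Re (?e (snd x)) * fst x (fst p, False) - Im (?e (snd x)) * fst x (fst p, True))
          \<in> borel_measurable (?\<gamma> \<Otimes>\<^sub>M lborel)"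
        by measurable
    qed
  qed
  have sm: "(\<Sum>j\<in>?J. k j) = (\<Sum>a\<in>A. k (a, False) + k (a, True))" for k :: "'i \<times> bool \<Rightarrow> real"
    unfolding J_def by (rule sum_times_bool)
  have mean: "ennreal c \<le> (\<integral>\<^sup>+t. indicator {0..1} t * h (rot A (?e t) x) \<partial>lborel)" if x: "x \<in> U" for x
  proof -
    define s where "s = (\<Sum>a\<in>A. cpx x a * cnj (cpx \<alpha> a))"
    define q where "q = (\<Sum>j\<in>?J. (\<alpha> j)\<^sup>2)"
    \<comment> \<open>The density at the rotated point is the squared modulus of the second factor, because the real
      inner product with \<open>\<alpha>\<close> is the real part of the complex linear \<open>z \<mapsto> z s\<close>.\<close>
    define g where "g z = F (\<lambda>j\<in>?J. rot A z x j + \<alpha> j) * exp (- (z * s) / 2 - complex_of_real q / 4)" for z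
    have "g holomorphic_on UNIV" unfolding g_def using hol[OF x] by (intro holomorphic_intros) auto
    then have "ennreal ((cmod (g 0))\<^sup>2) \<le> (\<integral>\<^sup>+t. indicator {0..1} t * ennreal ((cmod (g (?e t)))\<^sup>2) \<partial>lborel)"
      by (rule square_norm_le_circle_mean)
    moreover have "(cmod (g z))\<^sup>2 = w (rot A z x) * (cmod (F (\<lambda>j\<in>?J. rot A z x j + \<alpha> j)))\<^sup>2" for z
    proof -
      have "(\<Sum>j\<in>?J. rot A z x j * \<alpha> j) = (\<Sum>a\<in>A. Re (z * (cpx x a * cnj (cpx \<alpha> a))))"
        unfolding sm by (intro sum.cong refl) (simp add: rot_def cpx_def algebra_simps)
      also have "\<dots> = Re (z * s)" by (simp add: s_def sum_distrib_left)
      finally have "(cmod (exp (- (z * s) / 2 - complex_of_real q / 4)))\<^sup>2 = w (rot A z x)"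
        unfolding w_def q_def[symmetric]
        by (simp add: exp_double[symmetric] field_simps)
      then show ?thesis by (simp add: g_def norm_mult power_mult_distrib mult.commute)
    qed
    moreover have "(cmod (g 0))\<^sup>2 = c"
    proof -
      have "(\<lambda>j\<in>?J. rot A 0 x j + \<alpha> j) = (\<lambda>j\<in>?J. \<alpha> j)" by (auto simp: rot_def J_def fun_eq_iff)
      then show ?thesis
        by (simp add: g_def c_def q_def[symmetric] norm_mult power_mult_distrib)
           (simp add: power2_eq_square exp_add[symmetric])
    qed
    ultimately show ?thesis by (simp add: h_def)
  qed
  have "ennreal c * emeasure ?\<gamma> U = (\<integral>\<^sup>+x. ennreal c * indicator U x \<partial>?\<gamma>)"
    by (subst nn_integral_cmult_indicator) auto
  also have "\<dots> \<le> (\<integral>\<^sup>+x. (\<integral>\<^sup>+t. indicator {0..1} t * (indicator U (rot A (?e t) x) * h (rot A (?e t) x)) \<partial>lborel) \<partial>?\<gamma>)"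
  proof (rule nn_integral_mono)
    fix x
    show "ennreal c * indicator U x \<le> (\<integral>\<^sup>+t. indicator {0..1} t * (indicator U (rot A (?e t) x) * h (rot A (?e t) x)) \<partial>lborel)"
    proof (cases "x \<in> U")
      case True
      then have "rot A (?e t) x \<in> U" for t by (intro U_rot) auto
      then show ?thesis using mean[OF True] True by simp
    qed simp
  qed
  also have "\<dots> = (\<integral>\<^sup>+t. (\<integral>\<^sup>+x. indicator {0..1} t * (indicator U (rot A (?e t) x) * h (rot A (?e t) x)) \<partial>?\<gamma>) \<partial>lborel)"
  proof (rule P.Fubini'[symmetric])
    have "(\<lambda>p. indicator {0..1} (snd p) * (indicator U (rot A (?e (snd p)) (fst p)) * h (rot A (?e (snd p)) (fst p)))) \<in> borel_measurable (?\<gamma> \<Otimes>\<^sub>M lborel)"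
      using measurable_compose[OF rm borel_measurable_indicator[OF U]] measurable_compose[OF rm hm]
      by (intro borel_measurable_times_ennreal) (auto simp: split_beta')
    then show "(\<lambda>(x, t). indicator {0..1} t * (indicator U (rot A (?e t) x) * h (rot A (?e t) x))) \<in> borel_measurable (?\<gamma> \<Otimes>\<^sub>M lborel)"
      by (simp add: split_beta')
  qed
  also have "\<dots> = (\<integral>\<^sup>+t. indicator {0..1::real} t * (\<integral>\<^sup>+y. indicator U y * h y \<partial>?\<gamma>) \<partial>lborel)"
  proof (rule nn_integral_cong)
    fix t :: real
    have rt[measurable]: "rot A (?e t) \<in> measurable ?\<gamma> (PiM ?J (\<lambda>_. borel))"
      unfolding J_def by (subst measurable_cong_sets[OF sets[unfolded J_def] refl]) (rule rot_measurable)
    have "(\<integral>\<^sup>+x. indicator {0..1} t * (indicator U (rot A (?e t) x) * h (rot A (?e t) x)) \<partial>?\<gamma>)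
        = indicator {0..1} t * (\<integral>\<^sup>+x. indicator U (rot A (?e t) x) * h (rot A (?e t) x) \<partial>?\<gamma>)"
      by (rule nn_integral_cmult) measurable
    also have "(\<integral>\<^sup>+x. indicator U (rot A (?e t) x) * h (rot A (?e t) x) \<partial>?\<gamma>)
        = (\<integral>\<^sup>+y. indicator U y * h y \<partial>distr ?\<gamma> (PiM ?J (\<lambda>_. borel)) (rot A (?e t)))"
      by (rule nn_integral_distr[symmetric, OF rt]) measurable
    also have "distr ?\<gamma> (PiM ?J (\<lambda>_. borel)) (rot A (?e t)) = ?\<gamma>"
      unfolding J_def by (rule gauss_product_rotation[OF A]) simp
    finally show "(\<integral>\<^sup>+x. indicator {0..1} t * (indicator U (rot A (?e t) x) * h (rot A (?e t) x)) \<partial>?\<gamma>)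
      = indicator {0..1} t * (\<integral>\<^sup>+y. indicator U y * h y \<partial>?\<gamma>)" .
  qed
  also have "\<dots> = (\<integral>\<^sup>+y. indicator U y * h y \<partial>?\<gamma>)"
    by (subst nn_integral_multc) auto
  also have "\<dots> \<le> (\<integral>\<^sup>+x. ennreal (w x) * \<psi> (\<lambda>j\<in>?J. x j + \<alpha> j) \<partial>?\<gamma>)"
  proof (rule nn_integral_mono)
    fix x
    show "indicator U x * h x \<le> ennreal (w x) * \<psi> (\<lambda>j\<in>?J. x j + \<alpha> j)"
      using bound[of x] by (auto simp: indicator_def h_def w_def ennreal_mult intro!: mult_left_mono)
  qed
  also have "\<dots> = (\<integral>\<^sup>+x. \<psi> x \<partial>?\<gamma>)"
    unfolding w_def by (rule gauss_product_shift[OF fJ \<psi>])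
  finally show ?thesis unfolding c_def .
qed

section \<open>Complex abstract Wiener spaces\<close>

lemma bounded_linear_scaleC: "bounded_linear (\<lambda>x. a *\<^sub>C (x :: 'a :: complex_normed_vector))"
proof (rule bounded_linear_intro[where K = "cmod a"])
  show "a *\<^sub>C (r *\<^sub>R x) = r *\<^sub>R (a *\<^sub>C x)" for r and x :: 'a
    by (simp add: scaleC_of_real[symmetric] scaleC_scaleC mult.commute)
qed (simp_all add: scaleC_add_right norm_scaleC mult.commute)

lemma scaleC_one: "1 *\<^sub>C (x :: 'a :: complex_normed_vector) = x"
  using scaleC_of_real[of 1 x] by simp

lemma scaleC_zero: "0 *\<^sub>C (x :: 'a :: complex_normed_vector) = 0"
  using scaleC_of_real[of 0 x] by simp

lemma scaleC_minus1: "(- 1) *\<^sub>C (x :: 'a :: complex_normed_vector) = - x"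
  using scaleC_of_real[of "-1" x] by simp

lemma scaleC_neg_left: "(- a) *\<^sub>C (x :: 'a :: complex_normed_vector) = - (a *\<^sub>C x)"
  using scaleC_scaleC[of "-1" a x] by (simp add: scaleC_minus1)

lemma scaleC_ii: "\<i> *\<^sub>C \<i> *\<^sub>C (x :: 'a :: complex_normed_vector) = - x"
  by (simp add: scaleC_scaleC scaleC_minus1)

lemma scaleC_split: "a *\<^sub>C (x :: 'a :: complex_normed_vector) = Re a *\<^sub>R x + Im a *\<^sub>R (\<i> *\<^sub>C x)"
proof -
  have "a = complex_of_real (Re a) + complex_of_real (Im a) * \<i>" by (simp add: complex_eq_iff)
  then have "a *\<^sub>C x = (complex_of_real (Re a) + complex_of_real (Im a) * \<i>) *\<^sub>C x"
    by (rule arg_cong)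
  then show ?thesis by (simp only: scaleC_add_left scaleC_scaleC[symmetric] scaleC_of_real)
qed

lemmas scaleC_linear = linear_simps[OF bounded_linear_scaleC]

text \<open>The complex structure of the dual under which the representing vectors satisfy
  \<open>\<i> *\<^sub>C rep u = rep (dual_J u)\<close>.\<close>

definition dual_J :: "('w::complex_normed_vector \<Rightarrow>\<^sub>L real) \<Rightarrow> 'w \<Rightarrow>\<^sub>L real" where
  "dual_J u = Blinfun (\<lambda>w. - blinfun_apply u (\<i> *\<^sub>C w))"

lemma dual_J_apply: "blinfun_apply (dual_J u) w = - blinfun_apply u (\<i> *\<^sub>C w)"
  unfolding dual_J_def
  by (subst bounded_linear_Blinfun_apply)
     (auto intro!: bounded_linear_minus bounded_linear_compose[OF blinfun.bounded_linear_right bounded_linear_scaleC])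

lemma dual_J_linear: "dual_J (u + v) = dual_J u + dual_J v" "dual_J (r *\<^sub>R u) = r *\<^sub>R dual_J u"
    "dual_J (- u) = - dual_J u" "dual_J (dual_J u) = - u"
  by (rule blinfun_eqI; simp add: dual_J_apply blinfun.bilinear_simps scaleC_ii)+

text \<open>The complex linear functional with real part \<open>u\<close>.\<close>

definition cfun :: "('w::complex_normed_vector \<Rightarrow>\<^sub>L real) \<Rightarrow> 'w \<Rightarrow> complex" where
  "cfun u x = Complex (blinfun_apply u x) (blinfun_apply (dual_J u) x)"

lemma cfun_linear: "cfun u (x + y) = cfun u x + cfun u y" "cfun u (a *\<^sub>C x) = a * cfun u x"
    "cfun u (x - y) = cfun u x - cfun u y" "cfun u 0 = 0"
proof -
  show "cfun u (a *\<^sub>C x) = a * cfun u x"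
    by (subst scaleC_split) (simp add: cfun_def complex_eq_iff blinfun.bilinear_simps dual_J_apply scaleC_ii scaleC_linear)
qed (simp_all add: cfun_def complex_eq_iff blinfun.bilinear_simps)

lemma cfun_continuous: "continuous_on S (cfun u)"
proof -
  have "cfun u = (\<lambda>x. complex_of_real (blinfun_apply u x) + \<i> * complex_of_real (blinfun_apply (dual_J u) x))"
    by (simp add: cfun_def complex_eq_iff fun_eq_iff)
  then show ?thesis by (auto intro!: continuous_intros)
qed

locale cwiener =
  fixes \<mu> :: "'w::{complex_normed_vector, banach, second_countable_topology} measure"
    and q :: "('w \<Rightarrow>\<^sub>L real) \<Rightarrow> ('w \<Rightarrow>\<^sub>L real) \<Rightarrow> real"
  assumes cw: "complex_wiener_space \<mu> q"
begin

sublocale prob_space \<mu> using cw by (simp add: complex_wiener_space_def)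

lemma sets_mu [measurable_cong]: "sets \<mu> = sets borel" using cw by (simp add: complex_wiener_space_def)

lemma rip: "real_inner_product q" using cw by (simp add: complex_wiener_space_def)

lemma q_sym: "q u v = q v u" and q_add_left: "q (u + v) w = q u w + q v w"
  and q_scale_left: "q (r *\<^sub>R u) v = r * q u v" and q_pos: "u \<noteq> 0 \<Longrightarrow> 0 < q u u"
  using rip unfolding real_inner_product_def by blast+

lemma q_add_right: "q w (u + v) = q w u + q w v" by (metis q_add_left q_sym)
lemma q_scale_right: "q v (r *\<^sub>R u) = r * q v u" by (metis q_scale_left q_sym)
lemma q_zero: "q 0 v = 0" "q v 0 = 0" using q_scale_left[of 0 0 v] q_scale_right[of v 0 0] by simp_all
lemma q_minus: "q (- u) v = - q u v" "q v (- u) = - q v u"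
  using q_scale_left[of "-1" u v] q_scale_right[of v "-1" u] by simp_all
lemma q_nonneg: "0 \<le> q u u" using q_pos[of u] q_zero by (cases "u = 0") auto
lemma q_diff_left: "q (u - v) w = q u w - q v w"
  using q_add_left[of u "- v" w] by (simp add: q_minus)

lemmas q_simps = q_add_left q_add_right q_scale_left q_scale_right q_zero q_minus

lemma q_Cauchy_Schwarz: "\<bar>q u v\<bar> \<le> sqrt (q u u) * sqrt (q v v)"
proof (cases "v = 0")
  case False
  then have Q: "0 < q v v" by (rule q_pos)
  define s where "s = q u v / q v v"
  have "0 \<le> q (u + (- s) *\<^sub>R v) (u + (- s) *\<^sub>R v)" by (rule q_nonneg)
  also have "\<dots> = q u u - 2 * s * q u v + s\<^sup>2 * q v v"
    by (simp add: q_simps q_sym[of v u] power2_eq_square algebra_simps del: scaleR_minus_left)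
  also have "\<dots> = q u u - (q u v)\<^sup>2 / q v v" using Q by (simp add: s_def field_simps power2_eq_square)
  finally have "(q u v)\<^sup>2 \<le> q u u * q v v" using Q by (simp add: field_simps)
  then have "sqrt ((q u v)\<^sup>2) \<le> sqrt (q u u * q v v)" by (rule real_sqrt_le_mono)
  then show ?thesis by (simp add: real_sqrt_mult)
qed (simp add: q_zero)

lemma char_mu: "(CLINT w|\<mu>. iexp (blinfun_apply u w)) = complex_of_real (exp (- q u u / 2))"
  using cw by (simp add: complex_wiener_space_def)

lemma blinfun_measurable [measurable]: "blinfun_apply u \<in> borel_measurable \<mu>" for u :: "'w \<Rightarrow>\<^sub>L real"
  using borel_measurable_continuous_onI[OF linear_continuous_on[OF blinfun.bounded_linear_right]]
  by (subst measurable_cong_sets[OF sets_mu refl])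

lemma second_moments:
  shows "integrable \<mu> (\<lambda>w. (blinfun_apply u w)\<^sup>2)" "expectation (\<lambda>w. (blinfun_apply u w)\<^sup>2) = q u u"
proof -
  have "char (distr \<mu> borel (blinfun_apply u)) y = complex_of_real (exp (- q u u * y\<^sup>2 / 2))" for y
  proof -
    have "char (distr \<mu> borel (blinfun_apply u)) y = (CLINT w|\<mu>. iexp (blinfun_apply (y *\<^sub>R u) w))"
      by (simp add: char_def integral_distr blinfun.bilinear_simps)
    then show ?thesis unfolding char_mu by (simp add: q_simps power2_eq_square mult_ac)
  qed
  note gaussian_law_moments[OF blinfun_measurable q_nonneg this]
  then show "integrable \<mu> (\<lambda>w. (blinfun_apply u w)\<^sup>2)" "expectation (\<lambda>w. (blinfun_apply u w)\<^sup>2) = q u u"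
    by auto
qed

lemma mixed_moments:
  shows "integrable \<mu> (\<lambda>w. blinfun_apply u w * blinfun_apply v w)"
    "expectation (\<lambda>w. blinfun_apply u w * blinfun_apply v w) = q u v"
proof -
  have e: "blinfun_apply u w * blinfun_apply v w =
      ((blinfun_apply (u + v) w)\<^sup>2 - (blinfun_apply u w)\<^sup>2 - (blinfun_apply v w)\<^sup>2) / 2" for w
    by (simp add: blinfun.bilinear_simps power2_eq_square algebra_simps)
  show "integrable \<mu> (\<lambda>w. blinfun_apply u w * blinfun_apply v w)"
    unfolding e using second_moments(1) by (intro integrable_divide Bochner_Integration.integrable_diff) auto
  show "expectation (\<lambda>w. blinfun_apply u w * blinfun_apply v w) = q u v"
    unfolding e using second_moments by (simp add: q_simps q_sym[of v u])
qed

text \<open>Otherwise there are functionals \<open>u\<^sub>n\<close> tending to zero in norm with \<open>q u\<^sub>n u\<^sub>n > 1\<close>. By dominated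
  convergence the characteristic function tends to \<open>1\<close> along them, but it stays below \<open>exp (- 1 / 2)\<close>.\<close>

lemma q_bounded: obtains C where "0 < C" "\<And>u. q u u \<le> C\<^sup>2 * (norm u)\<^sup>2"
proof -
  have "\<exists>d>0. \<forall>u. norm u \<le> d \<longrightarrow> q u u \<le> 1"
  proof (rule ccontr)
    assume "\<not> (\<exists>d>0. \<forall>u. norm u \<le> d \<longrightarrow> q u u \<le> 1)"
    then have "\<forall>n. \<exists>u. norm u \<le> 1 / real (Suc n) \<and> 1 < q u u" by (metis divide_pos_pos not_le of_nat_0_less_iff zero_less_Suc zero_less_one)
    then obtain u where u: "\<And>n. norm (u n) \<le> 1 / real (Suc n)" "\<And>n. 1 < q (u n) (u n)" by metis
    have "(\<lambda>n. CLINT w|\<mu>. iexp (blinfun_apply (u n) w)) \<longlonglongrightarrow> (CLINT w|\<mu>. 1)"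
    proof (rule integral_dominated_convergence[where w = "\<lambda>_. 1"])
      show "AE w in \<mu>. (\<lambda>n. iexp (blinfun_apply (u n) w)) \<longlonglongrightarrow> 1"
      proof (rule AE_I2)
        fix w
        have "(\<lambda>n. blinfun_apply (u n) w) \<longlonglongrightarrow> 0"
        proof (rule Lim_null_comparison)
          show "\<forall>\<^sub>F n in sequentially. norm (blinfun_apply (u n) w) \<le> (1 / real (Suc n)) * norm w"
            using u(1) by (intro always_eventually allI order_trans[OF norm_blinfun] mult_right_mono) auto
          have "(\<lambda>n. 1 / real (Suc n) * norm w) \<longlonglongrightarrow> 0 * norm w"
            using LIMSEQ_inverse_real_of_nat by (intro tendsto_mult_right) (simp add: inverse_eq_divide)
          then show "(\<lambda>n. 1 / real (Suc n) * norm w) \<longlonglongrightarrow> 0" by simp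
        qed
        then have "(\<lambda>n. iexp (blinfun_apply (u n) w)) \<longlonglongrightarrow> iexp 0" by (intro tendsto_intros)
        then show "(\<lambda>n. iexp (blinfun_apply (u n) w)) \<longlonglongrightarrow> 1" by simp
      qed
    qed auto
    then have "(\<lambda>n. complex_of_real (exp (- q (u n) (u n) / 2))) \<longlonglongrightarrow> complex_of_real 1"
      unfolding char_mu by (simp add: prob_space)
    then have "(\<lambda>n. exp (- q (u n) (u n) / 2)) \<longlonglongrightarrow> 1" by (simp only: tendsto_of_real_iff)
    then have "1 \<le> exp (- 1 / 2 :: real)"
      using u(2) by (intro LIMSEQ_le_const2) (auto intro!: exI[of _ 0] less_imp_le)
    then show False by simp
  qed
  then obtain d where d: "0 < d" "\<And>u. norm u \<le> d \<Longrightarrow> q u u \<le> 1" by blast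
  show ?thesis
  proof (rule that[of "1 / d"])
    fix u
    show "q u u \<le> (1 / d)\<^sup>2 * (norm u)\<^sup>2"
    proof (cases "u = 0")
      case False
      then have n: "0 < norm u" by simp
      have "q ((d / norm u) *\<^sub>R u) ((d / norm u) *\<^sub>R u) \<le> 1" using n d(1) by (intro d(2)) auto
      then have "(d / norm u)\<^sup>2 * q u u \<le> 1" by (simp add: q_simps power2_eq_square)
      then show ?thesis using n d(1) by (simp add: field_simps)
    qed (simp add: q_zero)
  qed (use d in simp)
qed

definition qC :: real where "qC = (SOME C. 0 < C \<and> (\<forall>u. q u u \<le> C\<^sup>2 * (norm u)\<^sup>2))"

lemma qC_pos: "0 < qC" and q_le_qC: "q u u \<le> qC\<^sup>2 * (norm u)\<^sup>2"
proof -
  have "\<exists>C. 0 < C \<and> (\<forall>u. q u u \<le> C\<^sup>2 * (norm u)\<^sup>2)" using q_bounded by blast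
  from someI_ex[OF this] show "0 < qC" "q u u \<le> qC\<^sup>2 * (norm u)\<^sup>2" unfolding qC_def by blast+
qed

lemma sqrt_q_le: "sqrt (q u u) \<le> qC * norm u"
  using real_sqrt_le_mono[OF q_le_qC[of u]] qC_pos by (simp add: real_sqrt_mult)

text \<open>Invariance of the measure under multiplication by \<open>\<i>\<close>, read off from the characteristic function.\<close>

lemma q_J: "q (dual_J u) (dual_J u) = q u u"
proof -
  have [measurable]: "(\<lambda>w. \<i> *\<^sub>C w) \<in> measurable \<mu> borel"
    using borel_measurable_continuous_onI[OF linear_continuous_on[OF bounded_linear_scaleC]]
    by (subst measurable_cong_sets[OF sets_mu refl])
  have "complex_of_real (exp (- q (dual_J u) (dual_J u) / 2)) = (CLINT w|\<mu>. iexp (blinfun_apply (- u) (\<i> *\<^sub>C w)))"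
    unfolding char_mu[symmetric] by (simp add: dual_J_apply blinfun.bilinear_simps)
  also have "\<dots> = (CLINT w|distr \<mu> borel (\<lambda>w. \<i> *\<^sub>C w). iexp (blinfun_apply (- u) w))"
  proof (rule integral_distr[symmetric])
    have "blinfun_apply (- u) \<in> borel_measurable borel"
      by (intro borel_measurable_continuous_onI linear_continuous_on blinfun.bounded_linear_right)
    then show "(\<lambda>w. iexp (blinfun_apply (- u) w)) \<in> borel_measurable borel" by measurable
  qed measurable
  also have "distr \<mu> borel (\<lambda>w. \<i> *\<^sub>C w) = \<mu>" using cw by (simp add: complex_wiener_space_def)
  finally show ?thesis unfolding char_mu by (simp only: of_real_eq_iff exp_inj_iff q_minus)
qed

lemma q_JJ: "q (dual_J u) (dual_J v) = q u v"
  using q_J[of "u + v"] q_J[of u] q_J[of v] by (simp add: dual_J_linear q_simps q_sym[of v u] q_sym[of "dual_J v" "dual_J u"])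

lemma q_J_left: "q (dual_J u) v = - q u (dual_J v)"
  using q_JJ[of "dual_J u" v] by (simp add: dual_J_linear q_minus)

text \<open>The representing vector is the mean of \<open>u w *\<^sub>R w\<close>. Only the variables \<open>v w\<close> are known to be square
  integrable, not the norm of \<open>w\<close>, so the mean is taken over growing balls. The truncated means form a
  Cauchy sequence: their differences are tested with norming functionals \<open>v\<close>, and the second moments
  \<open>q v v\<close> of these are bounded by \<open>qC\<^sup>2\<close>.\<close>

lemma rep_exists: "\<exists>x. \<forall>v. blinfun_apply v x = q u v"
proof -
  define X where "X n = (LINT w|\<mu>. (indicator (cball 0 (real n)) w * blinfun_apply u w) *\<^sub>R w)" for n :: nat
  have idm: "(\<lambda>w. w) \<in> measurable \<mu> borel" by (simp add: measurable_ident_sets[OF sets_mu])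
  have iX: "integrable \<mu> (\<lambda>w. (indicator (cball 0 (real n)) w * blinfun_apply u w) *\<^sub>R w)" for n
  proof (rule integrable_const_bound[where B = "norm u * real n * real n"])
    have "norm ((indicator (cball 0 (real n)) w * blinfun_apply u w) *\<^sub>R w) \<le> norm u * real n * real n" for w
    proof (cases "norm w \<le> real n")
      case True
      have "\<bar>blinfun_apply u w\<bar> * norm w \<le> (norm u * real n) * real n"
        using order_trans[OF norm_blinfun[of u w] mult_left_mono[OF True norm_ge_zero]] True
        by (intro mult_mono) auto
      then show ?thesis using True by simp
    qed simp
    then show "AE w in \<mu>. norm ((indicator (cball 0 (real n)) w * blinfun_apply u w) *\<^sub>R w) \<le> norm u * real n * real n" by simp
    have "cball 0 (real n) \<in> sets \<mu>" by (simp add: sets_mu)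
    then show "(\<lambda>w. (indicator (cball 0 (real n)) w * blinfun_apply u w) *\<^sub>R w) \<in> borel_measurable \<mu>"
      by (intro borel_measurable_scaleR borel_measurable_times borel_measurable_indicator blinfun_measurable idm)
  qed
  have vX: "blinfun_apply v (X n) = (LINT w|\<mu>. indicator (cball 0 (real n)) w * (blinfun_apply u w * blinfun_apply v w))" for v n
    unfolding X_def integral_bounded_linear[OF blinfun.bounded_linear_right iX, symmetric]
    by (simp add: blinfun.bilinear_simps mult.assoc)
  have iuv: "integrable \<mu> (\<lambda>w. indicator S w * (blinfun_apply u w * blinfun_apply v w))" if "S \<in> sets borel" for S v
    using integrable_mult_indicator[OF _ mixed_moments(1)[of u v], of S] that by (simp add: sets_mu)
  define \<tau> where "\<tau> n = (LINT w|\<mu>. indicator (- cball 0 (real n)) w * (blinfun_apply u w)\<^sup>2)" for n :: nat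
  have pt: "(\<lambda>n. indicator (cball 0 (real n)) w :: real) \<longlonglongrightarrow> 1" for w :: 'w
  proof (rule tendsto_eventually)
    obtain N where "norm w \<le> real N" using real_arch_simple by blast
    then show "\<forall>\<^sub>F n in sequentially. indicator (cball 0 (real n)) w = (1::real)"
      by (intro eventually_sequentiallyI[of N]) (auto simp: indicator_def)
  qed
  have lim: "(\<lambda>n. LINT w|\<mu>. indicator (cball 0 (real n)) w * (blinfun_apply u w * blinfun_apply v w)) \<longlonglongrightarrow> q u v" for v
    unfolding mixed_moments(2)[symmetric]
  proof (rule integral_dominated_convergence[where w = "\<lambda>w. norm (blinfun_apply u w * blinfun_apply v w)"])
    show "AE w in \<mu>. (\<lambda>n. indicator (cball 0 (real n)) w * (blinfun_apply u w * blinfun_apply v w)) \<longlonglongrightarrow> blinfun_apply u w * blinfun_apply v w"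
      using tendsto_mult_right[OF pt] by auto
    show "integrable \<mu> (\<lambda>w. norm (blinfun_apply u w * blinfun_apply v w))" using mixed_moments(1) by (rule integrable_norm)
  qed (auto simp: indicator_def abs_mult)
  have \<tau>eq: "\<tau> n = q u u - (LINT w|\<mu>. indicator (cball 0 (real n)) w * (blinfun_apply u w * blinfun_apply u w))" for n
  proof -
    have "\<tau> n = (LINT w|\<mu>. blinfun_apply u w * blinfun_apply u w - indicator (cball 0 (real n)) w * (blinfun_apply u w * blinfun_apply u w))"
      unfolding \<tau>_def by (intro Bochner_Integration.integral_cong refl) (auto simp: indicator_def power2_eq_square)
    also have "\<dots> = q u u - (LINT w|\<mu>. indicator (cball 0 (real n)) w * (blinfun_apply u w * blinfun_apply u w))"
      using iuv[of "cball 0 (real n)" u] mixed_moments by simp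
    finally show ?thesis .
  qed
  have \<tau>0: "\<tau> \<longlonglongrightarrow> 0" using tendsto_diff[OF tendsto_const lim[of u], of "q u u"] unfolding \<tau>eq[abs_def] by simp
  have diff: "norm (X m - X n) \<le> \<tau> n / (2 * e) + e * qC\<^sup>2 / 2" if mn: "n \<le> m" and e: "0 < e" for m n e
  proof -
    obtain v :: "'w \<Rightarrow>\<^sub>L real" where v: "norm v \<le> 1" "blinfun_apply v (X m - X n) = norm (X m - X n)"
      by (rule norm_attained_by_functional)
    have "norm (X m - X n) = (LINT w|\<mu>. indicator (cball 0 (real m)) w * (blinfun_apply u w * blinfun_apply v w)
        - indicator (cball 0 (real n)) w * (blinfun_apply u w * blinfun_apply v w))"
      unfolding v(2)[symmetric] blinfun.diff_right vX using iuv by (intro Bochner_Integration.integral_diff[symmetric]) auto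
    also have "\<dots> \<le> (LINT w|\<mu>. indicator (- cball 0 (real n)) w * (blinfun_apply u w)\<^sup>2 / (2 * e) + e / 2 * (blinfun_apply v w)\<^sup>2)"
    proof (rule integral_mono)
      show "integrable \<mu> (\<lambda>w. indicator (cball 0 (real m)) w * (blinfun_apply u w * blinfun_apply v w)
        - indicator (cball 0 (real n)) w * (blinfun_apply u w * blinfun_apply v w))" using iuv by (intro Bochner_Integration.integrable_diff) auto
      show "integrable \<mu> (\<lambda>w. indicator (- cball 0 (real n)) w * (blinfun_apply u w)\<^sup>2 / (2 * e) + e / 2 * (blinfun_apply v w)\<^sup>2)"
        using iuv[of "- cball 0 (real n)" u] second_moments(1)[of v]
        by (intro Bochner_Integration.integrable_add integrable_divide integrable_mult_right) (auto simp: power2_eq_square)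
      fix w
      have am: "a * b \<le> a\<^sup>2 / (2 * e) + e / 2 * b\<^sup>2" for a b :: real
      proof -
        have "0 \<le> (a - e * b)\<^sup>2 / (2 * e)" using e by simp
        then show ?thesis using e by (simp add: power2_eq_square field_simps)
      qed
      show "indicator (cball 0 (real m)) w * (blinfun_apply u w * blinfun_apply v w) - indicator (cball 0 (real n)) w * (blinfun_apply u w * blinfun_apply v w)
        \<le> indicator (- cball 0 (real n)) w * (blinfun_apply u w)\<^sup>2 / (2 * e) + e / 2 * (blinfun_apply v w)\<^sup>2"
        using mn e am[of "blinfun_apply u w" "blinfun_apply v w"] by (auto simp: indicator_def)
    qed
    also have "\<dots> = \<tau> n / (2 * e) + e / 2 * q v v"
      using iuv[of "- cball 0 (real n)" u] second_moments[of v] unfolding \<tau>_def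
      by (subst Bochner_Integration.integral_add) (auto simp: power2_eq_square)
    also have "\<dots> \<le> \<tau> n / (2 * e) + e * qC\<^sup>2 / 2"
    proof -
      have "q v v \<le> qC\<^sup>2 * (norm v)\<^sup>2" by (rule q_le_qC)
      also have "\<dots> \<le> qC\<^sup>2 * 1" using v(1) by (intro mult_left_mono) (auto simp: power_le_one)
      finally show ?thesis using e by simp
    qed
    finally show ?thesis .
  qed
  have "Cauchy X"
  proof (rule metric_CauchyI)
    fix e :: real assume e: "0 < e"
    define d where "d = e / (2 * qC\<^sup>2)"
    have d: "0 < d" using e qC_pos by (simp add: d_def)
    have "\<forall>\<^sub>F n in sequentially. \<tau> n < e * d / 2" using e d by (intro order_tendstoD(2)[OF \<tau>0]) simp
    then obtain N where N: "\<And>n. N \<le> n \<Longrightarrow> \<tau> n < e * d / 2" by (auto simp: eventually_sequentially)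
    have small: "norm (X m - X n) < e / 2 + e / 2" if "N \<le> n" "n \<le> m" for m n
    proof -
      have "norm (X m - X n) \<le> \<tau> n / (2 * d) + d * qC\<^sup>2 / 2" using diff that d by blast
      moreover have "\<tau> n / (2 * d) < e / 2" 
      proof -
        have "\<tau> n < e * d" using N[OF that(1)] mult_pos_pos[OF e d] by linarith
        then show ?thesis using d by (simp add: field_simps)
      qed
      moreover have "d * qC\<^sup>2 / 2 \<le> e / 2" using qC_pos e by (simp add: d_def)
      ultimately show ?thesis by linarith
    qed
    show "\<exists>N. \<forall>m\<ge>N. \<forall>n\<ge>N. dist (X m) (X n) < e"
    proof (intro exI allI impI)
      fix m n assume "N \<le> m" "N \<le> n"
      then show "dist (X m) (X n) < e"
        using small[of n m] small[of m n] by (cases "n \<le> m") (auto simp: dist_norm norm_minus_commute)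
    qed
  qed
  then obtain x where x: "X \<longlonglongrightarrow> x" using Cauchy_convergent_iff convergentD by blast
  have "blinfun_apply v x = q u v" for v
  proof (rule LIMSEQ_unique)
    show "(\<lambda>n. blinfun_apply v (X n)) \<longlonglongrightarrow> blinfun_apply v x" using x by (intro tendsto_intros)
    show "(\<lambda>n. blinfun_apply v (X n)) \<longlonglongrightarrow> q u v" unfolding vX by (rule lim)
  qed
  then show ?thesis by blast
qed

definition rep :: "('w \<Rightarrow>\<^sub>L real) \<Rightarrow> 'w" where "rep u = (SOME x. \<forall>v. blinfun_apply v x = q u v)"

lemma apply_rep: "blinfun_apply v (rep u) = q u v"
  using someI_ex[OF rep_exists] unfolding rep_def by blast

lemma functionals_separate: "(\<And>v::'w \<Rightarrow>\<^sub>L real. blinfun_apply v x = blinfun_apply v y) \<Longrightarrow> x = y"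
  using norm_attained_by_functional[of "x - y"] by (metis blinfun.diff_right diff_self eq_iff_diff_eq_0 norm_eq_zero)

lemma rep_linear: "rep (u + v) = rep u + rep v" "rep (r *\<^sub>R u) = r *\<^sub>R rep u" "rep (- u) = - rep u" "rep 0 = 0"
    "\<i> *\<^sub>C rep u = rep (dual_J u)"
proof -
  show "\<i> *\<^sub>C rep u = rep (dual_J u)"
  proof (rule functionals_separate)
    fix v
    have "blinfun_apply v (\<i> *\<^sub>C rep u) = - blinfun_apply (dual_J v) (rep u)" by (simp add: dual_J_apply)
    also have "\<dots> = blinfun_apply v (rep (dual_J u))" by (simp add: apply_rep q_J_left)
    finally show "blinfun_apply v (\<i> *\<^sub>C rep u) = blinfun_apply v (rep (dual_J u))" .
  qed
qed (rule functionals_separate; simp add: apply_rep blinfun.bilinear_simps q_simps)+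

subsection \<open>The Cameron--Martin norm\<close>

lemma cm_bound: "w \<in> cm_space q \<Longrightarrow> \<bar>blinfun_apply u w\<bar> \<le> cm_norm q w * sqrt (q u u)"
proof (cases "u = 0")
  case False
  assume "w \<in> cm_space q"
  then have fin: "cm_ennnorm q w = ennreal (cm_norm q w)" by (simp add: cm_space_def cm_norm_def)
  have "ennreal (\<bar>blinfun_apply u w\<bar> / sqrt (q u u)) \<le> cm_ennnorm q w"
    unfolding cm_ennnorm_def using False by (intro SUP_upper) auto
  then have "\<bar>blinfun_apply u w\<bar> / sqrt (q u u) \<le> cm_norm q w"
    unfolding fin by (simp add: ennreal_le_iff cm_norm_def)
  then show ?thesis using q_pos[OF False] by (simp add: field_simps)
qed (simp add: q_zero)

lemma cm_spaceI:
  assumes K: "0 \<le> K" "\<And>u. \<bar>blinfun_apply u w\<bar> \<le> K * sqrt (q u u)"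
  shows "w \<in> cm_space q" "cm_norm q w \<le> K"
proof -
  have le: "cm_ennnorm q w \<le> ennreal K"
    unfolding cm_ennnorm_def
  proof (rule SUP_least)
    fix u :: "'w \<Rightarrow>\<^sub>L real" assume "u \<in> UNIV - {0}"
    then have "0 < q u u" using q_pos by auto
    then show "ennreal (\<bar>blinfun_apply u w\<bar> / sqrt (q u u)) \<le> ennreal K"
      using K(2)[of u] by (intro ennreal_leI) (simp add: field_simps)
  qed
  then show "w \<in> cm_space q" by (simp add: cm_space_def less_top[symmetric] top_unique) (metis ennreal_less_top le le_less_trans less_irrefl)
  show "cm_norm q w \<le> K" unfolding cm_norm_def using le K(1) enn2real_leI by blast
qed

lemma cm_norm_nonneg: "0 \<le> cm_norm q w" by (simp add: cm_norm_def)

lemma cm_zero: "0 \<in> cm_space q" "cm_norm q 0 = 0"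
  using cm_spaceI[of 0 0] cm_norm_nonneg[of 0] by (auto simp: blinfun.bilinear_simps intro: antisym)

lemma cm_add:
  assumes "x \<in> cm_space q" "y \<in> cm_space q"
  shows "x + y \<in> cm_space q" "cm_norm q (x + y) \<le> cm_norm q x + cm_norm q y"
proof -
  have b: "\<bar>blinfun_apply u (x + y)\<bar> \<le> (cm_norm q x + cm_norm q y) * sqrt (q u u)" for u
    using cm_bound[OF assms(1), of u] cm_bound[OF assms(2), of u] by (simp add: blinfun.bilinear_simps distrib_right)
  show "x + y \<in> cm_space q" "cm_norm q (x + y) \<le> cm_norm q x + cm_norm q y"
    using cm_spaceI[OF _ b] cm_norm_nonneg by (auto simp: add_nonneg_nonneg)
qed

lemma cm_scaleR:
  assumes "x \<in> cm_space q"
  shows "r *\<^sub>R x \<in> cm_space q" "cm_norm q (r *\<^sub>R x) = \<bar>r\<bar> * cm_norm q x"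
proof -
  have *: "s *\<^sub>R y \<in> cm_space q \<and> cm_norm q (s *\<^sub>R y) \<le> \<bar>s\<bar> * cm_norm q y" if y: "y \<in> cm_space q" for s y
  proof -
    have b: "\<bar>blinfun_apply u (s *\<^sub>R y)\<bar> \<le> (\<bar>s\<bar> * cm_norm q y) * sqrt (q u u)" for u
      using mult_left_mono[OF cm_bound[OF y, of u], of "\<bar>s\<bar>"] by (simp add: blinfun.bilinear_simps abs_mult mult.assoc)
    show ?thesis using cm_spaceI[OF _ b] cm_norm_nonneg[of y] by auto
  qed
  show 1: "r *\<^sub>R x \<in> cm_space q" using *[OF assms] by blast
  show "cm_norm q (r *\<^sub>R x) = \<bar>r\<bar> * cm_norm q x"
  proof (cases "r = 0")
    case False
    have "cm_norm q x \<le> \<bar>inverse r\<bar> * cm_norm q (r *\<^sub>R x)" using *[OF 1, of "inverse r"] False by simp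
    then have "\<bar>r\<bar> * cm_norm q x \<le> cm_norm q (r *\<^sub>R x)" using False by (simp add: field_simps abs_inverse)
    then show ?thesis using *[OF assms, of r] by linarith
  qed (simp add: cm_zero)
qed

lemma cm_scale_i:
  assumes "x \<in> cm_space q"
  shows "\<i> *\<^sub>C x \<in> cm_space q" "cm_norm q (\<i> *\<^sub>C x) = cm_norm q x"
proof -
  have *: "\<i> *\<^sub>C y \<in> cm_space q \<and> cm_norm q (\<i> *\<^sub>C y) \<le> cm_norm q y" if y: "y \<in> cm_space q" for y
  proof -
    have b: "\<bar>blinfun_apply u (\<i> *\<^sub>C y)\<bar> \<le> cm_norm q y * sqrt (q u u)" for u
      using cm_bound[OF y, of "dual_J u"] by (simp add: dual_J_apply q_J)
    show ?thesis using cm_spaceI[OF _ b] cm_norm_nonneg[of y] by auto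
  qed
  show 1: "\<i> *\<^sub>C x \<in> cm_space q" using *[OF assms] by blast
  have "cm_norm q (- x) = cm_norm q x" using cm_scaleR(2)[OF assms, of "-1"] by simp
  then show "cm_norm q (\<i> *\<^sub>C x) = cm_norm q x" using *[OF assms] *[OF 1] by (simp add: scaleC_ii)
qed

lemma cm_minus: "x \<in> cm_space q \<Longrightarrow> - x \<in> cm_space q" "x \<in> cm_space q \<Longrightarrow> cm_norm q (- x) = cm_norm q x"
  using cm_scaleR[of x "-1"] by simp_all

lemma cm_diff:
  assumes "x \<in> cm_space q" "y \<in> cm_space q"
  shows "x - y \<in> cm_space q" "cm_norm q (x - y) \<le> cm_norm q x + cm_norm q y"
  using cm_add[OF assms(1) cm_minus(1)[OF assms(2)]] cm_minus(2)[OF assms(2)] by simp_all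

lemma cm_scaleC:
  assumes "x \<in> cm_space q"
  shows "a *\<^sub>C x \<in> cm_space q" "cm_norm q (a *\<^sub>C x) \<le> 2 * cmod a * cm_norm q x"
proof -
  note i = cm_scale_i[OF assms]
  note r = cm_scaleR[OF assms, of "Re a"] and s = cm_scaleR[OF i(1), of "Im a"]
  show "a *\<^sub>C x \<in> cm_space q" unfolding scaleC_split[of a x] using cm_add r s by blast
  have "cm_norm q (a *\<^sub>C x) \<le> \<bar>Re a\<bar> * cm_norm q x + \<bar>Im a\<bar> * cm_norm q x"
    unfolding scaleC_split[of a x] using cm_add(2)[OF r(1) s(1)] r s i by simp
  also have "\<dots> \<le> cmod a * cm_norm q x + cmod a * cm_norm q x"
    using abs_Re_le_cmod abs_Im_le_cmod cm_norm_nonneg by (intro add_mono mult_right_mono) auto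
  finally show "cm_norm q (a *\<^sub>C x) \<le> 2 * cmod a * cm_norm q x" by simp
qed

lemma cm_subspace: "subspace (cm_space q)"
  using cm_zero cm_add cm_scaleR by (auto simp: subspace_def)

lemma norm_le_cm_norm:
  assumes "x \<in> cm_space q"
  shows "norm x \<le> qC * cm_norm q x"
proof -
  obtain u :: "'w \<Rightarrow>\<^sub>L real" where u: "norm u \<le> 1" "blinfun_apply u x = norm x" by (rule norm_attained_by_functional)
  have "norm x \<le> cm_norm q x * sqrt (q u u)" using cm_bound[OF assms, of u] u by simp
  also have "\<dots> \<le> cm_norm q x * (qC * 1)"
    using sqrt_q_le[of u] u(1) qC_pos cm_norm_nonneg
    by (intro mult_left_mono) (auto intro: order_trans)
  finally show ?thesis by (simp add: mult.commute)
qed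

lemma rep_in_cm: "rep u \<in> cm_space q" and cm_norm_rep: "(cm_norm q (rep u))\<^sup>2 = q u u"
proof -
  have b: "\<bar>blinfun_apply v (rep u)\<bar> \<le> sqrt (q u u) * sqrt (q v v)" for v
    unfolding apply_rep by (rule q_Cauchy_Schwarz)
  note c = cm_spaceI[OF real_sqrt_ge_zero[OF q_nonneg] b]
  show 1: "rep u \<in> cm_space q" by (rule c)
  have "q u u \<le> cm_norm q (rep u) * sqrt (q u u)"
    using cm_bound[OF 1, of u] q_nonneg[of u] by (simp add: apply_rep)
  then have "sqrt (q u u) * sqrt (q u u) \<le> cm_norm q (rep u) * sqrt (q u u)" using q_nonneg[of u] by simp
  then have "sqrt (q u u) \<le> cm_norm q (rep u)"
    using cm_norm_nonneg[of "rep u"] q_nonneg[of u]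
    by (cases "q u u = 0") (auto intro: mult_right_le_imp_le[of _ "sqrt (q u u)"])
  then have "cm_norm q (rep u) = sqrt (q u u)" using c(2) by simp
  then show "(cm_norm q (rep u))\<^sup>2 = q u u" using q_nonneg[of u] by simp
qed

text \<open>A functional that vanishes on the Cameron--Martin space vanishes at its own representing vector,
  where its value is \<open>q u u\<close>.\<close>

lemma cm_dense: "closure (cm_space q) = UNIV"
proof (rule ccontr)
  assume "closure (cm_space q) \<noteq> UNIV"
  then obtain x where "x \<notin> closure (cm_space q)" by blast
  then obtain u :: "'w \<Rightarrow>\<^sub>L real" where u: "\<And>h. h \<in> cm_space q \<Longrightarrow> blinfun_apply u h = 0" "blinfun_apply u x \<noteq> 0"
    using functional_separating_subspace[OF cm_subspace] by blast
  have "q u u = 0" using u(1)[OF rep_in_cm[of u]] by (simp add: apply_rep)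
  then have "u = 0" using q_pos[of u] by auto
  then show False using u(2) by simp
qed

lemma Cauchy_Schwarz_plane: "(a * b + c * d)\<^sup>2 \<le> (a\<^sup>2 + c\<^sup>2) * (b\<^sup>2 + d\<^sup>2)" for a b c d :: real
proof -
  have "0 \<le> (a * d - c * b)\<^sup>2" by simp
  then show ?thesis by (simp add: power2_eq_square algebra_simps)
qed

text \<open>Pythagoras' theorem for a norm that is given only as a supremum over functionals. Functionals are
  decomposed into a multiple of \<open>v\<close> and a part orthogonal to \<open>v\<close>; the two inequalities are the
  Cauchy--Schwarz inequality in the plane and its equality case.\<close>

lemma cm_norm_orthogonal:
  assumes x: "x \<in> cm_space q" and v: "blinfun_apply v x = 0"
  shows "(cm_norm q (x + c *\<^sub>R rep v))\<^sup>2 = (cm_norm q x)\<^sup>2 + c\<^sup>2 * q v v"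
proof (cases "v = 0")
  case False
  define Q where "Q = q v v"
  have Q: "0 < Q" using q_pos[OF False] by (simp add: Q_def)
  define y where "y = x + c *\<^sub>R rep v"
  have y: "y \<in> cm_space q" unfolding y_def by (intro cm_add x cm_scaleR rep_in_cm)
  define N where "N = cm_norm q x"
  define M where "M = cm_norm q y"
  have N0: "0 \<le> N" "0 \<le> M" by (simp_all add: N_def M_def cm_norm_nonneg)
  have dec: "\<exists>u0 \<beta>. q u0 v = 0 \<and> u = u0 + \<beta> *\<^sub>R v" for u
  proof -
    have "q (u - (q u v / Q) *\<^sub>R v) v = 0" using Q by (simp add: q_diff_left q_simps Q_def)
    then show ?thesis by (intro exI[of _ "u - (q u v / Q) *\<^sub>R v"] exI[of _ "q u v / Q"]) simp
  qed
  have q_dec: "q (u0 + \<beta> *\<^sub>R v) (u0 + \<beta> *\<^sub>R v) = q u0 u0 + \<beta>\<^sup>2 * Q" if "q u0 v = 0" for u0 \<beta>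
    using that q_sym[of v u0] by (simp add: q_simps Q_def power2_eq_square)
  have ap: "blinfun_apply (u0 + \<beta> *\<^sub>R v) y = blinfun_apply u0 x + c * \<beta> * Q" if "q u0 v = 0" for u0 \<beta>
    using that v q_sym[of v u0] by (simp add: y_def blinfun.bilinear_simps apply_rep Q_def q_simps algebra_simps)
  have "M \<le> sqrt (N\<^sup>2 + c\<^sup>2 * Q)"
    unfolding M_def
  proof (rule cm_spaceI(2))
    show "0 \<le> sqrt (N\<^sup>2 + c\<^sup>2 * Q)" using Q by simp
    fix u
    obtain u0 \<beta> where u: "q u0 v = 0" "u = u0 + \<beta> *\<^sub>R v" using dec by blast
    define p where "p = q u0 u0"
    have p: "0 \<le> p" by (simp add: p_def q_nonneg)
    have "\<bar>blinfun_apply u y\<bar> \<le> N * sqrt p + (\<bar>c\<bar> * sqrt Q) * (\<bar>\<beta>\<bar> * sqrt Q)"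
    proof -
      have "\<bar>c * \<beta> * Q\<bar> = (\<bar>c\<bar> * sqrt Q) * (\<bar>\<beta>\<bar> * sqrt Q)"
        using Q real_sqrt_mult_self[of Q] by (simp add: abs_mult mult_ac del: real_sqrt_mult_self)
      then show ?thesis
        using cm_bound[OF x, of u0] abs_triangle_ineq[of "blinfun_apply u0 x" "c * \<beta> * Q"]
        unfolding u(2) ap[OF u(1)] p_def N_def by linarith
    qed
    also have "\<dots> \<le> sqrt (N\<^sup>2 + c\<^sup>2 * Q) * sqrt (p + \<beta>\<^sup>2 * Q)"
    proof (rule power2_le_imp_le)
      have "(N * sqrt p + (\<bar>c\<bar> * sqrt Q) * (\<bar>\<beta>\<bar> * sqrt Q))\<^sup>2
          \<le> (N\<^sup>2 + (\<bar>c\<bar> * sqrt Q)\<^sup>2) * ((sqrt p)\<^sup>2 + (\<bar>\<beta>\<bar> * sqrt Q)\<^sup>2)"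
        by (rule Cauchy_Schwarz_plane)
      also have "\<dots> = (sqrt (N\<^sup>2 + c\<^sup>2 * Q) * sqrt (p + \<beta>\<^sup>2 * Q))\<^sup>2"
        using Q p by (simp add: power_mult_distrib)
      finally show "(N * sqrt p + (\<bar>c\<bar> * sqrt Q) * (\<bar>\<beta>\<bar> * sqrt Q))\<^sup>2 \<le> (sqrt (N\<^sup>2 + c\<^sup>2 * Q) * sqrt (p + \<beta>\<^sup>2 * Q))\<^sup>2" .
    qed (use Q p in simp)
    finally show "\<bar>blinfun_apply u y\<bar> \<le> sqrt (N\<^sup>2 + c\<^sup>2 * Q) * sqrt (q u u)"
      unfolding u(2) q_dec[OF u(1)] p_def .
  qed
  then have upper: "M\<^sup>2 \<le> N\<^sup>2 + c\<^sup>2 * Q" using N0 Q by (metis power_mono real_sqrt_pow2 add_nonneg_nonneg zero_le_power2 mult_nonneg_nonneg less_imp_le)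
  have MQ: "c\<^sup>2 * Q \<le> M\<^sup>2"
  proof -
    have "\<bar>c\<bar> * Q \<le> M * sqrt Q" using cm_bound[OF y, of v] ap[of 0 1] Q by (simp add: q_zero M_def Q_def abs_mult)
    then have "\<bar>c\<bar> * sqrt Q * sqrt Q \<le> M * sqrt Q"
      using Q by (simp only: mult.assoc real_sqrt_mult_self abs_of_pos)
    then have "\<bar>c\<bar> * sqrt Q \<le> M" by (rule mult_right_le_imp_le) (use Q in simp)
    then have "(\<bar>c\<bar> * sqrt Q)\<^sup>2 \<le> M\<^sup>2" using Q by (intro power_mono) auto
    then show ?thesis using Q by (simp add: power_mult_distrib)
  qed
  have "N \<le> sqrt (M\<^sup>2 - c\<^sup>2 * Q)"
    unfolding N_def
  proof (rule cm_spaceI(2))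
    show "0 \<le> sqrt (M\<^sup>2 - c\<^sup>2 * Q)" using MQ by simp
    fix u
    obtain u0 \<beta> where u: "q u0 v = 0" "u = u0 + \<beta> *\<^sub>R v" using dec by blast
    define p where "p = q u0 u0"
    have p: "0 \<le> p" "p \<le> q u u" using Q by (simp_all add: p_def q_nonneg u(2) q_dec[OF u(1)])
    define a where "a = blinfun_apply u0 x"
    have ua: "blinfun_apply u x = a" using v by (simp add: u(2) a_def blinfun.bilinear_simps)
    have "a\<^sup>2 \<le> (M\<^sup>2 - c\<^sup>2 * Q) * p"
    proof (cases "a = 0")
      case False
      \<comment> \<open>The multiple \<open>c * p / a\<close> of \<open>v\<close> makes the Cauchy--Schwarz inequality an equality.\<close>
      have "\<bar>a + c * (c * p / a) * Q\<bar> \<le> M * sqrt (p + (c * p / a)\<^sup>2 * Q)"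
        using cm_bound[OF y, of "u0 + (c * p / a) *\<^sub>R v"]
        unfolding ap[OF u(1)] q_dec[OF u(1)] M_def p_def[symmetric] a_def[symmetric] .
      then have "(a + c * (c * p / a) * Q)\<^sup>2 \<le> (M * sqrt (p + (c * p / a)\<^sup>2 * Q))\<^sup>2"
        by (metis abs_ge_zero power2_abs power_mono)
      also have "\<dots> = M\<^sup>2 * (p + (c * p / a)\<^sup>2 * Q)" using p Q by (simp add: power_mult_distrib)
      finally have le: "(a + c\<^sup>2 * Q * p / a)\<^sup>2 \<le> M\<^sup>2 * (p + c\<^sup>2 * Q * p\<^sup>2 / a\<^sup>2)"
        by (simp add: power_mult_distrib power_divide power2_eq_square mult_ac)
      define D where "D = a\<^sup>2 + c\<^sup>2 * Q * p"
      have D: "0 < D" using False Q p by (simp add: D_def add_pos_nonneg)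
      have "(a + c\<^sup>2 * Q * p / a)\<^sup>2 = D\<^sup>2 / a\<^sup>2" using False by (simp add: D_def power2_eq_square field_simps)
      moreover have "M\<^sup>2 * (p + c\<^sup>2 * Q * p\<^sup>2 / a\<^sup>2) = M\<^sup>2 * p * D / a\<^sup>2" using False by (simp add: D_def power2_eq_square field_simps)
      ultimately have "D\<^sup>2 \<le> M\<^sup>2 * p * D" using le False by (simp add: divide_le_cancel)
      then have "D \<le> M\<^sup>2 * p" using D by (simp add: power2_eq_square)
      then show ?thesis by (simp add: D_def algebra_simps)
    qed (use MQ p in simp)
    also have "\<dots> \<le> (M\<^sup>2 - c\<^sup>2 * Q) * q u u" using MQ p by (intro mult_left_mono) auto
    finally have "sqrt (a\<^sup>2) \<le> sqrt ((M\<^sup>2 - c\<^sup>2 * Q) * q u u)" by (rule real_sqrt_le_mono)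
    then show "\<bar>blinfun_apply u x\<bar> \<le> sqrt (M\<^sup>2 - c\<^sup>2 * Q) * sqrt (q u u)" by (simp add: ua real_sqrt_mult)
  qed
  then have "N\<^sup>2 \<le> M\<^sup>2 - c\<^sup>2 * Q" using N0 MQ by (metis diff_ge_0_iff_ge power_mono real_sqrt_pow2)
  then show ?thesis using upper by (simp add: N_def M_def y_def Q_def)
qed (simp add: rep_linear q_zero)

text \<open>The component of \<open>x\<close> along \<open>rep v\<close> is split off, so that \<open>cm_norm_orthogonal\<close> applies to the rest.\<close>

lemma cm_norm_add_rep:
  assumes x: "x \<in> cm_space q"
  shows "(cm_norm q (x + rep v))\<^sup>2 = (cm_norm q x)\<^sup>2 + 2 * blinfun_apply v x + q v v"
proof (cases "v = 0")
  case False
  have Q: "0 < q v v" using q_pos[OF False] .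
  define s where "s = blinfun_apply v x / q v v"
  define x' where "x' = x - s *\<^sub>R rep v"
  have x': "x' \<in> cm_space q" unfolding x'_def by (intro cm_diff x cm_scaleR rep_in_cm)
  have v: "blinfun_apply v x' = 0" using Q by (simp add: x'_def s_def blinfun.bilinear_simps apply_rep)
  have "x + rep v = x' + (s + 1) *\<^sub>R rep v" "x = x' + s *\<^sub>R rep v" by (simp_all add: x'_def algebra_simps)
  then have "(cm_norm q (x + rep v))\<^sup>2 = (cm_norm q x')\<^sup>2 + (s + 1)\<^sup>2 * q v v"
    "(cm_norm q x)\<^sup>2 = (cm_norm q x')\<^sup>2 + s\<^sup>2 * q v v"
    using cm_norm_orthogonal[OF x' v] by metis+
  moreover have "s * q v v = blinfun_apply v x" using Q by (simp add: s_def)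
  ultimately show ?thesis by (simp add: power2_eq_square algebra_simps)
qed (simp add: rep_linear q_zero)

lemma sum_four: "(\<Sum>j<(4::nat). f j) = f 0 + f 1 + f 2 + (f 3 :: complex)"
  by (simp add: eval_nat_numeral)

lemma i_pow3: "\<i> ^ 3 = - \<i>" by (simp add: power3_eq_cube)

text \<open>Polarization, with all four norms expanded by \<open>cm_norm_add_rep\<close>.\<close>

lemma cm_cinner_rep:
  assumes x: "x \<in> cm_space q"
  shows "cm_cinner q x (rep v) = cfun v x" "cm_cinner q (rep v) x = cnj (cfun v x)"
proof -
  have e: "x + (- \<i>) *\<^sub>C rep v = x + rep (- dual_J v)" "x + (- 1) *\<^sub>C rep v = x + rep (- v)"
    by (simp_all add: scaleC_neg_left rep_linear scaleC_one)
  have N: "(cm_norm q (x + rep v))\<^sup>2 = (cm_norm q x)\<^sup>2 + 2 * blinfun_apply v x + q v v"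
    "(cm_norm q (x + \<i> *\<^sub>C rep v))\<^sup>2 = (cm_norm q x)\<^sup>2 + 2 * blinfun_apply (dual_J v) x + q v v"
    "(cm_norm q (x + (- 1) *\<^sub>C rep v))\<^sup>2 = (cm_norm q x)\<^sup>2 - 2 * blinfun_apply v x + q v v"
    "(cm_norm q (x + (- \<i>) *\<^sub>C rep v))\<^sup>2 = (cm_norm q x)\<^sup>2 - 2 * blinfun_apply (dual_J v) x + q v v"
    unfolding e rep_linear(5) cm_norm_add_rep[OF x] by (simp_all add: q_J q_minus blinfun.bilinear_simps)
  show 1: "cm_cinner q x (rep v) = cfun v x"
    unfolding cm_cinner_def sum_four i_pow3
    by (simp only: power_0 power_one_right i_squared scaleC_one N) (simp add: cfun_def complex_eq_iff N)
  have r: "cm_norm q (rep v + \<i> *\<^sub>C x) = cm_norm q (x + (- \<i>) *\<^sub>C rep v)"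
    "cm_norm q (rep v + (- 1) *\<^sub>C x) = cm_norm q (x + (- 1) *\<^sub>C rep v)"
    "cm_norm q (rep v + (- \<i>) *\<^sub>C x) = cm_norm q (x + \<i> *\<^sub>C rep v)"
  proof -
    have a: "rep v + \<i> *\<^sub>C x = \<i> *\<^sub>C (x + (- \<i>) *\<^sub>C rep v)"
      by (simp add: scaleC_add_right scaleC_scaleC scaleC_one)
    have b: "rep v + (- 1) *\<^sub>C x = - (x + (- 1) *\<^sub>C rep v)" by (simp add: scaleC_minus1)
    have c: "- (rep v + (- \<i>) *\<^sub>C x) = \<i> *\<^sub>C (x + \<i> *\<^sub>C rep v)"
      by (simp add: scaleC_add_right scaleC_scaleC scaleC_neg_left scaleC_minus1 scaleC_one)
    show "cm_norm q (rep v + \<i> *\<^sub>C x) = cm_norm q (x + (- \<i>) *\<^sub>C rep v)"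
      unfolding a by (intro cm_scale_i cm_add x cm_scaleC rep_in_cm)
    show "cm_norm q (rep v + (- 1) *\<^sub>C x) = cm_norm q (x + (- 1) *\<^sub>C rep v)"
      unfolding b by (intro cm_minus cm_add x cm_scaleC rep_in_cm)
    have "cm_norm q (- (rep v + (- \<i>) *\<^sub>C x)) = cm_norm q (x + \<i> *\<^sub>C rep v)"
      unfolding c by (intro cm_scale_i cm_add x cm_scaleC rep_in_cm)
    then show "cm_norm q (rep v + (- \<i>) *\<^sub>C x) = cm_norm q (x + \<i> *\<^sub>C rep v)"
      using cm_minus(2)[of "rep v + (- \<i>) *\<^sub>C x"] cm_add cm_scaleC rep_in_cm x by metis
  qed
  show "cm_cinner q (rep v) x = cnj (cfun v x)"
    unfolding cm_cinner_def sum_four i_pow3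
    by (simp only: power_0 power_one_right i_squared scaleC_one r N add.commute[of "rep v" x]) (simp add: cfun_def complex_eq_iff r N)
qed

lemma Re_cm_cinner_self:
  assumes x: "x \<in> cm_space q"
  shows "Re (cm_cinner q x x) = (cm_norm q x)\<^sup>2"
proof -
  have 1: "(cm_norm q (x + x))\<^sup>2 = 4 * (cm_norm q x)\<^sup>2"
    using cm_scaleR(2)[OF x, of 2] by (simp add: scaleR_2 power_mult_distrib)
  have 2: "cm_norm q (x + (- 1) *\<^sub>C x) = 0" by (simp add: scaleC_minus1 cm_zero)
  show ?thesis unfolding cm_cinner_def sum_four i_pow3
    by (simp add: scaleC_one 1 2 power2_eq_square[of \<i>])
qed

text \<open>The continuous extension is unique because the Cameron--Martin space is dense.\<close>

lemma cm_ext_rep: "cm_ext q (rep v) = cfun v" and rep_in_star: "rep v \<in> cm_star q"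
proof -
  have p: "cm_ext_prop q (rep v) (cfun v)"
    by (simp add: cm_ext_prop_def cfun_continuous cm_cinner_rep)
  then show "rep v \<in> cm_star q" using rep_in_cm by (auto simp: cm_star_def)
  have "\<phi> = cfun v" if \<phi>: "cm_ext_prop q (rep v) \<phi>" for \<phi>
  proof -
    have "closed {x. \<phi> x = cfun v x}"
      using \<phi> cfun_continuous[of UNIV v] by (intro closed_Collect_eq) (auto simp: cm_ext_prop_def)
    moreover have "cm_space q \<subseteq> {x. \<phi> x = cfun v x}" using \<phi> p by (auto simp: cm_ext_prop_def)
    ultimately have "closure (cm_space q) \<subseteq> {x. \<phi> x = cfun v x}" by (rule closure_minimal[rotated])
    then show ?thesis using cm_dense by auto
  qed
  then show "cm_ext q (rep v) = cfun v" unfolding cm_ext_def using the_equality[of "cm_ext_prop q (rep v)", OF p] by blast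
qed

text \<open>A functional \<open>u\<close> that almost attains the norm of \<open>x\<close> leaves little of \<open>x\<close> after the best multiple of
  \<open>rep u\<close> has been subtracted.\<close>

lemma rep_dense:
  assumes x: "x \<in> cm_space q" and e: "0 < e"
  obtains u where "cm_norm q (x - rep u) < e"
proof (cases "cm_norm q x < e")
  case True
  then show ?thesis using that[of 0] by (simp add: rep_linear)
next
  case False
  define N where "N = cm_norm q x"
  have N: "e \<le> N" using False by (simp add: N_def)
  have e2: "e\<^sup>2 \<le> N\<^sup>2" using N e by (intro power_mono) auto
  have "\<exists>u. sqrt (N\<^sup>2 - e\<^sup>2) * sqrt (q u u) < \<bar>blinfun_apply u x\<bar>"
  proof (rule ccontr)
    assume "\<not> ?thesis"
    then have "N \<le> sqrt (N\<^sup>2 - e\<^sup>2)"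
      unfolding N_def[symmetric] using cm_spaceI(2)[of "sqrt (N\<^sup>2 - e\<^sup>2)" x] e2 unfolding N_def by (auto simp: not_less)
    then have "N\<^sup>2 \<le> (sqrt (N\<^sup>2 - e\<^sup>2))\<^sup>2" using N e by (intro power_mono) auto
    then have "N\<^sup>2 \<le> N\<^sup>2 - e\<^sup>2" using e2 by simp
    then show False using e by simp
  qed
  then obtain u where u: "sqrt (N\<^sup>2 - e\<^sup>2) * sqrt (q u u) < \<bar>blinfun_apply u x\<bar>" by blast
  have "u \<noteq> 0" using u by (auto simp: q_zero)
  then have Q: "0 < q u u" by (rule q_pos)
  have "(sqrt (N\<^sup>2 - e\<^sup>2) * sqrt (q u u))\<^sup>2 < \<bar>blinfun_apply u x\<bar>\<^sup>2"
    using u e2 Q by (intro power_strict_mono) auto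
  then have lt: "(N\<^sup>2 - e\<^sup>2) * q u u < (blinfun_apply u x)\<^sup>2" using e2 Q by (simp add: power_mult_distrib)
  define s where "s = blinfun_apply u x / q u u"
  have "(cm_norm q (x - rep (s *\<^sub>R u)))\<^sup>2 = N\<^sup>2 - 2 * s * blinfun_apply u x + s\<^sup>2 * q u u"
    using cm_norm_add_rep[OF x, of "(- s) *\<^sub>R u"]
    by (simp add: rep_linear blinfun.bilinear_simps q_simps N_def power2_eq_square)
  also have "\<dots> = N\<^sup>2 - (blinfun_apply u x)\<^sup>2 / q u u" using Q by (simp add: s_def power2_eq_square field_simps)
  also have "\<dots> < e\<^sup>2" using lt Q by (simp add: field_simps)
  finally have "cm_norm q (x - rep (s *\<^sub>R u)) < e" using e by (intro power_less_imp_less_base[of _ 2 e]) simp_all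
  then show ?thesis by (rule that)
qed

end

section \<open>Orthonormal systems and finite rank projections\<close>

text \<open>Orthonormality for the complex inner product with real part \<open>B\<close>, where \<open>J\<close> is multiplication by
  \<open>\<i>\<close>.\<close>

definition J_orthonormal :: "('v \<Rightarrow> 'v \<Rightarrow> real) \<Rightarrow> ('v \<Rightarrow> 'v) \<Rightarrow> 'v set \<Rightarrow> bool" where
  "J_orthonormal B J E \<longleftrightarrow> (\<forall>e\<in>E. \<forall>e'\<in>E. B e e' = (if e = e' then 1 else 0) \<and> B e (J e') = 0)"

text \<open>Complex orthonormalization in terms of a real form and a complex structure, so that it serves both
  for functionals and for vectors of a complex inner product space.\<close>

lemma Gram_Schmidt_complex:
  fixes B :: "'v::real_vector \<Rightarrow> 'v \<Rightarrow> real"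
  assumes B: "real_inner_product B"
    and J: "\<And>x y. B (J x) (J y) = B x y" "\<And>x. J (J x) = - x"
    and Y: "finite Y"
  shows "\<exists>E. finite E \<and> J_orthonormal B J E \<and> (\<forall>y\<in>Y. y = (\<Sum>e\<in>E. B y e *\<^sub>R e + B y (J e) *\<^sub>R J e))"
  using Y
proof (induction Y rule: finite_induct)
  case empty
  show ?case by (intro exI[of _ "{}"]) (simp add: J_orthonormal_def)
next
  case (insert y Y)
  have sym: "B u v = B v u" and add: "B (u + v) w = B u w + B v w" and sc: "B (r *\<^sub>R u) v = r * B u v"
    and pos: "u \<noteq> 0 \<Longrightarrow> 0 < B u u" for u v w r
    using B unfolding real_inner_product_def by blast+
  have add': "B w (u + v) = B w u + B w v" for u v w by (metis add sym)
  have sc': "B v (r *\<^sub>R u) = r * B v u" for u v r by (metis sc sym)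
  have zero: "B 0 v = 0" for v using sc[of 0 0 v] by simp
  have neg: "B (- u) v = - B u v" for u v using sc[of "-1" u v] by simp
  have sum: "B (\<Sum>e\<in>S. f e) v = (\<Sum>e\<in>S. B (f e) v)" for f v and S :: "'v set"
    by (induction S rule: infinite_finite_induct) (simp_all add: add zero)
  have Jl: "B (J u) v = - B u (J v)" for u v
    using J(1)[of "J u" v] by (simp add: J(2) neg)
  have Js: "B u (J u) = 0" for u using Jl[of u u] sym[of u "J u"] by simp
  obtain E where E: "finite E" "J_orthonormal B J E" "\<And>y. y \<in> Y \<Longrightarrow> y = (\<Sum>e\<in>E. B y e *\<^sub>R e + B y (J e) *\<^sub>R J e)"
    using insert.IH by blast
  have o: "B e e' = (if e = e' then 1 else 0)" "B e (J e') = 0" "B (J e) e' = 0" if "e \<in> E" "e' \<in> E" for e e'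
    using E(2) that Jl[of e e'] unfolding J_orthonormal_def by auto
  define p where "p y = (\<Sum>e\<in>E. B y e *\<^sub>R e + B y (J e) *\<^sub>R J e)" for y
  have Bp: "B (p y) v = (\<Sum>e\<in>E. B y e * B e v + B y (J e) * B (J e) v)" for y v
    by (simp add: p_def sum add sc)
  have Bpe: "B (p y) e = B y e" "B (p y) (J e) = B y (J e)" if "e \<in> E" for e
  proof -
    have "B (p y) e = (\<Sum>e'\<in>E. if e' = e then B y e else 0)"
      unfolding Bp using that o by (intro sum.cong) auto
    then show "B (p y) e = B y e" using that E(1) by simp
    have "B (p y) (J e) = (\<Sum>e'\<in>E. if e' = e then B y (J e) else 0)"
      unfolding Bp using that o by (intro sum.cong) (auto simp: J(1))
    then show "B (p y) (J e) = B y (J e)" using that E(1) by simp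
  qed
  define r where "r = y - p y"
  have yr: "y = p y + r" by (simp add: r_def)
  have re: "B r e = 0" "B r (J e) = 0" if "e \<in> E" for e
    using Bpe[OF that] add[of "p y" r e] add[of "p y" r "J e"] yr by auto
  show ?case
  proof (cases "r = 0")
    case True
    then have "y = (\<Sum>e\<in>E. B y e *\<^sub>R e + B y (J e) *\<^sub>R J e)" using yr by (simp add: p_def)
    then show ?thesis using E by (intro exI[of _ E]) blast
  next
    case False
    define n where "n = sqrt (B r r)"
    have n: "0 < n" "n * n = B r r" using pos[OF False] by (simp_all add: n_def)
    define e0 where "e0 = (1 / n) *\<^sub>R r"
    have r: "r = n *\<^sub>R e0" using n by (simp add: e0_def)
    have e00: "B e0 e0 = 1" using n(1) by (simp add: e0_def sc sc' n(2)[symmetric])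
    have e0e: "B e0 e = 0" "B e0 (J e) = 0" "B e e0 = 0" "B e (J e0) = 0" "B (J e) e0 = 0" "B (J e) (J e0) = 0" if "e \<in> E" for e
    proof -
      show 1: "B e0 e = 0" "B e0 (J e) = 0" using re[OF that] by (simp_all add: e0_def sc)
      then show 2: "B e e0 = 0" "B (J e) e0 = 0" by (metis sym)+
      show "B e (J e0) = 0" using 2 Jl[of e e0] by simp
      show "B (J e) (J e0) = 0" using 2 by (simp add: J(1))
    qed
    have e0E: "e0 \<notin> E" using e0e(1)[of e0] e00 by auto
    have on: "J_orthonormal B J (insert e0 E)"
      using e0e o e00 Js e0E unfolding J_orthonormal_def by auto
    have pe0: "B (p z) e0 = 0" "B (p z) (J e0) = 0" for z
      unfolding Bp using e0e by (auto intro: sum.neutral)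
    have "z = (\<Sum>e\<in>insert e0 E. B z e *\<^sub>R e + B z (J e) *\<^sub>R J e)" if "z \<in> insert y Y" for z
    proof (cases "z = y")
      case True
      have "B y e0 = n" "B y (J e0) = 0"
        using pe0[of y] e00 Js[of e0] add[of "p y" r e0] add[of "p y" r "J e0"] yr by (simp_all add: r sc)
      then show ?thesis using True e0E E(1) yr r by (simp add: p_def add.commute)
    next
      case False
      then have z: "z = p z" using that E(3)[of z] by (simp add: p_def)
      then have "B z e0 = 0" "B z (J e0) = 0" using pe0[of z] by simp_all
      then show ?thesis using z e0E E(1) by (simp add: p_def)
    qed
    then show ?thesis using on E(1) by (intro exI[of _ "insert e0 E"]) blast
  qed
qed

subsection \<open>Complex inner product spaces\<close>

lemma cinner_add_right: "cinner x (y + z) = cinner x y + cinner x z"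
  by (metis cinner_add_left cinner_commute complex_cnj_add)
lemma cinner_scaleC_right: "cinner x (a *\<^sub>C y) = cnj a * cinner x y"
  by (metis cinner_scaleC_left cinner_commute complex_cnj_mult)
lemma cinner_scaleR_left: "cinner (r *\<^sub>R x) y = complex_of_real r * cinner x y"
  by (metis cinner_scaleC_left scaleC_of_real)
lemma cinner_zero_left: "cinner 0 y = 0"
  using cinner_scaleR_left[of 0 0 y] by simp
lemma cinner_zero_right: "cinner x 0 = 0"
  using cinner_zero_left by (metis cinner_commute complex_cnj_zero)
lemma cinner_sum_left: "cinner (\<Sum>i\<in>S. f i) y = (\<Sum>i\<in>S. cinner (f i) y)"
  by (induction S rule: infinite_finite_induct) (simp_all add: cinner_add_left cinner_zero_left)
lemma cinner_sum_right: "cinner y (\<Sum>i\<in>S. f i) = (\<Sum>i\<in>S. cinner y (f i))"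
  by (induction S rule: infinite_finite_induct) (simp_all add: cinner_add_right cinner_zero_right)

lemma Re_cinner_self: "Re (cinner x x) = (norm x)\<^sup>2"
proof -
  have "0 \<le> Re (cinner x x)" using norm_ge_zero[of x] unfolding norm_eq_sqrt_cinner by simp
  then show ?thesis unfolding norm_eq_sqrt_cinner by simp
qed

lemma real_inner_product_Re_cinner:
  "real_inner_product (\<lambda>x y :: 'c::complex_inner_space. Re (cinner x y))"
  unfolding real_inner_product_def
proof (intro conjI allI impI)
  show "Re (cinner u v) = Re (cinner v u)" for u v :: 'c by (subst cinner_commute) simp
qed (simp_all add: cinner_add_left cinner_scaleR_left Re_cinner_self)

lemma Re_cinner_ii: "Re (cinner x (\<i> *\<^sub>C y)) = Im (cinner x y)"
  by (simp add: cinner_scaleC_right)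

lemma norm_add_sq_cinner: "(norm (x + y))\<^sup>2 = (norm x)\<^sup>2 + (norm y)\<^sup>2 + 2 * Re (cinner x (y::'c::complex_inner_space))"
proof -
  have "Re (cinner y x) = Re (cinner x y)" by (subst cinner_commute) simp
  then show ?thesis unfolding Re_cinner_self[symmetric] by (simp add: cinner_add_left cinner_add_right)
qed

lemma Re_cinner_le: "\<bar>Re (cinner x y)\<bar> \<le> norm x * norm (y::'c::complex_inner_space)"
proof -
  have le: "Re (cinner x y) \<le> norm x * norm y" for x y :: 'c
  proof -
    have "(norm (x + y))\<^sup>2 \<le> (norm x + norm y)\<^sup>2" by (intro power_mono norm_triangle_ineq) simp
    then show ?thesis unfolding norm_add_sq_cinner power2_sum by simp
  qed
  have "cinner (- x) y = - cinner x y" using cinner_scaleR_left[of "-1" x y] by simp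
  then show ?thesis using le[of x y] le[of "- x" y] by simp
qed

definition orthonormal_basis :: "'c::complex_inner_space set \<Rightarrow> bool" where
  "orthonormal_basis E \<longleftrightarrow> finite E \<and> (\<forall>e\<in>E. \<forall>e'\<in>E. cinner e e' = (if e = e' then 1 else 0)) \<and>
    (\<forall>x. x = (\<Sum>e\<in>E. cinner x e *\<^sub>C e))"

lemma orthonormal_basis_exists: "\<exists>E :: 'c::fin_dim_complex_inner_space set. orthonormal_basis E"
proof -
  obtain Y :: "'c set" where Y: "finite Y" "\<And>x. \<exists>a :: 'c \<Rightarrow> complex. x = (\<Sum>b\<in>Y. a b *\<^sub>C b)"
    using ex_finite_spanning by blast
  let ?B = "\<lambda>x y :: 'c. Re (cinner x y)" and ?J = "\<lambda>x :: 'c. \<i> *\<^sub>C x"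
  have "\<exists>E. finite E \<and> J_orthonormal ?B ?J E \<and> (\<forall>y\<in>Y. y = (\<Sum>e\<in>E. ?B y e *\<^sub>R e + ?B y (?J e) *\<^sub>R ?J e))"
    by (rule Gram_Schmidt_complex[OF real_inner_product_Re_cinner _ _ Y(1)])
      (simp_all add: scaleC_ii cinner_scaleC_left cinner_scaleC_right)
  then obtain E where E: "finite E" "J_orthonormal ?B ?J E" "\<And>y. y \<in> Y \<Longrightarrow> y = (\<Sum>e\<in>E. ?B y e *\<^sub>R e + ?B y (?J e) *\<^sub>R ?J e)"
    by blast
  have e: "?B y e *\<^sub>R e + ?B y (?J e) *\<^sub>R ?J e = cinner y e *\<^sub>C e" for y e
    unfolding Re_cinner_ii by (rule scaleC_split[symmetric])
  have "x = (\<Sum>e\<in>E. cinner x e *\<^sub>C e)" for x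
  proof -
    obtain a where a: "x = (\<Sum>b\<in>Y. a b *\<^sub>C b)" using Y(2) by blast
    have "x = (\<Sum>b\<in>Y. a b *\<^sub>C (\<Sum>e\<in>E. cinner b e *\<^sub>C e))" unfolding a using E(3) unfolding e by (intro sum.cong) auto
    also have "\<dots> = (\<Sum>b\<in>Y. \<Sum>e\<in>E. cinner (a b *\<^sub>C b) e *\<^sub>C e)"
      by (simp add: linear_sum[OF bounded_linear.linear[OF bounded_linear_scaleC]] scaleC_scaleC cinner_scaleC_left)
    also have "\<dots> = (\<Sum>e\<in>E. \<Sum>b\<in>Y. cinner (a b *\<^sub>C b) e *\<^sub>C e)" by (rule sum.swap)
    also have "\<dots> = (\<Sum>e\<in>E. cinner x e *\<^sub>C e)"
    proof (rule sum.cong[OF refl])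
      fix e :: 'c
      have "(\<Sum>b\<in>S. z b *\<^sub>C e) = (\<Sum>b\<in>S. z b) *\<^sub>C e" for z :: "'c \<Rightarrow> complex" and S
        by (induction S rule: infinite_finite_induct) (simp_all add: scaleC_add_left scaleC_zero)
      then show "(\<Sum>b\<in>Y. cinner (a b *\<^sub>C b) e *\<^sub>C e) = cinner x e *\<^sub>C e" by (simp add: a cinner_sum_left)
    qed
    finally show ?thesis .
  qed
  moreover have "cinner e e' = (if e = e' then 1 else 0)" if "e \<in> E" "e' \<in> E" for e e'
    using E(2) that unfolding J_orthonormal_def Re_cinner_ii by (auto simp: complex_eq_iff)
  ultimately show ?thesis using E(1) unfolding orthonormal_basis_def by blast
qed

lemma orthonormal_basis_norm:
  assumes E: "orthonormal_basis E"
  shows "(norm (\<Sum>e\<in>E. z e *\<^sub>C e))\<^sup>2 = (\<Sum>e\<in>E. (cmod (z e))\<^sup>2)"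
proof -
  have f: "finite E" and o: "\<And>e e'. e \<in> E \<Longrightarrow> e' \<in> E \<Longrightarrow> cinner e e' = (if e = e' then 1 else 0)"
    using E by (auto simp: orthonormal_basis_def)
  have "cinner (\<Sum>e\<in>E. z e *\<^sub>C e) (\<Sum>e\<in>E. z e *\<^sub>C e) = (\<Sum>e\<in>E. \<Sum>e'\<in>E. z e * cnj (z e') * cinner e e')"
    unfolding cinner_sum_left unfolding cinner_sum_right
    by (simp add: cinner_scaleC_left cinner_scaleC_right mult_ac)
  also have "\<dots> = (\<Sum>e\<in>E. \<Sum>e'\<in>E. if e = e' then z e * cnj (z e) else 0)"
    using o by (intro sum.cong refl) auto
  also have "\<dots> = (\<Sum>e\<in>E. complex_of_real ((cmod (z e))\<^sup>2))" using f by (simp add: complex_norm_square[symmetric])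
  finally show ?thesis unfolding Re_cinner_self[symmetric] by simp
qed

subsection \<open>Frames\<close>

context cwiener begin

text \<open>The scalar multiplication on functionals for which \<open>rep\<close> is complex linear.\<close>

definition cscale :: "complex \<Rightarrow> ('w \<Rightarrow>\<^sub>L real) \<Rightarrow> 'w \<Rightarrow>\<^sub>L real" where
  "cscale z u = Re z *\<^sub>R u + Im z *\<^sub>R dual_J u"

lemma rep_cscale: "z *\<^sub>C rep u = rep (cscale z u)"
  unfolding scaleC_split[of z] by (simp add: cscale_def rep_linear)

lemma cfun_cscale: "cfun (cscale z u) x = cnj z * cfun u x"
  by (simp add: cfun_def cscale_def complex_eq_iff blinfun.bilinear_simps dual_J_linear)

lemma rep_sum: "rep (\<Sum>i\<in>S. f i) = (\<Sum>i\<in>S. rep (f i))"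
  by (induction S rule: infinite_finite_induct) (simp_all add: rep_linear)

lemma cfun_add: "cfun (u + v) x = cfun u x + cfun v x" and cfun_zero: "cfun 0 x = 0"
  by (simp_all add: cfun_def complex_eq_iff blinfun.bilinear_simps dual_J_linear dual_J_apply)

lemma cfun_sum: "cfun (\<Sum>i\<in>S. f i) x = (\<Sum>i\<in>S. cfun (f i) x)"
  by (induction S rule: infinite_finite_induct) (simp_all add: cfun_add cfun_zero)

lemma cfun_bound: "cmod (cfun u w) \<le> (norm u + norm (dual_J u)) * norm w"
proof -
  have "cmod (cfun u w) \<le> \<bar>blinfun_apply u w\<bar> + \<bar>blinfun_apply (dual_J u) w\<bar>"
    using cmod_le[of "cfun u w"] by (simp add: cfun_def)
  also have "\<dots> \<le> norm u * norm w + norm (dual_J u) * norm w"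
    using norm_blinfun[of u w] norm_blinfun[of "dual_J u" w] by simp
  finally show ?thesis by (simp add: distrib_right)
qed

lemma cm_group_norm_sq:
  assumes "x \<in> cm_group q"
  shows "(cm_group_norm q x)\<^sup>2 = (cm_norm q (fst x))\<^sup>2 + (norm (snd x :: 'c::complex_inner_space))\<^sup>2"
    "0 \<le> cm_group_norm q x"
proof -
  have "Re (cm_group_cinner q x x) = (cm_norm q (fst x))\<^sup>2 + (norm (snd x))\<^sup>2"
    using assms Re_cm_cinner_self[of "fst x"] by (auto simp: cm_group_cinner_def cm_group_def Re_cinner_self)
  then show "(cm_group_norm q x)\<^sup>2 = (cm_norm q (fst x))\<^sup>2 + (norm (snd x))\<^sup>2" "0 \<le> cm_group_norm q x"
    by (simp_all add: cm_group_norm_def)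
qed

end

text \<open>An orthonormal basis of one of the finite dimensional subgroups. All probabilistic arguments take
  place in its coordinates.\<close>

locale frame = cwiener \<mu> q for \<mu> :: "'w::{complex_normed_vector, banach, second_countable_topology} measure" and q +
  fixes E1 :: "('w \<Rightarrow>\<^sub>L real) set" and E2 :: "'c::fin_dim_complex_inner_space set"
  assumes E1: "finite E1" "J_orthonormal q dual_J E1" and E2: "orthonormal_basis E2"
begin

definition proj :: "'w \<Rightarrow> 'w" where "proj w = (\<Sum>u\<in>E1. cfun u w *\<^sub>C rep u)"

lemma E2_finite: "finite E2" using E2 by (simp add: orthonormal_basis_def)

lemma cfun_rep: "u \<in> E1 \<Longrightarrow> v \<in> E1 \<Longrightarrow> cfun u (rep v) = (if u = v then 1 else 0)"
  using E1(2) unfolding J_orthonormal_def by (auto simp: cfun_def apply_rep complex_eq_iff)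

lemma sum_rep: "(\<Sum>u\<in>E1. z u *\<^sub>C rep u) = rep (\<Sum>u\<in>E1. cscale (z u) u)"
  by (simp add: rep_sum rep_cscale)

lemma proj_sum_rep: "proj (\<Sum>u\<in>E1. z u *\<^sub>C rep u) = (\<Sum>u\<in>E1. z u *\<^sub>C rep u)"
proof -
  have "cfun v (\<Sum>u\<in>E1. z u *\<^sub>C rep u) = z v" if v: "v \<in> E1" for v
  proof -
    have s: "cfun v (\<Sum>u\<in>S. f u) = (\<Sum>u\<in>S. cfun v (f u))" for f :: "_ \<Rightarrow> 'w" and S :: "('w \<Rightarrow>\<^sub>L real) set"
      by (induction S rule: infinite_finite_induct) (simp_all add: cfun_linear)
    have "cfun v (\<Sum>u\<in>E1. z u *\<^sub>C rep u) = (\<Sum>u\<in>E1. if u = v then z v else 0)"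
      unfolding s cfun_linear using v cfun_rep[OF v] by (intro sum.cong refl) auto
    then show ?thesis using v E1(1) by simp
  qed
  then show ?thesis unfolding proj_def by (intro sum.cong) auto
qed

lemma cm_norm_sum_rep: "(cm_norm q (\<Sum>u\<in>E1. z u *\<^sub>C rep u))\<^sup>2 = (\<Sum>u\<in>E1. (cmod (z u))\<^sup>2)"
proof -
  have o: "q u v = (if u = v then 1 else 0)" "q u (dual_J v) = 0" "q (dual_J u) v = 0"
    "q (dual_J u) (dual_J v) = (if u = v then 1 else 0)" if "u \<in> E1" "v \<in> E1" for u v
    using E1(2) that q_J_left[of u v] unfolding J_orthonormal_def q_JJ by auto
  have s: "q (\<Sum>u\<in>S. f u) v = (\<Sum>u\<in>S. q (f u) v)" "q v (\<Sum>u\<in>S. f u) = (\<Sum>u\<in>S. q v (f u))" for f v and S :: "('w \<Rightarrow>\<^sub>L real) set"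
    by (induction S rule: infinite_finite_induct) (simp_all add: q_simps)
  have "(cm_norm q (\<Sum>u\<in>E1. z u *\<^sub>C rep u))\<^sup>2 = (\<Sum>u\<in>E1. \<Sum>v\<in>E1. q (cscale (z u) u) (cscale (z v) v))"
    unfolding sum_rep cm_norm_rep s by (rule sum.swap)
  also have "\<dots> = (\<Sum>u\<in>E1. \<Sum>v\<in>E1. if u = v then (cmod (z u))\<^sup>2 else 0)"
    by (intro sum.cong refl) (auto simp: cscale_def q_simps o cmod_power2 power2_eq_square[symmetric])
  finally show ?thesis using E1(1) by simp
qed

lemma range_proj: "proj w \<in> cm_space q" "proj (proj w) = proj w"
proof -
  show "proj w \<in> cm_space q" unfolding proj_def sum_rep by (rule rep_in_cm)
  show "proj (proj w) = proj w" unfolding proj_def[of w] by (rule proj_sum_rep)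
qed

lemma proj_linear: "proj (x + y) = proj x + proj y" "proj (a *\<^sub>C x) = a *\<^sub>C proj x"
proof -
  show "proj (x + y) = proj x + proj y"
    by (simp add: proj_def cfun_linear scaleC_add_left sum.distrib)
  show "proj (a *\<^sub>C x) = a *\<^sub>C proj x"
    by (simp add: proj_def cfun_linear scaleC_scaleC linear_sum[OF bounded_linear.linear[OF bounded_linear_scaleC]])
qed

lemma proj_bound: "\<exists>K. \<forall>w. cm_norm q (proj w) \<le> K * norm w"
proof -
  have *: "cm_norm q (\<Sum>u\<in>S. f u) \<le> (\<Sum>u\<in>S. cm_norm q (f u)) \<and> (\<Sum>u\<in>S. f u) \<in> cm_space q"
    if "\<And>u. f u \<in> cm_space q" for f and S :: "('w \<Rightarrow>\<^sub>L real) set"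
    using that by (induction S rule: infinite_finite_induct) (auto simp: cm_zero intro: cm_add order_trans[OF cm_add(2)])
  have "cm_norm q (proj w) \<le> (\<Sum>u\<in>E1. 2 * (norm u + norm (dual_J u)) * cm_norm q (rep u)) * norm w" for w
  proof -
    have "cm_norm q (proj w) \<le> (\<Sum>u\<in>E1. cm_norm q (cfun u w *\<^sub>C rep u))"
      unfolding proj_def using *[of "\<lambda>u. cfun u w *\<^sub>C rep u" E1] cm_scaleC(1)[OF rep_in_cm] by blast
    also have "\<dots> \<le> (\<Sum>u\<in>E1. 2 * ((norm u + norm (dual_J u)) * norm w) * cm_norm q (rep u))"
      by (intro sum_mono order_trans[OF cm_scaleC(2)[OF rep_in_cm]] mult_right_mono mult_left_mono cfun_bound cm_norm_nonneg) simp
    also have "\<dots> = (\<Sum>u\<in>E1. 2 * (norm u + norm (dual_J u)) * cm_norm q (rep u)) * norm w"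
      unfolding sum_distrib_right by (simp add: mult_ac)
    finally show ?thesis .
  qed
  then show ?thesis by blast
qed

lemma proj_in_cm_proj: "proj \<in> cm_proj q"
  unfolding cm_proj_def
proof (intro CollectI conjI ballI)
  show "complex_linear proj" unfolding complex_linear_def by (simp add: proj_linear)
  show "range proj \<subseteq> cm_space q" using range_proj by auto
  show "\<exists>B. finite B \<and> range proj \<subseteq> span B"
  proof (intro exI conjI)
    show "finite (rep ` E1 \<union> (\<lambda>u. \<i> *\<^sub>C rep u) ` E1)" using E1 by simp
    show "range proj \<subseteq> span (rep ` E1 \<union> (\<lambda>u. \<i> *\<^sub>C rep u) ` E1)"
      unfolding proj_def
    proof (rule image_subsetI, rule span_sum)
      fix w u assume u: "u \<in> E1"
      show "cfun u w *\<^sub>C rep u \<in> span (rep ` E1 \<union> (\<lambda>u. \<i> *\<^sub>C rep u) ` E1)"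
        unfolding scaleC_split[of "cfun u w"] using u by (intro span_add span_scale) (auto intro: span_base)
    qed
  qed
  show "\<exists>K. \<forall>w. cm_norm q (proj w) \<le> K * norm w" by (rule proj_bound)
  show "proj (proj h) = proj h" for h by (rule range_proj)
  show "cm_cinner q (proj h) k = cm_cinner q h (proj k)" if "h \<in> cm_space q" "k \<in> cm_space q" for h k
    unfolding proj_def sum_rep cm_cinner_rep(1)[OF that(1)] cm_cinner_rep(2)[OF that(2)] cfun_sum cfun_cscale
    by (simp add: mult.commute)
qed

text \<open>The bases of both factors of the subgroup are merged into one, indexed by a disjoint sum.\<close>

abbreviation idx :: "(('w \<Rightarrow>\<^sub>L real) + 'c) set" where "idx \<equiv> E1 <+> E2"

primrec evec :: "('w \<Rightarrow>\<^sub>L real) + 'c \<Rightarrow> 'w \<times> 'c" where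
  "evec (Inl u) = (rep u, 0)" | "evec (Inr c) = (0, c)"

primrec ecoord :: "('w \<Rightarrow>\<^sub>L real) + 'c \<Rightarrow> 'w \<times> 'c \<Rightarrow> complex" where
  "ecoord (Inl u) v = cfun u (fst v)" | "ecoord (Inr c) v = cinner (snd v) c"

definition comb :: "(('w \<Rightarrow>\<^sub>L real) + 'c \<Rightarrow> complex) \<Rightarrow> 'w \<times> 'c" where
  "comb z = (\<Sum>a\<in>idx. z a *\<^sub>C evec a)"

lemma idx_finite: "finite idx" using E1 E2_finite by simp

lemma comb_eq: "comb z = (\<Sum>u\<in>E1. z (Inl u) *\<^sub>C rep u, \<Sum>c\<in>E2. z (Inr c) *\<^sub>C c)"
proof -
  have z: "a *\<^sub>C (0 :: 'x :: complex_normed_vector) = 0" for a by (simp add: scaleC_linear)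
  show ?thesis
    unfolding comb_def using E1(1) E2_finite
    by (subst sum.Plus) (auto simp: scaleC_prod_def z fst_sum snd_sum prod_eq_iff)
qed

lemma comb_ecoord: "comb (\<lambda>a. ecoord a v) = (proj (fst v), snd v)"
  using E2 unfolding comb_eq proj_def orthonormal_basis_def by simp

lemma comb_in_group: "comb z \<in> cm_group q" "fst (comb z) \<in> range proj"
proof -
  have "fst (comb z) = proj (fst (comb z))" unfolding comb_eq by (simp add: proj_sum_rep)
  then show 1: "fst (comb z) \<in> range proj" by (rule range_eqI)
  then show "comb z \<in> cm_group q" using range_proj(1) by (auto simp: cm_group_def mem_Times_iff)
qed

lemma comb_norm: "(cm_group_norm q (comb z))\<^sup>2 = (\<Sum>a\<in>idx. (cmod (z a))\<^sup>2)"
  unfolding cm_group_norm_sq(1)[OF comb_in_group(1)] unfolding comb_eq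
  using E1(1) E2_finite by (simp add: cm_norm_sum_rep orthonormal_basis_norm[OF E2] sum.Plus)

lemma comb_linear: "comb (\<lambda>a. z a + y a) = comb z + comb y" "comb (\<lambda>a. r * z a) = r *\<^sub>C comb z"
  by (simp_all add: comb_def scaleC_add_left sum.distrib scaleC_scaleC[symmetric]
      linear_sum[OF bounded_linear.linear[OF bounded_linear_scaleC]])

lemma ecoord_linear: "ecoord a (x + y) = ecoord a x + ecoord a y" "ecoord a (x - y) = ecoord a x - ecoord a y"
    "ecoord a 0 = 0"
proof -
  have "cinner (u - v) w = cinner u w - cinner v w" for u v w :: 'c
    using cinner_add_left[of "u - v" v w] by simp
  then show "ecoord a (x - y) = ecoord a x - ecoord a y" by (cases a) (simp_all add: cfun_linear)
qed (cases a; simp add: cfun_linear cinner_add_left cinner_zero_left)+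

text \<open>The covariance of the Brownian motion is given through \<open>cm_pairing\<close>; this makes it a statement
  about the coordinates.\<close>

lemma pairing_comb:
  shows "Re (cm_pairing q v (comb y)) = (\<Sum>a\<in>idx. Re (y a) * Re (ecoord a v) + Im (y a) * Im (ecoord a v))"
    "comb y \<in> cm_star q \<times> UNIV"
proof -
  have "cm_pairing q v (comb y) = (\<Sum>a\<in>idx. cnj (y a) * ecoord a v)"
    unfolding cm_pairing_def comb_eq using E1(1) E2_finite
    by (simp add: sum_rep cm_ext_rep cfun_sum cfun_cscale cinner_sum_right cinner_scaleC_right sum.Plus)
  then show "Re (cm_pairing q v (comb y)) = (\<Sum>a\<in>idx. Re (y a) * Re (ecoord a v) + Im (y a) * Im (ecoord a v))" by simp
  show "comb y \<in> cm_star q \<times> UNIV" unfolding comb_eq by (simp add: sum_rep rep_in_star)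
qed

end

text \<open>The functionals in \<open>U\<close> are orthonormalized.\<close>

lemma (in cwiener) frame_containing:
  assumes "finite U"
  obtains E1 and E2 :: "'c::fin_dim_complex_inner_space set" where "frame \<mu> q E1 E2"
    "\<And>u. u \<in> U \<Longrightarrow> \<exists>z. rep u = (\<Sum>e\<in>E1. z e *\<^sub>C rep e)"
proof -
  obtain E1 where E1: "finite E1" "J_orthonormal q dual_J E1"
    "\<And>u. u \<in> U \<Longrightarrow> u = (\<Sum>e\<in>E1. q u e *\<^sub>R e + q u (dual_J e) *\<^sub>R dual_J e)"
    using Gram_Schmidt_complex[OF rip q_JJ dual_J_linear(4) assms] by blast
  obtain E2 :: "'c set" where E2: "orthonormal_basis E2" using orthonormal_basis_exists by blast
  have "rep u = (\<Sum>e\<in>E1. Complex (q u e) (q u (dual_J e)) *\<^sub>C rep e)" if "u \<in> U" for u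
  proof -
    have "rep u = rep (\<Sum>e\<in>E1. q u e *\<^sub>R e + q u (dual_J e) *\<^sub>R dual_J e)" using E1(3)[OF that] by simp
    then show ?thesis by (simp add: rep_sum rep_cscale cscale_def)
  qed
  then show ?thesis using E1 E2 by (intro that[of E1 E2]) (auto simp: frame_def frame_axioms_def cwiener_axioms)
qed

section \<open>The Cameron--Martin group\<close>

context cwiener begin

lemma cm_groupI: "fst x \<in> cm_space q \<Longrightarrow> x \<in> cm_group q" and cm_groupD: "x \<in> cm_group q \<Longrightarrow> fst x \<in> cm_space q"
  by (auto simp: cm_group_def mem_Times_iff)

lemma cm_group_closed:
  assumes "x \<in> cm_group q" "y \<in> cm_group q"
  shows "x + y \<in> cm_group q" "x - y \<in> cm_group q" "r *\<^sub>R x \<in> cm_group q" "z *\<^sub>C x \<in> cm_group q" "0 \<in> cm_group q" "- x \<in> cm_group q"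
  using assms[THEN cm_groupD]
  by (auto intro!: cm_groupI cm_add cm_diff cm_scaleR cm_scaleC cm_minus cm_zero simp: scaleC_prod_def)

lemma cm_group_norm_eq:
  assumes "x \<in> cm_group q"
  shows "cm_group_norm q (x :: 'w \<times> 'c::complex_inner_space) = sqrt ((cm_norm q (fst x))\<^sup>2 + (norm (snd x))\<^sup>2)"
  using cm_group_norm_sq[OF assms] by (metis real_sqrt_unique)

lemma cm_group_norm_nonneg: "x \<in> cm_group q \<Longrightarrow> 0 \<le> cm_group_norm q (x :: 'w \<times> 'c::complex_inner_space)"
  by (rule cm_group_norm_sq)

lemma cm_group_norm_mono:
  assumes "x \<in> cm_group q" "y \<in> cm_group q" "0 \<le> k"
    and "cm_norm q (fst x) \<le> k * cm_norm q (fst y)" "norm (snd x) \<le> k * norm (snd y)"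
  shows "cm_group_norm q (x :: 'w \<times> 'c::complex_inner_space) \<le> k * cm_group_norm q (y :: 'w \<times> 'c)"
proof -
  have "(cm_norm q (fst x))\<^sup>2 + (norm (snd x))\<^sup>2 \<le> (k * cm_norm q (fst y))\<^sup>2 + (k * norm (snd y))\<^sup>2"
    using assms cm_norm_nonneg by (intro add_mono power_mono) auto
  also have "\<dots> = k\<^sup>2 * ((cm_norm q (fst y))\<^sup>2 + (norm (snd y))\<^sup>2)" by (simp add: power_mult_distrib distrib_left)
  finally have "sqrt ((cm_norm q (fst x))\<^sup>2 + (norm (snd x))\<^sup>2) \<le> sqrt (k\<^sup>2 * ((cm_norm q (fst y))\<^sup>2 + (norm (snd y))\<^sup>2))"
    by (rule real_sqrt_le_mono)
  then show ?thesis using assms by (simp add: cm_group_norm_eq real_sqrt_mult)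
qed

lemma cm_group_norm_triangle:
  assumes "x \<in> cm_group q" "y \<in> cm_group q"
  shows "cm_group_norm q (x + y :: 'w \<times> 'c::complex_inner_space) \<le> cm_group_norm q x + cm_group_norm q y"
proof -
  note H = assms[THEN cm_groupD]
  let ?a = "\<lambda>x. cm_norm q (fst x)" and ?b = "\<lambda>x :: 'w \<times> 'c. norm (snd x)"
  have "sqrt ((?a (x + y))\<^sup>2 + (?b (x + y))\<^sup>2) \<le> sqrt ((?a x + ?a y)\<^sup>2 + (?b x + ?b y)\<^sup>2)"
    using H by (intro real_sqrt_le_mono add_mono power_mono) (auto simp: cm_add cm_norm_nonneg norm_triangle_ineq)
  also have "\<dots> = norm ((?a x, ?b x) + (?a y, ?b y))" by (simp add: norm_prod_def)
  also have "\<dots> \<le> norm (?a x, ?b x) + norm (?a y, ?b y)" by (rule norm_triangle_ineq)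
  finally show ?thesis using assms cm_group_closed(1)[OF assms] by (simp add: cm_group_norm_eq norm_prod_def)
qed

text \<open>The factor \<open>2\<close> comes from treating the real and the imaginary part of the scalar separately.\<close>

lemma cm_group_norm_scaleC:
  assumes "x \<in> cm_group q"
  shows "cm_group_norm q (z *\<^sub>C (x :: 'w \<times> 'c::complex_inner_space)) \<le> 2 * cmod z * cm_group_norm q x"
proof (rule cm_group_norm_mono)
  show "norm (snd (z *\<^sub>C x)) \<le> 2 * cmod z * norm (snd x)"
    using mult_right_mono[of "cmod z" "2 * cmod z" "norm (snd x)"] by (simp add: scaleC_prod_def norm_scaleC)
qed (use assms cm_group_closed[OF assms assms] cm_scaleC(2)[OF cm_groupD[OF assms]] in \<open>auto simp: scaleC_prod_def\<close>)

lemma cm_group_norm_scaleR: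
  assumes "x \<in> cm_group q"
  shows "cm_group_norm q (r *\<^sub>R (x :: 'w \<times> 'c::complex_inner_space)) = \<bar>r\<bar> * cm_group_norm q x"
proof -
  have "(\<bar>r\<bar> * cm_norm q (fst x))\<^sup>2 + (\<bar>r\<bar> * norm (snd x))\<^sup>2 = r\<^sup>2 * ((cm_norm q (fst x))\<^sup>2 + (norm (snd x))\<^sup>2)"
    by (simp add: power_mult_distrib distrib_left)
  then show ?thesis
    using assms cm_group_closed(3)[OF assms assms] cm_scaleR[OF cm_groupD[OF assms]]
    by (simp add: cm_group_norm_eq real_sqrt_mult)
qed

lemma cm_group_norm_minus: "x \<in> cm_group q \<Longrightarrow> cm_group_norm q (- x :: 'w \<times> 'c::complex_inner_space) = cm_group_norm q x"
  using cm_group_norm_scaleR[of x "-1"] by simp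

lemma cm_norm_le_group_norm:
  assumes "x \<in> cm_group q"
  shows "cm_norm q (fst x) \<le> cm_group_norm q (x :: 'w \<times> 'c::complex_inner_space)" "norm (snd x) \<le> cm_group_norm q x"
  using assms by (simp_all add: cm_group_norm_eq real_le_rsqrt)

lemma cm_group_norm_le_sum:
  assumes "x \<in> cm_group q"
  shows "cm_group_norm q (x :: 'w \<times> 'c::complex_inner_space) \<le> cm_norm q (fst x) + norm (snd x)"
  using assms sqrt_add_le_add_sqrt[of "(cm_norm q (fst x))\<^sup>2" "(norm (snd x))\<^sup>2"]
  by (simp add: cm_group_norm_eq cm_norm_nonneg)

subsection \<open>Holomorphic functions on the group\<close>

lemma holomorphic_line:
  assumes f: "cm_holomorphic q f" and x: "x \<in> cm_group q" and v: "v \<in> cm_group q"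
  shows "(\<lambda>z. f (x + z *\<^sub>C (v :: 'w \<times> 'c::complex_inner_space))) holomorphic_on UNIV"
  unfolding holomorphic_on_def
proof
  fix z0 :: complex
  have "(\<lambda>z. f ((x + z0 *\<^sub>C v) + z *\<^sub>C v)) field_differentiable (at 0)"
    using f v cm_group_closed(1)[OF x cm_group_closed(4)[OF v v]] unfolding cm_holomorphic_def by blast
  moreover have "(x + z0 *\<^sub>C v) + z *\<^sub>C v = x + (z0 + z) *\<^sub>C v" for z by (simp add: scaleC_add_left add.assoc)
  ultimately obtain D where "((\<lambda>z. f (x + (z0 + z) *\<^sub>C v)) has_field_derivative D) (at 0)"
    unfolding field_differentiable_def by auto
  then have "((\<lambda>z. f (x + z *\<^sub>C v)) has_field_derivative D) (at z0)"
    unfolding DERIV_def by simp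
  then show "(\<lambda>z. f (x + z *\<^sub>C v)) field_differentiable at z0 within UNIV"
    unfolding field_differentiable_def by auto
qed

lemma local_bound:
  assumes f: "cm_holomorphic q f" and x: "x \<in> cm_group q"
  obtains r K where "0 < r" "0 < K"
    "\<And>v R. v \<in> cm_group q \<Longrightarrow> 0 < R \<Longrightarrow> 2 * R * cm_group_norm q v \<le> r \<Longrightarrow>
      (\<forall>z \<in> ball 0 R. cmod (f (x + z *\<^sub>C (v :: 'w \<times> 'c::complex_inner_space))) \<le> K)"
proof -
  obtain r K where r: "0 < r" and K: "\<And>y. y \<in> cm_group q \<Longrightarrow> cm_group_norm q (y - x) < r \<Longrightarrow> cmod (f y) \<le> K"
    using f x unfolding cm_holomorphic_def by blast
  show ?thesis
  proof (rule that[of r "max K 1"])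
    fix v :: "'w \<times> 'c" and R assume v: "v \<in> cm_group q" and R: "0 < R" "2 * R * cm_group_norm q v \<le> r"
    show "\<forall>z \<in> ball 0 R. cmod (f (x + z *\<^sub>C v)) \<le> max K 1"
    proof
      fix z :: complex assume z: "z \<in> ball 0 R"
      have "cm_group_norm q (z *\<^sub>C v) < r"
      proof (cases "cm_group_norm q v = 0")
        case True
        then show ?thesis using cm_group_norm_scaleC[OF v, of z] r by simp
      next
        case False
        then have "2 * cmod z * cm_group_norm q v < 2 * R * cm_group_norm q v"
          using z cm_group_norm_nonneg[OF v] by simp
        then show ?thesis using cm_group_norm_scaleC[OF v, of z] R by linarith
      qed
      then have "cmod (f (x + z *\<^sub>C v)) \<le> K"
        using cm_group_closed(1)[OF x cm_group_closed(4)[OF v v]] by (intro K) auto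
      then show "cmod (f (x + z *\<^sub>C v)) \<le> max K 1" by simp
    qed
  qed (use r in auto)
qed

text \<open>Local boundedness and the Cauchy estimate along the complex line through \<open>x\<close> and \<open>y\<close>.\<close>

lemma holomorphic_continuous:
  assumes f: "cm_holomorphic q f" and x: "x \<in> cm_group q" and e: "0 < e"
  obtains d where "0 < d"
    "\<And>y. y \<in> cm_group q \<Longrightarrow> cm_group_norm q (y - x :: 'w \<times> 'c::complex_inner_space) < d \<Longrightarrow> cmod (f y - f x) < e"
proof -
  obtain r K where r: "0 < r" "0 < K" and B: "\<And>v R. v \<in> cm_group q \<Longrightarrow> 0 < R \<Longrightarrow> 2 * R * cm_group_norm q v \<le> r \<Longrightarrow>
      (\<forall>z \<in> ball 0 R. cmod (f (x + z *\<^sub>C v)) \<le> K)"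
    using local_bound[OF f x] by metis
  define d where "d = min (r / 4) (e * r / (16 * K))"
  have d: "0 < d" "d \<le> r / 4" "d \<le> e * r / (16 * K)" using r e by (auto simp: d_def)
  show ?thesis
  proof (rule that[OF d(1)])
    fix y :: "'w \<times> 'c" assume y: "y \<in> cm_group q" "cm_group_norm q (y - x) < d"
    define v where "v = y - x"
    have v: "v \<in> cm_group q" unfolding v_def by (rule cm_group_closed(2)[OF y(1) x])
    define R where "R = r / (2 * d)"
    have R: "0 < R" "2 * R * cm_group_norm q v \<le> r" "1 \<le> R / 2"
      using r d y(2) by (simp_all add: R_def v_def[symmetric] field_simps)
    have "cmod (f (x + 1 *\<^sub>C v) - f (x + 0 *\<^sub>C v)) \<le> 4 * K / R * cmod 1"
      using B[OF v R(1,2)] R(1,3)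
      by (intro holomorphic_increment_bounds(1)[where g = "\<lambda>z. f (x + z *\<^sub>C v)"])
        (auto intro: holomorphic_on_subset[OF holomorphic_line[OF f x v]])
    also have "4 * K / R * cmod 1 = 8 * K * d / r" by (simp add: R_def)
    also have "\<dots> \<le> 8 * K * (e * r / (16 * K)) / r" using d r by (intro divide_right_mono mult_left_mono) auto
    also have "\<dots> < e" using r e by simp
    finally show "cmod (f y - f x) < e" by (simp add: scaleC_one scaleC_zero v_def)
  qed
qed

text \<open>Only differentiability along complex lines is given; the second order remainder is uniform in
  bounded directions, so the directional derivative may be taken along a moving direction.\<close>

lemma holomorphic_quadratic_curve:
  assumes f: "cm_holomorphic q f" and p: "p0 \<in> cm_group q" "p1 \<in> cm_group q" "p2 \<in> cm_group q"
  shows "(\<lambda>z. f (p0 + z *\<^sub>C p1 + z\<^sup>2 *\<^sub>C (p2 :: 'w \<times> 'c::complex_inner_space))) holomorphic_on UNIV"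
  unfolding holomorphic_on_def
proof
  fix z0 :: complex
  let ?n = "cm_group_norm q :: 'w \<times> 'c \<Rightarrow> real"
  define x where "x = p0 + z0 *\<^sub>C p1 + z0\<^sup>2 *\<^sub>C p2"
  define v where "v = p1 + (2 * z0) *\<^sub>C p2"
  define u where "u h = v + h *\<^sub>C p2" for h
  have x: "x \<in> cm_group q" unfolding x_def using p by (intro cm_group_closed) auto
  have v: "v \<in> cm_group q" unfolding v_def using p by (intro cm_group_closed) auto
  have u: "u h \<in> cm_group q" for h unfolding u_def using p v by (intro cm_group_closed) auto
  have curve: "p0 + (z0 + h) *\<^sub>C p1 + (z0 + h)\<^sup>2 *\<^sub>C p2 = x + h *\<^sub>C u h" for h
    by (simp add: x_def u_def v_def scaleC_add_left scaleC_add_right scaleC_scaleC power2_eq_square algebra_simps)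
  define g where "g w z = f (x + z *\<^sub>C w)" for w z
  define D where "D w = deriv (g w) 0" for w
  obtain r K where r: "0 < r" "0 < K" and B: "\<And>v R. v \<in> cm_group q \<Longrightarrow> 0 < R \<Longrightarrow> 2 * R * ?n v \<le> r \<Longrightarrow>
      (\<forall>z \<in> ball 0 R. cmod (f (x + z *\<^sub>C v)) \<le> K)"
    using local_bound[OF f x] by metis
  define S where "S = ?n v + 2 * ?n p2 + 1"
  have S: "0 < S" using cm_group_norm_nonneg[OF v] cm_group_norm_nonneg[OF p(3)] by (simp add: S_def)
  define R where "R = r / (2 * S)"
  have R: "0 < R" using r S by (simp add: R_def)
  define C where "C = 32 * K / R\<^sup>2"
  have C: "0 < C" using r R by (simp add: C_def)
  have taylor: "cmod (g (u h) z - f x - z * D (u h)) \<le> C * (cmod z)\<^sup>2" if h: "cmod h \<le> 1" and z: "cmod z \<le> R / 2" for h z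
  proof -
    have "?n (u h) \<le> ?n v + 2 * cmod h * ?n p2"
      unfolding u_def using cm_group_norm_triangle[OF v cm_group_closed(4)[OF p(3) p(3)], of h] cm_group_norm_scaleC[OF p(3), of h] by linarith
    also have "\<dots> \<le> S" using mult_right_mono[OF h cm_group_norm_nonneg[OF p(3)]] by (simp add: S_def)
    finally have "2 * R * ?n (u h) \<le> 2 * R * S" using R by (intro mult_left_mono) auto
    then have "2 * R * ?n (u h) \<le> r" using S by (simp add: R_def)
    then have "cmod (g (u h) z - g (u h) 0 - z * deriv (g (u h)) 0) \<le> 32 * K / R\<^sup>2 * (cmod z)\<^sup>2"
      unfolding g_def using B[OF u R] R z
      by (intro holomorphic_increment_bounds(2)) (auto intro: holomorphic_on_subset[OF holomorphic_line[OF f x u]])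
    moreover have "g (u h) 0 = f x" by (simp add: g_def scaleC_zero)
    ultimately show ?thesis by (simp add: D_def C_def)
  qed
  have u0: "u 0 = v" by (simp add: u_def scaleC_zero)
  have "((\<lambda>h. (f (x + h *\<^sub>C u h) - f x) / h) \<longlongrightarrow> D v) (at 0)"
  proof (rule LIM_I)
    fix e :: real assume e: "0 < e"
    define t where "t = min (R / 2) (e / (8 * C))"
    have t: "0 < t" "t \<le> R / 2" "t \<le> e / (8 * C)" using R C e by (auto simp: t_def)
    have xt: "x + complex_of_real t *\<^sub>C v \<in> cm_group q" using x v by (intro cm_group_closed) auto
    obtain d where d: "0 < d" "\<And>y. y \<in> cm_group q \<Longrightarrow> ?n (y - (x + complex_of_real t *\<^sub>C v)) < d \<Longrightarrow>
        cmod (f y - f (x + complex_of_real t *\<^sub>C v)) < e * t / 4"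
      using holomorphic_continuous[OF f xt, of "e * t / 4"] e t by auto
    define s where "s = min (min 1 (R / 2)) (min (e / (4 * C)) (d / (4 * t * (?n p2 + 1))))"
    have np: "0 < ?n p2 + 1" using cm_group_norm_nonneg[OF p(3)] by simp
    have s: "0 < s" using R C e d t np by (auto simp: s_def)
    show "\<exists>s>0. \<forall>h. h \<noteq> 0 \<and> norm (h - 0) < s \<longrightarrow> norm ((f (x + h *\<^sub>C u h) - f x) / h - D v) < e"
    proof (intro exI[of _ s] conjI allI impI s)
      fix h :: complex assume "h \<noteq> 0 \<and> norm (h - 0) < s"
      then have h: "h \<noteq> 0" "cmod h \<le> 1" "cmod h \<le> R / 2" "cmod h < e / (4 * C)" "cmod h < d / (4 * t * (?n p2 + 1))"
        by (auto simp: s_def)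
      have q1: "cmod ((f (x + h *\<^sub>C u h) - f x) / h - D (u h)) \<le> C * cmod h"
      proof -
        have "(f (x + h *\<^sub>C u h) - f x) / h - D (u h) = (g (u h) h - f x - h * D (u h)) / h"
          using h(1) by (simp add: g_def field_simps)
        then have "cmod ((f (x + h *\<^sub>C u h) - f x) / h - D (u h)) \<le> C * (cmod h)\<^sup>2 / cmod h"
          using taylor[OF h(2,3)] h(1) by (simp add: norm_divide divide_right_mono)
        then show ?thesis using h(1) by (simp add: power2_eq_square)
      qed
      have q2: "C * cmod h < e / 4" using h(4) C by (simp add: field_simps)
      have Dq: "cmod ((g (u k) (complex_of_real t) - f x) / complex_of_real t - D (u k)) \<le> e / 8" if "cmod k \<le> 1" for k
      proof -
        have "(g (u k) (complex_of_real t) - f x) / complex_of_real t - D (u k) = (g (u k) (complex_of_real t) - f x - complex_of_real t * D (u k)) / complex_of_real t"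
          using t by (simp add: field_simps)
        then have "cmod ((g (u k) (complex_of_real t) - f x) / complex_of_real t - D (u k)) \<le> C * t\<^sup>2 / t"
          using taylor[OF that, of "complex_of_real t"] t by (simp add: norm_divide divide_right_mono)
        also have "\<dots> = C * t" using t by (simp add: power2_eq_square)
        also have "\<dots> \<le> e / 8" using t(3) C by (simp add: field_simps)
        finally show ?thesis .
      qed
      have "cmod (g (u h) (complex_of_real t) - g v (complex_of_real t)) < e * t / 4"
        unfolding g_def
      proof (rule d(2))
        show "x + complex_of_real t *\<^sub>C u h \<in> cm_group q" using x u by (intro cm_group_closed) auto
        have "x + complex_of_real t *\<^sub>C u h - (x + complex_of_real t *\<^sub>C v) = (complex_of_real t * h) *\<^sub>C p2"
          by (simp add: u_def scaleC_add_right scaleC_scaleC)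
        then have "?n (x + complex_of_real t *\<^sub>C u h - (x + complex_of_real t *\<^sub>C v)) \<le> 2 * (t * cmod h) * ?n p2"
          using cm_group_norm_scaleC[OF p(3), of "complex_of_real t * h"] t by (simp add: norm_mult)
        also have "\<dots> \<le> 2 * (t * cmod h) * (?n p2 + 1)" using t by (intro mult_left_mono) auto
        also have "\<dots> < d"
        proof -
          have "cmod h * (4 * t * (?n p2 + 1)) < d" using h(5) t np by (simp add: pos_less_divide_eq)
          moreover have "0 \<le> cmod h * (2 * t * (?n p2 + 1))" using t np by simp
          ultimately show ?thesis by (simp add: algebra_simps)
        qed
        finally show "?n (x + complex_of_real t *\<^sub>C u h - (x + complex_of_real t *\<^sub>C v)) < d" .
      qed
      then have "cmod ((g (u h) (complex_of_real t) - f x) / complex_of_real t - (g v (complex_of_real t) - f x) / complex_of_real t) < e / 4"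
        using t by (simp add: diff_divide_distrib[symmetric] norm_divide field_simps)
      moreover note Dq[OF h(2)] Dq[of 0, unfolded u0] q1 q2
      moreover have "(f (x + h *\<^sub>C u h) - f x) / h - D v = ((f (x + h *\<^sub>C u h) - f x) / h - D (u h))
          - ((g (u h) (complex_of_real t) - f x) / complex_of_real t - D (u h))
          + ((g (u h) (complex_of_real t) - f x) / complex_of_real t - (g v (complex_of_real t) - f x) / complex_of_real t)
          + ((g v (complex_of_real t) - f x) / complex_of_real t - D v)" by simp
      ultimately show "norm ((f (x + h *\<^sub>C u h) - f x) / h - D v) < e"
        using e norm_triangle_ineq[of "(f (x + h *\<^sub>C u h) - f x) / h - D (u h) - ((g (u h) (complex_of_real t) - f x) / complex_of_real t - D (u h))
          + ((g (u h) (complex_of_real t) - f x) / complex_of_real t - (g v (complex_of_real t) - f x) / complex_of_real t)" "(g v (complex_of_real t) - f x) / complex_of_real t - D v"]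
          norm_triangle_ineq[of "(f (x + h *\<^sub>C u h) - f x) / h - D (u h) - ((g (u h) (complex_of_real t) - f x) / complex_of_real t - D (u h))"
          "(g (u h) (complex_of_real t) - f x) / complex_of_real t - (g v (complex_of_real t) - f x) / complex_of_real t"]
          norm_triangle_ineq4[of "(f (x + h *\<^sub>C u h) - f x) / h - D (u h)" "(g (u h) (complex_of_real t) - f x) / complex_of_real t - D (u h)"]
        by (simp only: norm_zero order.refl) linarith
    qed
  qed
  then have "((\<lambda>z. f (p0 + z *\<^sub>C p1 + z\<^sup>2 *\<^sub>C p2)) has_field_derivative D v) (at z0)"
    unfolding DERIV_def curve by (simp add: x_def)
  then show "(\<lambda>z. f (p0 + z *\<^sub>C p1 + z\<^sup>2 *\<^sub>C p2)) field_differentiable at z0 within UNIV"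
    unfolding field_differentiable_def by auto
qed

end

section \<open>The group law\<close>

text \<open>The product of \<open>X 0, \<dots>, X (N - 1)\<close> in closed form.\<close>

definition heis_prod :: "('w::complex_normed_vector \<Rightarrow> 'w \<Rightarrow> 'c::complex_normed_vector) \<Rightarrow> nat \<Rightarrow> (nat \<Rightarrow> 'w \<times> 'c) \<Rightarrow> 'w \<times> 'c" where
  "heis_prod \<omega> N X = ((\<Sum>i<N. fst (X i)), (\<Sum>i<N. snd (X i)) + (1/2) *\<^sub>R (\<Sum>i<N. \<omega> (\<Sum>j<i. fst (X j)) (fst (X i))))"

definition heis_list :: "('w::complex_normed_vector \<Rightarrow> 'w \<Rightarrow> 'c::complex_normed_vector) \<Rightarrow> ('w \<times> 'c) list \<Rightarrow> 'w \<times> 'c" where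
  "heis_list \<omega> xs = foldl (heis_mult \<omega>) 0 xs"

lemma heis_prod_Suc: "heis_prod \<omega> (Suc n) X = heis_mult \<omega> (heis_prod \<omega> n X) (X n)"
  by (simp add: heis_prod_def heis_mult_def scaleR_add_right add_ac)

lemma heis_prod_cong: "(\<And>i. i < N \<Longrightarrow> X i = Y i) \<Longrightarrow> heis_prod \<omega> N X = heis_prod \<omega> N Y"
  by (induction N) (simp_all add: heis_prod_Suc, simp add: heis_prod_def)

lemma heis_list_eq_prod: "heis_list \<omega> xs = heis_prod \<omega> (length xs) (nth xs)"
proof (induction xs rule: rev_induct)
  case Nil
  show ?case by (simp add: heis_list_def heis_prod_def zero_prod_def)
next
  case (snoc x xs)
  have "heis_prod \<omega> (length xs) (nth (xs @ [x])) = heis_prod \<omega> (length xs) (nth xs)"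
    by (rule heis_prod_cong) (simp add: nth_append)
  then show ?case using snoc by (simp add: heis_list_def heis_prod_Suc)
qed

locale heis =
  fixes \<omega> :: "'w::complex_normed_vector \<Rightarrow> 'w \<Rightarrow> 'c::complex_inner_space"
  assumes heis: "heis_form \<omega>"
begin

sublocale om: bounded_bilinear \<omega> using heis by (simp add: heis_form_def)

lemma om_scaleC: "\<omega> (a *\<^sub>C x) y = a *\<^sub>C \<omega> x y" "\<omega> x (a *\<^sub>C y) = a *\<^sub>C \<omega> x y"
  and om_skew: "\<omega> x y = - \<omega> y x"
  using heis unfolding heis_form_def by blast+

lemma om_self: "\<omega> x x = 0"
proof -
  have "\<omega> x x + \<omega> x x = 0" using om_skew[of x x] by (metis add.right_inverse)
  then have "2 *\<^sub>R \<omega> x x = 0" by (simp add: scaleR_2)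
  then show ?thesis by simp
qed

lemma heis_mult_unit: "heis_mult \<omega> 0 x = x" "heis_mult \<omega> x 0 = x"
  by (simp_all add: heis_mult_def om.zero_left om.zero_right)

lemma heis_mult_assoc: "heis_mult \<omega> (heis_mult \<omega> x y) z = heis_mult \<omega> x (heis_mult \<omega> y z)"
  by (simp add: heis_mult_def om.add_left om.add_right scaleR_add_right add_ac)

lemma heis_list_append: "heis_list \<omega> (xs @ ys) = heis_mult \<omega> (heis_list \<omega> xs) (heis_list \<omega> ys)"
proof (induction ys rule: rev_induct)
  case Nil
  show ?case by (simp add: heis_list_def heis_mult_unit)
next
  case (snoc y ys)
  have 1: "heis_list \<omega> (zs @ [y]) = heis_mult \<omega> (heis_list \<omega> zs) y" for zs by (simp add: heis_list_def)
  show ?case using snoc 1[of "xs @ ys"] by (simp add: 1 heis_mult_assoc)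
qed

lemma heis_list_Cons: "heis_list \<omega> (x # xs) = heis_mult \<omega> x (heis_list \<omega> xs)"
  using heis_list_append[of "[x]" xs] by (simp add: heis_list_def heis_mult_unit)

lemma heis_list_replicate: "heis_list \<omega> (replicate k x) = real k *\<^sub>R x"
proof (induction k)
  case 0
  show ?case by (simp add: heis_list_def)
next
  case (Suc k)
  then show ?case
    by (simp add: heis_list_Cons) (simp add: heis_mult_def om.scaleR_right om_self prod_eq_iff scaleR_add_left)
qed

text \<open>Products are quadratic in the first components of their factors, so a scaled and shifted product is
  a polynomial of degree two in the scale. Skew symmetry of \<open>\<omega>\<close> moves the factors of \<open>X\<close> to the right
  argument, which is the origin of the difference of two sums of \<open>Y\<close>.\<close>

lemma heis_prod_scaled_shift:
  "heis_prod \<omega> N (\<lambda>i. z *\<^sub>C X i + Y i) = heis_prod \<omega> N Y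
    + z *\<^sub>C (\<Sum>i<N. fst (X i), (\<Sum>i<N. snd (X i)) + (1/2) *\<^sub>R (\<Sum>i<N. \<omega> ((\<Sum>j<i. fst (Y j)) - (\<Sum>j\<in>{i<..<N}. fst (Y j))) (fst (X i))))
    + z\<^sup>2 *\<^sub>C (0, (1/2) *\<^sub>R (\<Sum>i<N. \<omega> (\<Sum>j<i. fst (X j)) (fst (X i))))"
proof -
  note sC = linear_sum[OF bounded_linear.linear[OF bounded_linear_scaleC]]
  have sw: "(\<Sum>i<N. \<omega> (\<Sum>j<i. fst (X j)) (fst (Y i))) = - (\<Sum>i<N. \<omega> (\<Sum>j\<in>{i<..<N}. fst (Y j)) (fst (X i)))"
  proof -
    have "(\<Sum>i<N. \<omega> (\<Sum>j<i. fst (X j)) (fst (Y i))) = (\<Sum>i<N. \<Sum>j<i. \<omega> (fst (X j)) (fst (Y i)))"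
      by (simp add: om.sum_left)
    also have "\<dots> = (\<Sum>i<N. \<Sum>j<N. if j < i then \<omega> (fst (X j)) (fst (Y i)) else 0)"
      by (intro sum.cong refl sum.mono_neutral_cong_left) auto
    also have "\<dots> = (\<Sum>j<N. \<Sum>i<N. if j < i then \<omega> (fst (X j)) (fst (Y i)) else 0)" by (rule sum.swap)
    also have "\<dots> = (\<Sum>j<N. \<Sum>i\<in>{j<..<N}. \<omega> (fst (X j)) (fst (Y i)))"
      by (intro sum.cong refl sum.mono_neutral_cong_right) auto
    also have "\<dots> = (\<Sum>j<N. \<Sum>i\<in>{j<..<N}. - \<omega> (fst (Y i)) (fst (X j)))"
      by (intro sum.cong refl) (rule om_skew)
    also have "\<dots> = - (\<Sum>j<N. \<omega> (\<Sum>i\<in>{j<..<N}. fst (Y i)) (fst (X j)))" by (simp add: om.sum_left sum_negf)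
    finally show ?thesis .
  qed
  have q: "\<omega> (\<Sum>j<i. z *\<^sub>C fst (X j) + fst (Y j)) (z *\<^sub>C fst (X i) + fst (Y i)) =
      z\<^sup>2 *\<^sub>C \<omega> (\<Sum>j<i. fst (X j)) (fst (X i)) + z *\<^sub>C \<omega> (\<Sum>j<i. fst (Y j)) (fst (X i))
      + z *\<^sub>C \<omega> (\<Sum>j<i. fst (X j)) (fst (Y i)) + \<omega> (\<Sum>j<i. fst (Y j)) (fst (Y i))" for i
    by (simp add: sum.distrib sC[symmetric] om.add_left om.add_right om_scaleC scaleC_scaleC scaleC_add_right power2_eq_square)
  have "(\<Sum>i<N. \<omega> (\<Sum>j<i. fst (z *\<^sub>C X j + Y j)) (fst (z *\<^sub>C X i + Y i))) =
      z\<^sup>2 *\<^sub>C (\<Sum>i<N. \<omega> (\<Sum>j<i. fst (X j)) (fst (X i)))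
      + z *\<^sub>C (\<Sum>i<N. \<omega> ((\<Sum>j<i. fst (Y j)) - (\<Sum>j\<in>{i<..<N}. fst (Y j))) (fst (X i)))
      + (\<Sum>i<N. \<omega> (\<Sum>j<i. fst (Y j)) (fst (Y i)))"
  proof -
    have "(\<Sum>i<N. \<omega> (\<Sum>j<i. fst (z *\<^sub>C X j + Y j)) (fst (z *\<^sub>C X i + Y i))) =
      z\<^sup>2 *\<^sub>C (\<Sum>i<N. \<omega> (\<Sum>j<i. fst (X j)) (fst (X i))) + z *\<^sub>C (\<Sum>i<N. \<omega> (\<Sum>j<i. fst (Y j)) (fst (X i)))
      + z *\<^sub>C (\<Sum>i<N. \<omega> (\<Sum>j<i. fst (X j)) (fst (Y i))) + (\<Sum>i<N. \<omega> (\<Sum>j<i. fst (Y j)) (fst (Y i)))"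
      by (simp only: scaleC_prod_def fst_add fst_conv q) (simp only: sum.distrib sC)
    also have "\<dots> = z\<^sup>2 *\<^sub>C (\<Sum>i<N. \<omega> (\<Sum>j<i. fst (X j)) (fst (X i)))
      + z *\<^sub>C (\<Sum>i<N. \<omega> ((\<Sum>j<i. fst (Y j)) - (\<Sum>j\<in>{i<..<N}. fst (Y j))) (fst (X i)))
      + (\<Sum>i<N. \<omega> (\<Sum>j<i. fst (Y j)) (fst (Y i)))"
      unfolding sw by (simp add: om.diff_left sum_subtractf scaleC_linear)
    finally show ?thesis .
  qed
  moreover have "z *\<^sub>C (r *\<^sub>R y) = r *\<^sub>R (z *\<^sub>C y)" for z r and y :: 'c by (simp add: scaleC_linear)
  ultimately show ?thesis
    by (simp add: heis_prod_def prod_eq_iff scaleC_prod_def sum.distrib sC scaleC_add_right scaleR_add_right scaleC_linear add_ac)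
qed

end

section \<open>Brownian motion\<close>

locale heis_bm = frame \<mu> q E1 E2 + heis \<omega>
  for \<mu> :: "'w::{complex_normed_vector, banach, second_countable_topology} measure" and q E1
    and E2 :: "'c::fin_dim_complex_inner_space set" and \<omega> :: "'w \<Rightarrow> 'w \<Rightarrow> 'c" +
  fixes M :: "'a measure" and b :: "real \<Rightarrow> 'a \<Rightarrow> 'w \<times> 'c"
  assumes cbm: "cm_brownian_motion q M b"
begin

lemma bm: "brownian_motion M b" using cbm by (simp add: cm_brownian_motion_def)

sublocale BM: prob_space M using bm by (simp add: brownian_motion_def)

lemma b_measurable [measurable]: "0 \<le> t \<Longrightarrow> b t \<in> borel_measurable M"
  using bm by (simp add: brownian_motion_def)

lemma b_zero: "AE x in M. b 0 x = 0"
  using bm by (simp add: brownian_motion_def)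

abbreviation inc :: "real \<Rightarrow> real \<Rightarrow> 'a \<Rightarrow> 'w \<times> 'c" where "inc s t x \<equiv> b t x - b s x"

lemma inc_measurable [measurable]: "0 \<le> s \<Longrightarrow> 0 \<le> t \<Longrightarrow> inc s t \<in> borel_measurable M"
  by (rule borel_measurable_diff) (rule b_measurable; simp)+

subsection \<open>The filtration\<close>

lemma past_sets: "0 \<le> s \<Longrightarrow> sets (past M b s) \<subseteq> sets M" and past_space: "space (past M b s) = space M"
proof -
  have sub: "(\<Union>r\<in>{0..s}. {b r -` A \<inter> space M |A. A \<in> sets borel}) \<subseteq> Pow (space M)" by auto
  show "space (past M b s) = space M" unfolding past_def using sub by (rule space_measure_of)
  show "sets (past M b s) \<subseteq> sets M" if "0 \<le> s"
    unfolding past_def sets_measure_of[OF sub]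
    by (rule sets.sigma_sets_subset) (use b_measurable in \<open>auto intro: measurable_sets\<close>)
qed

lemma past_measurable: "0 \<le> s \<Longrightarrow> f \<in> measurable (past M b s) N \<Longrightarrow> f \<in> measurable M N"
  using past_sets[of s] past_space[of s] by (auto simp: measurable_def)

lemma past_mono: "r \<le> s \<Longrightarrow> f \<in> measurable (past M b r) N \<Longrightarrow> f \<in> measurable (past M b s) N"
proof -
  assume rs: "r \<le> s"
  have "sets (past M b r) \<subseteq> sets (past M b s)"
  proof -
    have sub: "(\<Union>r\<in>{0..s}. {b r -` A \<inter> space M |A. A \<in> sets borel}) \<subseteq> Pow (space M)" for s by auto
    show ?thesis
      unfolding past_def sets_measure_of[OF sub]
      by (intro sigma_sets_mono' UN_mono) (use rs in auto)
  qed
  then show "f \<in> measurable (past M b r) N \<Longrightarrow> f \<in> measurable (past M b s) N"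
    using past_space by (auto simp: measurable_def)
qed

lemma b_past: "0 \<le> r \<Longrightarrow> r \<le> s \<Longrightarrow> b r \<in> borel_measurable (past M b s)"
proof (rule measurableI)
  fix A :: "('w \<times> 'c) set" assume A: "A \<in> sets borel" and rs: "0 \<le> r" "r \<le> s"
  have sub: "(\<Union>r\<in>{0..s}. {b r -` A \<inter> space M |A. A \<in> sets borel}) \<subseteq> Pow (space M)" by auto
  have "b r -` A \<inter> space M \<in> (\<Union>r\<in>{0..s}. {b r -` A \<inter> space M |A. A \<in> sets borel})"
    using A rs by (intro UN_I[of r]) auto
  then show "b r -` A \<inter> space (past M b s) \<in> sets (past M b s)"
    unfolding past_space unfolding past_def sets_measure_of[OF sub] by (rule sigma_sets.Basic)
qed simp

lemma past_indep:
  fixes Z :: "'a \<Rightarrow> real" and g :: "'w \<times> 'c \<Rightarrow> real"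
  assumes st: "0 \<le> s" "s \<le> t" and Z: "Z \<in> borel_measurable (past M b s)" and g: "g \<in> borel_measurable borel"
  shows "BM.indep_var borel Z borel (\<lambda>x. g (inc s t x))"
proof -
  have i: "BM.indep_set (sets (past M b s)) {inc s t -` A \<inter> space M | A. A \<in> sets borel}"
    using bm st unfolding brownian_motion_def by blast
  let ?D = "\<lambda>x. g (inc s t x)"
  have inc: "inc s t \<in> borel_measurable M" by (intro inc_measurable) (use st in auto)
  have D: "?D \<in> borel_measurable M" by (rule measurable_compose[OF inc g])
  show ?thesis
    unfolding BM.indep_var_eq
  proof (intro conjI)
    show "Z \<in> borel_measurable M" using past_measurable[OF st(1) Z] .
    show "?D \<in> borel_measurable M" by (rule D)
    have 1: "sigma_sets (space M) {Z -` A \<inter> space M |A. A \<in> sets borel} \<subseteq> sets (past M b s)"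
    proof -
      have "{Z -` A \<inter> space M |A. A \<in> sets borel} \<subseteq> sets (past M b s)"
        using measurable_sets[OF Z] by (auto simp: past_space)
      from sets.sigma_sets_subset[OF this] show ?thesis by (simp add: past_space)
    qed
    have 2: "sigma_sets (space M) {?D -` A \<inter> space M |A. A \<in> sets borel} = {?D -` A \<inter> space M |A. A \<in> sets borel}"
      using sigma_sets_vimage_commute[of ?D "space M" "space borel" "sets borel"]
      by (simp add: sets.sigma_sets_eq[of borel, simplified])
    have 3: "{?D -` A \<inter> space M |A. A \<in> sets borel} \<subseteq> {inc s t -` A \<inter> space M | A. A \<in> sets borel}"
    proof clarify
      fix A :: "real set" assume "A \<in> sets borel"
      then have "g -` A \<in> sets borel" using measurable_sets[OF g] by simp
      then show "\<exists>B. ?D -` A \<inter> space M = inc s t -` B \<inter> space M \<and> B \<in> sets borel"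
        by (intro exI[of _ "g -` A"]) auto
    qed
    show "BM.indep_set (sigma_sets (space M) {Z -` A \<inter> space M |A. A \<in> sets borel})
       (sigma_sets (space M) {?D -` A \<inter> space M |A. A \<in> sets borel})"
      unfolding 2 BM.indep_sets2_eq
    proof (intro conjI ballI)
      note i' = i[unfolded BM.indep_sets2_eq]
      show "sigma_sets (space M) {Z -` A \<inter> space M |A. A \<in> sets borel} \<subseteq> BM.events"
        using 1 i' by (rule order_trans[OF _ conjunct1])
      show "{?D -` A \<inter> space M |A. A \<in> sets borel} \<subseteq> BM.events"
        using order_trans[OF 3 conjunct1[OF conjunct2[OF i']]] .
      fix u v assume "u \<in> sigma_sets (space M) {Z -` A \<inter> space M |A. A \<in> sets borel}"
        "v \<in> {?D -` A \<inter> space M |A. A \<in> sets borel}"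
      then show "BM.prob (u \<inter> v) = BM.prob u * BM.prob v"
        using bspec[OF bspec[OF conjunct2[OF conjunct2[OF i']] subsetD[OF 1]] subsetD[OF 3]] by simp
    qed
  qed
qed

subsection \<open>Laws of the increments\<close>

definition lin :: "(('w \<Rightarrow>\<^sub>L real) + 'c \<Rightarrow> complex) \<Rightarrow> 'w \<times> 'c \<Rightarrow> real" where
  "lin y v = (\<Sum>a\<in>idx. Re (y a) * Re (ecoord a v) + Im (y a) * Im (ecoord a v))"

lemma ecoord_bounded_linear: "bounded_linear (ecoord a)"
proof (cases a)
  case (Inl u)
  show ?thesis
  proof (rule bounded_linear_intro)
    show "ecoord a (r *\<^sub>R x) = r *\<^sub>R ecoord a x" for r x
      using cfun_linear(2)[of u "complex_of_real r" "fst x"] by (simp add: Inl scaleC_of_real scaleR_conv_of_real)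
    show "norm (ecoord a x) \<le> norm x * (norm u + norm (dual_J u))" for x
      using order_trans[OF cfun_bound[of u "fst x"] mult_left_mono[OF norm_fst_le[of "fst x" "snd x"], of "norm u + norm (dual_J u)"]]
      by (simp add: Inl mult.commute)
  qed (simp add: ecoord_linear)
next
  case (Inr c)
  show ?thesis
  proof (rule bounded_linear_intro)
    show "ecoord a (r *\<^sub>R x) = r *\<^sub>R ecoord a x" for r x
      by (simp add: Inr cinner_scaleR_left scaleR_conv_of_real)
    show "norm (ecoord a x) \<le> norm x * (2 * norm c)" for x
    proof -
      have "cmod (cinner (snd x) c) \<le> \<bar>Re (cinner (snd x) c)\<bar> + \<bar>Im (cinner (snd x) c)\<bar>" by (rule cmod_le)
      also have "\<dots> \<le> norm (snd x) * norm c + norm (snd x) * norm c"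
        using Re_cinner_le[of "snd x" c] Re_cinner_le[of "snd x" "\<i> *\<^sub>C c"]
        by (intro add_mono) (simp_all only: Re_cinner_ii norm_scaleC norm_ii mult_1_left)
      also have "\<dots> \<le> norm x * (2 * norm c)"
        using mult_right_mono[OF norm_snd_le[of "snd x" "fst x"], of "2 * norm c"] by (simp add: mult_ac)
      finally show ?thesis by (simp add: Inr)
    qed
  qed (simp add: ecoord_linear)
qed

lemma ecoord_measurable [measurable]: "ecoord a \<in> borel_measurable borel"
  by (intro borel_measurable_continuous_onI linear_continuous_on ecoord_bounded_linear)

lemma lin_bounded_linear: "bounded_linear (lin y)"
  unfolding lin_def
  by (intro bounded_linear_sum bounded_linear_add bounded_linear_compose[OF bounded_linear_mult_right]
      bounded_linear_compose[OF bounded_linear_Re] bounded_linear_compose[OF bounded_linear_Im] ecoord_bounded_linear)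

lemma lin_measurable [measurable]: "lin y \<in> borel_measurable borel"
  by (intro borel_measurable_continuous_onI linear_continuous_on lin_bounded_linear)

text \<open>The definition of Brownian motion leaves the variance of the increments open; it is determined here
  from the prescribed covariance.\<close>

lemma char_lin_inc:
  assumes st: "0 \<le> s" "s \<le> t"
  shows "char (distr M borel (\<lambda>x. lin y (inc s t x))) \<theta> =
    complex_of_real (exp (- ((t - s) * ((\<Sum>a\<in>idx. (cmod (y a))\<^sup>2) / 2)) * \<theta>\<^sup>2 / 2))"
proof -
  have ap: "blinfun_apply (Blinfun (lin y)) = lin y" by (rule bounded_linear_Blinfun_apply[OF lin_bounded_linear])
  obtain V where V: "\<And>u s t y. 0 \<le> V u \<and> (0 \<le> s \<and> s \<le> t \<longrightarrow>
      char (distr M borel (\<lambda>x. blinfun_apply u (b t x - b s x))) y = complex_of_real (exp (- (t - s) * V u * y\<^sup>2 / 2)))"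
    using bm unfolding brownian_motion_def by blast
  define v where "v = V (Blinfun (lin y))"
  have v: "0 \<le> v" "\<And>s t \<theta>. 0 \<le> s \<Longrightarrow> s \<le> t \<Longrightarrow>
      char (distr M borel (\<lambda>x. lin y (inc s t x))) \<theta> = complex_of_real (exp (- (t - s) * v * \<theta>\<^sup>2 / 2))"
    using V[of "Blinfun (lin y)"] unfolding v_def ap by auto
  have m: "(\<lambda>x. lin y (inc 0 1 x)) \<in> borel_measurable M" by measurable
  have "v = BM.expectation (\<lambda>x. (lin y (inc 0 1 x))\<^sup>2)"
    using BM.gaussian_law_moments(4)[OF m v(1)] v(2)[of 0 1] by simp
  also have "\<dots> = BM.expectation (\<lambda>x. (lin y (b 1 x))\<^sup>2)"
    using b_zero by (intro integral_cong_AE) auto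
  also have "\<dots> = BM.expectation (\<lambda>x. Re (cm_pairing q (b 1 x) (comb y)) * Re (cm_pairing q (b 1 x) (comb y)))"
    unfolding pairing_comb(1) lin_def by (simp add: power2_eq_square)
  also have "\<dots> = 1/2 * Re (cm_group_cinner q (comb y) (comb y)) * min 1 1"
  proof -
    have "\<forall>h \<in> cm_star q \<times> UNIV. \<forall>k \<in> cm_star q \<times> UNIV. \<forall>s\<ge>0. \<forall>t\<ge>0.
        (LINT x|M. Re (cm_pairing q (b s x) h) * Re (cm_pairing q (b t x) k)) = 1/2 * Re (cm_group_cinner q h k) * min s t"
      using cbm unfolding cm_brownian_motion_def by (rule conjunct2)
    from bspec[OF bspec[OF this pairing_comb(2)[of y]] pairing_comb(2)[of y]]
    show ?thesis by (auto dest: spec[of _ 1])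
  qed
  also have "Re (cm_group_cinner q (comb y) (comb y)) = (cm_group_norm q (comb y))\<^sup>2"
    using cm_group_norm_sq(1)[OF comb_in_group(1), of y] comb_in_group(1)[of y] Re_cm_cinner_self[of "fst (comb y)"]
    by (auto simp: cm_group_cinner_def cm_group_def Re_cinner_self mem_Times_iff)
  also have "\<dots> = (\<Sum>a\<in>idx. (cmod (y a))\<^sup>2)" by (rule comb_norm)
  finally have veq: "v = (\<Sum>a\<in>idx. (cmod (y a))\<^sup>2) / 2" by simp
  then have "- (t - s) * v * \<theta>\<^sup>2 / 2 = - ((t - s) * ((\<Sum>a\<in>idx. (cmod (y a))\<^sup>2) / 2)) * \<theta>\<^sup>2 / 2"
    by (simp add: veq algebra_simps diff_divide_distrib)
  then show ?thesis using v(2)[OF st, of \<theta>] by (simp only:)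
qed

text \<open>By induction on the number of increments: the sum of the earlier ones is measurable with respect to
  the past, hence independent of the next one.\<close>

lemma char_lin_sum:
  assumes s: "0 \<le> s 0" "\<And>i. i < n \<Longrightarrow> s i \<le> s (Suc i)"
  shows "(\<lambda>x. \<Sum>i<n. lin (y i) (inc (s i) (s (Suc i)) x)) \<in> borel_measurable (past M b (s n)) \<and> 0 \<le> s n \<and>
    char (distr M borel (\<lambda>x. \<Sum>i<n. lin (y i) (inc (s i) (s (Suc i)) x))) 1 =
    complex_of_real (exp (- (\<Sum>i<n. (s (Suc i) - s i) * ((\<Sum>a\<in>idx. (cmod (y i a))\<^sup>2) / 2)) / 2))"
  using s(2)
proof (induction n)
  case 0
  have "char (distr M borel (\<lambda>x. 0)) 1 = 1" by (subst char_def, subst integral_distr) (auto simp: BM.prob_space)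
  then show ?case using s(1) by simp
next
  case (Suc n)
  let ?Z = "\<lambda>x. \<Sum>i<n. lin (y i) (inc (s i) (s (Suc i)) x)"
  have IH: "?Z \<in> borel_measurable (past M b (s n))" "0 \<le> s n"
    "char (distr M borel ?Z) 1 = complex_of_real (exp (- (\<Sum>i<n. (s (Suc i) - s i) * ((\<Sum>a\<in>idx. (cmod (y i a))\<^sup>2) / 2)) / 2))"
    using Suc by auto
  have le: "s n \<le> s (Suc n)" using Suc.prems by simp
  have "inc (s n) (s (Suc n)) \<in> borel_measurable (past M b (s (Suc n)))"
    using b_past[of "s n" "s (Suc n)"] b_past[of "s (Suc n)" "s (Suc n)"] IH(2) le by (intro borel_measurable_diff) auto
  then have m: "(\<lambda>x. lin (y n) (inc (s n) (s (Suc n)) x)) \<in> borel_measurable (past M b (s (Suc n)))"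
    by (rule measurable_compose[OF _ lin_measurable])
  have "BM.indep_var borel ?Z borel (\<lambda>x. lin (y n) (inc (s n) (s (Suc n)) x))"
    by (rule past_indep[OF IH(2) le IH(1) lin_measurable])
  from BM.char_distr_add[OF this, of 1] show ?case
    using IH le m past_mono[OF le IH(1)] char_lin_inc[OF IH(2) le, of "y n" 1]
    by (auto simp: exp_add[symmetric] of_real_mult[symmetric] add_divide_distrib simp del: of_real_mult intro!: borel_measurable_add)
qed

text \<open>The real coordinates of the increments over a uniform partition. Each of them has variance
  \<open>T / (2 * N)\<close>, which the factor normalizes to one.\<close>

definition gauss_coord :: "real \<Rightarrow> nat \<Rightarrow> (nat \<times> (('w \<Rightarrow>\<^sub>L real) + 'c)) \<times> bool \<Rightarrow> 'a \<Rightarrow> real" where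
  "gauss_coord T N j x = sqrt (2 * real N / T) *
    (let z = ecoord (snd (fst j)) (inc (real (fst (fst j)) * T / real N) (real (Suc (fst (fst j))) * T / real N) x)
     in if snd j then Im z else Re z)"

lemma gauss_coord_law:
  assumes T: "0 < T" and N: "0 < N"
  defines "J \<equiv> ({..<N} \<times> idx) \<times> (UNIV :: bool set)"
  shows "distr M (PiM J (\<lambda>_. borel)) (\<lambda>x. \<lambda>j\<in>J. gauss_coord T N j x) = gauss_product J"
    "\<And>j. gauss_coord T N j \<in> borel_measurable M"
proof -
  let ?s = "\<lambda>i. real i * T / real N"
  show meas: "gauss_coord T N j \<in> borel_measurable M" for j
  proof -
    have "inc (?s i) (?s (Suc i)) \<in> borel_measurable M" for i using T by (intro inc_measurable) auto
    from measurable_compose[OF this ecoord_measurable]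
    have "(\<lambda>x. ecoord a (inc (?s i) (?s (Suc i)) x)) \<in> borel_measurable M" for i a .
    then show ?thesis unfolding gauss_coord_def Let_def by (cases "snd j") simp_all
  qed
  have fJ: "finite J" using idx_finite by (simp add: J_def)
  let ?k = "sqrt (2 * real N / T)"
  show "distr M (PiM J (\<lambda>_. borel)) (\<lambda>x. \<lambda>j\<in>J. gauss_coord T N j x) = gauss_product J"
  proof (rule BM.joint_gaussian_law[OF fJ meas])
    fix y :: "((nat \<times> (('w \<Rightarrow>\<^sub>L real) + 'c)) \<times> bool) \<Rightarrow> real"
    define Y where "Y i a = complex_of_real ?k * Complex (y ((i, a), False)) (y ((i, a), True))" for i a
    have sJ: "(\<Sum>j\<in>J. h j) = (\<Sum>i<N. \<Sum>a\<in>idx. h ((i, a), False) + h ((i, a), True))" for h :: "((nat \<times> (('w \<Rightarrow>\<^sub>L real) + 'c)) \<times> bool) \<Rightarrow> real"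
    proof -
      have "(\<Sum>j\<in>J. h j) = (\<Sum>p\<in>{..<N} \<times> idx. h (p, False) + h (p, True))"
        unfolding J_def by (rule sum_times_bool)
      also have "\<dots> = (\<Sum>i<N. \<Sum>a\<in>idx. h ((i, a), False) + h ((i, a), True))"
        using sum.cartesian_product[of "\<lambda>i a. h ((i, a), False) + h ((i, a), True)" idx "{..<N}"] by (simp add: split_beta')
      finally show ?thesis .
    qed
    have 1: "(\<Sum>j\<in>J. y j * gauss_coord T N j x) = (\<Sum>i<N. lin (Y i) (inc (?s i) (?s (Suc i)) x))" for x
      unfolding sJ lin_def by (intro sum.cong refl) (simp add: gauss_coord_def Y_def algebra_simps)
    have 2: "(\<Sum>i<N. (?s (Suc i) - ?s i) * ((\<Sum>a\<in>idx. (cmod (Y i a))\<^sup>2) / 2)) = (\<Sum>j\<in>J. (y j)\<^sup>2)"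
      unfolding sJ
    proof (intro sum.cong refl)
      fix i
      have d: "?s (Suc i) - ?s i = T / real N" by (simp add: distrib_right add_divide_distrib)
      have "(cmod (Y i a))\<^sup>2 = (2 * real N / T) * ((y ((i, a), False))\<^sup>2 + (y ((i, a), True))\<^sup>2)" for a
        using T by (simp add: Y_def norm_mult power_mult_distrib cmod_power2[of "Complex _ _"])
      then have "(\<Sum>a\<in>idx. (cmod (Y i a))\<^sup>2) = (2 * real N / T) * (\<Sum>a\<in>idx. (y ((i, a), False))\<^sup>2 + (y ((i, a), True))\<^sup>2)"
        by (simp add: sum_distrib_left)
      then show "(?s (Suc i) - ?s i) * ((\<Sum>a\<in>idx. (cmod (Y i a))\<^sup>2) / 2) = (\<Sum>a\<in>idx. (y ((i, a), False))\<^sup>2 + (y ((i, a), True))\<^sup>2)"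
        unfolding d using T N by simp
    qed
    have "char (distr M borel (\<lambda>x. \<Sum>i<N. lin (Y i) (inc (?s i) (?s (Suc i)) x))) 1 = complex_of_real (exp (- (\<Sum>j\<in>J. (y j)\<^sup>2) / 2))"
      using char_lin_sum[of ?s N Y] T unfolding 2 by (simp add: divide_right_mono mult_right_mono)
    moreover have "(\<lambda>x. \<Sum>i<N. lin (Y i) (inc (?s i) (?s (Suc i)) x)) \<in> borel_measurable M"
      unfolding 1[symmetric] using meas by (intro borel_measurable_sum borel_measurable_times) auto
    ultimately show "(CLINT x|M. iexp (\<Sum>j\<in>J. y j * gauss_coord T N j x)) = complex_of_real (exp (- (\<Sum>j\<in>J. (y j)\<^sup>2) / 2))"
      unfolding 1 by (simp add: char_def integral_distr)
  qed
qed

end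

section \<open>Ito integrals\<close>

lemma bounded_bilinear_Re_cinner: "bounded_bilinear (\<lambda>x y :: 'c::complex_inner_space. Re (cinner x y))"
proof
  show "Re (cinner (r *\<^sub>R a) b) = r *\<^sub>R Re (cinner a b)" for r and a b :: 'c by (simp add: cinner_scaleR_left)
  show "Re (cinner a (r *\<^sub>R b)) = r *\<^sub>R Re (cinner a b)" for r and a b :: 'c
    using cinner_scaleC_right[of a "complex_of_real r" b] by (simp add: scaleC_of_real)
  show "\<exists>K. \<forall>a b :: 'c. norm (Re (cinner a b)) \<le> norm a * norm b * K"
    by (intro exI[of _ 1] allI) (simp add: Re_cinner_le)
qed (simp_all add: cinner_add_left cinner_add_right)

lemma bounded_bilinear_measurable:
  fixes f :: "'x \<Rightarrow> 'p::{second_countable_topology, real_normed_vector}"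
    and g :: "'x \<Rightarrow> 'r::{second_countable_topology, real_normed_vector}"
  assumes "bounded_bilinear h" "f \<in> borel_measurable N" "g \<in> borel_measurable N"
  shows "(\<lambda>x. h (f x) (g x)) \<in> borel_measurable N"
  by (rule borel_measurable_continuous_Pair[OF assms(2,3)])
    (intro bounded_bilinear.continuous_on[OF assms(1)] continuous_intros)

lemma norm_diff_sq_le: "(norm (a - c))\<^sup>2 \<le> 2 * (norm (a - p))\<^sup>2 + 2 * (norm (c - p :: 'v::real_normed_vector))\<^sup>2"
proof -
  have "norm (a - c) \<le> norm (a - p) + norm (c - p)" using norm_triangle_ineq4[of "a - p" "c - p"] by simp
  then have "(norm (a - c))\<^sup>2 \<le> (norm (a - p) + norm (c - p))\<^sup>2" by (intro power_mono) auto
  also have "\<dots> \<le> 2 * (norm (a - p))\<^sup>2 + 2 * (norm (c - p))\<^sup>2"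
    using sum_squares_bound[of "norm (a - p)" "norm (c - p)"] by (simp add: power2_sum)
  finally show ?thesis .
qed

lemma nn_integral_norm_diff_sq_le:
  fixes f g h :: "'x \<Rightarrow> 'v::{second_countable_topology, real_normed_vector}"
  assumes [measurable]: "f \<in> borel_measurable N" "g \<in> borel_measurable N" "h \<in> borel_measurable N"
  shows "(\<integral>\<^sup>+x. ennreal ((norm (f x - g x))\<^sup>2) \<partial>N) \<le>
    2 * (\<integral>\<^sup>+x. ennreal ((norm (f x - h x))\<^sup>2) \<partial>N) + 2 * (\<integral>\<^sup>+x. ennreal ((norm (g x - h x))\<^sup>2) \<partial>N)"
proof -
  have "(\<integral>\<^sup>+x. ennreal ((norm (f x - g x))\<^sup>2) \<partial>N) \<le>
      (\<integral>\<^sup>+x. 2 * ennreal ((norm (f x - h x))\<^sup>2) + 2 * ennreal ((norm (g x - h x))\<^sup>2) \<partial>N)"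
  proof (rule nn_integral_mono)
    fix x
    have "ennreal ((norm (f x - g x))\<^sup>2) \<le> ennreal (2 * (norm (f x - h x))\<^sup>2 + 2 * (norm (g x - h x))\<^sup>2)"
      by (intro ennreal_leI norm_diff_sq_le)
    then show "ennreal ((norm (f x - g x))\<^sup>2) \<le> 2 * ennreal ((norm (f x - h x))\<^sup>2) + 2 * ennreal ((norm (g x - h x))\<^sup>2)"
      by (simp add: ennreal_mult)
  qed
  also have "\<dots> = 2 * (\<integral>\<^sup>+x. ennreal ((norm (f x - h x))\<^sup>2) \<partial>N) + 2 * (\<integral>\<^sup>+x. ennreal ((norm (g x - h x))\<^sup>2) \<partial>N)"
    by (subst nn_integral_add) (auto simp: nn_integral_cmult)
  finally show ?thesis .
qed

subsection \<open>Partitions\<close>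

lemma partition_mono:
  fixes s :: "nat \<Rightarrow> real"
  assumes "\<And>i. i < n \<Longrightarrow> s i < s (Suc i)" "i \<le> j" "j \<le> n"
  shows "s i \<le> s j" "i < j \<Longrightarrow> s i < s j"
proof -
  have "s i \<le> s j \<and> (i < j \<longrightarrow> s i < s j)" using assms(2,3)
  proof (induction j rule: dec_induct)
    case (step j)
    then show ?case using assms(1)[of j] by auto
  qed simp
  then show "s i \<le> s j" "i < j \<Longrightarrow> s i < s j" by auto
qed

lemma partition_cell:
  fixes s :: "nat \<Rightarrow> real"
  assumes "s 0 < \<tau>" "\<tau> \<le> s n"
  shows "\<exists>i<n. s i < \<tau> \<and> \<tau> \<le> s (Suc i)"
  using assms(2)
proof (induction n)
  case 0
  then show ?case using assms(1) by simp
next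
  case (Suc n)
  then show ?case by (cases "\<tau> \<le> s n") (auto intro: less_SucI)
qed

lemma simple_process_cell:
  assumes s: "\<And>i. i < n \<Longrightarrow> s i < s (Suc i)" and i: "i < n" "s i < \<tau>" "\<tau> \<le> s (Suc i)"
  shows "simple_process n s \<xi> \<tau> = \<xi> i"
proof
  fix x
  have "simple_process n s \<xi> \<tau> x = (\<Sum>k<n. if k = i then \<xi> i x else 0)"
    unfolding simple_process_def
  proof (rule sum.cong[OF refl])
    fix k assume k: "k \<in> {..<n}"
    consider "k = i" | "k < i" | "i < k" by linarith
    then show "indicator {s k<..s (Suc k)} \<tau> *\<^sub>R \<xi> k x = (if k = i then \<xi> i x else 0)"
    proof cases
      case 1
      then show ?thesis using i by simp
    next
      case 2
      then have "s (Suc k) \<le> s i" using partition_mono(1)[of n s "Suc k" i] s i by auto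
      then show ?thesis using 2 i by simp
    next
      case 3
      then have "s (Suc i) \<le> s k" using partition_mono(1)[of n s "Suc i" k] s k by auto
      then show ?thesis using 3 i by simp
    qed
  qed
  then show "simple_process n s \<xi> \<tau> x = \<xi> i x" using i by simp
qed

lemma common_partition:
  fixes D :: "real set"
  assumes D: "finite D" "D \<noteq> {}"
  obtains r :: "nat \<Rightarrow> real" and L where "\<And>j. j < L \<Longrightarrow> r j < r (Suc j)" "D = r ` {..L}"
proof -
  define l where "l = sorted_list_of_set D"
  have l: "sorted l" "distinct l" "set l = D" using D by (simp_all add: l_def)
  have ne: "0 < length l" using D l by auto
  show ?thesis
  proof (rule that[of "length l - 1" "nth l"])
    show "l ! j < l ! Suc j" if "j < length l - 1" for j
      using that l by (simp add: sorted_wrt_nth_less[OF strict_sorted_iff[THEN iffD2]] )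
    show "D = (!) l ` {..length l - 1}"
      unfolding l(3)[symmetric] set_conv_nth using ne by (auto simp: image_iff less_Suc_eq_le[symmetric])
  qed
qed

lemma partition_index:
  assumes r: "\<And>j. j < L \<Longrightarrow> r j < (r (Suc j) :: real)" and a: "a \<le> L" "j \<le> L"
  shows "r a \<le> r j \<longleftrightarrow> a \<le> j" "r a < r j \<longleftrightarrow> a < j"
proof -
  consider "a < j" | "a = j" | "j < a" by linarith
  then have "(r a \<le> r j \<longleftrightarrow> a \<le> j) \<and> (r a < r j \<longleftrightarrow> a < j)"
  proof cases
    case 1
    then show ?thesis using partition_mono(2)[of L r a j] r a by auto
  next
    case 3
    then show ?thesis using partition_mono(2)[of L r j a] r a by auto
  qed auto
  then show "r a \<le> r j \<longleftrightarrow> a \<le> j" "r a < r j \<longleftrightarrow> a < j" by auto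
qed

text \<open>An elementary integral may be computed on any finer partition.\<close>

lemma simple_integral_refine:
  fixes X :: "real \<Rightarrow> 'a \<Rightarrow> 'w::real_normed_vector" and \<beta> :: "'v::real_normed_vector \<Rightarrow> 'w \<Rightarrow> 'c::real_normed_vector"
  assumes \<beta>: "bounded_bilinear \<beta>" and r: "\<And>j. j < L \<Longrightarrow> r j < r (Suc j)"
    and s: "\<And>i. i < n \<Longrightarrow> s i < s (Suc i)" "s ` {..n} \<subseteq> r ` {..L}"
  shows "simple_integral \<beta> X n s \<xi> x = (\<Sum>j<L. \<beta> (simple_process n s \<xi> (r (Suc j)) x) (X (r (Suc j)) x - X (r j) x))"
proof -
  interpret bounded_bilinear \<beta> by fact
  let ?d = "\<lambda>j. X (r (Suc j)) x - X (r j) x"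
  have "(\<Sum>j<L. \<beta> (simple_process n s \<xi> (r (Suc j)) x) (?d j))
      = (\<Sum>j<L. \<Sum>i<n. indicator {s i<..s (Suc i)} (r (Suc j)) *\<^sub>R \<beta> (\<xi> i x) (?d j))"
    by (simp add: simple_process_def sum_left scaleR_left)
  also have "\<dots> = (\<Sum>i<n. \<Sum>j<L. indicator {s i<..s (Suc i)} (r (Suc j)) *\<^sub>R \<beta> (\<xi> i x) (?d j))"
    by (rule sum.swap)
  also have "\<dots> = (\<Sum>i<n. \<beta> (\<xi> i x) (X (s (Suc i)) x - X (s i) x))"
  proof (rule sum.cong[OF refl])
    fix i assume "i \<in> {..<n}"
    then have i: "i < n" by simp
    have "s i \<in> r ` {..L}" "s (Suc i) \<in> r ` {..L}" using s(2) i by auto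
    then obtain a c where a: "a \<le> L" "s i = r a" and c: "c \<le> L" "s (Suc i) = r c" by auto
    have ac: "a < c" using s(1)[OF i] partition_index(2)[of L r a c, OF r a(1) c(1)] a c by simp
    have ind: "indicator {s i<..s (Suc i)} (r (Suc j)) = (if j \<in> {a..<c} then 1 else 0 :: real)" if "j < L" for j
      using partition_index[of L r a "Suc j", OF r] partition_index[of L r "Suc j" c, OF r] a c that
      by (auto simp: indicator_def less_Suc_eq_le Suc_le_eq)
    have "(\<Sum>j<L. indicator {s i<..s (Suc i)} (r (Suc j)) *\<^sub>R \<beta> (\<xi> i x) (?d j))
        = (\<Sum>j<L. if j \<in> {a..<c} then \<beta> (\<xi> i x) (?d j) else 0)"
      using ind by (intro sum.cong refl) auto
    also have "\<dots> = (\<Sum>j\<in>{a..<c}. \<beta> (\<xi> i x) (?d j))"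
      using c by (subst sum.inter_restrict[symmetric]) (auto intro!: sum.cong)
    also have "\<dots> = \<beta> (\<xi> i x) (\<Sum>j\<in>{a..<c}. ?d j)" by (simp add: sum_right)
    also have "(\<Sum>j\<in>{a..<c}. ?d j) = X (s (Suc i)) x - X (s i) x"
      using sum_Suc_diff'[of a c "\<lambda>j. X (r j) x"] ac a c by simp
    finally show "(\<Sum>j<L. indicator {s i<..s (Suc i)} (r (Suc j)) *\<^sub>R \<beta> (\<xi> i x) (?d j)) = \<beta> (\<xi> i x) (X (s (Suc i)) x - X (s i) x)" .
  qed
  finally show ?thesis by (simp add: simple_integral_def)
qed

lemma simple_process_refine:
  assumes r: "\<And>j. j < L \<Longrightarrow> r j < r (Suc j)"
    and s: "\<And>i. i < n \<Longrightarrow> s i < s (Suc i)" "s ` {..n} \<subseteq> r ` {..L}" and ends: "r 0 = s 0" "r L = s n" and j: "j < L"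
  shows "\<exists>i<n. s i \<le> r j \<and> (\<forall>\<tau>. r j < \<tau> \<longrightarrow> \<tau> \<le> r (Suc j) \<longrightarrow> simple_process n s \<xi> \<tau> = \<xi> i)"
proof -
  have "r 0 < r (Suc j)" "r (Suc j) \<le> r L" using partition_mono[of L r 0 "Suc j"] partition_mono[of L r "Suc j" L] r j by auto
  then obtain i where i: "i < n" "s i < r (Suc j)" "r (Suc j) \<le> s (Suc i)"
    using partition_cell[of s "r (Suc j)" n] ends by auto
  have "s i \<in> r ` {..L}" using s(2) i(1) by auto
  then obtain a where a: "a \<le> L" "s i = r a" by auto
  have "a \<le> j" using partition_index(2)[of L r a "Suc j", OF r a(1)] i(2) a j by auto
  then have le: "s i \<le> r j" using partition_index(1)[of L r a j, OF r a(1)] a j by auto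
  show ?thesis using i le s by (intro exI[of _ i]) (auto intro!: simple_process_cell[of n s i])
qed

subsection \<open>The Ito isometry\<close>

context heis_bm begin

abbreviation PB :: "real \<Rightarrow> 'a \<Rightarrow> 'w" where "PB \<tau> x \<equiv> proj (fst (b \<tau> x))"

text \<open>The real orthonormal basis that consists of \<open>E1\<close> and its image under the complex structure.
  Expanded in it, the increments have real random coefficients.\<close>

definition dir :: "('w \<Rightarrow>\<^sub>L real) \<times> bool \<Rightarrow> 'w \<Rightarrow>\<^sub>L real" where
  "dir p = (if snd p then dual_J (fst p) else fst p)"

abbreviation dirs :: "(('w \<Rightarrow>\<^sub>L real) \<times> bool) set" where "dirs \<equiv> E1 \<times> UNIV"

lemma proj_dir: "proj w = (\<Sum>p\<in>dirs. blinfun_apply (dir p) w *\<^sub>R rep (dir p))"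
proof -
  show ?thesis unfolding proj_def scaleC_split[of "cfun _ _"] rep_linear(5) sum_times_bool
    by (simp add: cfun_def dir_def)
qed

lemma proj_minus: "proj (x - y) = proj x - proj y"
  using proj_linear(1)[of "x - y" y] by simp

lemma proj_continuous: "continuous_on S proj"
  unfolding proj_dir[abs_def] by (intro continuous_intros)

lemma PB_measurable: "0 \<le> t \<Longrightarrow> PB t \<in> borel_measurable M"
    and PB_past: "0 \<le> r \<Longrightarrow> r \<le> s \<Longrightarrow> PB r \<in> borel_measurable (past M b s)"
proof -
  have m: "(\<lambda>v :: 'w \<times> 'c. proj (fst v)) \<in> borel_measurable borel"
    by (intro borel_measurable_continuous_onI continuous_on_compose2[OF proj_continuous[of UNIV]] continuous_intros) auto
  show "0 \<le> t \<Longrightarrow> PB t \<in> borel_measurable M" using measurable_compose[OF b_measurable m] .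
  show "0 \<le> r \<Longrightarrow> r \<le> s \<Longrightarrow> PB r \<in> borel_measurable (past M b s)" using measurable_compose[OF b_past m] .
qed

abbreviation rho :: "('w \<Rightarrow>\<^sub>L real) \<times> bool \<Rightarrow> real \<Rightarrow> real \<Rightarrow> 'a \<Rightarrow> real" where
  "rho p s t x \<equiv> blinfun_apply (dir p) (fst (inc s t x))"

lemma dir_fst_measurable: "(\<lambda>v :: 'w \<times> 'c. blinfun_apply (dir p) (fst v)) \<in> borel_measurable borel"
  by (intro borel_measurable_continuous_onI continuous_intros)

lemma rho_moments:
  assumes p: "p \<in> dirs" and st: "0 \<le> s" "s \<le> t"
  shows "integrable M (rho p s t)" "BM.expectation (rho p s t) = 0"
    "integrable M (\<lambda>x. (rho p s t x)\<^sup>2)" "BM.expectation (\<lambda>x. (rho p s t x)\<^sup>2) = (t - s) / 2"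
proof -
  define y where "y a = (if a = Inl (fst p) then (if snd p then \<i> else 1) else 0)" for a :: "('w \<Rightarrow>\<^sub>L real) + 'c"
  have pa: "Inl (fst p) \<in> idx" using p by auto
  have "lin y v = (\<Sum>a\<in>idx. if a = Inl (fst p) then blinfun_apply (dir p) (fst v) else 0)" for v
    unfolding lin_def by (intro sum.cong refl) (auto simp: y_def cfun_def dir_def)
  then have l: "lin y v = blinfun_apply (dir p) (fst v)" for v using pa idx_finite by simp
  have "(\<Sum>a\<in>idx. (cmod (y a))\<^sup>2) = (\<Sum>a\<in>idx. if a = Inl (fst p) then 1 else 0)"
    by (intro sum.cong refl) (auto simp: y_def)
  then have n: "(\<Sum>a\<in>idx. (cmod (y a))\<^sup>2) = 1" using pa idx_finite by simp
  have m: "rho p s t \<in> borel_measurable M" using measurable_compose[OF inc_measurable dir_fst_measurable] st by auto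
  have "char (distr M borel (rho p s t)) \<theta> = complex_of_real (exp (- ((t - s) / 2) * \<theta>\<^sup>2 / 2))" for \<theta>
    using char_lin_inc[OF st, of y \<theta>] unfolding l n by simp
  then show "integrable M (rho p s t)" "BM.expectation (rho p s t) = 0"
    "integrable M (\<lambda>x. (rho p s t x)\<^sup>2)" "BM.expectation (\<lambda>x. (rho p s t x)\<^sup>2) = (t - s) / 2"
    using BM.gaussian_law_moments[OF m, of "(t - s) / 2"] st by auto
qed

lemma PB_increment: "PB t x - PB s x = (\<Sum>p\<in>dirs. rho p s t x *\<^sub>R rep (dir p))"
  unfolding proj_minus[symmetric] unfolding proj_dir fst_diff ..

lemma rho_indep:
  assumes "p \<in> dirs" "0 \<le> s" "s \<le> t" "Z \<in> borel_measurable (past M b s)" "integrable M Z"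
  shows "integrable M (\<lambda>x. Z x * rho p s t x)" "BM.expectation (\<lambda>x. Z x * rho p s t x) = 0"
    "integrable M (\<lambda>x. Z x * (rho p s t x)\<^sup>2)" "BM.expectation (\<lambda>x. Z x * (rho p s t x)\<^sup>2) = BM.expectation Z * ((t - s) / 2)"
proof -
  note r = rho_moments[OF assms(1-3)]
  have 1: "BM.indep_var borel Z borel (rho p s t)"
    by (rule past_indep[OF assms(2,3,4) dir_fst_measurable])
  have 2: "BM.indep_var borel Z borel (\<lambda>x. (rho p s t x)\<^sup>2)"
    by (rule past_indep[OF assms(2,3,4), where g = "\<lambda>v. (blinfun_apply (dir p) (fst v))\<^sup>2"])
      (use dir_fst_measurable in measurable)
  show "integrable M (\<lambda>x. Z x * rho p s t x)" "BM.expectation (\<lambda>x. Z x * rho p s t x) = 0"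
    using BM.indep_var_integrable[OF 1 assms(5) r(1)] BM.indep_var_lebesgue_integral[OF 1 assms(5) r(1)] r(2) by auto
  show "integrable M (\<lambda>x. Z x * (rho p s t x)\<^sup>2)" "BM.expectation (\<lambda>x. Z x * (rho p s t x)\<^sup>2) = BM.expectation Z * ((t - s) / 2)"
    using BM.indep_var_integrable[OF 2 assms(5) r(3)] BM.indep_var_lebesgue_integral[OF 2 assms(5) r(3)] r(4) by auto
qed

text \<open>The coordinates of an increment are centred with variance \<open>(t - s) / 2\<close> and independent of the past,
  so the mixed terms of the square have mean zero. The constant accounts for the norm of \<open>\<omega>\<close> and the
  number of coordinates; what matters is that it depends neither on the partition nor on the process.\<close>

lemma ito_isometry_exists:
  "\<exists>K\<ge>0. \<forall>n s \<eta>. 0 \<le> s 0 \<longrightarrow> (\<forall>i<n. s i \<le> s (Suc i) \<and> \<eta> i \<in> borel_measurable (past M b (s i)) \<and>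
      integrable M (\<lambda>x. (norm (\<eta> i x))\<^sup>2)) \<longrightarrow>
    integrable M (\<lambda>x. (norm (\<Sum>i<n. \<omega> (\<eta> i x) (PB (s (Suc i)) x - PB (s i) x)))\<^sup>2) \<and>
    BM.expectation (\<lambda>x. (norm (\<Sum>i<n. \<omega> (\<eta> i x) (PB (s (Suc i)) x - PB (s i) x)))\<^sup>2) \<le>
      K * (\<Sum>i<n. (s (Suc i) - s i) * BM.expectation (\<lambda>x. (norm (\<eta> i x))\<^sup>2))"
proof -
  obtain B where B: "0 \<le> B" "\<And>x y. norm (\<omega> x y) \<le> norm x * norm y * B" using om.nonneg_bounded by blast
  define R where "R = (\<Sum>p\<in>dirs. (norm (rep (dir p)))\<^sup>2)"
  have R: "0 \<le> R" by (simp add: R_def sum_nonneg)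
  define K where "K = B\<^sup>2 * R * (real (card dirs) / 2)"
  have K: "0 \<le> K" using R by (simp add: K_def)
  have main: "0 \<le> s n \<and> (\<lambda>x. \<Sum>i<n. \<omega> (\<eta> i x) (PB (s (Suc i)) x - PB (s i) x)) \<in> borel_measurable (past M b (s n)) \<and>
    integrable M (\<lambda>x. (norm (\<Sum>i<n. \<omega> (\<eta> i x) (PB (s (Suc i)) x - PB (s i) x)))\<^sup>2) \<and>
    BM.expectation (\<lambda>x. (norm (\<Sum>i<n. \<omega> (\<eta> i x) (PB (s (Suc i)) x - PB (s i) x)))\<^sup>2) \<le>
      K * (\<Sum>i<n. (s (Suc i) - s i) * BM.expectation (\<lambda>x. (norm (\<eta> i x))\<^sup>2))"
    if s0: "0 \<le> s 0" and h: "\<And>i. i < n \<Longrightarrow> s i \<le> s (Suc i) \<and> \<eta> i \<in> borel_measurable (past M b (s i)) \<and>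
      integrable M (\<lambda>x. (norm (\<eta> i x))\<^sup>2)" for n s \<eta>
    using h
  proof (induction n)
    case 0
    then show ?case using s0 by simp
  next
    case (Suc n)
    define S where "S x = (\<Sum>i<n. \<omega> (\<eta> i x) (PB (s (Suc i)) x - PB (s i) x))" for x
    define Z where "Z x = \<omega> (\<eta> n x) (PB (s (Suc n)) x - PB (s n) x)" for x
    have sn: "0 \<le> s n" and Sm: "S \<in> borel_measurable (past M b (s n))" and Si: "integrable M (\<lambda>x. (norm (S x))\<^sup>2)"
      and Sb: "BM.expectation (\<lambda>x. (norm (S x))\<^sup>2) \<le> K * (\<Sum>i<n. (s (Suc i) - s i) * BM.expectation (\<lambda>x. (norm (\<eta> i x))\<^sup>2))"
      using Suc.IH Suc.prems by (auto simp: S_def[abs_def])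
    have le: "s n \<le> s (Suc n)" and em: "\<eta> n \<in> borel_measurable (past M b (s n))" and ei: "integrable M (\<lambda>x. (norm (\<eta> n x))\<^sup>2)"
      using Suc.prems[of n] by auto
    let ?r = "\<lambda>p. rho p (s n) (s (Suc n))"
    note ri = rho_indep[OF _ sn le]
    have Zr: "Z x = (\<Sum>p\<in>dirs. ?r p x *\<^sub>R \<omega> (\<eta> n x) (rep (dir p)))" for x
      unfolding Z_def PB_increment by (simp add: om.sum_right om.scaleR_right)
    have Zm: "Z \<in> borel_measurable (past M b (s (Suc n)))"
      unfolding Z_def using past_mono[OF le em] PB_past[of "s (Suc n)" "s (Suc n)"] PB_past[of "s n" "s (Suc n)"] sn le
      by (intro bounded_bilinear_measurable[OF om.bounded_bilinear_axioms] borel_measurable_diff) auto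
    have ZM: "Z \<in> borel_measurable M" using past_measurable[OF _ Zm] sn le by auto
    have SM: "S \<in> borel_measurable M" using past_measurable[OF sn Sm] .
    have Z2: "(norm (Z x))\<^sup>2 \<le> (B\<^sup>2 * R) * (\<Sum>p\<in>dirs. (norm (\<eta> n x))\<^sup>2 * (?r p x)\<^sup>2)" for x
    proof -
      have "norm (Z x) \<le> (\<Sum>p\<in>dirs. norm (?r p x *\<^sub>R \<omega> (\<eta> n x) (rep (dir p))))" unfolding Zr by (rule norm_sum)
      also have "\<dots> \<le> (\<Sum>p\<in>dirs. \<bar>?r p x\<bar> * (norm (\<eta> n x) * norm (rep (dir p)) * B))"
        using B by (intro sum_mono) (auto intro!: mult_left_mono)
      also have "\<dots> = (norm (\<eta> n x) * B) * (\<Sum>p\<in>dirs. \<bar>?r p x\<bar> * norm (rep (dir p)))"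
        by (simp add: sum_distrib_left mult_ac)
      finally have "(norm (Z x))\<^sup>2 \<le> ((norm (\<eta> n x) * B) * (\<Sum>p\<in>dirs. \<bar>?r p x\<bar> * norm (rep (dir p))))\<^sup>2"
        by (intro power_mono) auto
      also have "\<dots> = (norm (\<eta> n x))\<^sup>2 * B\<^sup>2 * (\<Sum>p\<in>dirs. \<bar>?r p x\<bar> * norm (rep (dir p)))\<^sup>2" by (simp add: power_mult_distrib)
      also have "\<dots> \<le> (norm (\<eta> n x))\<^sup>2 * B\<^sup>2 * ((\<Sum>p\<in>dirs. \<bar>?r p x\<bar>\<^sup>2) * R)"
        unfolding R_def by (intro mult_left_mono Cauchy_Schwarz_ineq_sum) auto
      also have "\<dots> = (B\<^sup>2 * R) * (\<Sum>p\<in>dirs. (norm (\<eta> n x))\<^sup>2 * (?r p x)\<^sup>2)"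
        by (simp add: sum_distrib_left sum_distrib_right mult_ac)
      finally show ?thesis .
    qed
    have n2m: "(\<lambda>x. (norm (\<eta> n x))\<^sup>2) \<in> borel_measurable (past M b (s n))" using em by measurable
    have bi: "integrable M (\<lambda>x. (B\<^sup>2 * R) * (\<Sum>p\<in>dirs. (norm (\<eta> n x))\<^sup>2 * (?r p x)\<^sup>2))"
      using ri(3)[OF _ n2m ei] by (intro integrable_mult_right Bochner_Integration.integrable_sum) auto
    have Zi: "integrable M (\<lambda>x. (norm (Z x))\<^sup>2)"
    proof (rule Bochner_Integration.integrable_bound[OF bi])
      show "(\<lambda>x. (norm (Z x))\<^sup>2) \<in> borel_measurable M" using ZM by measurable
      show "AE x in M. norm ((norm (Z x))\<^sup>2) \<le> norm ((B\<^sup>2 * R) * (\<Sum>p\<in>dirs. (norm (\<eta> n x))\<^sup>2 * (?r p x)\<^sup>2))"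
        using order_trans[OF Z2 abs_ge_self] by (intro AE_I2) simp
    qed
    have Zb: "BM.expectation (\<lambda>x. (norm (Z x))\<^sup>2) \<le> K * ((s (Suc n) - s n) * BM.expectation (\<lambda>x. (norm (\<eta> n x))\<^sup>2))"
    proof -
      have "BM.expectation (\<lambda>x. (norm (Z x))\<^sup>2) \<le> BM.expectation (\<lambda>x. (B\<^sup>2 * R) * (\<Sum>p\<in>dirs. (norm (\<eta> n x))\<^sup>2 * (?r p x)\<^sup>2))"
        using Zi bi Z2 by (rule integral_mono)
      also have "\<dots> = (B\<^sup>2 * R) * (\<Sum>p\<in>dirs. BM.expectation (\<lambda>x. (norm (\<eta> n x))\<^sup>2 * (?r p x)\<^sup>2))"
        using ri(3)[OF _ n2m ei] by (simp only: integral_mult_right_zero Bochner_Integration.integral_sum)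
      also have "\<dots> = (B\<^sup>2 * R) * (\<Sum>p\<in>dirs. BM.expectation (\<lambda>x. (norm (\<eta> n x))\<^sup>2) * ((s (Suc n) - s n) / 2))"
        using ri(4)[OF _ n2m ei] by (intro arg_cong2[where f = "(*)"] sum.cong refl)
      also have "\<dots> = K * ((s (Suc n) - s n) * BM.expectation (\<lambda>x. (norm (\<eta> n x))\<^sup>2))" by (simp add: K_def)
      finally show ?thesis .
    qed
    have cross: "integrable M (\<lambda>x. Re (cinner (S x) (Z x))) \<and> BM.expectation (\<lambda>x. Re (cinner (S x) (Z x))) = 0"
    proof -
      define Y where "Y p x = Re (cinner (S x) (\<omega> (\<eta> n x) (rep (dir p))))" for p x
      have om_m: "(\<lambda>x. \<omega> (\<eta> n x) (rep (dir p))) \<in> borel_measurable (past M b (s n))" for p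
        by (rule bounded_bilinear_measurable[OF om.bounded_bilinear_axioms em]) simp
      have Ym: "Y p \<in> borel_measurable (past M b (s n))" for p
        unfolding Y_def by (rule bounded_bilinear_measurable[OF bounded_bilinear_Re_cinner Sm om_m])
      have Yi: "integrable M (Y p)" for p
      proof (rule Bochner_Integration.integrable_bound)
        show "integrable M (\<lambda>x. (norm (S x))\<^sup>2 + (norm (rep (dir p)) * B)\<^sup>2 * (norm (\<eta> n x))\<^sup>2)" using Si ei by simp
        show "Y p \<in> borel_measurable M" using past_measurable[OF sn Ym] .
        show "AE x in M. norm (Y p x) \<le> norm ((norm (S x))\<^sup>2 + (norm (rep (dir p)) * B)\<^sup>2 * (norm (\<eta> n x))\<^sup>2)"
        proof (rule AE_I2)
          fix x
          let ?o = "norm (\<eta> n x) * norm (rep (dir p)) * B"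
          have "\<bar>Y p x\<bar> \<le> norm (S x) * norm (\<omega> (\<eta> n x) (rep (dir p)))" unfolding Y_def by (rule Re_cinner_le)
          also have "\<dots> \<le> norm (S x) * ?o" using B by (intro mult_left_mono) auto
          also have "\<dots> \<le> (norm (S x))\<^sup>2 + ?o\<^sup>2"
            using sum_squares_bound[of "norm (S x)" ?o] zero_le_power2[of "norm (S x)"] zero_le_power2[of ?o] by linarith
          finally show "norm (Y p x) \<le> norm ((norm (S x))\<^sup>2 + (norm (rep (dir p)) * B)\<^sup>2 * (norm (\<eta> n x))\<^sup>2)"
            by (simp add: power_mult_distrib mult_ac)
        qed
      qed
      have e: "Re (cinner (S x) (Z x)) = (\<Sum>p\<in>dirs. Y p x * ?r p x)" for x
        unfolding Zr Y_def bounded_bilinear.sum_right[OF bounded_bilinear_Re_cinner]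
          bounded_bilinear.scaleR_right[OF bounded_bilinear_Re_cinner]
        by (simp add: mult.commute)
      show ?thesis unfolding e using ri(1,2)[OF _ Ym Yi]
        by (auto simp: Bochner_Integration.integral_sum intro!: Bochner_Integration.integrable_sum)
    qed
    have e: "(norm (S x + Z x))\<^sup>2 = (norm (S x))\<^sup>2 + (norm (Z x))\<^sup>2 + 2 * Re (cinner (S x) (Z x))" for x
      by (rule norm_add_sq_cinner)
    have "integrable M (\<lambda>x. (norm (S x + Z x))\<^sup>2)" unfolding e using Si Zi cross by simp
    moreover have "BM.expectation (\<lambda>x. (norm (S x + Z x))\<^sup>2) = BM.expectation (\<lambda>x. (norm (S x))\<^sup>2) + BM.expectation (\<lambda>x. (norm (Z x))\<^sup>2)"
      unfolding e using Si Zi cross by simp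
    moreover have "(\<lambda>x. S x + Z x) \<in> borel_measurable (past M b (s (Suc n)))"
      using past_mono[OF le Sm] Zm by (rule borel_measurable_add)
    ultimately show ?case using Sb Zb sn le by (simp add: S_def Z_def distrib_left)
  qed
  show ?thesis
    using K main by (intro exI[of _ K]) blast
qed

definition KI :: real where "KI = (SOME K. K \<ge> 0 \<and> (\<forall>n s \<eta>. 0 \<le> s 0 \<longrightarrow> (\<forall>i<n. s i \<le> s (Suc i) \<and> \<eta> i \<in> borel_measurable (past M b (s i)) \<and>
      integrable M (\<lambda>x. (norm (\<eta> i x))\<^sup>2)) \<longrightarrow>
    integrable M (\<lambda>x. (norm (\<Sum>i<n. \<omega> (\<eta> i x) (PB (s (Suc i)) x - PB (s i) x)))\<^sup>2) \<and>
    BM.expectation (\<lambda>x. (norm (\<Sum>i<n. \<omega> (\<eta> i x) (PB (s (Suc i)) x - PB (s i) x)))\<^sup>2) \<le>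
      K * (\<Sum>i<n. (s (Suc i) - s i) * BM.expectation (\<lambda>x. (norm (\<eta> i x))\<^sup>2))))"

lemma KI_nonneg: "0 \<le> KI"
  using someI_ex[OF ito_isometry_exists] unfolding KI_def[symmetric] by blast

lemma ito_isometry:
  assumes "0 \<le> s 0" "\<And>i. i < n \<Longrightarrow> s i \<le> s (Suc i)" "\<And>i. i < n \<Longrightarrow> \<eta> i \<in> borel_measurable (past M b (s i))"
    "\<And>i. i < n \<Longrightarrow> (\<integral>\<^sup>+x. ennreal ((norm (\<eta> i x))\<^sup>2) \<partial>M) \<le> ennreal (v i)" "\<And>i. i < n \<Longrightarrow> 0 \<le> v i"
  shows "(\<integral>\<^sup>+x. ennreal ((norm (\<Sum>i<n. \<omega> (\<eta> i x) (PB (s (Suc i)) x - PB (s i) x)))\<^sup>2) \<partial>M)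
    \<le> ennreal (KI * (\<Sum>i<n. (s (Suc i) - s i) * v i))"
proof -
  have pos: "0 \<le> s i" if "i \<le> n" for i using that
  proof (induction i)
    case (Suc i)
    then show ?case using assms(2)[of i] by simp
  qed (use assms(1) in simp)
  have m: "\<eta> i \<in> borel_measurable M" if "i < n" for i
    using past_measurable[OF pos assms(3)] that by simp
  have i: "integrable M (\<lambda>x. (norm (\<eta> i x))\<^sup>2)" if "i < n" for i
    using m[OF that] assms(4)[OF that] by (intro integrableI_nonneg) (auto simp: le_less_trans[OF _ ennreal_less_top])
  have e: "BM.expectation (\<lambda>x. (norm (\<eta> i x))\<^sup>2) \<le> v i" if "i < n" for i
    using assms(4)[OF that] assms(5)[OF that] nn_integral_eq_integral[OF i[OF that]] by (simp add: ennreal_le_iff)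
  have all: "\<forall>n s \<eta>. 0 \<le> s 0 \<longrightarrow> (\<forall>i<n. s i \<le> s (Suc i) \<and> \<eta> i \<in> borel_measurable (past M b (s i)) \<and>
      integrable M (\<lambda>x. (norm (\<eta> i x))\<^sup>2)) \<longrightarrow>
    integrable M (\<lambda>x. (norm (\<Sum>i<n. \<omega> (\<eta> i x) (PB (s (Suc i)) x - PB (s i) x)))\<^sup>2) \<and>
    BM.expectation (\<lambda>x. (norm (\<Sum>i<n. \<omega> (\<eta> i x) (PB (s (Suc i)) x - PB (s i) x)))\<^sup>2) \<le>
      KI * (\<Sum>i<n. (s (Suc i) - s i) * BM.expectation (\<lambda>x. (norm (\<eta> i x))\<^sup>2))"
    using someI_ex[OF ito_isometry_exists] unfolding KI_def[symmetric] by blast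
  have k: "integrable M (\<lambda>x. (norm (\<Sum>i<n. \<omega> (\<eta> i x) (PB (s (Suc i)) x - PB (s i) x)))\<^sup>2) \<and>
    BM.expectation (\<lambda>x. (norm (\<Sum>i<n. \<omega> (\<eta> i x) (PB (s (Suc i)) x - PB (s i) x)))\<^sup>2) \<le>
      KI * (\<Sum>i<n. (s (Suc i) - s i) * BM.expectation (\<lambda>x. (norm (\<eta> i x))\<^sup>2))"
    using spec[OF spec[OF spec[OF all, of n], of s], of \<eta>] assms(1,2,3) i by blast
  have "KI * (\<Sum>i<n. (s (Suc i) - s i) * BM.expectation (\<lambda>x. (norm (\<eta> i x))\<^sup>2)) \<le> KI * (\<Sum>i<n. (s (Suc i) - s i) * v i)"
    using e assms(2) KI_nonneg by (intro mult_left_mono sum_mono) auto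
  then show ?thesis
    using k by (subst nn_integral_eq_integral) (auto intro!: ennreal_leI)
qed

end

lemma ennreal_linear:
  assumes "0 \<le> k" "0 \<le> a" "0 \<le> b"
  shows "ennreal k * (2 * ennreal a + ennreal b) = ennreal (k * (2 * a + b))"
  using assms by (simp add: ennreal_mult ennreal_plus)

lemma ennreal_twice: "0 \<le> k \<Longrightarrow> 0 \<le> a \<Longrightarrow> 2 * (ennreal k * (2 * 0 + ennreal a)) + 2 * 0 = ennreal (2 * (k * a))"
  by (simp add: ennreal_mult)

lemma ennreal_affine: "0 \<le> k \<Longrightarrow> 0 \<le> a \<Longrightarrow> 0 \<le> c \<Longrightarrow> ennreal (k * a + c) = ennreal k * ennreal a + ennreal c"
  by (simp add: ennreal_mult)

context heis_bm begin

subsection \<open>Elementary integrals and the Ito integral\<close>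

definition simple_ok :: "real \<Rightarrow> nat \<Rightarrow> (nat \<Rightarrow> real) \<Rightarrow> (nat \<Rightarrow> 'a \<Rightarrow> 'w) \<Rightarrow> bool" where
  "simple_ok T n s \<xi> \<longleftrightarrow> s 0 = 0 \<and> s n = T \<and> (\<forall>i<n. s i < s (Suc i) \<and>
     \<xi> i \<in> borel_measurable (past M b (s i)) \<and> (\<integral>\<^sup>+x. ennreal ((norm (\<xi> i x))\<^sup>2) \<partial>M) < \<infinity>)"

lemma simple_okD:
  assumes "simple_ok T n s \<xi>"
  shows "s 0 = 0" "s n = T" "\<And>i. i < n \<Longrightarrow> s i < s (Suc i)" "\<And>i. i < n \<Longrightarrow> \<xi> i \<in> borel_measurable (past M b (s i))"
    "\<And>i. i < n \<Longrightarrow> (\<integral>\<^sup>+x. ennreal ((norm (\<xi> i x))\<^sup>2) \<partial>M) < \<infinity>" "\<And>i. i \<le> n \<Longrightarrow> 0 \<le> s i"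
proof -
  show s: "s 0 = 0" "s n = T" "\<And>i. i < n \<Longrightarrow> s i < s (Suc i)" "\<And>i. i < n \<Longrightarrow> \<xi> i \<in> borel_measurable (past M b (s i))"
    "\<And>i. i < n \<Longrightarrow> (\<integral>\<^sup>+x. ennreal ((norm (\<xi> i x))\<^sup>2) \<partial>M) < \<infinity>"
    using assms unfolding simple_ok_def by auto
  show "0 \<le> s i" if "i \<le> n" for i using partition_mono(1)[of n s 0 i] s that by auto
qed

lemma simple_integral_measurable:
  assumes "simple_ok T n s \<xi>"
  shows "simple_integral \<omega> PB n s \<xi> \<in> borel_measurable M"
proof -
  note s = simple_okD[OF assms]
  have "(\<lambda>x. \<omega> (\<xi> i x) (PB (s (Suc i)) x - PB (s i) x)) \<in> borel_measurable M" if "i < n" for i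
    using past_measurable[OF s(6) s(4)] PB_measurable[OF s(6)] that
    by (intro bounded_bilinear_measurable[OF om.bounded_bilinear_axioms] borel_measurable_diff) auto
  then show ?thesis unfolding simple_integral_def[abs_def] by (intro borel_measurable_sum) auto
qed

text \<open>Both elementary integrals are computed on a common refinement, where the isometry applies. The
  distance of \<open>\<xi>\<close> to the projected Brownian path enters only through a lower bound that is constant on
  the cells, since its measurability in time is not at hand.\<close>

lemma simple_integral_distance:
  assumes T: "0 < T" and x: "simple_ok T n s \<xi>" and e: "simple_ok T m t \<eta>" and c: "0 \<le> c"
    and close: "\<And>\<tau>. 0 < \<tau> \<Longrightarrow> \<tau> \<le> T \<Longrightarrow> (\<integral>\<^sup>+x. ennreal ((norm (simple_process m t \<eta> \<tau> x - PB \<tau> x))\<^sup>2) \<partial>M) \<le> ennreal c"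
  shows "(\<integral>\<^sup>+x. ennreal ((norm (simple_integral \<omega> PB m t \<eta> x - simple_integral \<omega> PB n s \<xi> x))\<^sup>2) \<partial>M) \<le>
    ennreal KI * (2 * (\<integral>\<^sup>+\<tau>\<in>{0..T}. (\<integral>\<^sup>+x. ennreal ((norm (simple_process n s \<xi> \<tau> x - PB \<tau> x))\<^sup>2) \<partial>M) \<partial>lborel) + ennreal (2 * c * T))"
proof -
  note sx = simple_okD[OF x] and te = simple_okD[OF e]
  obtain r :: "nat \<Rightarrow> real" and L where r: "\<And>j. j < L \<Longrightarrow> r j < r (Suc j)" "s ` {..n} \<union> t ` {..m} = r ` {..L}"
    by (rule common_partition[of "s ` {..n} \<union> t ` {..m}"]) auto
  have bnd: "0 \<le> y \<and> y \<le> T" if "y \<in> r ` {..L}" for y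
    using that unfolding r(2)[symmetric]
    using partition_mono(1)[of n s _ n] partition_mono(1)[of m t _ m] sx(1,2,3,6) te(1,2,3,6) by auto
  have r0: "r 0 = 0"
  proof -
    have "0 \<in> r ` {..L}" unfolding r(2)[symmetric] using sx(1) by (auto intro!: image_eqI[of _ _ 0])
    then obtain k where k: "k \<le> L" "r k = 0" by auto
    have "r 0 \<le> r k" using partition_mono(1)[of L r 0 k] r(1) k by auto
    then show ?thesis using k bnd[of "r 0"] by auto
  qed
  have rL: "r L = T"
  proof -
    have "T \<in> r ` {..L}" unfolding r(2)[symmetric] using sx(2) by (auto intro!: image_eqI[of _ _ n])
    then obtain k where k: "k \<le> L" "r k = T" by auto
    have "r k \<le> r L" using partition_mono(1)[of L r k L] r(1) k by auto
    then show ?thesis using k bnd[of "r L"] by auto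
  qed
  have rpos: "0 \<le> r j" if "j \<le> L" for j using bnd that by auto
  define \<xi>' where "\<xi>' j = simple_process n s \<xi> (r (Suc j))" for j
  define \<eta>' where "\<eta>' j = simple_process m t \<eta> (r (Suc j))" for j
  have sub: "s ` {..n} \<subseteq> r ` {..L}" "t ` {..m} \<subseteq> r ` {..L}" unfolding r(2)[symmetric] by auto
  have X: "\<xi>' j \<in> borel_measurable (past M b (r j)) \<and> (\<integral>\<^sup>+x. ennreal ((norm (\<xi>' j x))\<^sup>2) \<partial>M) < \<infinity> \<and>
      (\<forall>\<tau>. r j < \<tau> \<longrightarrow> \<tau> \<le> r (Suc j) \<longrightarrow> simple_process n s \<xi> \<tau> = \<xi>' j)" if j: "j < L" for j
  proof -
    obtain i where i: "i < n" "s i \<le> r j" "\<And>\<tau>. r j < \<tau> \<Longrightarrow> \<tau> \<le> r (Suc j) \<Longrightarrow> simple_process n s \<xi> \<tau> = \<xi> i"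
      using simple_process_refine[of L r n s j \<xi>, OF r(1) sx(3) sub(1) _ _ j] r0 rL sx(1,2) by auto
    have "\<xi>' j = \<xi> i" using i(3)[of "r (Suc j)"] r(1)[OF j] by (simp add: \<xi>'_def)
    then show ?thesis using i past_mono[OF i(2) sx(4)[OF i(1)]] sx(5)[OF i(1)] by simp
  qed
  have E: "\<eta>' j \<in> borel_measurable (past M b (r j)) \<and> (\<integral>\<^sup>+x. ennreal ((norm (\<eta>' j x))\<^sup>2) \<partial>M) < \<infinity> \<and>
      (\<forall>\<tau>. r j < \<tau> \<longrightarrow> \<tau> \<le> r (Suc j) \<longrightarrow> simple_process m t \<eta> \<tau> = \<eta>' j)" if j: "j < L" for j
  proof -
    obtain i where i: "i < m" "t i \<le> r j" "\<And>\<tau>. r j < \<tau> \<Longrightarrow> \<tau> \<le> r (Suc j) \<Longrightarrow> simple_process m t \<eta> \<tau> = \<eta> i"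
      using simple_process_refine[of L r m t j \<eta>, OF r(1) te(3) sub(2) _ _ j] r0 rL te(1,2) by auto
    have "\<eta>' j = \<eta> i" using i(3)[of "r (Suc j)"] r(1)[OF j] by (simp add: \<eta>'_def)
    then show ?thesis using i past_mono[OF i(2) te(4)[OF i(1)]] te(5)[OF i(1)] by simp
  qed
  define d where "d \<tau> = (\<integral>\<^sup>+x. ennreal ((norm (simple_process n s \<xi> \<tau> x - PB \<tau> x))\<^sup>2) \<partial>M)" for \<tau>
  define g where "g j = (\<integral>\<^sup>+x. ennreal ((norm (\<eta>' j x - \<xi>' j x))\<^sup>2) \<partial>M)" for j
  have mM: "\<xi>' j \<in> borel_measurable M" "\<eta>' j \<in> borel_measurable M" if "j < L" for j
    using past_measurable[OF rpos[OF less_imp_le[OF that]] conjunct1[OF X[OF that]]]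
      past_measurable[OF rpos[OF less_imp_le[OF that]] conjunct1[OF E[OF that]]] by auto
  have gfin: "g j < \<infinity>" if j: "j < L" for j
  proof -
    have "g j \<le> 2 * (\<integral>\<^sup>+x. ennreal ((norm (\<eta>' j x - 0))\<^sup>2) \<partial>M) + 2 * (\<integral>\<^sup>+x. ennreal ((norm (\<xi>' j x - 0))\<^sup>2) \<partial>M)"
      unfolding g_def by (rule nn_integral_norm_diff_sq_le) (use mM[OF j] in auto)
    also have "\<dots> < \<infinity>" using X[OF j] E[OF j] by (simp add: ennreal_mult_less_top)
    finally show ?thesis .
  qed
  define G where "G j = enn2real (g j)" for j
  have G: "g j = ennreal (G j)" "0 \<le> G j" if "j < L" for j using gfin[OF that] by (simp_all add: G_def)
  \<comment> \<open>A lower bound on the cell for the mean square distance of \<open>\<xi>\<close> to the path: \<open>\<eta>\<close> is within \<open>c\<close> of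
    the path, and squares of sums are at most twice the sums of squares.\<close>
  define e' where "e' j = max 0 (G j / 2 - c)" for j
  have e'd: "ennreal (e' j) \<le> d \<tau>" if j: "j < L" and \<tau>: "r j < \<tau>" "\<tau> \<le> r (Suc j)" for j \<tau>
  proof (cases "d \<tau>")
    case (real D)
    have \<tau>T: "0 < \<tau>" "\<tau> \<le> T" using \<tau> rpos[of j] bnd[of "r (Suc j)"] j by auto
    have "g j \<le> 2 * (\<integral>\<^sup>+x. ennreal ((norm (\<eta>' j x - PB \<tau> x))\<^sup>2) \<partial>M) + 2 * (\<integral>\<^sup>+x. ennreal ((norm (\<xi>' j x - PB \<tau> x))\<^sup>2) \<partial>M)"
      unfolding g_def by (rule nn_integral_norm_diff_sq_le) (use mM[OF j] PB_measurable \<tau>T in auto)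
    also have "\<dots> \<le> 2 * ennreal c + 2 * d \<tau>"
    proof -
      have "simple_process n s \<xi> \<tau> = \<xi>' j" "simple_process m t \<eta> \<tau> = \<eta>' j" using X[OF j] E[OF j] \<tau> by auto
      then show ?thesis using close[OF \<tau>T] by (intro add_mono mult_left_mono) (auto simp: d_def)
    qed
    also have "\<dots> = ennreal (2 * c + 2 * D)" using real c by (simp add: ennreal_mult)
    finally have "G j \<le> 2 * c + 2 * D" using G[OF j] real c by (simp add: ennreal_le_iff del: ennreal_plus)
    then have "e' j \<le> D" using real by (simp add: e'_def)
    then show ?thesis using real by (simp add: ennreal_leI)
  qed simp
  have low: "ennreal (\<Sum>j<L. e' j * (r (Suc j) - r j)) \<le> (\<integral>\<^sup>+\<tau>\<in>{0..T}. d \<tau> \<partial>lborel)"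
  proof -
    have "ennreal (\<Sum>j<L. e' j * (r (Suc j) - r j)) = (\<Sum>j<L. ennreal (e' j) * emeasure lborel {r j<..r (Suc j)})"
      using r(1) by (subst sum_ennreal[symmetric]) (auto simp: e'_def ennreal_mult less_imp_le intro!: sum.cong)
    also have "\<dots> = (\<integral>\<^sup>+\<tau>. (\<Sum>j<L. ennreal (e' j) * indicator {r j<..r (Suc j)} \<tau>) \<partial>lborel)"
      by (subst nn_integral_sum) (auto intro!: sum.cong simp: nn_integral_cmult_indicator)
    also have "\<dots> \<le> (\<integral>\<^sup>+\<tau>\<in>{0..T}. d \<tau> \<partial>lborel)"
    proof (rule nn_integral_mono)
      fix \<tau>
      show "(\<Sum>j<L. ennreal (e' j) * indicator {r j<..r (Suc j)} \<tau>) \<le> d \<tau> * indicator {0..T} \<tau>"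
      proof (cases "\<exists>j<L. r j < \<tau> \<and> \<tau> \<le> r (Suc j)")
        case True
        then obtain j where j: "j < L" "r j < \<tau>" "\<tau> \<le> r (Suc j)" by blast
        have "(\<Sum>k<L. ennreal (e' k) * indicator {r k<..r (Suc k)} \<tau>) = (\<Sum>k<L. if k = j then ennreal (e' j) else 0)"
        proof (rule sum.cong[OF refl])
          fix k assume k: "k \<in> {..<L}"
          have "\<not> (r k < \<tau> \<and> \<tau> \<le> r (Suc k))" if kj: "k \<noteq> j"
          proof -
            consider "k < j" | "j < k" using kj by linarith
            then show ?thesis
            proof cases
              case 1
              then show ?thesis using partition_mono(1)[of L r "Suc k" j] r(1) j by auto
            next
              case 2
              then show ?thesis using partition_mono(1)[of L r "Suc j" k] r(1) j k by auto
            qed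
          qed
          then show "ennreal (e' k) * indicator {r k<..r (Suc k)} \<tau> = (if k = j then ennreal (e' j) else 0)"
            using j by (auto simp: indicator_def)
        qed
        also have "\<dots> = ennreal (e' j)" using j by simp
        also have "\<dots> \<le> d \<tau>" using e'd[OF j] .
        finally show ?thesis using j rpos[of j] bnd[of "r (Suc j)"] by (auto simp: indicator_def)
      next
        case False
        then have "(\<Sum>j<L. ennreal (e' j) * indicator {r j<..r (Suc j)} \<tau>) = 0"
          by (intro sum.neutral) (auto simp: indicator_def)
        then show ?thesis by simp
      qed
    qed
    finally show ?thesis .
  qed
  have tel: "(\<Sum>j<L. r (Suc j) - r j) = T" using sum_lessThan_telescope[of r L] r0 rL by simp
  have up: "(\<Sum>j<L. (r (Suc j) - r j) * G j) \<le> 2 * (\<Sum>j<L. e' j * (r (Suc j) - r j)) + 2 * c * T"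
  proof -
    have "(\<Sum>j<L. (r (Suc j) - r j) * G j) \<le> (\<Sum>j<L. 2 * (e' j * (r (Suc j) - r j)) + 2 * c * (r (Suc j) - r j))"
    proof (rule sum_mono)
      fix j assume "j \<in> {..<L}"
      then have "0 \<le> r (Suc j) - r j" using r(1)[of j] by simp
      then have "(r (Suc j) - r j) * G j \<le> (r (Suc j) - r j) * (2 * e' j + 2 * c)"
      proof (rule mult_left_mono[rotated])
        have "G j / 2 - c \<le> e' j" by (simp add: e'_def)
        then show "G j \<le> 2 * e' j + 2 * c" by simp
      qed
      then show "(r (Suc j) - r j) * G j \<le> 2 * (e' j * (r (Suc j) - r j)) + 2 * c * (r (Suc j) - r j)"
        by (simp add: algebra_simps)
    qed
    also have "\<dots> = 2 * (\<Sum>j<L. e' j * (r (Suc j) - r j)) + 2 * c * (\<Sum>j<L. r (Suc j) - r j)"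
      by (simp add: sum.distrib sum_distrib_left)
    finally show ?thesis unfolding tel .
  qed
  have "simple_integral \<omega> PB m t \<eta> x - simple_integral \<omega> PB n s \<xi> x =
      (\<Sum>j<L. \<omega> (\<eta>' j x - \<xi>' j x) (PB (r (Suc j)) x - PB (r j) x))" for x
  proof -
    have "simple_integral \<omega> PB n s \<xi> x = (\<Sum>j<L. \<omega> (\<xi>' j x) (PB (r (Suc j)) x - PB (r j) x))"
      unfolding \<xi>'_def by (rule simple_integral_refine[where L = L and n = n and r = r and s = s, OF om.bounded_bilinear_axioms r(1) sx(3)]) (use r(2) in auto)
    moreover have "simple_integral \<omega> PB m t \<eta> x = (\<Sum>j<L. \<omega> (\<eta>' j x) (PB (r (Suc j)) x - PB (r j) x))"
      unfolding \<eta>'_def by (rule simple_integral_refine[where L = L and n = m and r = r and s = t, OF om.bounded_bilinear_axioms r(1) te(3)]) (use r(2) in auto)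
    ultimately show ?thesis by (simp add: om.diff_left sum_subtractf)
  qed
  then have "(\<integral>\<^sup>+x. ennreal ((norm (simple_integral \<omega> PB m t \<eta> x - simple_integral \<omega> PB n s \<xi> x))\<^sup>2) \<partial>M)
      = (\<integral>\<^sup>+x. ennreal ((norm (\<Sum>j<L. \<omega> (\<eta>' j x - \<xi>' j x) (PB (r (Suc j)) x - PB (r j) x)))\<^sup>2) \<partial>M)" by simp
  also have "\<dots> \<le> ennreal (KI * (\<Sum>j<L. (r (Suc j) - r j) * G j))"
  proof (rule ito_isometry)
    show "(\<lambda>x. \<eta>' j x - \<xi>' j x) \<in> borel_measurable (past M b (r j))" if "j < L" for j
      using X[OF that] E[OF that] by (intro borel_measurable_diff) auto
    show "(\<integral>\<^sup>+x. ennreal ((norm (\<eta>' j x - \<xi>' j x))\<^sup>2) \<partial>M) \<le> ennreal (G j)" if "j < L" for j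
      using G[OF that] by (simp add: g_def)
  qed (use r0 r(1) G in \<open>auto simp: less_imp_le\<close>)
  also have "\<dots> \<le> ennreal (KI * (2 * (\<Sum>j<L. e' j * (r (Suc j) - r j)) + 2 * c * T))"
    using up KI_nonneg by (intro ennreal_leI mult_left_mono)
  also have "\<dots> = ennreal KI * (2 * ennreal (\<Sum>j<L. e' j * (r (Suc j) - r j)) + ennreal (2 * c * T))"
  proof -
    have "0 \<le> (\<Sum>j<L. e' j * (r (Suc j) - r j))" using r(1) by (intro sum_nonneg mult_nonneg_nonneg) (auto simp: e'_def less_imp_le)
    then show ?thesis using KI_nonneg c T by (intro ennreal_linear[symmetric]) auto
  qed
  also have "\<dots> \<le> ennreal KI * (2 * (\<integral>\<^sup>+\<tau>\<in>{0..T}. d \<tau> \<partial>lborel) + ennreal (2 * c * T))"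
    using low by (intro mult_left_mono add_mono) auto
  finally show ?thesis unfolding d_def .
qed

definition KB :: real where "KB = (\<Sum>p\<in>dirs. (norm (rep (dir p)))\<^sup>2) * real (card dirs) / 2"

lemma KB_nonneg: "0 \<le> KB" unfolding KB_def by (intro divide_nonneg_pos mult_nonneg_nonneg sum_nonneg) auto

lemma PB_increment_moment:
  assumes st: "0 \<le> s" "s \<le> t"
  shows "(\<integral>\<^sup>+x. ennreal ((norm (PB t x - PB s x))\<^sup>2) \<partial>M) \<le> ennreal (KB * (t - s))"
proof -
  define R where "R = (\<Sum>p\<in>dirs. (norm (rep (dir p)))\<^sup>2)"
  note rm = rho_moments[OF _ st]
  have i: "integrable M (\<lambda>x. R * (\<Sum>p\<in>dirs. (rho p s t x)\<^sup>2))"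
    using rm(3) by (intro integrable_mult_right Bochner_Integration.integrable_sum) auto
  have R0: "0 \<le> R" by (simp add: R_def sum_nonneg)
  have "(norm (PB t x - PB s x))\<^sup>2 \<le> R * (\<Sum>p\<in>dirs. (rho p s t x)\<^sup>2)" for x
  proof -
    have "norm (PB t x - PB s x) \<le> (\<Sum>p\<in>dirs. norm (rho p s t x *\<^sub>R rep (dir p)))"
      unfolding PB_increment by (rule norm_sum)
    then have "(norm (PB t x - PB s x))\<^sup>2 \<le> (\<Sum>p\<in>dirs. \<bar>rho p s t x\<bar> * norm (rep (dir p)))\<^sup>2"
      by (intro power_mono) auto
    also have "\<dots> \<le> (\<Sum>p\<in>dirs. \<bar>rho p s t x\<bar>\<^sup>2) * R" unfolding R_def by (rule Cauchy_Schwarz_ineq_sum)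
    finally show ?thesis by (simp add: mult.commute)
  qed
  then have "(\<integral>\<^sup>+x. ennreal ((norm (PB t x - PB s x))\<^sup>2) \<partial>M) \<le> (\<integral>\<^sup>+x. ennreal (R * (\<Sum>p\<in>dirs. (rho p s t x)\<^sup>2)) \<partial>M)"
    by (intro nn_integral_mono ennreal_leI)
  also have "\<dots> = ennreal (BM.expectation (\<lambda>x. R * (\<Sum>p\<in>dirs. (rho p s t x)\<^sup>2)))"
    using i R0 by (intro nn_integral_eq_integral) (auto intro!: AE_I2 mult_nonneg_nonneg sum_nonneg)
  also have "BM.expectation (\<lambda>x. R * (\<Sum>p\<in>dirs. (rho p s t x)\<^sup>2)) = R * (\<Sum>p\<in>dirs. BM.expectation (\<lambda>x. (rho p s t x)\<^sup>2))"
    using rm(3) by (simp only: integral_mult_right_zero Bochner_Integration.integral_sum)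
  also have "(\<Sum>p\<in>dirs. BM.expectation (\<lambda>x. (rho p s t x)\<^sup>2)) = (\<Sum>p\<in>dirs. (t - s) / 2)"
    using rm(4) by (rule sum.cong[OF refl])
  also have "R * (\<Sum>p\<in>dirs. (t - s) / 2) = KB * (t - s)" by (simp add: KB_def R_def)
  finally show ?thesis .
qed

lemma PB_moment:
  assumes "0 \<le> t" shows "(\<integral>\<^sup>+x. ennreal ((norm (PB t x))\<^sup>2) \<partial>M) \<le> ennreal (KB * t)"
proof -
  have z: "proj 0 = 0" using proj_minus[of 0 0] by simp
  have "(\<integral>\<^sup>+x. ennreal ((norm (PB t x))\<^sup>2) \<partial>M) = (\<integral>\<^sup>+x. ennreal ((norm (PB t x - PB 0 x))\<^sup>2) \<partial>M)"
    using b_zero by (intro nn_integral_cong_AE) (auto simp: z)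
  then show ?thesis using PB_increment_moment[of 0 t] assms by simp
qed

subsection \<open>Riemann sums\<close>

abbreviation grid :: "real \<Rightarrow> nat \<Rightarrow> nat \<Rightarrow> real" where "grid T N i \<equiv> real i * T / real N"

definition riemann :: "real \<Rightarrow> nat \<Rightarrow> 'a \<Rightarrow> 'c" where
  "riemann T N = simple_integral \<omega> PB N (grid T N) (\<lambda>i. PB (grid T N i))"

lemma grid_simps: "0 < T \<Longrightarrow> 0 \<le> grid T N i" "0 < N \<Longrightarrow> grid T N (Suc i) - grid T N i = T / real N"
  by (auto simp: distrib_right add_divide_distrib)

lemma riemann_ok:
  assumes T: "0 < T" and N: "0 < N"
  shows "simple_ok T N (grid T N) (\<lambda>i. PB (grid T N i))"
  unfolding simple_ok_def
proof (intro conjI allI impI)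
  fix i
  show "grid T N i < grid T N (Suc i)" using T N by (simp add: divide_strict_right_mono)
  show "PB (grid T N i) \<in> borel_measurable (past M b (grid T N i))"
    by (rule PB_past[OF grid_simps(1)[OF T] order_refl])
  show "(\<integral>\<^sup>+x. ennreal ((norm (PB (grid T N i) x))\<^sup>2) \<partial>M) < \<infinity>"
    using le_less_trans[OF PB_moment[OF grid_simps(1)[OF T, where N = N and i = i]] ennreal_less_top] by simp
qed (use N in auto)

lemma riemann_measurable: "0 < T \<Longrightarrow> 0 < N \<Longrightarrow> riemann T N \<in> borel_measurable M"
  unfolding riemann_def by (rule simple_integral_measurable[OF riemann_ok])

lemma riemann_close:
  assumes T: "0 < T" and N: "0 < N" and \<tau>: "0 < \<tau>" "\<tau> \<le> T"
  shows "(\<integral>\<^sup>+x. ennreal ((norm (simple_process N (grid T N) (\<lambda>i. PB (grid T N i)) \<tau> x - PB \<tau> x))\<^sup>2) \<partial>M) \<le> ennreal (KB * (T / real N))"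
proof -
  have gs: "grid T N i < grid T N (Suc i)" for i using T N by (simp add: divide_strict_right_mono)
  obtain i where i: "i < N" "grid T N i < \<tau>" "\<tau> \<le> grid T N (Suc i)"
    using partition_cell[of "grid T N" \<tau> N] \<tau> N by auto
  have sp: "simple_process N (grid T N) (\<lambda>i. PB (grid T N i)) \<tau> = PB (grid T N i)"
    by (rule simple_process_cell[OF gs i])
  have "(\<integral>\<^sup>+x. ennreal ((norm (PB (grid T N i) x - PB \<tau> x))\<^sup>2) \<partial>M) \<le> ennreal (KB * (\<tau> - grid T N i))"
    using PB_increment_moment[OF grid_simps(1)[OF T] less_imp_le[OF i(2)]] by (simp add: norm_minus_commute)
  also have "\<dots> \<le> ennreal (KB * (T / real N))"
    using i grid_simps(2)[OF N, of i T] KB_nonneg by (intro ennreal_leI mult_left_mono) auto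
  finally show ?thesis unfolding sp .
qed

definition KR :: "real \<Rightarrow> real" where "KR T = 4 * KI * KB * T * T"

lemma KR_nonneg: "0 < T \<Longrightarrow> 0 \<le> KR T" using KI_nonneg KB_nonneg by (simp add: KR_def)

lemma riemann_process_distance:
  assumes T: "0 < T" and N: "0 < N"
  shows "(\<integral>\<^sup>+\<tau>\<in>{0..T}. (\<integral>\<^sup>+x. ennreal ((norm (simple_process N (grid T N) (\<lambda>i. PB (grid T N i)) \<tau> x - PB \<tau> x))\<^sup>2) \<partial>M) \<partial>lborel)
    \<le> ennreal (KB * T * T / real N)"
proof -
  have z: "proj 0 = 0" using proj_minus[of 0 0] by simp
  have 0: "(\<integral>\<^sup>+x. ennreal ((norm (simple_process N (grid T N) (\<lambda>i. PB (grid T N i)) 0 x - PB 0 x))\<^sup>2) \<partial>M) = 0"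
  proof -
    have "simple_process N (grid T N) (\<lambda>i. PB (grid T N i)) 0 x = 0" for x
      unfolding simple_process_def using grid_simps(1)[OF T] by (intro sum.neutral) (auto simp: indicator_def not_less)
    then have "AE x in M. ennreal ((norm (simple_process N (grid T N) (\<lambda>i. PB (grid T N i)) 0 x - PB 0 x))\<^sup>2) = 0"
      using b_zero by (auto simp: z)
    from nn_integral_cong_AE[OF this] show ?thesis by simp
  qed
  have "(\<integral>\<^sup>+\<tau>\<in>{0..T}. (\<integral>\<^sup>+x. ennreal ((norm (simple_process N (grid T N) (\<lambda>i. PB (grid T N i)) \<tau> x - PB \<tau> x))\<^sup>2) \<partial>M) \<partial>lborel)
      \<le> (\<integral>\<^sup>+\<tau>. ennreal (KB * (T / real N)) * indicator {0..T} \<tau> \<partial>lborel)"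
  proof (rule nn_integral_mono)
    fix \<tau> :: real
    show "(\<integral>\<^sup>+x. ennreal ((norm (simple_process N (grid T N) (\<lambda>i. PB (grid T N i)) \<tau> x - PB \<tau> x))\<^sup>2) \<partial>M) * indicator {0..T} \<tau>
      \<le> ennreal (KB * (T / real N)) * indicator {0..T} \<tau>"
      using riemann_close[OF T N, of \<tau>] 0 by (cases "\<tau> = 0") (auto simp: indicator_def)
  qed
  also have "\<dots> = ennreal (KB * T * T / real N)"
    using T KB_nonneg by (subst nn_integral_cmult_indicator) (auto simp: ennreal_mult[symmetric] mult_ac)
  finally show ?thesis .
qed

lemma riemann_Cauchy:
  assumes T: "0 < T" and N: "0 < N" "0 < N'"
  shows "(\<integral>\<^sup>+x. ennreal ((norm (riemann T N x - riemann T N' x))\<^sup>2) \<partial>M) \<le> ennreal (KR T * (1 / real N + 1 / real N'))"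
proof -
  have c: "0 \<le> KB * (T / real N)" using T KB_nonneg by simp
  have "(\<integral>\<^sup>+x. ennreal ((norm (riemann T N x - riemann T N' x))\<^sup>2) \<partial>M) \<le>
      ennreal KI * (2 * ennreal (KB * T * T / real N') + ennreal (2 * (KB * (T / real N)) * T))"
    unfolding riemann_def
    by (rule order_trans[OF simple_integral_distance[OF T riemann_ok[OF T N(2)] riemann_ok[OF T N(1)] c riemann_close[OF T N(1)]]])
      (auto intro!: mult_left_mono add_mono riemann_process_distance[OF T N(2)])
  also have "\<dots> = ennreal (KI * (2 * (KB * T * T / real N') + 2 * (KB * (T / real N)) * T))"
    by (rule ennreal_linear) (use KI_nonneg KB_nonneg T in auto)
  also have "\<dots> \<le> ennreal (KR T * (1 / real N + 1 / real N'))"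
  proof (rule ennreal_leI)
    have "KI * (2 * (KB * T * T / real N') + 2 * (KB * (T / real N)) * T) = KR T / 2 * (1 / real N + 1 / real N')"
      by (simp add: KR_def algebra_simps)
    also have "\<dots> \<le> KR T * (1 / real N + 1 / real N')"
      using KR_nonneg[OF T] by (intro mult_right_mono) auto
    finally show "KI * (2 * (KB * T * T / real N') + 2 * (KB * (T / real N)) * T) \<le> KR T * (1 / real N + 1 / real N')" .
  qed
  finally show ?thesis .
qed

text \<open>Whatever elementary processes an Ito integral was obtained from, the Riemann sums approach it at the
  same rate.\<close>

lemma riemann_ito_distance:
  assumes T: "0 < T" and N: "0 < N" and I: "has_ito_integral M (past M b) \<omega> PB PB T I"
  shows "(\<integral>\<^sup>+x. ennreal ((norm (riemann T N x - I x))\<^sup>2) \<partial>M) \<le> ennreal (KR T / real N)"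
proof -
  obtain n s \<xi> where Im: "I \<in> borel_measurable M" and ok: "\<And>k. simple_ok T (n k) (s k) (\<xi> k)"
    and l1: "(\<lambda>k. \<integral>\<^sup>+\<tau>\<in>{0..T}. (\<integral>\<^sup>+x. ennreal ((norm (simple_process (n k) (s k) (\<xi> k) \<tau> x - PB \<tau> x))\<^sup>2) \<partial>M) \<partial>lborel) \<longlonglongrightarrow> 0"
    and l2: "(\<lambda>k. \<integral>\<^sup>+x. ennreal ((norm (simple_integral \<omega> PB (n k) (s k) (\<xi> k) x - I x))\<^sup>2) \<partial>M) \<longlonglongrightarrow> 0"
    using I unfolding has_ito_integral_def simple_ok_def by blast
  let ?d = "\<lambda>k. \<integral>\<^sup>+\<tau>\<in>{0..T}. (\<integral>\<^sup>+x. ennreal ((norm (simple_process (n k) (s k) (\<xi> k) \<tau> x - PB \<tau> x))\<^sup>2) \<partial>M) \<partial>lborel"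
  let ?e = "\<lambda>k. \<integral>\<^sup>+x. ennreal ((norm (simple_integral \<omega> PB (n k) (s k) (\<xi> k) x - I x))\<^sup>2) \<partial>M"
  have c: "0 \<le> KB * (T / real N)" using T KB_nonneg by simp
  have le: "(\<integral>\<^sup>+x. ennreal ((norm (riemann T N x - I x))\<^sup>2) \<partial>M) \<le>
      2 * (ennreal KI * (2 * ?d k + ennreal (2 * (KB * (T / real N)) * T))) + 2 * ?e k" for k
  proof -
    have "(\<integral>\<^sup>+x. ennreal ((norm (riemann T N x - I x))\<^sup>2) \<partial>M) \<le>
      2 * (\<integral>\<^sup>+x. ennreal ((norm (riemann T N x - simple_integral \<omega> PB (n k) (s k) (\<xi> k) x))\<^sup>2) \<partial>M) +
      2 * (\<integral>\<^sup>+x. ennreal ((norm (I x - simple_integral \<omega> PB (n k) (s k) (\<xi> k) x))\<^sup>2) \<partial>M)"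
      by (rule nn_integral_norm_diff_sq_le[OF riemann_measurable[OF T N] Im simple_integral_measurable[OF ok]])
    also have "\<dots> \<le> 2 * (ennreal KI * (2 * ?d k + ennreal (2 * (KB * (T / real N)) * T))) + 2 * ?e k"
      unfolding riemann_def
      using simple_integral_distance[OF T ok riemann_ok[OF T N] c riemann_close[OF T N]]
      by (intro add_mono mult_left_mono) (auto simp: norm_minus_commute)
    finally show ?thesis .
  qed
  have "(\<lambda>k. 2 * (ennreal KI * (2 * ?d k + ennreal (2 * (KB * (T / real N)) * T))) + 2 * ?e k) \<longlonglongrightarrow>
      2 * (ennreal KI * (2 * 0 + ennreal (2 * (KB * (T / real N)) * T))) + 2 * 0"
    by (intro tendsto_add ennreal_tendsto_cmult l1 l2 tendsto_const) auto
  then have "(\<integral>\<^sup>+x. ennreal ((norm (riemann T N x - I x))\<^sup>2) \<partial>M) \<le> 2 * (ennreal KI * (2 * 0 + ennreal (2 * (KB * (T / real N)) * T))) + 2 * 0"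
    by (rule LIMSEQ_le_const) (use le in blast)
  also have "\<dots> = ennreal (2 * (KI * (2 * (KB * (T / real N)) * T)))"
    by (rule ennreal_twice) (use KI_nonneg KB_nonneg T in auto)
  also have "2 * (KI * (2 * (KB * (T / real N)) * T)) = KR T / real N" by (simp add: KR_def)
  finally show ?thesis .
qed

text \<open>Along the grids with \<open>4\<^sup>k\<close> steps the mean square distances of consecutive Riemann sums decay
  geometrically, so these converge almost surely; the pointwise limit is the integral.\<close>

lemma ito_integral_exists:
  assumes T: "0 < T"
  shows "\<exists>I. has_ito_integral M (past M b) \<omega> PB PB T I"
proof -
  define S where "S k = riemann T (4 ^ k)" for k :: nat
  have Sm[measurable]: "S k \<in> borel_measurable M" for k unfolding S_def by (rule riemann_measurable[OF T]) simp
  define C where "C = KR T"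
  have C: "0 \<le> C" using KR_nonneg[OF T] by (simp add: C_def)
  have dist: "(\<integral>\<^sup>+x. ennreal ((norm (S k x - S j x))\<^sup>2) \<partial>M) \<le> ennreal (2 * C / 4 ^ k)" if "k \<le> j" for k j
  proof -
    have "(\<integral>\<^sup>+x. ennreal ((norm (S k x - S j x))\<^sup>2) \<partial>M) \<le> ennreal (C * (1 / 4 ^ k + 1 / 4 ^ j))"
      using riemann_Cauchy[OF T, of "4 ^ k" "4 ^ j"] by (simp add: S_def C_def)
    also have "\<dots> \<le> ennreal (C * (1 / 4 ^ k + 1 / 4 ^ k))"
      using that C by (intro ennreal_leI mult_left_mono add_left_mono divide_left_mono power_increasing) auto
    finally show ?thesis by (simp add: field_simps)
  qed
  \<comment> \<open>The inequality \<open>d \<le> 2 ^ k / 2 * d\<^sup>2 + 1 / (2 * 2 ^ k)\<close> turns the bound \<open>2 * C / 4 ^ k\<close> on the mean of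
    \<open>d\<^sup>2\<close> into a summable bound on the mean of \<open>d\<close>.\<close>
  have D: "(\<integral>\<^sup>+x. ennreal (norm (S (Suc k) x - S k x)) \<partial>M) \<le> ennreal ((C + 1/2) * (1/2) ^ k)" for k
  proof -
    have "(\<integral>\<^sup>+x. ennreal (norm (S (Suc k) x - S k x)) \<partial>M) \<le>
        (\<integral>\<^sup>+x. ennreal (2 ^ k / 2) * ennreal ((norm (S k x - S (Suc k) x))\<^sup>2) + ennreal (1 / (2 * 2 ^ k)) \<partial>M)"
    proof (rule nn_integral_mono)
      fix x
      let ?d = "norm (S k x - S (Suc k) x)"
      have "0 \<le> (2 ^ k * ?d - 1)\<^sup>2 / (2 * 2 ^ k)" by simp
      also have "\<dots> = 2 ^ k / 2 * ?d\<^sup>2 + 1 / (2 * 2 ^ k) - ?d" by (simp add: power2_eq_square field_simps)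
      finally have "?d \<le> 2 ^ k / 2 * ?d\<^sup>2 + 1 / (2 * 2 ^ k)" by simp
      then have "ennreal ?d \<le> ennreal (2 ^ k / 2 * ?d\<^sup>2 + 1 / (2 * 2 ^ k))" by (rule ennreal_leI)
      then show "ennreal (norm (S (Suc k) x - S k x)) \<le> ennreal (2 ^ k / 2) * ennreal (?d\<^sup>2) + ennreal (1 / (2 * 2 ^ k))"
        by (subst (asm) ennreal_affine) (simp_all add: norm_minus_commute)
    qed
    also have "\<dots> = ennreal (2 ^ k / 2) * (\<integral>\<^sup>+x. ennreal ((norm (S k x - S (Suc k) x))\<^sup>2) \<partial>M) + ennreal (1 / (2 * 2 ^ k))"
      by (subst nn_integral_add) (auto simp: nn_integral_cmult BM.emeasure_space_1)
    also have "\<dots> \<le> ennreal (2 ^ k / 2) * ennreal (2 * C / 4 ^ k) + ennreal (1 / (2 * 2 ^ k))"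
      by (intro add_mono mult_left_mono dist) auto
    also have "\<dots> = ennreal (2 ^ k / 2 * (2 * C / 4 ^ k) + 1 / (2 * 2 ^ k))"
      by (rule ennreal_affine[symmetric]) (use C in auto)
    also have "2 ^ k / 2 * (2 * C / 4 ^ k) + 1 / (2 * 2 ^ k) = (C + 1/2) * (1/2) ^ k"
    proof -
      have "(4::real) ^ k = 2 ^ k * 2 ^ k" by (simp add: power_mult_distrib[symmetric])
      then show ?thesis by (simp add: power_one_over field_simps)
    qed
    finally show ?thesis .
  qed
  have sum: "AE x in M. summable (\<lambda>k. norm (S (Suc k) x - S k x))"
  proof -
    have "(\<integral>\<^sup>+x. (\<Sum>k. ennreal (norm (S (Suc k) x - S k x))) \<partial>M) = (\<Sum>k. \<integral>\<^sup>+x. ennreal (norm (S (Suc k) x - S k x)) \<partial>M)"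
      by (rule nn_integral_suminf) measurable
    also have "\<dots> \<le> (\<Sum>k. ennreal ((C + 1/2) * (1/2) ^ k))" by (intro suminf_le D) auto
    also have "\<dots> < \<infinity>"
    proof -
      have "summable (\<lambda>k. (C + 1/2) * (1/2) ^ k)" by (intro summable_mult summable_geometric) simp
      then have "(\<Sum>k. ennreal ((C + 1/2) * (1/2) ^ k)) \<noteq> top"
        by (rule ennreal_suminf_neq_top) (use C in simp)
      then show ?thesis by (simp only: infinity_ennreal_def less_top)
    qed
    finally have "(\<integral>\<^sup>+x. (\<Sum>k. ennreal (norm (S (Suc k) x - S k x))) \<partial>M) \<noteq> \<infinity>" by simp
    then have "AE x in M. (\<Sum>k. ennreal (norm (S (Suc k) x - S k x))) \<noteq> \<infinity>"
      by (intro nn_integral_PInf_AE) measurable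
    then show ?thesis by eventually_elim (auto intro: summable_suminf_not_top)
  qed
  have cin: "bounded_linear (\<lambda>y :: 'c. cinner y e)" for e
    using bounded_linear_compose[OF ecoord_bounded_linear[of "Inr e"], of "\<lambda>y. (0, y)"] bounded_linear_Pair[OF bounded_linear_zero bounded_linear_ident]
    by simp
  define z where "z e k x = cinner (S k x) e" for e :: 'c and k x
  have [measurable]: "z e k \<in> borel_measurable M" for e k
    unfolding z_def[abs_def] by (rule measurable_compose[OF Sm borel_measurable_continuous_onI[OF linear_continuous_on[OF cin]]])
  have Sz: "S k x = (\<Sum>e\<in>E2. z e k x *\<^sub>C e)" for k x using E2 unfolding z_def orthonormal_basis_def by blast
  define I where "I x = (\<Sum>e\<in>E2. lim (\<lambda>k. z e k x) *\<^sub>C e)" for x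
  have scC: "bounded_linear (\<lambda>a. a *\<^sub>C (e :: 'c))" for e
  proof -
    have "(\<lambda>a. a *\<^sub>C e) = (\<lambda>a. Re a *\<^sub>R e + Im a *\<^sub>R (\<i> *\<^sub>C e))" by (rule ext) (rule scaleC_split)
    moreover have "bounded_linear (\<lambda>a. Re a *\<^sub>R e + Im a *\<^sub>R (\<i> *\<^sub>C e))"
      by (intro bounded_linear_add bounded_linear_compose[OF bounded_linear_scaleR_left] bounded_linear_Re bounded_linear_Im)
    ultimately show ?thesis by simp
  qed
  have lm: "(\<lambda>x. lim (\<lambda>k. z e k x)) \<in> borel_measurable M" for e by (rule borel_measurable_lim_metric) measurable
  have Im[measurable]: "I \<in> borel_measurable M"
    unfolding I_def[abs_def]
    by (intro borel_measurable_sum measurable_compose[OF lm borel_measurable_continuous_onI[OF linear_continuous_on[OF scC]]])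
  have conv: "AE x in M. (\<lambda>k. S k x) \<longlonglongrightarrow> I x"
    using sum
  proof eventually_elim
    fix x assume s: "summable (\<lambda>k. norm (S (Suc k) x - S k x))"
    have "(\<lambda>k. z e k x) \<longlonglongrightarrow> lim (\<lambda>k. z e k x)" for e
    proof -
      obtain K where K: "\<And>y. cmod (cinner y e) \<le> norm y * K" using bounded_linear.bounded[OF cin[of e]] by blast
      have "summable (\<lambda>k. z e (Suc k) x - z e k x)"
      proof (rule summable_comparison_test')
        show "summable (\<lambda>k. norm (S (Suc k) x - S k x) * K)" by (rule summable_mult2[OF s])
        show "norm (z e (Suc k) x - z e k x) \<le> norm (S (Suc k) x - S k x) * K" for k
          using K[of "S (Suc k) x - S k x"] linear_diff[OF bounded_linear.linear[OF cin[of e]]] by (simp add: z_def)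
      qed
      then have "convergent (\<lambda>n. (\<Sum>k<n. z e (Suc k) x - z e k x))" by (simp add: summable_iff_convergent)
      then have "convergent (\<lambda>n. z e n x - z e 0 x)" by (simp only: sum_lessThan_telescope[of "\<lambda>k. z e k x"])
      then have "convergent (\<lambda>n. (z e n x - z e 0 x) + z e 0 x)" by (intro convergent_add convergent_const)
      then show ?thesis by (simp add: convergent_LIMSEQ_iff)
    qed
    then have "(\<lambda>k. \<Sum>e\<in>E2. z e k x *\<^sub>C e) \<longlonglongrightarrow> (\<Sum>e\<in>E2. lim (\<lambda>k. z e k x) *\<^sub>C e)"
      by (intro tendsto_sum bounded_linear.tendsto[OF scC])
    then show "(\<lambda>k. S k x) \<longlonglongrightarrow> I x" unfolding Sz I_def .
  qed
  have rate: "(\<integral>\<^sup>+x. ennreal ((norm (S k x - I x))\<^sup>2) \<partial>M) \<le> ennreal (2 * C / 4 ^ k)" for k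
  proof -
    have "(\<integral>\<^sup>+x. ennreal ((norm (S k x - I x))\<^sup>2) \<partial>M) = (\<integral>\<^sup>+x. liminf (\<lambda>j. ennreal ((norm (S k x - S j x))\<^sup>2)) \<partial>M)"
    proof (rule nn_integral_cong_AE)
      show "AE x in M. ennreal ((norm (S k x - I x))\<^sup>2) = liminf (\<lambda>j. ennreal ((norm (S k x - S j x))\<^sup>2))"
        using conv
      proof eventually_elim
        fix x assume "(\<lambda>k. S k x) \<longlonglongrightarrow> I x"
        then have "(\<lambda>j. ennreal ((norm (S k x - S j x))\<^sup>2)) \<longlonglongrightarrow> ennreal ((norm (S k x - I x))\<^sup>2)"
          by (intro tendsto_ennrealI tendsto_intros)
        then show "ennreal ((norm (S k x - I x))\<^sup>2) = liminf (\<lambda>j. ennreal ((norm (S k x - S j x))\<^sup>2))"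
          using lim_imp_Liminf[OF sequentially_bot] by metis
      qed
    qed
    also have "\<dots> \<le> liminf (\<lambda>j. \<integral>\<^sup>+x. ennreal ((norm (S k x - S j x))\<^sup>2) \<partial>M)"
      by (rule nn_integral_liminf) measurable
    also have "\<dots> \<le> liminf (\<lambda>j. ennreal (2 * C / 4 ^ k))"
      using dist by (intro Liminf_mono eventually_sequentiallyI[of k])
    also have "\<dots> = ennreal (2 * C / 4 ^ k)" by (simp add: Liminf_const)
    finally show ?thesis .
  qed
  have pow0: "(\<lambda>k. ennreal (c / 4 ^ k)) \<longlonglongrightarrow> 0" for c :: real
  proof -
    have "(\<lambda>k. c * (1/4) ^ k) \<longlonglongrightarrow> c * 0" by (intro tendsto_mult_left LIMSEQ_realpow_zero) auto
    then have "(\<lambda>k. ennreal (c * (1/4) ^ k)) \<longlonglongrightarrow> ennreal (c * 0)" by (rule tendsto_ennrealI)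
    then show ?thesis by (simp add: power_one_over)
  qed
  have "has_ito_integral M (past M b) \<omega> PB PB T I"
    unfolding has_ito_integral_def
  proof (intro conjI exI)
    let ?n = "\<lambda>k::nat. (4::nat) ^ k" and ?s = "\<lambda>k. grid T (4 ^ k)" and ?\<xi> = "\<lambda>k i. PB (grid T (4 ^ k) i)"
    show "I \<in> borel_measurable M" by (rule Im)
    show "\<forall>k. ?s k 0 = 0 \<and> ?s k (?n k) = T \<and> (\<forall>i<?n k. ?s k i < ?s k (Suc i) \<and> ?\<xi> k i \<in> borel_measurable (past M b (?s k i)) \<and>
        (\<integral>\<^sup>+x. ennreal ((norm (?\<xi> k i x))\<^sup>2) \<partial>M) < \<infinity>)"
      using riemann_ok[OF T, of "4 ^ _"] unfolding simple_ok_def by simp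
    show "(\<lambda>k. \<integral>\<^sup>+\<tau>\<in>{0..T}. (\<integral>\<^sup>+x. ennreal ((norm (simple_process (?n k) (?s k) (?\<xi> k) \<tau> x - PB \<tau> x))\<^sup>2) \<partial>M) \<partial>lborel) \<longlonglongrightarrow> 0"
    proof (rule tendsto_sandwich[OF always_eventually always_eventually tendsto_const pow0], rule_tac [!] allI)
      fix k :: nat
      show "(\<integral>\<^sup>+\<tau>\<in>{0..T}. (\<integral>\<^sup>+x. ennreal ((norm (simple_process (?n k) (?s k) (?\<xi> k) \<tau> x - PB \<tau> x))\<^sup>2) \<partial>M) \<partial>lborel) \<le> ennreal (KB * T * T / 4 ^ k)"
        using riemann_process_distance[OF T, of "4 ^ k"] by simp
    qed simp
    have e: "simple_integral \<omega> PB (?n k) (?s k) (?\<xi> k) = S k" for k by (simp add: S_def riemann_def)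
    show "(\<lambda>k. \<integral>\<^sup>+x. ennreal ((norm (simple_integral \<omega> PB (?n k) (?s k) (?\<xi> k) x - I x))\<^sup>2) \<partial>M) \<longlonglongrightarrow> 0"
      unfolding e
    proof (rule tendsto_sandwich[OF always_eventually always_eventually tendsto_const pow0], rule_tac [!] allI)
      show "(\<integral>\<^sup>+x. ennreal ((norm (S k x - I x))\<^sup>2) \<partial>M) \<le> ennreal (2 * C / 4 ^ k)" for k by (rule rate)
    qed simp
  qed
  then show ?thesis by blast
qed

lemma ito_integral_limit:
  assumes T: "0 < T"
  shows "ito_integral M (past M b) \<omega> PB PB T \<in> borel_measurable M"
    "0 < N \<Longrightarrow> (\<integral>\<^sup>+x. ennreal ((norm (riemann T N x - ito_integral M (past M b) \<omega> PB PB T x))\<^sup>2) \<partial>M) \<le> ennreal (KR T / real N)"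
proof -
  have h: "has_ito_integral M (past M b) \<omega> PB PB T (ito_integral M (past M b) \<omega> PB PB T)"
    unfolding ito_integral_def using ito_integral_exists[OF T] by (rule someI_ex)
  then show "ito_integral M (past M b) \<omega> PB PB T \<in> borel_measurable M" unfolding has_ito_integral_def by blast
  show "0 < N \<Longrightarrow> (\<integral>\<^sup>+x. ennreal ((norm (riemann T N x - ito_integral M (past M b) \<omega> PB PB T x))\<^sup>2) \<partial>M) \<le> ennreal (KR T / real N)"
    using riemann_ito_distance[OF T _ h] .
qed

end

section \<open>Products of Brownian increments\<close>

text \<open>Continuous functions are therefore bounded on sets of combinations with bounded coefficients.\<close>

lemma compact_combinations:
  fixes e :: "'i \<Rightarrow> 'v::complex_normed_vector"
  assumes "finite A"
  shows "compact {\<Sum>a\<in>A. z a *\<^sub>C e a | z. \<forall>a\<in>A. cmod (z a) \<le> r}"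
  using assms
proof (induction A rule: finite_induct)
  case empty
  have "{\<Sum>a\<in>{}. z a *\<^sub>C e a | z. \<forall>a\<in>{}. cmod (z a) \<le> r} = {0 :: 'v}" by auto
  then show ?case by simp
next
  case (insert a A)
  let ?S = "{\<Sum>a\<in>A. z a *\<^sub>C e a | z. \<forall>a\<in>A. cmod (z a) \<le> r}"
  have eq: "{\<Sum>a\<in>insert a A. z a *\<^sub>C e a | z. \<forall>a\<in>insert a A. cmod (z a) \<le> r} = (\<lambda>(w, v). (Re w *\<^sub>R e a + Im w *\<^sub>R (\<i> *\<^sub>C e a)) + v) ` (cball 0 r \<times> ?S)"
  proof (intro equalityI subsetI)
    fix x assume "x \<in> {\<Sum>a\<in>insert a A. z a *\<^sub>C e a | z. \<forall>a\<in>insert a A. cmod (z a) \<le> r}"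
    then obtain z where z: "x = (\<Sum>a\<in>insert a A. z a *\<^sub>C e a)" "\<forall>a\<in>insert a A. cmod (z a) \<le> r" by blast
    have "x = (Re (z a) *\<^sub>R e a + Im (z a) *\<^sub>R (\<i> *\<^sub>C e a)) + (\<Sum>a\<in>A. z a *\<^sub>C e a)"
      unfolding z(1) scaleC_split[of "z a" "e a", symmetric] using insert by simp
    then show "x \<in> (\<lambda>(w, v). (Re w *\<^sub>R e a + Im w *\<^sub>R (\<i> *\<^sub>C e a)) + v) ` (cball 0 r \<times> ?S)"
      using z(2) by (intro image_eqI[of _ _ "(z a, \<Sum>a\<in>A. z a *\<^sub>C e a)"]) auto
  next
    fix x assume "x \<in> (\<lambda>(w, v). (Re w *\<^sub>R e a + Im w *\<^sub>R (\<i> *\<^sub>C e a)) + v) ` (cball 0 r \<times> ?S)"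
    then obtain w z where w: "cmod w \<le> r" "\<forall>a\<in>A. cmod (z a) \<le> r"
      "x = (Re w *\<^sub>R e a + Im w *\<^sub>R (\<i> *\<^sub>C e a)) + (\<Sum>a\<in>A. z a *\<^sub>C e a)" by auto
    have "x = (\<Sum>b\<in>insert a A. (z(a := w)) b *\<^sub>C e b)"
      unfolding w(3) scaleC_split[of w "e a", symmetric] using insert by (auto intro!: sum.cong)
    then show "x \<in> {\<Sum>a\<in>insert a A. z a *\<^sub>C e a | z. \<forall>a\<in>insert a A. cmod (z a) \<le> r}"
      using w(1,2) by (intro CollectI exI[of _ "z(a := w)"]) auto
  qed
  show ?case
    unfolding eq using insert.IH
    by (intro compact_continuous_image compact_Times) (auto simp: split_beta' intro!: continuous_intros)
qed

context heis begin

text \<open>The coefficients of \<open>z\<close> and \<open>z\<^sup>2\<close> in \<open>heis_prod_scaled_shift\<close>.\<close>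

definition lin_part :: "nat \<Rightarrow> (nat \<Rightarrow> 'w \<times> 'c) \<Rightarrow> (nat \<Rightarrow> 'w \<times> 'c) \<Rightarrow> 'w \<times> 'c" where
  "lin_part N Y X = (\<Sum>i<N. fst (X i), (\<Sum>i<N. snd (X i)) +
     (1/2) *\<^sub>R (\<Sum>i<N. \<omega> ((\<Sum>j<i. fst (Y j)) - (\<Sum>j\<in>{i<..<N}. fst (Y j))) (fst (X i))))"

definition quad_part :: "nat \<Rightarrow> (nat \<Rightarrow> 'w \<times> 'c) \<Rightarrow> 'w \<times> 'c" where
  "quad_part N X = (0, (1/2) *\<^sub>R (\<Sum>i<N. \<omega> (\<Sum>j<i. fst (X j)) (fst (X i))))"

lemma heis_prod_parts:
  "heis_prod \<omega> N (\<lambda>i. z *\<^sub>C X i + Y i) = heis_prod \<omega> N Y + z *\<^sub>C lin_part N Y X + z\<^sup>2 *\<^sub>C quad_part N X"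
  unfolding lin_part_def quad_part_def by (rule heis_prod_scaled_shift)

lemma lin_part_scale: "lin_part N Y (\<lambda>i. z *\<^sub>C X i) = z *\<^sub>C lin_part N Y X"
  by (simp add: lin_part_def scaleC_prod_def om_scaleC linear_sum[OF bounded_linear.linear[OF bounded_linear_scaleC]] scaleC_linear)

lemma quad_part_scale: "quad_part N (\<lambda>i. z *\<^sub>C X i) = z\<^sup>2 *\<^sub>C quad_part N X"
  by (simp add: quad_part_def scaleC_prod_def om_scaleC scaleC_scaleC power2_eq_square scaleC_linear
      linear_sum[OF bounded_linear.linear[OF bounded_linear_scaleC], symmetric])

lemma parts_cong:
  assumes "\<And>i. i < N \<Longrightarrow> X i = X' i"
  shows "lin_part N Y X = lin_part N Y X'" "quad_part N X = quad_part N X'"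
proof -
  have 1: "(\<Sum>i<N. fst (X i)) = (\<Sum>i<N. fst (X' i))" "(\<Sum>i<N. snd (X i)) = (\<Sum>i<N. snd (X' i))"
    "(\<Sum>i<N. \<omega> (c i) (fst (X i))) = (\<Sum>i<N. \<omega> (c i) (fst (X' i)))" for c
    using assms by (auto intro: sum.cong)
  then show "lin_part N Y X = lin_part N Y X'" unfolding lin_part_def by (simp only:)
  have "(\<Sum>j<i. fst (X j)) = (\<Sum>j<i. fst (X' j))" if "i < N" for i using assms that by (intro sum.cong) auto
  then have "(\<Sum>i<N. \<omega> (\<Sum>j<i. fst (X j)) (fst (X i))) = (\<Sum>i<N. \<omega> (\<Sum>j<i. fst (X' j)) (fst (X' i)))"
    using assms by (intro sum.cong) auto
  then show "quad_part N X = quad_part N X'" unfolding quad_part_def by (simp only:)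
qed

end

context frame begin

lemma proj_subspace: "subspace (range proj)"
proof -
  have "proj (r *\<^sub>R x) = r *\<^sub>R proj x" for r x using proj_linear(2)[of "complex_of_real r" x] by (simp add: scaleC_of_real)
  then have l: "linear proj" using proj_linear(1) by (intro linearI) auto
  show ?thesis by (rule linear_subspace_image[OF l subspace_UNIV])
qed

abbreviation GP :: "('w \<times> 'c) set" where "GP \<equiv> range proj \<times> UNIV"

lemma GP_comb: "v \<in> GP \<Longrightarrow> comb (\<lambda>a. ecoord a v) = v"
  unfolding comb_ecoord by (auto simp: range_proj mem_Times_iff prod_eq_iff)

lemma GP_in_group: "v \<in> GP \<Longrightarrow> v \<in> cm_group q"
  using range_proj(1) by (auto simp: cm_group_def mem_Times_iff)

lemma comb_in_GP: "comb z \<in> GP" using comb_in_group(2)[of z] by (simp add: mem_Times_iff)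

lemma holomorphic_continuous_on_GP:
  assumes f: "cm_holomorphic q f"
  shows "continuous_on GP f"
proof (rule continuous_on_iff[THEN iffD2], intro ballI allI impI)
  fix x and e :: real assume x: "x \<in> GP" and e: "0 < e"
  obtain d where d: "0 < d" "\<And>y. y \<in> cm_group q \<Longrightarrow> cm_group_norm q (y - x) < d \<Longrightarrow> cmod (f y - f x) < e"
    using holomorphic_continuous[OF f GP_in_group[OF x] e] by blast
  obtain K where K: "\<And>w. cm_norm q (proj w) \<le> K * norm w" using proj_bound by blast
  define k where "k = \<bar>K\<bar> + 1"
  have k: "0 < k" by (simp add: k_def)
  show "\<exists>d>0. \<forall>y\<in>GP. dist y x < d \<longrightarrow> dist (f y) (f x) < e"
  proof (intro exI[of _ "d / k"] conjI ballI impI)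
    show "0 < d / k" using d k by simp
    fix y assume y: "y \<in> GP" "dist y x < d / k"
    have "fst (y - x) \<in> range proj" using x y subspace_diff[OF proj_subspace] by (auto simp: mem_Times_iff)
    then have p: "proj (fst (y - x)) = fst (y - x)" using range_proj(2) by auto
    have n: "norm (fst (y - x)) \<le> norm (y - x)" "norm (snd (y - x)) \<le> norm (y - x)"
      using norm_fst_le[of "fst (y - x)" "snd (y - x)"] norm_snd_le[of "snd (y - x)" "fst (y - x)"]
      by (simp_all only: prod.collapse)
    have "cm_norm q (fst (y - x)) \<le> K * norm (fst (y - x))" using K[of "fst (y - x)"] unfolding p .
    also have "\<dots> \<le> \<bar>K\<bar> * norm (y - x)" using n(1) by (intro mult_mono) auto
    finally have "cm_norm q (fst (y - x)) + norm (snd (y - x)) \<le> k * norm (y - x)"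
      using n(2) by (simp add: k_def distrib_right)
    then have "cm_group_norm q (y - x) \<le> k * norm (y - x)"
      using cm_group_norm_le_sum[OF cm_group_closed(2)[OF GP_in_group[OF y(1)] GP_in_group[OF x]]] by linarith
    also have "\<dots> < d" using y(2) k by (simp add: dist_norm field_simps)
    finally show "dist (f y) (f x) < e" using d(2)[OF GP_in_group[OF y(1)]] by (simp add: dist_norm)
  qed
qed

end

context heis_bm begin

lemma holomorphic_bounded_on_GP:
  assumes f: "cm_holomorphic q f"
  obtains K where "0 \<le> K" "\<And>v. v \<in> GP \<Longrightarrow> norm v \<le> R \<Longrightarrow> cmod (f v) \<le> K"
proof -
  have "\<forall>a. \<exists>k. \<forall>v. cmod (ecoord a v) \<le> norm v * k" using bounded_linear.bounded[OF ecoord_bounded_linear] by blast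
  then obtain k where k: "\<And>a v. cmod (ecoord a v) \<le> norm v * k a" by metis
  define r where "r = (\<Sum>a\<in>idx. \<bar>R\<bar> * \<bar>k a\<bar>)"
  let ?S = "{\<Sum>a\<in>idx. z a *\<^sub>C evec a | z. \<forall>a\<in>idx. cmod (z a) \<le> r}"
  have S: "?S \<subseteq> GP" using comb_in_GP unfolding comb_def by blast
  have "compact (f ` ?S)"
    using compact_combinations[OF idx_finite, of evec r] continuous_on_subset[OF holomorphic_continuous_on_GP[OF f] S]
    by (intro compact_continuous_image)
  then have "bounded (f ` ?S)" by (rule compact_imp_bounded)
  then obtain K where K: "\<And>y. y \<in> f ` ?S \<Longrightarrow> norm y \<le> K" unfolding bounded_iff by blast
  show ?thesis
  proof (rule that[of "max K 0"])
    fix v assume v: "v \<in> GP" "norm v \<le> R"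
    have "cmod (ecoord a v) \<le> r" if a: "a \<in> idx" for a
    proof -
      have "cmod (ecoord a v) \<le> norm v * k a" by (rule k)
      also have "\<dots> \<le> norm v * \<bar>k a\<bar>" by (intro mult_left_mono) auto
      also have "\<dots> \<le> \<bar>R\<bar> * \<bar>k a\<bar>" using v(2) by (intro mult_right_mono) auto
      also have "\<dots> \<le> r" unfolding r_def using a idx_finite by (intro member_le_sum) auto
      finally show ?thesis .
    qed
    then have "v \<in> ?S" using GP_comb[OF v(1)] unfolding comb_def by (intro CollectI exI[of _ "\<lambda>a. ecoord a v"]) auto
    then have "cmod (f v) \<le> K" by (intro K imageI)
    then show "cmod (f v) \<le> max K 0" by simp
  qed simp
qed

subsection \<open>Products of increments\<close>

definition gp_inc :: "real \<Rightarrow> nat \<Rightarrow> nat \<Rightarrow> 'a \<Rightarrow> 'w \<times> 'c" where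
  "gp_inc T N i x = (PB (grid T N (Suc i)) x - PB (grid T N i) x, snd (inc (grid T N i) (grid T N (Suc i)) x))"

lemma gp_inc_comb: "gp_inc T N i x = comb (\<lambda>a. ecoord a (inc (grid T N i) (grid T N (Suc i)) x))"
  unfolding comb_ecoord gp_inc_def by (simp add: proj_minus)

lemma gp_inc_sums:
  assumes "0 < N"
  shows "(\<Sum>j<i. fst (gp_inc T N j x)) = PB (grid T N i) x - PB 0 x"
    "(\<Sum>j<i. snd (gp_inc T N j x)) = snd (inc 0 (grid T N i) x)"
  unfolding gp_inc_def using sum_lessThan_telescope[of "\<lambda>j. PB (grid T N j) x" i] sum_lessThan_telescope[of "\<lambda>j. snd (b (grid T N j) x)" i]
  by simp_all

lemma b0_proj: "AE x in M. PB 0 x = 0 \<and> snd (b 0 x) = 0"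
  using b_zero proj_minus[of 0 0] by auto

lemma quad_part_inc:
  assumes "0 < N"
  shows "AE x in M. quad_part N (\<lambda>i. gp_inc T N i x) = (0, (1/2) *\<^sub>R riemann T N x)"
  using b0_proj
  by eventually_elim (simp add: quad_part_def gp_inc_sums[OF assms] riemann_def simple_integral_def, simp add: gp_inc_def)

text \<open>The central component of the product of the increments is a Riemann sum for the Ito integral. This
  is how the group law produces the Brownian motion on the group.\<close>

lemma heis_prod_inc:
  assumes "0 < N"
  shows "AE x in M. heis_prod \<omega> N (\<lambda>i. gp_inc T N i x) = (PB T x, snd (b T x) + (1/2) *\<^sub>R riemann T N x)"
  using b0_proj
  by eventually_elim (use assms in \<open>simp add: heis_prod_def gp_inc_sums[OF assms] riemann_def simple_integral_def, simp add: gp_inc_def\<close>)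

lemma riemann_moment:
  assumes T: "0 < T" and N: "0 < N"
  shows "(\<integral>\<^sup>+x. ennreal ((norm (riemann T N x))\<^sup>2) \<partial>M) \<le> ennreal (KI * KB * T * T)"
proof -
  have "(\<integral>\<^sup>+x. ennreal ((norm (riemann T N x))\<^sup>2) \<partial>M) \<le> ennreal (KI * (\<Sum>i<N. (grid T N (Suc i) - grid T N i) * (KB * T)))"
    unfolding riemann_def simple_integral_def
  proof (rule ito_isometry)
    fix i assume i: "i < N"
    show "grid T N i \<le> grid T N (Suc i)" using T by (simp add: divide_right_mono)
    show "PB (grid T N i) \<in> borel_measurable (past M b (grid T N i))" by (rule PB_past[OF grid_simps(1)[OF T] order_refl])
    have "grid T N i \<le> T" using i N T by (simp add: field_simps)
    then show "(\<integral>\<^sup>+x. ennreal ((norm (PB (grid T N i) x))\<^sup>2) \<partial>M) \<le> ennreal (KB * T)"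
      using KB_nonneg by (intro order_trans[OF PB_moment[OF grid_simps(1)[OF T]]] ennreal_leI mult_left_mono) auto
  qed (use T KB_nonneg in auto)
  also have "(\<Sum>i<N. (grid T N (Suc i) - grid T N i) * (KB * T)) = KB * T * T"
    unfolding grid_simps(2)[OF N] using N by simp
  finally show ?thesis by (simp add: mult.assoc)
qed

text \<open>Controls the term of \<open>lin_part\<close> that contains the shift, uniformly in the grid.\<close>

lemma deterministic_integral_moment:
  assumes T: "0 < T" and N: "0 < N" and c: "\<And>i. i < N \<Longrightarrow> norm (c i) \<le> B" and B: "0 \<le> B"
  shows "(\<integral>\<^sup>+x. ennreal ((norm (\<Sum>i<N. \<omega> (c i) (PB (grid T N (Suc i)) x - PB (grid T N i) x)))\<^sup>2) \<partial>M) \<le> ennreal (KI * (B\<^sup>2 * T))"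
proof -
  have "(\<integral>\<^sup>+x. ennreal ((norm (\<Sum>i<N. \<omega> (c i) (PB (grid T N (Suc i)) x - PB (grid T N i) x)))\<^sup>2) \<partial>M)
      \<le> ennreal (KI * (\<Sum>i<N. (grid T N (Suc i) - grid T N i) * B\<^sup>2))"
  proof (rule ito_isometry[where \<eta> = "\<lambda>i x. c i"])
    fix i assume i: "i < N"
    show "grid T N i \<le> grid T N (Suc i)" using T by (simp add: divide_right_mono)
    show "(\<integral>\<^sup>+x. ennreal ((norm (c i))\<^sup>2) \<partial>M) \<le> ennreal (B\<^sup>2)"
      using c[OF i] by (simp add: BM.emeasure_space_1 power_mono ennreal_leI)
  qed (use T in auto)
  also have "(\<Sum>i<N. (grid T N (Suc i) - grid T N i) * B\<^sup>2) = B\<^sup>2 * T"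
    unfolding grid_simps(2)[OF N] using N by simp
  finally show ?thesis .
qed

lemma tail_small:
  fixes X :: "'a \<Rightarrow> real"
  assumes [measurable]: "X \<in> borel_measurable M" and e: "0 < (e::real)"
  obtains R0 where "\<And>R. R0 \<le> R \<Longrightarrow> BM.prob {x \<in> space M. R < X x} < e"
proof -
  let ?A = "\<lambda>n::nat. {x \<in> space M. real n < X x}"
  have "(\<lambda>n. BM.prob (?A n)) \<longlonglongrightarrow> BM.prob (\<Inter>n. ?A n)"
    by (rule BM.finite_Lim_measure_decseq) (auto simp: decseq_def)
  moreover have "(\<Inter>n. ?A n) = {}"
  proof (rule ccontr)
    assume "(\<Inter>n. ?A n) \<noteq> {}"
    then obtain x where x: "\<And>n. real n < X x" by auto
    obtain n where "X x < real n" using reals_Archimedean2 by blast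
    then show False using x[of n] by simp
  qed
  ultimately have "(\<lambda>n. BM.prob (?A n)) \<longlonglongrightarrow> 0" by simp
  then have "\<forall>\<^sub>F n in sequentially. BM.prob (?A n) < e" using e by (rule order_tendstoD)
  then obtain n where n: "BM.prob (?A n) < e" by (auto simp: eventually_sequentially)
  show ?thesis
  proof (rule that[of "real n"])
    fix R assume "real n \<le> R"
    then have "BM.prob {x \<in> space M. R < X x} \<le> BM.prob (?A n)" by (intro BM.finite_measure_mono) auto
    then show "BM.prob {x \<in> space M. R < X x} < e" using n by simp
  qed
qed

lemma Markov_square:
  assumes [measurable]: "X \<in> borel_measurable M" and C: "(\<integral>\<^sup>+x. ennreal ((norm (X x))\<^sup>2) \<partial>M) \<le> ennreal C" "0 \<le> C" and R: "0 < R"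
  shows "BM.prob {x \<in> space M. R < norm (X x :: 'v::{second_countable_topology, real_normed_vector})} \<le> C / R\<^sup>2"
proof -
  have "emeasure M {x \<in> space M. R < norm (X x)} \<le> emeasure M ({x \<in> space M. 1 \<le> ennreal (1 / R\<^sup>2) * ennreal ((norm (X x))\<^sup>2)} \<inter> space M)"
  proof (rule emeasure_mono)
    show "{x \<in> space M. R < norm (X x)} \<subseteq> {x \<in> space M. 1 \<le> ennreal (1 / R\<^sup>2) * ennreal ((norm (X x))\<^sup>2)} \<inter> space M"
    proof clarsimp
      fix x assume "R < norm (X x)"
      then have "R\<^sup>2 \<le> (norm (X x))\<^sup>2" using R by (intro power_mono) auto
      then have "ennreal 1 \<le> ennreal (1 / R\<^sup>2 * (norm (X x))\<^sup>2)" using R by (intro ennreal_leI) simp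
      then show "1 \<le> ennreal (1 / R\<^sup>2) * ennreal ((norm (X x))\<^sup>2)" by (subst (asm) ennreal_mult) auto
    qed
  qed measurable
  also have "\<dots> \<le> ennreal (1 / R\<^sup>2) * (\<integral>\<^sup>+x. ennreal ((norm (X x))\<^sup>2) * indicator (space M) x \<partial>M)"
    using nn_integral_Markov_inequality[of "\<lambda>x. ennreal ((norm (X x))\<^sup>2)" "space M" M "ennreal (1 / R\<^sup>2)"]
    by (simp add: Int_def conj_commute)
  also have "(\<integral>\<^sup>+x. ennreal ((norm (X x))\<^sup>2) * indicator (space M) x \<partial>M) = (\<integral>\<^sup>+x. ennreal ((norm (X x))\<^sup>2) \<partial>M)"
    by (intro nn_integral_cong) simp
  also have "ennreal (1 / R\<^sup>2) * (\<integral>\<^sup>+x. ennreal ((norm (X x))\<^sup>2) \<partial>M) \<le> ennreal (1 / R\<^sup>2) * ennreal C"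
    by (intro mult_left_mono C) auto
  also have "\<dots> = ennreal (C / R\<^sup>2)" using C by (simp add: ennreal_mult[symmetric])
  finally show ?thesis using C(2) R by (simp add: BM.emeasure_eq_measure ennreal_le_iff)
qed

subsection \<open>Coordinates\<close>

text \<open>The increments as functions of the normalized coordinates \<open>gauss_coord\<close>.\<close>

definition incv :: "real \<Rightarrow> nat \<Rightarrow> ((nat \<times> (('w \<Rightarrow>\<^sub>L real) + 'c)) \<times> bool \<Rightarrow> real) \<Rightarrow> nat \<Rightarrow> 'w \<times> 'c" where
  "incv T N y i = comb (\<lambda>a. complex_of_real (sqrt (T / (2 * real N))) * cpx y (i, a))"

lemma incv_measurable:
  assumes "i < N"
  shows "(\<lambda>y. incv T N y i) \<in> borel_measurable (PiM (({..<N} \<times> idx) \<times> UNIV) (\<lambda>_. borel))"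
proof -
  have m: "(\<lambda>y. y ((i, a), c)) \<in> borel_measurable (PiM (({..<N} \<times> idx) \<times> UNIV) (\<lambda>_. borel))" if "a \<in> idx" for a c
    using assms that by (intro measurable_component_singleton) auto
  have e: "incv T N y i = (\<Sum>a\<in>idx. (sqrt (T / (2 * real N)) * y ((i, a), False)) *\<^sub>R evec a
      + (sqrt (T / (2 * real N)) * y ((i, a), True)) *\<^sub>R (\<i> *\<^sub>C evec a))" for y
    unfolding incv_def comb_def by (intro sum.cong refl, subst scaleC_split) (simp add: cpx_def)
  show ?thesis unfolding e
    by (intro borel_measurable_sum borel_measurable_add borel_measurable_scaleR borel_measurable_times borel_measurable_const m)
qed

lemma heis_prod_measurable:
  assumes "\<And>i. i < N \<Longrightarrow> (\<lambda>y. X y i) \<in> borel_measurable P"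
  shows "(\<lambda>y. heis_prod \<omega> N (X y)) \<in> borel_measurable P" "(\<lambda>y. lin_part N Y (X y)) \<in> borel_measurable P"
    "(\<lambda>y. quad_part N (X y)) \<in> borel_measurable P"
proof -
  have f: "(\<lambda>y. fst (X y i)) \<in> borel_measurable P" "(\<lambda>y. snd (X y i)) \<in> borel_measurable P" if "i < N" for i
    using measurable_compose[OF assms[OF that] borel_measurable_continuous_onI[OF continuous_on_fst[OF continuous_on_id]]]
      measurable_compose[OF assms[OF that] borel_measurable_continuous_onI[OF continuous_on_snd[OF continuous_on_id]]] by auto
  have o: "(\<lambda>y. \<Sum>i<N. \<omega> (\<Sum>j<i. fst (X y j)) (fst (X y i))) \<in> borel_measurable P"
    using f by (intro borel_measurable_sum bounded_bilinear_measurable[OF om.bounded_bilinear_axioms]) auto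
  have o2: "(\<lambda>y. \<Sum>i<N. \<omega> (c i) (fst (X y i))) \<in> borel_measurable P" for c
    using f by (intro borel_measurable_sum bounded_bilinear_measurable[OF om.bounded_bilinear_axioms]) auto
  have sm: "(\<lambda>y. \<Sum>i<N. fst (X y i)) \<in> borel_measurable P" "(\<lambda>y. \<Sum>i<N. snd (X y i)) \<in> borel_measurable P"
    using f by (auto intro: borel_measurable_sum)
  show "(\<lambda>y. heis_prod \<omega> N (X y)) \<in> borel_measurable P" "(\<lambda>y. lin_part N Y (X y)) \<in> borel_measurable P"
    "(\<lambda>y. quad_part N (X y)) \<in> borel_measurable P"
    unfolding heis_prod_def lin_part_def quad_part_def
    by (intro borel_measurable_Pair borel_measurable_add borel_measurable_scaleR borel_measurable_const sm o o2)+
qed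

lemma heis_parts_in_GP:
  assumes "\<And>i. i < N \<Longrightarrow> X i \<in> GP"
  shows "heis_prod \<omega> N X \<in> GP" "lin_part N Y X \<in> GP" "quad_part N X \<in> GP"
  using assms subspace_sum[OF proj_subspace, of "{..<N}" "\<lambda>i. fst (X i)"] subspace_0[OF proj_subspace]
  by (auto simp: heis_prod_def lin_part_def quad_part_def mem_Times_iff)

lemma incv_in_GP: "incv T N y i \<in> GP" unfolding incv_def by (rule comb_in_GP)

lemma incv_gauss_coord:
  assumes "0 < T" "i < N"
  shows "incv T N (\<lambda>j\<in>({..<N} \<times> idx) \<times> UNIV. gauss_coord T N j x) i = gp_inc T N i x"
proof -
  have k: "sqrt (T / (2 * real N)) * sqrt (2 * real N / T) = 1"
    using assms by (simp add: real_sqrt_mult[symmetric])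
  have "complex_of_real (sqrt (T / (2 * real N))) * cpx (\<lambda>j\<in>({..<N} \<times> idx) \<times> UNIV. gauss_coord T N j x) (i, a)
      = ecoord a (inc (grid T N i) (grid T N (Suc i)) x)" if a: "a \<in> idx" for a
  proof -
    have "cpx (\<lambda>j\<in>({..<N} \<times> idx) \<times> UNIV. gauss_coord T N j x) (i, a)
        = complex_of_real (sqrt (2 * real N / T)) * ecoord a (inc (grid T N i) (grid T N (Suc i)) x)"
      using a assms by (simp add: cpx_def gauss_coord_def complex_eq_iff)
    then show ?thesis using k by (simp add: mult.assoc[symmetric] of_real_mult[symmetric] del: of_real_mult)
  qed
  then show ?thesis unfolding incv_def gp_inc_comb comb_def by (intro sum.cong) auto
qed

lemma incv_rot:
  assumes "i < N"
  shows "incv T N (\<lambda>j\<in>({..<N} \<times> idx) \<times> UNIV. rot ({..<N} \<times> idx) z y j + \<alpha> j) i = z *\<^sub>C incv T N y i + incv T N \<alpha> i"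
    "incv T N (rot ({..<N} \<times> idx) z y) i = z *\<^sub>C incv T N y i"
proof -
  let ?k = "complex_of_real (sqrt (T / (2 * real N)))"
  have r: "cpx (rot ({..<N} \<times> idx) z y) (i, a) = z * cpx y (i, a)" if "a \<in> idx" for a
    using assms that by (intro cpx_rot) auto
  have c: "cpx (\<lambda>j\<in>({..<N} \<times> idx) \<times> UNIV. rot ({..<N} \<times> idx) z y j + \<alpha> j) (i, a) = z * cpx y (i, a) + cpx \<alpha> (i, a)" if "a \<in> idx" for a
    using assms that r[OF that] by (simp add: cpx_def complex_eq_iff)
  have "incv T N (\<lambda>j\<in>({..<N} \<times> idx) \<times> UNIV. rot ({..<N} \<times> idx) z y j + \<alpha> j) i = comb (\<lambda>a. z * (?k * cpx y (i, a)) + ?k * cpx \<alpha> (i, a))"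
    unfolding incv_def comb_def by (intro sum.cong refl) (simp only: c, simp add: algebra_simps)
  then show "incv T N (\<lambda>j\<in>({..<N} \<times> idx) \<times> UNIV. rot ({..<N} \<times> idx) z y j + \<alpha> j) i = z *\<^sub>C incv T N y i + incv T N \<alpha> i"
    by (simp add: comb_linear incv_def)
  have "incv T N (rot ({..<N} \<times> idx) z y) i = comb (\<lambda>a. z * (?k * cpx y (i, a)))"
    unfolding incv_def comb_def by (intro sum.cong refl) (simp only: r, simp add: algebra_simps)
  then show "incv T N (rot ({..<N} \<times> idx) z y) i = z *\<^sub>C incv T N y i" by (simp add: comb_linear incv_def)
qed

text \<open>The shift of the normalized coordinates that translates the increment number \<open>i\<close> by \<open>Y i\<close>.\<close>

definition coords :: "real \<Rightarrow> nat \<Rightarrow> (nat \<Rightarrow> 'w \<times> 'c) \<Rightarrow> (nat \<times> (('w \<Rightarrow>\<^sub>L real) + 'c)) \<times> bool \<Rightarrow> real" where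
  "coords T N Y j = sqrt (2 * real N / T) *
     (let z = ecoord (snd (fst j)) (Y (fst (fst j))) in if snd j then Im z else Re z)"

lemma incv_coords:
  assumes "0 < T" "i < N" "Y i \<in> GP"
  shows "incv T N (coords T N Y) i = Y i"
proof -
  have k: "sqrt (T / (2 * real N)) * sqrt (2 * real N / T) = 1"
    using assms by (simp add: real_sqrt_mult[symmetric])
  have "cpx (coords T N Y) (i, a) = complex_of_real (sqrt (2 * real N / T)) * ecoord a (Y i)" for a
    by (simp add: cpx_def coords_def complex_eq_iff)
  then have "complex_of_real (sqrt (T / (2 * real N))) * cpx (coords T N Y) (i, a) = ecoord a (Y i)" for a
    using k by (simp add: mult.assoc[symmetric] of_real_mult[symmetric] del: of_real_mult)
  then show ?thesis unfolding incv_def using GP_comb[OF assms(3)] by simp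
qed

text \<open>The exponent of the Cameron--Martin density for this shift.\<close>

lemma coords_energy:
  assumes T: "0 < T" and Y: "\<And>i. i < N \<Longrightarrow> Y i \<in> GP"
  shows "(\<Sum>j\<in>({..<N} \<times> idx) \<times> UNIV. (coords T N Y j)\<^sup>2) / 2 = real N * (\<Sum>i<N. (cm_group_norm q (Y i))\<^sup>2) / T"
proof -
  have "(\<Sum>j\<in>({..<N} \<times> idx) \<times> UNIV. (coords T N Y j)\<^sup>2) = (\<Sum>p\<in>{..<N} \<times> idx. (2 * real N / T) * (cmod (ecoord (snd p) (Y (fst p))))\<^sup>2)"
    unfolding sum_times_bool using T
    by (intro sum.cong refl) (simp add: coords_def power_mult_distrib cmod_power2 distrib_left)
  also have "\<dots> = (2 * real N / T) * (\<Sum>i<N. \<Sum>a\<in>idx. (cmod (ecoord a (Y i)))\<^sup>2)"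
  proof -
    have e: "(\<Sum>i<N. \<Sum>a\<in>idx. (cmod (ecoord a (Y i)))\<^sup>2) = (\<Sum>p\<in>{..<N} \<times> idx. (cmod (ecoord (snd p) (Y (fst p))))\<^sup>2)"
      using sum.cartesian_product[of "\<lambda>i a. (cmod (ecoord a (Y i)))\<^sup>2" idx "{..<N}"] by (simp add: split_beta')
    show ?thesis unfolding e sum_distrib_left ..
  qed
  also have "(\<Sum>i<N. \<Sum>a\<in>idx. (cmod (ecoord a (Y i)))\<^sup>2) = (\<Sum>i<N. (cm_group_norm q (Y i))\<^sup>2)"
    using comb_norm GP_comb[OF Y] by (intro sum.cong refl) (metis lessThan_iff)
  finally show ?thesis by simp
qed

end

context heis_bm begin

section \<open>The bound along refining products\<close>

text \<open>A cutoff that is continuous, so that its expectations pass to the limit as the grid is refined.\<close>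

definition cutoff :: "real \<Rightarrow> 'w \<times> 'c \<Rightarrow> real" where
  "cutoff R v = max 0 (min 1 (R + 1 - norm v))"

lemma cutoff: "0 \<le> cutoff R v" "cutoff R v \<le> 1" "norm v \<le> R \<Longrightarrow> cutoff R v = 1" "R + 1 < norm v \<Longrightarrow> cutoff R v = 0"
    "continuous_on S (cutoff R)"
  by (auto simp: cutoff_def intro!: continuous_intros)

text \<open>The shift estimate for \<open>f\<close> composed with the product of the increments. The event is rotation
  invariant because the two parts are homogeneous in the increments; on it the shifted product has norm
  at most \<open>norm (heis_prod \<omega> N Y) + 2 * R\<close>, so \<open>f\<close> may be cut off outside that ball.\<close>

lemma gaussian_estimate_for_grid:
  assumes f: "cm_holomorphic q f" and T: "0 < T" and N: "0 < N"
    and Y: "\<And>i. i < N \<Longrightarrow> Y i \<in> GP" and R: "0 \<le> R"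
  shows "ennreal ((cmod (f (heis_prod \<omega> N Y)))\<^sup>2 * exp (- (real N * (\<Sum>i<N. (cm_group_norm q (Y i))\<^sup>2) / T))) *
      emeasure M {x \<in> space M. norm (lin_part N Y (\<lambda>i. gp_inc T N i x)) \<le> R \<and> norm (quad_part N (\<lambda>i. gp_inc T N i x)) \<le> R}
    \<le> (\<integral>\<^sup>+x. ennreal (cutoff (norm (heis_prod \<omega> N Y) + 2 * R) (heis_prod \<omega> N (\<lambda>i. gp_inc T N i x)) *
        (cmod (f (heis_prod \<omega> N (\<lambda>i. gp_inc T N i x))))\<^sup>2) \<partial>M)"
proof -
  let ?A = "{..<N} \<times> idx"
  let ?J = "?A \<times> (UNIV :: bool set)"
  let ?P = "PiM ?J (\<lambda>_. borel :: real measure)"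
  have A: "finite ?A" using idx_finite by simp
  define R' where "R' = norm (heis_prod \<omega> N Y) + 2 * R"
  define \<Phi> where "\<Phi> y = heis_prod \<omega> N (incv T N y)" for y
  define \<alpha> where "\<alpha> = coords T N Y"
  define U where "U = {y \<in> space ?P. norm (lin_part N Y (incv T N y)) \<le> R \<and> norm (quad_part N (incv T N y)) \<le> R}"
  define \<psi> where "\<psi> y = ennreal (cutoff R' (\<Phi> y) * (cmod (f (\<Phi> y)))\<^sup>2)" for y
  define \<xi> where "\<xi> x = (\<lambda>j\<in>?J. gauss_coord T N j x)" for x
  note pm = heis_prod_measurable[of N "incv T N", OF incv_measurable]
  have \<Phi>m[measurable]: "\<Phi> \<in> borel_measurable ?P" unfolding \<Phi>_def[abs_def] by (rule pm(1))
  have \<Phi>GP: "\<Phi> y \<in> GP" for y unfolding \<Phi>_def by (rule heis_parts_in_GP(1)) (rule incv_in_GP)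
  have fm: "f \<in> borel_measurable (restrict_space borel GP)"
    by (rule borel_measurable_continuous_on_restrict[OF holomorphic_continuous_on_GP[OF f]])
  have Fm[measurable]: "(\<lambda>y. f (\<Phi> y)) \<in> borel_measurable ?P"
    by (rule measurable_compose[OF measurable_restrict_space2[OF _ \<Phi>m] fm]) (use \<Phi>GP in auto)
  have cm[measurable]: "(\<lambda>y. cutoff R' (\<Phi> y)) \<in> borel_measurable ?P"
    by (rule measurable_compose[OF \<Phi>m borel_measurable_continuous_onI[OF cutoff(5)]])
  have \<psi>m: "\<psi> \<in> borel_measurable ?P" unfolding \<psi>_def[abs_def] by measurable
  have Um: "U \<in> sets ?P"
    unfolding U_def using pm(2)[of Y] pm(3) by measurable
  have sp: "(\<lambda>j\<in>?J. h j) \<in> space ?P" for h :: "_ \<Rightarrow> real" by (simp add: space_PiM)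
  have i\<alpha>: "incv T N \<alpha> i = Y i" if "i < N" for i unfolding \<alpha>_def by (rule incv_coords[where Y = Y, OF T that Y[OF that]])
  have shift: "\<Phi> (\<lambda>j\<in>?J. rot ?A z y j + \<alpha> j) = heis_prod \<omega> N Y + z *\<^sub>C lin_part N Y (incv T N y) + z\<^sup>2 *\<^sub>C quad_part N (incv T N y)" for z y
  proof -
    have "\<Phi> (\<lambda>j\<in>?J. rot ?A z y j + \<alpha> j) = heis_prod \<omega> N (\<lambda>i. z *\<^sub>C incv T N y i + Y i)"
      unfolding \<Phi>_def by (rule heis_prod_cong) (simp only: incv_rot i\<alpha>)
    then show ?thesis by (simp only: heis_prod_parts)
  qed
  have rot1: "(\<lambda>j\<in>?J. y j + \<alpha> j) = (\<lambda>j\<in>?J. rot ?A 1 y j + \<alpha> j)" for y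
    by (rule ext) (auto simp: rot_def cpx_def)
  have rot0: "(\<lambda>j\<in>?J. \<alpha> j) = (\<lambda>j\<in>?J. rot ?A 0 y j + \<alpha> j)" for y
    by (rule ext) (auto simp: rot_def)
  have zR: "norm (z *\<^sub>C v) = cmod z * norm v" for z and v :: "'w \<times> 'c" by (rule norm_scaleC)
  have main: "ennreal ((cmod (f (\<Phi> (\<lambda>j\<in>?J. \<alpha> j))))\<^sup>2 * exp (- (\<Sum>j\<in>?J. (\<alpha> j)\<^sup>2) / 2)) * emeasure (gauss_product ?J) U
      \<le> (\<integral>\<^sup>+y. \<psi> y \<partial>gauss_product ?J)"
  proof (rule gaussian_shift_estimate[OF A, of "\<lambda>y. f (\<Phi> y)" \<psi> U \<alpha>, OF Fm \<psi>m Um])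
    fix y z assume y: "y \<in> U" and z: "cmod z = 1"
    have "lin_part N Y (incv T N (rot ?A z y)) = z *\<^sub>C lin_part N Y (incv T N y)"
      unfolding lin_part_scale[symmetric] by (rule parts_cong) (rule incv_rot)
    moreover have "quad_part N (incv T N (rot ?A z y)) = z\<^sup>2 *\<^sub>C quad_part N (incv T N y)"
      unfolding quad_part_scale[symmetric] by (rule parts_cong) (rule incv_rot)
    moreover have "rot ?A z y \<in> space ?P" by (auto simp: rot_def space_PiM PiE_def extensional_def)
    ultimately show "rot ?A z y \<in> U" using y z by (simp add: U_def zR norm_power)
  next
    fix y assume y: "y \<in> U"
    show "(\<lambda>z. f (\<Phi> (\<lambda>j\<in>?J. rot ?A z y j + \<alpha> j))) holomorphic_on UNIV"
      unfolding shift
      using heis_parts_in_GP[of N "incv T N y"] heis_parts_in_GP(1)[of N Y] Y incv_in_GP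
      by (intro holomorphic_quadratic_curve[OF f] GP_in_group) auto
  next
    fix y assume y: "y \<in> U"
    have "\<Phi> (\<lambda>j\<in>?J. y j + \<alpha> j) = heis_prod \<omega> N Y + lin_part N Y (incv T N y) + quad_part N (incv T N y)"
      unfolding rot1[of y] shift by (simp add: scaleC_one)
    then have "norm (\<Phi> (\<lambda>j\<in>?J. y j + \<alpha> j)) \<le> norm (heis_prod \<omega> N Y) + norm (lin_part N Y (incv T N y)) + norm (quad_part N (incv T N y))"
      using norm_triangle_ineq[of "heis_prod \<omega> N Y + lin_part N Y (incv T N y)" "quad_part N (incv T N y)"]
        norm_triangle_ineq[of "heis_prod \<omega> N Y" "lin_part N Y (incv T N y)"] by simp
    then have "norm (\<Phi> (\<lambda>j\<in>?J. y j + \<alpha> j)) \<le> R'" using y by (simp add: U_def R'_def)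
    then show "ennreal ((cmod (f (\<Phi> (\<lambda>j\<in>?J. y j + \<alpha> j))))\<^sup>2) \<le> \<psi> (\<lambda>j\<in>?J. y j + \<alpha> j)"
      by (simp add: \<psi>_def cutoff(3))
  qed
  have law: "distr M ?P \<xi> = gauss_product ?J" and gm: "\<And>j. gauss_coord T N j \<in> borel_measurable M"
    unfolding \<xi>_def[abs_def] using gauss_coord_law[OF T N] by auto
  have \<xi>m: "\<xi> \<in> measurable M ?P" unfolding \<xi>_def[abs_def] using gm by measurable
  have iv: "incv T N (\<xi> x) i = gp_inc T N i x" if "i < N" for i x
    unfolding \<xi>_def by (rule incv_gauss_coord[OF T that])
  have \<Phi>\<xi>: "\<Phi> (\<xi> x) = heis_prod \<omega> N (\<lambda>i. gp_inc T N i x)" for x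
    unfolding \<Phi>_def by (rule heis_prod_cong) (rule iv)
  have \<Phi>\<alpha>: "\<Phi> (\<lambda>j\<in>?J. \<alpha> j) = heis_prod \<omega> N Y"
    unfolding rot0[of undefined] shift by (simp add: scaleC_zero)
  have "emeasure (gauss_product ?J) U = emeasure M (\<xi> -` U \<inter> space M)"
    unfolding law[symmetric] by (rule emeasure_distr[OF \<xi>m Um])
  also have "\<xi> -` U \<inter> space M = {x \<in> space M. norm (lin_part N Y (\<lambda>i. gp_inc T N i x)) \<le> R \<and> norm (quad_part N (\<lambda>i. gp_inc T N i x)) \<le> R}"
  proof -
    have "lin_part N Y (incv T N (\<xi> x)) = lin_part N Y (\<lambda>i. gp_inc T N i x)" "quad_part N (incv T N (\<xi> x)) = quad_part N (\<lambda>i. gp_inc T N i x)" for x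
      by (auto intro!: parts_cong iv)
    moreover have "\<xi> x \<in> space ?P" for x unfolding \<xi>_def by (rule sp)
    ultimately show ?thesis unfolding U_def by auto
  qed
  finally have eU: "emeasure (gauss_product ?J) U = emeasure M {x \<in> space M. norm (lin_part N Y (\<lambda>i. gp_inc T N i x)) \<le> R \<and> norm (quad_part N (\<lambda>i. gp_inc T N i x)) \<le> R}" .
  have eI: "(\<integral>\<^sup>+y. \<psi> y \<partial>gauss_product ?J) = (\<integral>\<^sup>+x. \<psi> (\<xi> x) \<partial>M)"
    unfolding law[symmetric] by (rule nn_integral_distr[OF \<xi>m]) (simp add: \<psi>m)
  have en: "(\<Sum>j\<in>?J. (\<alpha> j)\<^sup>2) / 2 = real N * (\<Sum>i<N. (cm_group_norm q (Y i))\<^sup>2) / T"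
    unfolding \<alpha>_def by (rule coords_energy[OF T Y])
  show ?thesis
    using main unfolding eU eI \<Phi>\<alpha> minus_divide_left[symmetric] en unfolding \<psi>_def \<Phi>\<xi> R'_def .
qed

lemma gp_inc_measurable: "0 < T \<Longrightarrow> gp_inc T N i \<in> borel_measurable M"
proof -
  assume T: "0 < T"
  have i: "inc (grid T N i) (grid T N (Suc i)) \<in> borel_measurable M"
    using grid_simps(1)[OF T] by (intro inc_measurable)
  show ?thesis
    unfolding gp_inc_def[abs_def]
    by (intro borel_measurable_Pair borel_measurable_diff PB_measurable grid_simps(1)[OF T]
      measurable_compose[OF i borel_measurable_continuous_onI[OF continuous_on_snd[OF continuous_on_id]]])
qed

text \<open>The events on which the linear and quadratic parts stay bounded have probability close to one,
  uniformly in the grid, because the second moments of these parts are controlled by the Ito isometry.\<close>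

lemma good_event_uniform:
  assumes T: "0 < T" and e: "0 < e" and B: "0 \<le> B"
  obtains R where "0 \<le> R"
    "\<And>N Y. 0 < N \<Longrightarrow> (\<Sum>i<N. norm (fst (Y i))) \<le> B \<Longrightarrow>
      1 - e \<le> BM.prob {x \<in> space M. norm (lin_part N Y (\<lambda>i. gp_inc T N i x)) \<le> R \<and> norm (quad_part N (\<lambda>i. gp_inc T N i x)) \<le> R}"
proof -
  define X where "X x = norm (PB T x - PB 0 x) + norm (snd (inc 0 T x))" for x
  have i: "inc 0 T \<in> borel_measurable M" using T by (intro inc_measurable) auto
  have Xm: "X \<in> borel_measurable M"
    unfolding X_def
    using PB_measurable[of T] PB_measurable[of 0] T
      measurable_compose[OF i borel_measurable_continuous_onI[OF continuous_on_snd[OF continuous_on_id]]]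
    by (intro borel_measurable_add borel_measurable_norm[THEN measurable_compose[rotated]] borel_measurable_diff) auto
  obtain R0 where R0: "\<And>R. R0 \<le> R \<Longrightarrow> BM.prob {x \<in> space M. R < X x} < e / 3"
    by (rule tail_small[OF Xm, of "e / 3"]) (use e in auto)
  define C1 where "C1 = KI * (B\<^sup>2 * T)"
  define C2 where "C2 = KI * KB * T * T"
  have C: "0 \<le> C1" "0 \<le> C2" using KI_nonneg KB_nonneg T by (simp_all add: C1_def C2_def)
  define R where "R = max 1 (max (2 * R0) (3 * (C1 + C2) / e))"
  have R: "1 \<le> R" "R0 \<le> R / 2" "3 * (C1 + C2) / e \<le> R" by (auto simp: R_def)
  have RR: "R \<le> R\<^sup>2" using R(1) by (simp add: power2_eq_square)
  have small: "C1 / R\<^sup>2 \<le> e / 3" "C2 / (2 * R)\<^sup>2 \<le> e / 3"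
  proof -
    have "3 * (C1 + C2) \<le> R * e" using R(3) e by (simp add: pos_divide_le_eq)
    also have "\<dots> \<le> R\<^sup>2 * e" using RR e by (intro mult_right_mono) auto
    finally have "3 * (C1 + C2) \<le> e * R\<^sup>2" by (simp add: mult.commute)
    then have "C1 \<le> e / 3 * R\<^sup>2" "C2 \<le> e / 3 * R\<^sup>2" using C by auto
    moreover have "e / 3 * R\<^sup>2 \<le> e / 3 * (2 * R)\<^sup>2" using e by (intro mult_left_mono) (auto simp: power_mult_distrib)
    ultimately show "C1 / R\<^sup>2 \<le> e / 3" "C2 / (2 * R)\<^sup>2 \<le> e / 3" using R(1) by (auto simp: divide_le_eq)
  qed
  show ?thesis
  proof (rule that[of R])
    show "0 \<le> R" using R by simp
    fix N :: nat and Y :: "nat \<Rightarrow> 'w \<times> 'c" assume N: "0 < N" and Y: "(\<Sum>i<N. norm (fst (Y i))) \<le> B"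
    define c where "c i = (\<Sum>j<i. fst (Y j)) - (\<Sum>j\<in>{i<..<N}. fst (Y j))" for i
    have cB: "norm (c i) \<le> B" if "i < N" for i
    proof -
      have "norm (c i) \<le> (\<Sum>j<i. norm (fst (Y j))) + (\<Sum>j\<in>{i<..<N}. norm (fst (Y j)))"
        unfolding c_def by (intro order_trans[OF norm_triangle_ineq4] add_mono norm_sum)
      also have "\<dots> = (\<Sum>j\<in>{..<i} \<union> {i<..<N}. norm (fst (Y j)))" by (rule sum.union_disjoint[symmetric]) auto
      also have "\<dots> \<le> (\<Sum>j<N. norm (fst (Y j)))" using that by (intro sum_mono2) auto
      finally show ?thesis using Y by simp
    qed
    define W where "W x = (\<Sum>i<N. \<omega> (c i) (PB (grid T N (Suc i)) x - PB (grid T N i) x))" for x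
    note PBg = PB_measurable[OF grid_simps(1)[OF T]]
    have Wm: "W \<in> borel_measurable M"
      unfolding W_def
      by (intro borel_measurable_sum bounded_bilinear_measurable[OF om.bounded_bilinear_axioms]
        borel_measurable_diff borel_measurable_const PBg)
    note rm = riemann_measurable[OF T N]
    let ?E1 = "{x \<in> space M. R / 2 < X x}" and ?E2 = "{x \<in> space M. R < norm (W x)}" and ?E3 = "{x \<in> space M. 2 * R < norm (riemann T N x)}"
    let ?G = "{x \<in> space M. norm (lin_part N Y (\<lambda>i. gp_inc T N i x)) \<le> R \<and> norm (quad_part N (\<lambda>i. gp_inc T N i x)) \<le> R}"
    have E1: "BM.prob ?E1 < e / 3" using R0 R by blast
    have E2: "BM.prob ?E2 \<le> e / 3"
    proof -
      have "(\<integral>\<^sup>+x. ennreal ((norm (W x))\<^sup>2) \<partial>M) \<le> ennreal C1"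
        unfolding W_def C1_def by (rule deterministic_integral_moment[OF T N _ B]) (rule cB)
      then have "BM.prob ?E2 \<le> C1 / R\<^sup>2" using R(1) by (intro Markov_square[OF Wm _ C(1)]) auto
      then show ?thesis using small(1) by (rule order_trans)
    qed
    have E3: "BM.prob ?E3 \<le> e / 3"
      using Markov_square[OF rm, of C2 "2 * R"] riemann_moment[OF T N] C R small by (simp add: C2_def)
    have Gm: "?G \<in> sets M"
    proof -
      have "(\<lambda>x. lin_part N Y (\<lambda>i. gp_inc T N i x)) \<in> borel_measurable M" "(\<lambda>x. quad_part N (\<lambda>i. gp_inc T N i x)) \<in> borel_measurable M"
        using heis_prod_measurable[of N "\<lambda>x i. gp_inc T N i x" M] gp_inc_measurable[OF T] by auto
      then show ?thesis by measurable
    qed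
    have Em: "?E1 \<in> sets M" "?E2 \<in> sets M" "?E3 \<in> sets M" using Xm Wm rm by measurable
    have lin: "norm (lin_part N Y (\<lambda>i. gp_inc T N i x)) \<le> X x + norm (W x) / 2" for x
    proof -
      have g: "grid T N N = T" using N by simp
      have "lin_part N Y (\<lambda>i. gp_inc T N i x) = (PB T x - PB 0 x, snd (inc 0 T x) + (1/2) *\<^sub>R W x)"
        unfolding lin_part_def gp_inc_sums[OF N] g c_def[symmetric] W_def by (simp add: gp_inc_def)
      then have "norm (lin_part N Y (\<lambda>i. gp_inc T N i x)) \<le> norm (PB T x - PB 0 x) + norm (snd (inc 0 T x) + (1/2) *\<^sub>R W x)"
        by (simp only: norm_Pair_le)
      also have "\<dots> \<le> norm (PB T x - PB 0 x) + (norm (snd (inc 0 T x)) + norm ((1/2) *\<^sub>R W x))"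
        by (intro add_left_mono norm_triangle_ineq)
      finally show ?thesis by (simp add: X_def)
    qed
    have sub: "AE x in M. x \<notin> ?E1 \<union> ?E2 \<union> ?E3 \<longrightarrow> x \<in> ?G"
      using quad_part_inc[OF N, of T] AE_space
    proof eventually_elim
      fix x assume qx: "quad_part N (\<lambda>i. gp_inc T N i x) = (0, (1/2) *\<^sub>R riemann T N x)" and x: "x \<in> space M"
      show "x \<notin> ?E1 \<union> ?E2 \<union> ?E3 \<longrightarrow> x \<in> ?G"
        using lin[of x] x by (auto simp: not_less qx)
    qed
    have "1 - e \<le> BM.prob (space M - (?E1 \<union> ?E2 \<union> ?E3))"
    proof -
      have "BM.prob (?E1 \<union> ?E2 \<union> ?E3) \<le> BM.prob ?E1 + BM.prob ?E2 + BM.prob ?E3"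
        using Em by (intro order_trans[OF measure_Un_le] add_mono measure_Un_le) auto
      then show ?thesis using E1 E2 E3 Em by (subst BM.prob_compl) auto
    qed
    also have "\<dots> \<le> BM.prob ?G"
      using sub Gm by (intro BM.finite_measure_mono_AE) auto
    finally show "1 - e \<le> BM.prob ?G" .
  qed
qed

text \<open>As the grid is refined the products of the increments converge along a subsequence almost surely to
  the Brownian motion on the group at time \<open>T\<close>. The cut off function is bounded and continuous on \<open>GP\<close>,
  so its expectation converges; afterwards the probability of the event is sent to one.\<close>

theorem holomorphic_bound_along_refining_products:
  assumes f: "cm_holomorphic q f" and T: "0 < T" and N: "\<And>m. 0 < N m" "filterlim N at_top sequentially"
    and Y: "\<And>m i. i < N m \<Longrightarrow> Y m i \<in> GP" "\<And>m. heis_prod \<omega> (N m) (Y m) = g"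
    and B: "\<And>m. (\<Sum>i<N m. norm (fst (Y m i))) \<le> B"
    and E: "\<And>m. real (N m) * (\<Sum>i<N m. (cm_group_norm q (Y m i))\<^sup>2) \<le> E m" "E \<longlonglongrightarrow> E0"
  shows "ennreal ((cmod (f g))\<^sup>2 * exp (- (E0 / T))) \<le> (\<integral>\<^sup>+v. ennreal ((cmod (f v))\<^sup>2) \<partial>heat_measure M b \<omega> proj T)"
proof -
  let ?I = "ito_integral M (past M b) \<omega> PB PB T"
  note ito = ito_integral_limit[OF T]
  let ?h = "\<lambda>x. (PB T x, snd (b T x) + (1/2) *\<^sub>R ?I x)"
  have B0: "0 \<le> B" using B[of 0] by (meson order_trans sum_nonneg norm_ge_zero)
  have fm: "f \<in> borel_measurable (restrict_space borel GP)"
    by (rule borel_measurable_continuous_on_restrict[OF holomorphic_continuous_on_GP[OF f]])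
  have PBm: "PB T \<in> borel_measurable M" using PB_measurable T by simp
  have bm: "(\<lambda>x. snd (b T x)) \<in> borel_measurable M"
    using measurable_compose[OF b_measurable borel_measurable_continuous_onI[OF continuous_on_snd[OF continuous_on_id]]] T by simp
  have GPm: "(\<lambda>x. (PB T x, snd (b T x) + (1/2) *\<^sub>R J x)) \<in> measurable M (restrict_space borel GP)" if "J \<in> borel_measurable M" for J
    using that PBm bm
    by (intro measurable_restrict_space2 borel_measurable_Pair borel_measurable_add borel_measurable_scaleR borel_measurable_const) auto
  have heat: "(\<integral>\<^sup>+v. ennreal ((cmod (f v))\<^sup>2) \<partial>heat_measure M b \<omega> proj T) = (\<integral>\<^sup>+x. ennreal ((cmod (f (?h x)))\<^sup>2) \<partial>M)"
  proof -
    have hb: "heis_brownian_motion M b \<omega> proj T = ?h" by (simp add: heis_brownian_motion_def Let_def fun_eq_iff)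
    show ?thesis unfolding heat_measure_def hb
      by (rule nn_integral_distr[OF GPm[OF ito(1)]]) (use fm in measurable)
  qed
  have bd: "ennreal ((cmod (f g))\<^sup>2 * exp (- (E0 / T)) * (1 - e)) \<le> (\<integral>\<^sup>+x. ennreal ((cmod (f (?h x)))\<^sup>2) \<partial>M)"
    if e: "0 < e" "e < 1" for e
  proof -
    obtain R where R: "0 \<le> R" and G: "\<And>N Y. 0 < N \<Longrightarrow> (\<Sum>i<N. norm (fst (Y i))) \<le> B \<Longrightarrow>
      1 - e \<le> BM.prob {x \<in> space M. norm (lin_part N Y (\<lambda>i. gp_inc T N i x)) \<le> R \<and> norm (quad_part N (\<lambda>i. gp_inc T N i x)) \<le> R}"
      using good_event_uniform[OF T e(1) B0] by blast
    define R' where "R' = norm g + 2 * R"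
    define \<theta> where "\<theta> v = cutoff R' v * (cmod (f v))\<^sup>2" for v
    obtain K where K: "0 \<le> K" "\<And>v. v \<in> GP \<Longrightarrow> norm v \<le> R' + 1 \<Longrightarrow> cmod (f v) \<le> K"
      using holomorphic_bounded_on_GP[OF f] by blast
    have \<theta>0: "0 \<le> \<theta> v" for v using cutoff(1) by (simp add: \<theta>_def)
    have \<theta>K: "\<theta> v \<le> K\<^sup>2" if "v \<in> GP" for v
    proof (cases "norm v \<le> R' + 1")
      case True
      have "\<theta> v \<le> 1 * K\<^sup>2"
        unfolding \<theta>_def using cutoff(1,2) K that True by (intro mult_mono power_mono) auto
      then show ?thesis by simp
    next
      case False
      then show ?thesis using cutoff(4)[of R' v] by (simp add: \<theta>_def)
    qed
    have \<theta>c: "continuous_on GP \<theta>"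
      unfolding \<theta>_def using holomorphic_continuous_on_GP[OF f] cutoff(5)[of GP R'] by (intro continuous_intros)
    have \<theta>m: "\<theta> \<in> borel_measurable (restrict_space borel GP)" by (rule borel_measurable_continuous_on_restrict[OF \<theta>c])
    define H where "H m x = (PB T x, snd (b T x) + (1/2) *\<^sub>R riemann T (N m) x)" for m x
    have HGP: "H m x \<in> GP" for m x by (simp add: H_def)
    have hGP: "?h x \<in> GP" for x by simp
    have Hm: "(\<lambda>x. \<theta> (H m x)) \<in> borel_measurable M" for m
      unfolding H_def by (rule measurable_compose[OF GPm[OF riemann_measurable[OF T N(1)]] \<theta>m])
    have hm: "(\<lambda>x. \<theta> (?h x)) \<in> borel_measurable M"
      by (rule measurable_compose[OF GPm[OF ito(1)] \<theta>m])
    have step: "ennreal ((cmod (f g))\<^sup>2 * exp (- (E m / T)) * (1 - e)) \<le> (\<integral>\<^sup>+x. ennreal (\<theta> (H m x)) \<partial>M)" for m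
    proof -
      let ?G = "{x \<in> space M. norm (lin_part (N m) (Y m) (\<lambda>i. gp_inc T (N m) i x)) \<le> R \<and> norm (quad_part (N m) (\<lambda>i. gp_inc T (N m) i x)) \<le> R}"
      let ?en = "real (N m) * (\<Sum>i<N m. (cm_group_norm q (Y m i))\<^sup>2)"
      have "exp (- (E m / T)) \<le> exp (- (?en / T))" using E(1)[of m] T by (simp add: divide_right_mono)
      then have "(cmod (f g))\<^sup>2 * exp (- (E m / T)) * (1 - e) \<le> (cmod (f g))\<^sup>2 * exp (- (?en / T)) * BM.prob ?G"
        using G[OF N(1) B, of m] e by (intro mult_mono mult_left_mono) auto
      then have "ennreal ((cmod (f g))\<^sup>2 * exp (- (E m / T)) * (1 - e)) \<le> ennreal ((cmod (f g))\<^sup>2 * exp (- (?en / T)) * BM.prob ?G)"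
        by (rule ennreal_leI)
      also have "\<dots> = ennreal ((cmod (f g))\<^sup>2 * exp (- (?en / T))) * emeasure M ?G"
        by (simp add: BM.emeasure_eq_measure ennreal_mult)
      also have "\<dots> \<le> (\<integral>\<^sup>+x. ennreal (\<theta> (heis_prod \<omega> (N m) (\<lambda>i. gp_inc T (N m) i x))) \<partial>M)"
        using gaussian_estimate_for_grid[where N = "N m" and Y = "Y m", OF f T N(1) Y(1) R] unfolding Y(2) \<theta>_def R'_def .
      also have "\<dots> = (\<integral>\<^sup>+x. ennreal (\<theta> (H m x)) \<partial>M)"
      proof (rule nn_integral_cong_AE)
        show "AE x in M. ennreal (\<theta> (heis_prod \<omega> (N m) (\<lambda>i. gp_inc T (N m) i x))) = ennreal (\<theta> (H m x))"
          using heis_prod_inc[OF N(1)[of m], where T = T] by eventually_elim (simp only: H_def)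
      qed
      finally show ?thesis .
    qed
    define D where "D m x = (norm (riemann T (N m) x - ?I x))\<^sup>2" for m x
    have D0: "0 \<le> D m x" for m x by (simp add: D_def)
    have Dm: "D m \<in> borel_measurable M" for m
      unfolding D_def[abs_def] using riemann_measurable[OF T N(1)] ito(1) by measurable
    have Db: "(\<integral>\<^sup>+x. ennreal (D m x) \<partial>M) \<le> ennreal (KR T / real (N m))" for m
      unfolding D_def by (rule ito(2)[OF N(1)])
    have Di: "integrable M (D m)" for m
      using Dm Db[of m] by (intro integrableI_nonneg) (auto simp: D_def le_less_trans[OF _ ennreal_less_top])
    have "(\<lambda>m. \<integral>x. norm (D m x) \<partial>M) \<longlonglongrightarrow> 0"
    proof (rule tendsto_sandwich[of "\<lambda>_. 0"])
      have "(\<integral>x. norm (D m x) \<partial>M) \<le> KR T / real (N m)" for m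
      proof -
        have "ennreal (\<integral>x. norm (D m x) \<partial>M) = (\<integral>\<^sup>+x. ennreal (D m x) \<partial>M)"
          using nn_integral_eq_integral[OF Di[of m]] D0 by simp
        then show ?thesis using Db[of m] KR_nonneg[OF T]
          by (subst ennreal_le_iff[symmetric]) (auto intro: divide_nonneg_nonneg)
      qed
      then show "\<forall>\<^sub>F m in sequentially. (\<integral>x. norm (D m x) \<partial>M) \<le> KR T / real (N m)" by simp
      have "filterlim (\<lambda>m. real (N m)) at_top sequentially"
        using filterlim_compose[OF filterlim_real_sequentially N(2)] .
      then show "(\<lambda>m. KR T / real (N m)) \<longlonglongrightarrow> 0"
        by (intro tendsto_divide_0[OF tendsto_const] filterlim_at_top_imp_at_infinity)
    qed auto
    from tendsto_L1_AE_subseq[OF Di this] obtain r where r: "strict_mono r" "AE x in M. (\<lambda>k. D (r k) x) \<longlonglongrightarrow> 0" by auto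
    have lim: "(\<lambda>k. \<integral>\<^sup>+x. ennreal (\<theta> (H (r k) x)) \<partial>M) \<longlonglongrightarrow> (\<integral>\<^sup>+x. ennreal (\<theta> (?h x)) \<partial>M)"
    proof (rule nn_integral_dominated_convergence[where w = "\<lambda>_. ennreal (K\<^sup>2)"])
      show "AE x in M. (\<lambda>k. ennreal (\<theta> (H (r k) x))) \<longlonglongrightarrow> ennreal (\<theta> (?h x))"
        using r(2)
      proof eventually_elim
        fix x assume "(\<lambda>k. D (r k) x) \<longlonglongrightarrow> 0"
        then have "(\<lambda>k. sqrt (D (r k) x)) \<longlonglongrightarrow> sqrt 0" by (rule tendsto_real_sqrt)
        then have "(\<lambda>k. norm (riemann T (N (r k)) x - ?I x)) \<longlonglongrightarrow> 0" by (simp add: D_def)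
        then have "(\<lambda>k. riemann T (N (r k)) x) \<longlonglongrightarrow> ?I x" by (simp add: tendsto_norm_zero_iff LIM_zero_iff)
        then have "(\<lambda>k. H (r k) x) \<longlonglongrightarrow> ?h x" unfolding H_def by (intro tendsto_intros)
        then have "(\<lambda>k. \<theta> (H (r k) x)) \<longlonglongrightarrow> \<theta> (?h x)"
          by (rule continuous_on_tendsto_compose[OF \<theta>c _ hGP]) (use HGP in \<open>auto intro: always_eventually\<close>)
        then show "(\<lambda>k. ennreal (\<theta> (H (r k) x))) \<longlonglongrightarrow> ennreal (\<theta> (?h x))" by (rule tendsto_ennrealI)
      qed
      show "AE x in M. ennreal (\<theta> (H (r k) x)) \<le> ennreal (K\<^sup>2)" for k
        using \<theta>K HGP by (intro AE_I2 ennreal_leI) blast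
      show "(\<integral>\<^sup>+x. ennreal (K\<^sup>2) \<partial>M) < \<infinity>" by (simp add: BM.emeasure_space_1)
    qed (use Hm hm in measurable)
    have "(\<lambda>m. ennreal ((cmod (f g))\<^sup>2 * exp (- (E m / T)) * (1 - e))) \<longlonglongrightarrow> ennreal ((cmod (f g))\<^sup>2 * exp (- (E0 / T)) * (1 - e))"
      using E(2) T by (intro tendsto_ennrealI tendsto_intros) auto
    from LIMSEQ_subseq_LIMSEQ[OF this r(1)]
    have "(\<lambda>k. ennreal ((cmod (f g))\<^sup>2 * exp (- (E (r k) / T)) * (1 - e))) \<longlonglongrightarrow> ennreal ((cmod (f g))\<^sup>2 * exp (- (E0 / T)) * (1 - e))"
      by (simp add: o_def)
    then have "ennreal ((cmod (f g))\<^sup>2 * exp (- (E0 / T)) * (1 - e)) \<le> (\<integral>\<^sup>+x. ennreal (\<theta> (?h x)) \<partial>M)"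
      using lim step by (intro LIMSEQ_le[OF _ lim]) auto
    also have "\<dots> \<le> (\<integral>\<^sup>+x. ennreal ((cmod (f (?h x)))\<^sup>2) \<partial>M)"
    proof (intro nn_integral_mono ennreal_leI)
      fix x
      show "\<theta> (?h x) \<le> (cmod (f (?h x)))\<^sup>2"
        unfolding \<theta>_def using mult_right_mono[OF cutoff(2)[of R' "?h x"], of "(cmod (f (?h x)))\<^sup>2"] by simp
    qed
    finally show ?thesis .
  qed
  have le: "ennreal ((cmod (f g))\<^sup>2 * exp (- (E0 / T)) * (1 - 1 / (real n + 2))) \<le> (\<integral>\<^sup>+x. ennreal ((cmod (f (?h x)))\<^sup>2) \<partial>M)" for n :: nat
    by (rule bd) auto
  have "(\<lambda>n. 1 / (real n + 2)) \<longlonglongrightarrow> 0"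
    using LIMSEQ_ignore_initial_segment[OF lim_1_over_n, of 2] by (simp add: add.commute)
  then have "(\<lambda>n. ennreal ((cmod (f g))\<^sup>2 * exp (- (E0 / T)) * (1 - 1 / (real n + 2)))) \<longlonglongrightarrow> ennreal ((cmod (f g))\<^sup>2 * exp (- (E0 / T)) * (1 - 0))"
    by (intro tendsto_ennrealI tendsto_intros)
  then have "ennreal ((cmod (f g))\<^sup>2 * exp (- (E0 / T)) * (1 - 0)) \<le> (\<integral>\<^sup>+x. ennreal ((cmod (f (?h x)))\<^sup>2) \<partial>M)"
    by (rule LIMSEQ_le_const2) (use le in auto)
  then show ?thesis unfolding heat by simp
qed

end

context heis begin

section \<open>Pointwise bounds at products\<close>

text \<open>Multiples of one element commute, so \<open>x\<close> is the \<open>k\<close>-th power of \<open>x /\<^sub>R k\<close>.\<close>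

lemma heis_list_split:
  assumes "\<And>x. x \<in> set xs \<Longrightarrow> 0 < k x"
  shows "heis_list \<omega> (concat (map (\<lambda>x. replicate (k x) (x /\<^sub>R real (k x))) xs)) = heis_list \<omega> xs"
  using assms
proof (induction xs)
  case (Cons x xs)
  then show ?case by (simp add: heis_list_append heis_list_Cons heis_list_replicate)
qed simp

end

lemma sum_list_split:
  "(\<Sum>y\<leftarrow>concat (map (\<lambda>x. replicate (k x) (h x)) xs). \<phi> y) = (\<Sum>x\<leftarrow>xs. real (k x) * (\<phi> (h x) :: real))"
  by (induction xs) (simp_all add: sum_list_replicate)

lemma sum_nth: "(\<Sum>i<length xs. \<phi> (xs ! i)) = (\<Sum>x\<leftarrow>xs. \<phi> x)"
  by (simp add: sum_list_sum_nth atLeast0LessThan)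

context heis_bm begin

text \<open>By the Cauchy--Schwarz inequality \<open>N * (\<Sum>i<N. \<bar>Y i\<bar>\<^sup>2)\<close> is at least \<open>(\<Sum>i<N. \<bar>Y i\<bar>)\<^sup>2\<close>, with equality
  for pieces of equal norm. Each factor \<open>x\<close> is therefore split into a number of pieces proportional to
  its norm, and the energy tends to \<open>L\<^sup>2\<close> as the pieces get smaller.\<close>

lemma holomorphic_bound_at_product:
  assumes f: "cm_holomorphic q f" and T: "0 < T"
    and xs: "set xs \<subseteq> GP" and L: "(\<Sum>x\<leftarrow>xs. cm_group_norm q x) < L"
  shows "ennreal ((cmod (f (heis_list \<omega> xs)))\<^sup>2 * exp (- (L\<^sup>2 / T))) \<le> (\<integral>\<^sup>+v. ennreal ((cmod (f v))\<^sup>2) \<partial>heat_measure M b \<omega> proj T)"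
proof -
  let ?n = "cm_group_norm q"
  \<comment> \<open>The additional factor makes the list nonempty, so that the number of pieces tends to infinity.\<close>
  define ys where "ys = 0 # xs"
  have z: "(0 :: 'w \<times> 'c) \<in> GP" using comb_in_GP[of "\<lambda>_. 0"] by (simp add: comb_def scaleC_zero)
  have ys: "ys \<noteq> []" "set ys \<subseteq> GP" "heis_list \<omega> ys = heis_list \<omega> xs"
    using xs z by (auto simp: ys_def heis_list_Cons heis_mult_unit)
  have yn: "0 \<le> ?n y" if "y \<in> set ys" for y using cm_group_norm_nonneg[OF GP_in_group] that ys(2) by blast
  have n0: "?n (0 :: 'w \<times> 'c) = 0" using cm_group_norm_scaleR[OF GP_in_group[OF z], of 0] by simp
  \<comment> \<open>The margin makes the weights of factors of norm zero positive and their sum equal to \<open>L\<close>.\<close>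
  define \<delta> where "\<delta> = (L - (\<Sum>x\<leftarrow>ys. ?n x)) / real (length ys)"
  have d: "0 < \<delta>" using L ys(1) by (simp add: \<delta>_def ys_def n0)
  define w :: "'w \<times> 'c \<Rightarrow> real" where "w x = ?n x + \<delta>" for x
  have w: "0 < w y" "?n y \<le> w y" if "y \<in> set ys" for y using yn[OF that] d by (auto simp: w_def)
  have sw: "(\<Sum>x\<leftarrow>ys. w x) = L"
    unfolding w_def using ys(1) by (simp add: sum_list_addf sum_list_triv \<delta>_def)
  have L0: "0 < L" 
  proof -
    have "0 \<le> (\<Sum>x\<leftarrow>ys. ?n x)" using yn by (intro sum_list_nonneg) (auto simp del: split_paired_All)
    then show ?thesis using L by (simp add: ys_def n0)
  qed
  define k where "k m x = nat \<lfloor>real (Suc m) * w x / L\<rfloor> + 1" for m x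
  have k: "0 < k m x" "real (Suc m) * w x / L \<le> real (k m x)" "real (k m x) \<le> real (Suc m) * w x / L + 1" if "x \<in> set ys" for m x
  proof -
    have "0 \<le> real (Suc m) * w x / L" using w(1)[OF that] L0 by simp
    then show "0 < k m x" "real (Suc m) * w x / L \<le> real (k m x)" "real (k m x) \<le> real (Suc m) * w x / L + 1"
      unfolding k_def by linarith+
  qed
  define zs where "zs m = concat (map (\<lambda>x. replicate (k m x) (x /\<^sub>R real (k m x))) ys)" for m
  define N where "N m = length (zs m)" for m
  note split = sum_list_split[where h = "\<lambda>x. x /\<^sub>R real (k m x)" and k = "k m" and xs = ys for m, folded zs_def]
  have N: "real (N m) = (\<Sum>x\<leftarrow>ys. real (k m x))" for m
    using split[where \<phi> = "\<lambda>_. 1"] by (simp add: N_def sum_list_triv)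
  have lin: "(\<Sum>x\<leftarrow>ys. real (Suc m) * w x / L) = real (Suc m)" for m
  proof -
    have "(\<Sum>x\<leftarrow>ys. real (Suc m) * w x / L) = (\<Sum>x\<leftarrow>ys. (real (Suc m) / L) * w x)" by (simp add: field_simps)
    also have "\<dots> = real (Suc m)" unfolding sum_list_const_mult sw using L0 by simp
    finally show ?thesis .
  qed
  have Nlo: "real (Suc m) \<le> real (N m)" for m
    unfolding N by (subst lin[symmetric]) (intro sum_list_mono k(2))
  have Nhi: "real (N m) \<le> real (Suc m) + real (length ys)" for m
  proof -
    have "real (N m) \<le> (\<Sum>x\<leftarrow>ys. real (Suc m) * w x / L + 1)" unfolding N by (intro sum_list_mono k(3))
    also have "\<dots> = real (Suc m) + real (length ys)" unfolding sum_list_addf lin by (simp add: sum_list_triv)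
    finally show ?thesis .
  qed
  define E where "E m = (1 + real (length ys) / real (Suc m)) * L\<^sup>2" for m
  have zGP: "zs m ! i \<in> GP" if "i < N m" for m i
  proof -
    have "zs m ! i \<in> set (zs m)" using that by (simp add: N_def)
    then obtain x where x: "x \<in> set ys" "zs m ! i = x /\<^sub>R real (k m x)" by (auto simp: zs_def)
    obtain u where u: "fst x = proj u" using x(1) ys(2) by auto
    have "fst (x /\<^sub>R real (k m x)) = proj (complex_of_real (inverse (real (k m x))) *\<^sub>C u)"
      unfolding proj_linear by (simp only: u scaleC_of_real fst_scaleR)
    then show ?thesis unfolding x(2) by (simp add: mem_Times_iff)
  qed
  show ?thesis
    unfolding ys(3)[symmetric]
  proof (rule holomorphic_bound_along_refining_products[OF f T, of N "\<lambda>m i. zs m ! i"])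
    show "0 < N m" for m using Nlo[of m] by simp
    have "m \<le> N m" for m using Nlo[of m] by simp
    then show "filterlim N at_top sequentially" by (intro filterlim_at_top_mono[OF filterlim_ident]) auto
    show "zs m ! i \<in> GP" if "i < N m" for m i by (rule zGP[OF that])
    show "heis_prod \<omega> (N m) (\<lambda>i. zs m ! i) = heis_list \<omega> ys" for m
      using heis_list_eq_prod[of \<omega> "zs m"] heis_list_split[of ys "k m"] k(1) by (simp add: N_def zs_def)
    show "(\<Sum>i<N m. norm (fst (zs m ! i))) \<le> (\<Sum>x\<leftarrow>ys. norm (fst x))" for m
    proof -
      have "(\<Sum>i<N m. norm (fst (zs m ! i))) = (\<Sum>x\<leftarrow>ys. real (k m x) * norm (fst (x /\<^sub>R real (k m x))))"
        unfolding N_def sum_nth[where \<phi> = "\<lambda>y. norm (fst y)"] split[where \<phi> = "\<lambda>y. norm (fst y)"] ..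
      also have "\<dots> \<le> (\<Sum>x\<leftarrow>ys. norm (fst x))"
      proof (rule sum_list_mono)
        fix x assume "x \<in> set ys"
        from k(1)[OF this, of m] show "real (k m x) * norm (fst (x /\<^sub>R real (k m x))) \<le> norm (fst x)"
          by (simp add: mult.assoc[symmetric])
      qed
      finally show ?thesis .
    qed
    show "real (N m) * (\<Sum>i<N m. (?n (zs m ! i))\<^sup>2) \<le> E m" for m
    proof -
      have "(\<Sum>i<N m. (?n (zs m ! i))\<^sup>2) = (\<Sum>x\<leftarrow>ys. real (k m x) * (?n (x /\<^sub>R real (k m x)))\<^sup>2)"
        unfolding N_def sum_nth[where \<phi> = "\<lambda>y. (?n y)\<^sup>2"] split[where \<phi> = "\<lambda>y. (?n y)\<^sup>2"] ..
      also have "\<dots> \<le> (\<Sum>x\<leftarrow>ys. (L / real (Suc m)) * w x)"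
      proof (rule sum_list_mono)
        fix x assume x: "x \<in> set ys"
        have xg: "x \<in> cm_group q" using x ys(2) GP_in_group by blast
        have k0: "0 < real (k m x)" using k(1)[OF x] by simp
        have wk: "w x / real (k m x) \<le> L / real (Suc m)"
          using k(2)[OF x, of m] k0 L0 by (simp add: field_simps)
        have "real (k m x) * (?n (x /\<^sub>R real (k m x)))\<^sup>2 = ?n x * (?n x / real (k m x))"
          using k0 by (simp add: cm_group_norm_scaleR[OF xg] power2_eq_square field_simps)
        also have "\<dots> \<le> w x * (w x / real (k m x))"
          using w[OF x] yn[OF x] k0 by (intro mult_mono divide_right_mono) auto
        also have "\<dots> \<le> w x * (L / real (Suc m))" using wk w[OF x] by (intro mult_left_mono) auto
        finally show "real (k m x) * (?n (x /\<^sub>R real (k m x)))\<^sup>2 \<le> (L / real (Suc m)) * w x" by (simp add: mult.commute)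
      qed
      also have "\<dots> = L\<^sup>2 / real (Suc m)" unfolding sum_list_const_mult sw by (simp add: power2_eq_square)
      finally have "real (N m) * (\<Sum>i<N m. (?n (zs m ! i))\<^sup>2) \<le> (real (Suc m) + real (length ys)) * (L\<^sup>2 / real (Suc m))"
        using Nhi by (intro mult_mono) (auto intro: sum_nonneg)
      also have "\<dots> = E m" unfolding E_def by (simp add: field_simps del: of_nat_Suc)
      finally show ?thesis .
    qed
    have "(\<lambda>m. real (length ys) * (1 / real (Suc m))) \<longlonglongrightarrow> real (length ys) * 0"
      by (intro tendsto_intros) (rule LIMSEQ_Suc[OF lim_1_over_n])
    then have "(\<lambda>m. real (length ys) / real (Suc m)) \<longlonglongrightarrow> 0" by simp
    then have "E \<longlonglongrightarrow> (1 + 0) * L\<^sup>2" unfolding E_def by (intro tendsto_intros)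
    then show "E \<longlonglongrightarrow> L\<^sup>2" by simp
  qed
qed

lemma pointwise_bound_at_product:
  assumes f: "f \<in> hol_L2 q \<omega> M b T" and T: "0 < T"
    and xs: "set xs \<subseteq> GP" and L: "(\<Sum>x\<leftarrow>xs. cm_group_norm q x) < L"
  shows "cmod (f (heis_list \<omega> xs)) \<le> enn2real (hol_L2_norm q \<omega> M b T f) * exp (L\<^sup>2 / (2 * T))"
proof -
  let ?N = "hol_L2_norm q \<omega> M b T f" and ?a = "cmod (f (heis_list \<omega> xs))"
  define I where "I = (\<integral>\<^sup>+v. ennreal ((cmod (f v))\<^sup>2) \<partial>heat_measure M b \<omega> proj T)"
  have fh: "cm_holomorphic q f" and fin: "?N < \<infinity>" using f by (auto simp: hol_L2_def)
  have le: "L2_ennnorm (heat_measure M b \<omega> proj T) f \<le> ?N"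
    unfolding hol_L2_norm_def by (rule SUP_upper[OF proj_in_cm_proj])
  then have I: "I \<noteq> \<infinity>" "ennreal (sqrt (enn2real I)) \<le> ?N"
    using fin by (auto simp: L2_ennnorm_def Let_def I_def split: if_splits)
  have "sqrt (enn2real I) \<le> enn2real ?N"
    using enn2real_mono[OF I(2)] fin by simp
  moreover have "?a\<^sup>2 * exp (- (L\<^sup>2 / T)) \<le> enn2real I"
    using enn2real_mono[OF holomorphic_bound_at_product[OF fh T xs L, folded I_def]] I(1) by (simp add: less_top)
  moreover have "?a\<^sup>2 * exp (- (L\<^sup>2 / T)) = (?a * exp (- (L\<^sup>2 / (2 * T))))\<^sup>2"
    using T by (simp add: power_mult_distrib exp_double[symmetric] field_simps)
  ultimately have "?a * exp (- (L\<^sup>2 / (2 * T))) \<le> enn2real ?N"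
    using real_le_rsqrt[of "?a * exp (- (L\<^sup>2 / (2 * T)))" "enn2real I"] by linarith
  then have "?a * exp (- (L\<^sup>2 / (2 * T))) * exp (L\<^sup>2 / (2 * T)) \<le> enn2real ?N * exp (L\<^sup>2 / (2 * T))"
    by (intro mult_right_mono) auto
  then show ?thesis unfolding mult.assoc exp_add[symmetric] by simp
qed

end

locale wiener_heis = cwiener \<mu> q + heis \<omega>
  for \<mu> :: "'w::{complex_normed_vector, banach, second_countable_topology} measure" and q
    and \<omega> :: "'w \<Rightarrow> 'w \<Rightarrow> 'c::fin_dim_complex_inner_space"
begin

abbreviation gnorm :: "'w \<times> 'c \<Rightarrow> real" where "gnorm \<equiv> cm_group_norm q"

lemma gnorm_zero: "gnorm 0 = 0"
  using cm_group_norm_scaleR[of "0 :: 'w \<times> 'c" 0] by (simp add: cm_groupI cm_zero)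

lemma gnorm_snd_shift:
  assumes "x \<in> cm_group q"
  shows "gnorm (x + (0, c)) \<le> gnorm x + norm c" and "(0, c) \<in> cm_group q"
proof -
  show g: "(0, c) \<in> cm_group q" by (simp add: cm_groupI cm_zero)
  have "gnorm (0, c) \<le> norm c" using cm_group_norm_le_sum[OF g] by (simp add: cm_zero)
  then show "gnorm (x + (0, c)) \<le> gnorm x + norm c" using cm_group_norm_triangle[OF assms g] by simp
qed

lemma norm_fst_le_gnorm: "x \<in> cm_group q \<Longrightarrow> norm (fst x) \<le> qC * gnorm x"
  using norm_le_cm_norm[OF cm_groupD] cm_norm_le_group_norm(1)[of x] qC_pos
  by (meson less_imp_le mult_left_mono order_trans)

lemma om_bound:
  obtains C where "0 < C" "\<And>x y :: 'w \<times> 'c. x \<in> cm_group q \<Longrightarrow> y \<in> cm_group q \<Longrightarrow> norm (\<omega> (fst x) (fst y)) \<le> C * gnorm x * gnorm y"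
proof -
  obtain K where K: "0 < K" "\<And>x y. norm (\<omega> x y) \<le> norm x * norm y * K" using om.pos_bounded by blast
  show ?thesis
  proof (rule that[of "K * qC\<^sup>2"])
    show "0 < K * qC\<^sup>2" using K(1) qC_pos by simp
    fix x y :: "'w \<times> 'c" assume xy: "x \<in> cm_group q" "y \<in> cm_group q"
    have "norm (\<omega> (fst x) (fst y)) \<le> norm (fst x) * norm (fst y) * K" by (rule K)
    also have "\<dots> \<le> (qC * gnorm x) * (qC * gnorm y) * K"
      using K(1) norm_fst_le_gnorm[OF xy(1)] norm_fst_le_gnorm[OF xy(2)] cm_group_norm_nonneg[OF xy(1)] qC_pos
      by (intro mult_right_mono mult_mono) auto
    finally show "norm (\<omega> (fst x) (fst y)) \<le> K * qC\<^sup>2 * gnorm x * gnorm y" by (simp add: power2_eq_square mult_ac)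
  qed
qed

lemma heis_mult_in_group: "x \<in> cm_group q \<Longrightarrow> y \<in> cm_group q \<Longrightarrow> heis_mult \<omega> x y \<in> cm_group q"
  by (auto intro!: cm_groupI cm_add dest: cm_groupD simp: heis_mult_def)

lemma heis_list_in_group: "set xs \<subseteq> cm_group q \<Longrightarrow> heis_list \<omega> xs \<in> cm_group q"
  by (induction xs) (simp_all add: heis_list_Cons heis_mult_in_group, simp add: heis_list_def cm_groupI cm_zero)

lemma rep_in_group: "range rep \<times> UNIV \<subseteq> cm_group q" using rep_in_cm by (auto intro: cm_groupI)

text \<open>The vectors \<open>rep u\<close> are dense, and the group law is continuous.\<close>

lemma heis_list_approx:
  assumes "set xs \<subseteq> cm_group q" "0 < e"
  shows "\<exists>ys. set ys \<subseteq> range rep \<times> UNIV \<and> gnorm (heis_list \<omega> ys - heis_list \<omega> xs) < e \<and>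
    (\<Sum>y\<leftarrow>ys. gnorm y) < (\<Sum>x\<leftarrow>xs. gnorm x) + e"
  using assms
proof (induction xs arbitrary: e)
  case Nil
  then show ?case by (intro exI[of _ "[]"]) (simp add: gnorm_zero)
next
  case (Cons x xs)
  obtain C where C: "0 < C" "\<And>x y :: 'w \<times> 'c. x \<in> cm_group q \<Longrightarrow> y \<in> cm_group q \<Longrightarrow> norm (\<omega> (fst x) (fst y)) \<le> C * gnorm x * gnorm y"
    by (rule om_bound) blast
  define g where "g = heis_list \<omega> xs"
  have x: "x \<in> cm_group q" and xs: "set xs \<subseteq> cm_group q" using Cons.prems by auto
  have g: "g \<in> cm_group q" unfolding g_def by (rule heis_list_in_group[OF xs])
  define S where "S = 2 + C * (gnorm x + gnorm g + 1)"
  have xg0: "0 \<le> gnorm x" "0 \<le> gnorm g" using cm_group_norm_nonneg[OF x] cm_group_norm_nonneg[OF g] by simp_all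
  have S: "2 \<le> S" using C(1) xg0 by (simp add: S_def)
  define d where "d = min 1 (e / S)"
  have d: "0 < d" "d \<le> 1" "S * d \<le> e"
    using S Cons.prems by (auto simp: d_def min_def field_simps)
  obtain ys where ys: "set ys \<subseteq> range rep \<times> UNIV" "gnorm (heis_list \<omega> ys - g) < d" "(\<Sum>y\<leftarrow>ys. gnorm y) < (\<Sum>x\<leftarrow>xs. gnorm x) + d"
    using Cons.IH[OF xs d(1)] unfolding g_def by blast
  obtain u where u: "cm_norm q (fst x - rep u) < d" by (rule rep_dense[OF cm_groupD[OF x] d(1)])
  define y where "y = (rep u, snd x)"
  define h where "h = heis_list \<omega> ys"
  have y: "y \<in> cm_group q" by (simp add: y_def cm_groupI rep_in_cm)
  have h: "h \<in> cm_group q" unfolding h_def using ys(1) rep_in_group by (intro heis_list_in_group) (rule order_trans)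
  have yx: "y - x \<in> cm_group q" "h - g \<in> cm_group q" "x - y \<in> cm_group q" by (intro cm_group_closed(2) x y g h)+
  have "gnorm (x - y) < d"
    using u cm_group_norm_le_sum[OF yx(3)] by (simp add: y_def)
  then have nyx: "gnorm (y - x) < d" using cm_group_norm_minus[OF yx(3)] by simp
  have nh: "gnorm (h - g) < d" using ys(2) by (simp add: h_def)
  have ny: "gnorm y \<le> gnorm x + gnorm (y - x)" using cm_group_norm_triangle[OF x yx(1)] by simp
  have nhg: "gnorm h \<le> gnorm g + gnorm (h - g)" using cm_group_norm_triangle[OF g yx(2)] by simp
  let ?r = "\<omega> (fst (y - x)) (fst h) + \<omega> (fst x) (fst (h - g))"
  have eq: "heis_mult \<omega> y h - heis_mult \<omega> x g = ((y - x) + (h - g)) + (0, (1/2) *\<^sub>R ?r)"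
    by (simp add: heis_mult_def prod_eq_iff om.diff_left om.diff_right scaleR_diff_right)
  have "norm ?r \<le> C * gnorm (y - x) * gnorm h + C * gnorm x * gnorm (h - g)"
    by (intro norm_triangle_mono C(2) yx x h)
  also have "\<dots> \<le> C * d * (gnorm g + 1) + C * gnorm x * d"
    using nyx nh nhg d C(1) xg0 cm_group_norm_nonneg[OF yx(1)] cm_group_norm_nonneg[OF yx(2)] cm_group_norm_nonneg[OF h]
    by (intro add_mono mult_mono mult_left_mono) auto
  also have "\<dots> = (S - 2) * d" by (simp add: S_def algebra_simps)
  finally have r: "norm ?r \<le> (S - 2) * d" .
  have "gnorm (heis_mult \<omega> y h - heis_mult \<omega> x g) \<le> gnorm ((y - x) + (h - g)) + norm ((1/2) *\<^sub>R ?r)"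
    unfolding eq by (rule gnorm_snd_shift(1)) (rule cm_group_closed(1)[OF yx(1,2)])
  also have "\<dots> < (d + d) + (S - 2) * d"
  proof -
    have "0 \<le> (S - 2) * d" using S d(1) by simp
    moreover have "norm ((1/2) *\<^sub>R ?r) = norm ?r / 2" by simp
    ultimately show ?thesis using cm_group_norm_triangle[OF yx(1,2)] nyx nh r by linarith
  qed
  also have "\<dots> \<le> e" using d(3) by (simp add: algebra_simps)
  finally have 1: "gnorm (heis_list \<omega> (y # ys) - heis_list \<omega> (x # xs)) < e" by (simp add: heis_list_Cons h_def g_def)
  have "2 * d \<le> S * d" using S d(1) by (intro mult_right_mono) auto
  then have 2: "(\<Sum>z\<leftarrow>y # ys. gnorm z) < (\<Sum>z\<leftarrow>x # xs. gnorm z) + e" using ny nyx ys(3) d(3) by simp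
  show ?case using 1 2 ys(1) by (intro exI[of _ "y # ys"]) (simp add: y_def)
qed

text \<open>The approximating factors lie in a common finite dimensional subgroup, where the preceding bound
  applies; continuity of \<open>f\<close> removes the approximation.\<close>

lemma pointwise_bound_at_group_product:
  assumes bm: "cm_brownian_motion q M b" and f: "f \<in> hol_L2 q \<omega> M b T" and T: "0 < T"
    and xs: "set xs \<subseteq> cm_group q" and L: "(\<Sum>x\<leftarrow>xs. gnorm x) < L"
  shows "cmod (f (heis_list \<omega> xs)) \<le> enn2real (hol_L2_norm q \<omega> M b T f) * exp (L\<^sup>2 / (2 * T))"
proof (rule field_le_epsilon)
  fix e :: real assume e: "0 < e"
  have fh: "cm_holomorphic q f" using f by (simp add: hol_L2_def)
  obtain d where d: "0 < d" "\<And>y. y \<in> cm_group q \<Longrightarrow> gnorm (y - heis_list \<omega> xs) < d \<Longrightarrow> cmod (f y - f (heis_list \<omega> xs)) < e"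
    by (rule holomorphic_continuous[OF fh heis_list_in_group[OF xs] e]) blast
  have "0 < min d (L - (\<Sum>x\<leftarrow>xs. gnorm x))" using d(1) L by simp
  from heis_list_approx[OF xs this] obtain ys where ys: "set ys \<subseteq> range rep \<times> UNIV"
    "gnorm (heis_list \<omega> ys - heis_list \<omega> xs) < d" "(\<Sum>y\<leftarrow>ys. gnorm y) < L" by auto
  obtain U where U: "finite U" "fst ` set ys = rep ` U"
  proof -
    have "fst ` set ys \<subseteq> range rep" using ys(1) by auto
    from finite_subset_image[OF _ this] show ?thesis using that by auto
  qed
  obtain E1 and E2 :: "'c set" where F: "frame \<mu> q E1 E2" "\<And>u. u \<in> U \<Longrightarrow> \<exists>z. rep u = (\<Sum>e\<in>E1. z e *\<^sub>C rep e)"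
    by (rule frame_containing[OF U(1)]) blast
  interpret heis_bm \<mu> q E1 E2 \<omega> M b
    by (intro heis_bm.intro F heis_axioms heis_bm_axioms.intro bm)
  have repU: "rep u \<in> range proj" if "u \<in> U" for u
  proof -
    from F(2)[OF that] obtain z where "rep u = (\<Sum>e\<in>E1. z e *\<^sub>C rep e)" by blast
    then have "rep u = proj (rep u)" by (simp only: proj_sum_rep)
    then show ?thesis by (rule range_eqI)
  qed
  have ysGP: "set ys \<subseteq> range proj \<times> UNIV" 
  proof (intro subsetI)
    fix y assume "y \<in> set ys"
    then have "fst y \<in> rep ` U" using U(2) by blast
    then obtain u where "u \<in> U" "fst y = rep u" by blast
    then have "fst y \<in> range proj" using repU by simp
    then show "y \<in> range proj \<times> UNIV" by (simp add: mem_Times_iff)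
  qed
  have "cmod (f (heis_list \<omega> ys)) \<le> enn2real (hol_L2_norm q \<omega> M b T f) * exp (L\<^sup>2 / (2 * T))"
    by (rule pointwise_bound_at_product[OF f T ysGP ys(3)])
  moreover have "heis_list \<omega> ys \<in> cm_group q"
    using ys(1) rep_in_group by (intro heis_list_in_group) (rule order_trans)
  then have "cmod (f (heis_list \<omega> ys) - f (heis_list \<omega> xs)) < e" using d(2) ys(2) by blast
  ultimately show "cmod (f (heis_list \<omega> xs)) \<le> enn2real (hol_L2_norm q \<omega> M b T f) * exp (L\<^sup>2 / (2 * T)) + e"
    using norm_triangle_ineq2[of "f (heis_list \<omega> xs)" "f (heis_list \<omega> ys)"] by (simp add: norm_minus_commute)
qed

end

section \<open>Lengths of paths\<close>

context wiener_heis begin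

lemma heis_velocity_in_group: "v \<in> cm_group q \<Longrightarrow> heis_velocity \<omega> x v \<in> cm_group q"
  by (auto intro!: cm_groupI dest: cm_groupD simp: heis_velocity_def)

lemma heis_velocity_bound:
  assumes x: "x \<in> cm_group q"
  obtains C where "0 < C" "\<And>v. v \<in> cm_group q \<Longrightarrow> gnorm (heis_velocity \<omega> x v) \<le> C * gnorm v"
proof -
  obtain K where K: "0 < K" "\<And>x y :: 'w \<times> 'c. x \<in> cm_group q \<Longrightarrow> y \<in> cm_group q \<Longrightarrow> norm (\<omega> (fst x) (fst y)) \<le> K * gnorm x * gnorm y"
    by (rule om_bound) blast
  show ?thesis
  proof (rule that[of "1 + K * gnorm x"])
    show "0 < 1 + K * gnorm x" using K(1) cm_group_norm_nonneg[OF x] by (simp add: add_pos_nonneg)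
    fix v :: "'w \<times> 'c" assume v: "v \<in> cm_group q"
    have "heis_velocity \<omega> x v = v + (0, - ((1/2) *\<^sub>R \<omega> (fst x) (fst v)))"
      by (simp add: heis_velocity_def prod_eq_iff)
    then have "gnorm (heis_velocity \<omega> x v) \<le> gnorm v + norm ((1/2) *\<^sub>R \<omega> (fst x) (fst v))"
      using gnorm_snd_shift(1)[OF v, of "- ((1/2) *\<^sub>R \<omega> (fst x) (fst v))"] by simp
    also have "\<dots> \<le> gnorm v + norm (\<omega> (fst x) (fst v))" by simp
    finally show "gnorm (heis_velocity \<omega> x v) \<le> (1 + K * gnorm x) * gnorm v"
      using K(2)[OF x v] by (simp add: algebra_simps)
  qed
qed

lemma heis_velocity_linear:
  "heis_velocity \<omega> x (u + v) = heis_velocity \<omega> x u + heis_velocity \<omega> x v"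
  "heis_velocity \<omega> x (r *\<^sub>R v) = r *\<^sub>R heis_velocity \<omega> x v"
  by (simp_all add: heis_velocity_def prod_eq_iff om.add_right om.scaleR_right scaleR_add_right scaleR_diff_right)

text \<open>The group element that leads from \<open>x\<close> to \<open>y\<close>.\<close>

definition gdiff :: "'w \<times> 'c \<Rightarrow> 'w \<times> 'c \<Rightarrow> 'w \<times> 'c" where
  "gdiff x y = heis_mult \<omega> (- x) y"

lemma gdiff_trans: "heis_mult \<omega> (gdiff x y) (gdiff y z) = gdiff x z"
proof -
  have "heis_mult \<omega> y (- y) = 0" by (simp add: heis_mult_def om.minus_right om_self prod_eq_iff)
  then have "heis_mult \<omega> y (gdiff y z) = z" by (simp add: gdiff_def heis_mult_assoc[symmetric] heis_mult_unit)
  then show ?thesis by (simp add: gdiff_def heis_mult_assoc)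
qed

text \<open>An exact identity, since \<open>\<omega>\<close> vanishes on the diagonal.\<close>

lemma gdiff_velocity: "gdiff x y = heis_velocity \<omega> x (y - x)"
  by (simp add: gdiff_def heis_mult_def heis_velocity_def om.minus_left om.diff_right om_self prod_eq_iff)

lemma gdiff_swap: "gdiff y x = - gdiff x y"
proof -
  have "\<omega> (fst y) (fst x) = - \<omega> (fst x) (fst y)" by (rule om_skew)
  then show ?thesis by (simp add: gdiff_def heis_mult_def om.minus_left prod_eq_iff)
qed

context
  fixes \<sigma> \<sigma>' :: "real \<Rightarrow> 'w \<times> 'c"
  assumes C1: "cm_C1_path q \<sigma> \<sigma>'"
begin

definition speed :: "real \<Rightarrow> real" where "speed s = gnorm (heis_velocity \<omega> (\<sigma> s) (\<sigma>' s))"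

lemma path_in_group: "s \<in> {0..1} \<Longrightarrow> \<sigma> s \<in> cm_group q" "s \<in> {0..1} \<Longrightarrow> \<sigma>' s \<in> cm_group q"
  using C1 by (auto simp: cm_C1_path_def)

lemma path_limits: "s \<in> {0..1} \<Longrightarrow> ((\<lambda>r. gnorm ((\<sigma> r - \<sigma> s) /\<^sub>R (r - s) - \<sigma>' s)) \<longlongrightarrow> 0) (at s within {0..1})"
    "s \<in> {0..1} \<Longrightarrow> ((\<lambda>r. gnorm (\<sigma>' r - \<sigma>' s)) \<longlongrightarrow> 0) (at s within {0..1})"
  using C1 by (auto simp: cm_C1_path_def)

lemma fst_tendsto:
  fixes X :: "real \<Rightarrow> 'w \<times> 'c"
  assumes "\<And>r. r \<in> {0..1} \<Longrightarrow> X r \<in> cm_group q" "s \<in> {0..1}"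
    and "((\<lambda>r. gnorm (X r - X s)) \<longlongrightarrow> 0) (at s within {0..1})"
  shows "((\<lambda>r. fst (X r)) \<longlongrightarrow> fst (X s)) (at s within {0..1})"
proof -
  have lim: "((\<lambda>r. qC * gnorm (X r - X s)) \<longlongrightarrow> qC * 0) (at s within {0..1})" by (intro tendsto_intros assms)
  have "\<forall>\<^sub>F r in at s within {0..1}. norm (fst (X r) - fst (X s)) \<le> qC * gnorm (X r - X s)"
    unfolding eventually_at_filter
  proof (intro always_eventually allI impI)
    fix r :: real assume "r \<in> {0..1}"
    then have "X r - X s \<in> cm_group q" using assms by (intro cm_group_closed(2)) auto
    from norm_fst_le_gnorm[OF this] show "norm (fst (X r) - fst (X s)) \<le> qC * gnorm (X r - X s)" by simp
  qed
  from Lim_null_comparison[OF this lim[unfolded mult_zero_right]]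
  have "((\<lambda>r. fst (X r) - fst (X s)) \<longlongrightarrow> 0) (at s within {0..1})" .
  then show ?thesis by (simp add: LIM_zero_iff)
qed

lemma path_tendsto:
  assumes s: "s \<in> {0..1}"
  shows "((\<lambda>r. gnorm (\<sigma> r - \<sigma> s)) \<longlongrightarrow> 0) (at s within {0..1})"
proof (rule Lim_null_comparison)
  let ?R = "\<lambda>r. \<bar>r - s\<bar> * (gnorm ((\<sigma> r - \<sigma> s) /\<^sub>R (r - s) - \<sigma>' s) + gnorm (\<sigma>' s))"
  have "(?R \<longlongrightarrow> \<bar>s - s\<bar> * (0 + gnorm (\<sigma>' s))) (at s within {0..1})" by (intro tendsto_intros path_limits s)
  then show "(?R \<longlongrightarrow> 0) (at s within {0..1})" by simp
  show "\<forall>\<^sub>F r in at s within {0..1}. norm (gnorm (\<sigma> r - \<sigma> s)) \<le> ?R r"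
    unfolding eventually_at_filter
  proof (intro always_eventually allI impI)
    fix r :: real assume r: "r \<noteq> s" "r \<in> {0..1}"
    let ?d = "(\<sigma> r - \<sigma> s) /\<^sub>R (r - s)"
    have d: "?d \<in> cm_group q" "?d - \<sigma>' s \<in> cm_group q" "\<sigma> r - \<sigma> s \<in> cm_group q"
      using path_in_group[OF s] path_in_group[OF r(2)] cm_group_closed(2,3) by blast+
    have "\<sigma> r - \<sigma> s = (r - s) *\<^sub>R ?d" using r(1) by simp
    then have "gnorm (\<sigma> r - \<sigma> s) = \<bar>r - s\<bar> * gnorm ?d" using cm_group_norm_scaleR[OF d(1), of "r - s"] by simp
    also have "\<dots> \<le> ?R r"
      using cm_group_norm_triangle[OF d(2) path_in_group(2)[OF s]] by (intro mult_left_mono) auto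
    finally show "norm (gnorm (\<sigma> r - \<sigma> s)) \<le> ?R r" using cm_group_norm_nonneg[OF d(3)] by simp
  qed
qed

lemma speed_continuous: "continuous_on {0..1} speed"
  unfolding continuous_on_def
proof
  fix s :: real assume s: "s \<in> {0..1}"
  let ?w = "\<lambda>r. \<omega> (fst (\<sigma> r)) (fst (\<sigma>' r))"
  let ?R = "\<lambda>r. gnorm (\<sigma>' r - \<sigma>' s) + norm ((1/2) *\<^sub>R (?w s - ?w r))"
  have 1: "((\<lambda>r. fst (\<sigma> r)) \<longlongrightarrow> fst (\<sigma> s)) (at s within {0..1})" "((\<lambda>r. fst (\<sigma>' r)) \<longlongrightarrow> fst (\<sigma>' s)) (at s within {0..1})"
    by (intro fst_tendsto path_in_group s path_tendsto path_limits; assumption)+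
  have "(?w \<longlongrightarrow> ?w s) (at s within {0..1})" by (rule om.tendsto[OF 1])
  then have "(?R \<longlongrightarrow> 0 + norm ((1/2) *\<^sub>R (?w s - ?w s))) (at s within {0..1})" by (intro tendsto_intros path_limits s)
  then have lim: "(?R \<longlongrightarrow> 0) (at s within {0..1})" by simp
  have "((\<lambda>r. speed r - speed s) \<longlongrightarrow> 0) (at s within {0..1})"
  proof (rule Lim_null_comparison[OF _ lim])
    show "\<forall>\<^sub>F r in at s within {0..1}. norm (speed r - speed s) \<le> ?R r"
      unfolding eventually_at_filter
    proof (intro always_eventually allI impI)
      fix r :: real assume r: "r \<in> {0..1}"
      let ?a = "heis_velocity \<omega> (\<sigma> r) (\<sigma>' r)" and ?b = "heis_velocity \<omega> (\<sigma> s) (\<sigma>' s)"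
      have ab: "?a \<in> cm_group q" "?b \<in> cm_group q" using path_in_group r s heis_velocity_in_group by blast+
      have d: "\<sigma>' r - \<sigma>' s \<in> cm_group q" "?a - ?b \<in> cm_group q" using path_in_group r s ab cm_group_closed(2) by blast+
      have "?a - ?b = (\<sigma>' r - \<sigma>' s) + (0, (1/2) *\<^sub>R (?w s - ?w r))"
        by (simp add: heis_velocity_def prod_eq_iff scaleR_diff_right)
      then have "gnorm (?a - ?b) \<le> ?R r" by (simp only: gnorm_snd_shift(1)[OF d(1)])
      moreover have "\<bar>gnorm ?a - gnorm ?b\<bar> \<le> gnorm (?a - ?b)"
        using cm_group_norm_triangle[OF d(2) ab(2)] cm_group_norm_triangle[OF cm_group_closed(6)[OF d(2) d(2)] ab(1)] cm_group_norm_minus[OF d(2)] by simp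
      ultimately show "norm (speed r - speed s) \<le> ?R r" by (simp add: speed_def)
    qed
  qed
  then show "(speed \<longlongrightarrow> speed s) (at s within {0..1})" by (simp add: LIM_zero_iff)
qed

lemma speed_integrable: "0 \<le> a \<Longrightarrow> b \<le> 1 \<Longrightarrow> speed integrable_on {a..b}"
  by (rule integrable_continuous_real) (rule continuous_on_subset[OF speed_continuous], auto)

text \<open>Infinitesimally the group difference of two points of the path is its velocity.\<close>

lemma gdiff_local:
  assumes x: "x \<in> {0..1}" and e: "0 < e"
  obtains d where "0 < d"
    "\<And>r. r \<in> {0..1} \<Longrightarrow> \<bar>r - x\<bar> < d \<Longrightarrow> gnorm (gdiff (\<sigma> x) (\<sigma> r)) \<le> \<bar>r - x\<bar> * (speed x + e)"
    "\<And>r. r \<in> {0..1} \<Longrightarrow> \<bar>r - x\<bar> < d \<Longrightarrow> speed x \<le> speed r + e"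
proof -
  obtain C where C: "0 < C" "\<And>v. v \<in> cm_group q \<Longrightarrow> gnorm (heis_velocity \<omega> (\<sigma> x) v) \<le> C * gnorm v"
    by (rule heis_velocity_bound[OF path_in_group(1)[OF x]]) blast
  have eC: "0 < e / C" using e C by simp
  obtain d1 where d1: "0 < d1" "\<And>r. r \<in> {0..1} \<Longrightarrow> r \<noteq> x \<Longrightarrow> \<bar>r - x\<bar> < d1 \<Longrightarrow> gnorm ((\<sigma> r - \<sigma> x) /\<^sub>R (r - x) - \<sigma>' x) < e / C"
    using order_tendstoD(2)[OF path_limits(1)[OF x] eC] unfolding eventually_at by (auto simp: dist_real_def)
  obtain d2 where d2: "0 < d2" "\<And>r. r \<in> {0..1} \<Longrightarrow> \<bar>r - x\<bar> < d2 \<Longrightarrow> \<bar>speed r - speed x\<bar> < e"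
    using speed_continuous x e unfolding continuous_on_iff dist_real_def by meson
  show ?thesis
  proof (rule that[of "min d1 d2"])
    show "0 < min d1 d2" using d1 d2 by simp
    fix r :: real assume r: "r \<in> {0..1}" "\<bar>r - x\<bar> < min d1 d2"
    show "speed x \<le> speed r + e" using d2(2)[of r] r by auto
    show "gnorm (gdiff (\<sigma> x) (\<sigma> r)) \<le> \<bar>r - x\<bar> * (speed x + e)"
    proof (cases "r = x")
      case True
      have "gdiff (\<sigma> x) (\<sigma> x) = 0" by (simp add: gdiff_velocity heis_velocity_def om.zero_right zero_prod_def)
      then show ?thesis using True by (simp add: gnorm_zero)
    next
      case False
      let ?d = "(\<sigma> r - \<sigma> x) /\<^sub>R (r - x)"
      have d: "?d - \<sigma>' x \<in> cm_group q"
        using path_in_group[OF x] path_in_group[OF r(1)] cm_group_closed(2,3) by blast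
      let ?u = "\<sigma>' x + (?d - \<sigma>' x)"
      have u: "?u \<in> cm_group q" using cm_group_closed(1)[OF path_in_group(2)[OF x] d] .
      have "\<sigma> r - \<sigma> x = (r - x) *\<^sub>R ?u" using False by simp
      then have "heis_velocity \<omega> (\<sigma> x) (\<sigma> r - \<sigma> x) = heis_velocity \<omega> (\<sigma> x) ((r - x) *\<^sub>R ?u)" by (rule arg_cong)
      then have "gdiff (\<sigma> x) (\<sigma> r) = (r - x) *\<^sub>R heis_velocity \<omega> (\<sigma> x) ?u"
        unfolding gdiff_velocity heis_velocity_linear(2) .
      then have "gnorm (gdiff (\<sigma> x) (\<sigma> r)) = \<bar>r - x\<bar> * gnorm (heis_velocity \<omega> (\<sigma> x) ?u)"
        using cm_group_norm_scaleR[OF heis_velocity_in_group[OF u]] by simp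
      also have "\<dots> \<le> \<bar>r - x\<bar> * (speed x + e)"
      proof (rule mult_left_mono)
        have "gnorm (heis_velocity \<omega> (\<sigma> x) ?u) \<le> speed x + gnorm (heis_velocity \<omega> (\<sigma> x) (?d - \<sigma>' x))"
          unfolding speed_def heis_velocity_linear(1)
          by (intro cm_group_norm_triangle heis_velocity_in_group path_in_group x d)
        also have "\<dots> \<le> speed x + C * (e / C)"
          using d1(2)[OF r(1) False] r(2) C(1) by (intro add_left_mono order_trans[OF C(2)[OF d]] mult_left_mono) auto
        finally show "gnorm (heis_velocity \<omega> (\<sigma> x) ?u) \<le> speed x + e" using C(1) by simp
      qed simp
      finally show ?thesis .
    qed
  qed
qed

text \<open>The property to be shown is additive over adjacent intervals, and near every point it holds with a
  product of two factors, one for each side of the point; bisection extends it to the unit interval.\<close>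

lemma path_product:
  assumes e: "0 < e"
  shows "\<exists>xs. set xs \<subseteq> cm_group q \<and> heis_list \<omega> xs = gdiff (\<sigma> 0) (\<sigma> 1) \<and>
    (\<Sum>x\<leftarrow>xs. gnorm x) \<le> cm_length q \<omega> \<sigma> \<sigma>' + e"
proof -
  \<comment> \<open>The bisection principle asks for the local property on all small intervals around a point,
    including those that leave the unit interval; there it holds vacuously.\<close>
  define P where "P p r \<longleftrightarrow> (0 \<le> p \<and> r \<le> 1 \<longrightarrow> (\<exists>xs. set xs \<subseteq> cm_group q \<and> heis_list \<omega> xs = gdiff (\<sigma> p) (\<sigma> r) \<and>
    (\<Sum>x\<leftarrow>xs. gnorm x) \<le> integral {p..r} speed + e * (r - p)))" for p r
  have "P 0 1"
  proof (rule Bolzano)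
    fix p s r assume P: "P p s" "P s r" and le: "p \<le> s" "s \<le> r"
    show "P p r"
      unfolding P_def
    proof
      assume pr: "0 \<le> p \<and> r \<le> 1"
      obtain xs where xs: "set xs \<subseteq> cm_group q" "heis_list \<omega> xs = gdiff (\<sigma> p) (\<sigma> s)"
          "(\<Sum>x\<leftarrow>xs. gnorm x) \<le> integral {p..s} speed + e * (s - p)"
        using P(1) pr le unfolding P_def by fastforce
      obtain ys where ys: "set ys \<subseteq> cm_group q" "heis_list \<omega> ys = gdiff (\<sigma> s) (\<sigma> r)"
          "(\<Sum>x\<leftarrow>ys. gnorm x) \<le> integral {s..r} speed + e * (r - s)"
        using P(2) pr le unfolding P_def by fastforce
      have "integral {p..s} speed + integral {s..r} speed = integral {p..r} speed"
        using pr by (intro Henstock_Kurzweil_Integration.integral_combine le speed_integrable) auto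
      then have "(\<Sum>x\<leftarrow>xs @ ys. gnorm x) \<le> integral {p..r} speed + e * (r - p)"
        using xs(3) ys(3) by (simp add: algebra_simps)
      then show "\<exists>xs. set xs \<subseteq> cm_group q \<and> heis_list \<omega> xs = gdiff (\<sigma> p) (\<sigma> r) \<and>
          (\<Sum>x\<leftarrow>xs. gnorm x) \<le> integral {p..r} speed + e * (r - p)"
        using xs(1,2) ys(1,2) by (intro exI[of _ "xs @ ys"]) (simp add: heis_list_append gdiff_trans)
    qed
  next
    fix x :: real assume x: "0 \<le> x" "x \<le> 1"
    have x': "x \<in> {0..1}" using x by simp
    have e2: "0 < e / 2" using e by simp
    obtain d where d: "0 < d"
      "\<And>r. r \<in> {0..1} \<Longrightarrow> \<bar>r - x\<bar> < d \<Longrightarrow> gnorm (gdiff (\<sigma> x) (\<sigma> r)) \<le> \<bar>r - x\<bar> * (speed x + e / 2)"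
      "\<And>r. r \<in> {0..1} \<Longrightarrow> \<bar>r - x\<bar> < d \<Longrightarrow> speed x \<le> speed r + e / 2"
      by (rule gdiff_local[OF x' e2]) blast
    show "\<exists>d>0. \<forall>p r. p \<le> x \<and> x \<le> r \<and> r - p < d \<longrightarrow> P p r"
    proof (intro exI[of _ d] conjI d(1) allI impI)
      fix p r assume pr: "p \<le> x \<and> x \<le> r \<and> r - p < d"
      show "P p r"
        unfolding P_def
      proof
        assume b: "0 \<le> p \<and> r \<le> 1"
        let ?xs = "[gdiff (\<sigma> p) (\<sigma> x), gdiff (\<sigma> x) (\<sigma> r)]"
        have G: "\<sigma> p \<in> cm_group q" "\<sigma> x \<in> cm_group q" "\<sigma> r \<in> cm_group q" using path_in_group(1) pr b by auto
        have g: "gdiff (\<sigma> p) (\<sigma> x) \<in> cm_group q" "gdiff (\<sigma> x) (\<sigma> r) \<in> cm_group q" "gdiff (\<sigma> x) (\<sigma> p) \<in> cm_group q"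
          unfolding gdiff_velocity by (intro heis_velocity_in_group cm_group_closed(2) G)+
        have "gnorm (gdiff (\<sigma> p) (\<sigma> x)) = gnorm (gdiff (\<sigma> x) (\<sigma> p))"
          using gdiff_swap[of "\<sigma> p" "\<sigma> x"] cm_group_norm_minus[OF g(3)] by simp
        also have "\<dots> \<le> (x - p) * (speed x + e / 2)" using d(2)[of p] pr b by auto
        finally have 1: "gnorm (gdiff (\<sigma> p) (\<sigma> x)) \<le> (x - p) * (speed x + e / 2)" .
        have 2: "gnorm (gdiff (\<sigma> x) (\<sigma> r)) \<le> (r - x) * (speed x + e / 2)" using d(2)[of r] pr b by auto
        have "integral {p..r} (\<lambda>_. speed x - e / 2) \<le> integral {p..r} speed"
          using d(3) pr b by (intro integral_le speed_integrable) (auto simp: diff_le_eq)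
        then have 3: "(r - p) * (speed x - e / 2) \<le> integral {p..r} speed" using pr by simp
        have "(\<Sum>x\<leftarrow>?xs. gnorm x) \<le> integral {p..r} speed + e * (r - p)"
        proof -
          have "(x - p) * (speed x + e / 2) + (r - x) * (speed x + e / 2) = (r - p) * (speed x - e / 2) + e * (r - p)"
            by (simp add: field_simps)
          then show ?thesis using 1 2 3 by simp
        qed
        moreover have "heis_list \<omega> ?xs = gdiff (\<sigma> p) (\<sigma> r)"
          by (simp add: heis_list_Cons gdiff_trans) (simp add: heis_list_def heis_mult_unit gdiff_trans)
        ultimately show "\<exists>xs. set xs \<subseteq> cm_group q \<and> heis_list \<omega> xs = gdiff (\<sigma> p) (\<sigma> r) \<and>
          (\<Sum>x\<leftarrow>xs. gnorm x) \<le> integral {p..r} speed + e * (r - p)"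
          using g by (intro exI[of _ ?xs]) simp
      qed
    qed
  qed simp
  then show ?thesis by (simp add: P_def cm_length_def speed_def[abs_def])
qed

end

text \<open>The infimum that defines the distance is thus over a nonempty set.\<close>

lemma straight_path:
  fixes g :: "'w \<times> 'c"
  assumes g: "g \<in> cm_group q"
  shows "cm_C1_path q (\<lambda>t. t *\<^sub>R g) (\<lambda>_. g)"
  unfolding cm_C1_path_def
proof (intro ballI conjI)
  fix s :: real assume "s \<in> {0..1}"
  show "s *\<^sub>R g \<in> cm_group q" "g \<in> cm_group q" using g cm_group_closed(3)[OF g g] by blast+
  show "((\<lambda>r. gnorm ((r *\<^sub>R g - s *\<^sub>R g) /\<^sub>R (r - s) - g)) \<longlongrightarrow> 0) (at s within {0..1})"
    by (rule tendsto_eventually) (simp add: eventually_at_filter scaleR_diff_left[symmetric] gnorm_zero)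
qed (simp add: gnorm_zero)

lemma cm_dist_product:
  fixes g :: "'w \<times> 'c"
  assumes g: "g \<in> cm_group q" and L: "cm_dist q \<omega> (0, 0) g < L"
  obtains xs where "set xs \<subseteq> cm_group q" "heis_list \<omega> xs = g" "(\<Sum>x\<leftarrow>xs. gnorm x) < L"
proof -
  let ?S = "{cm_length q \<omega> \<sigma> \<sigma>' | \<sigma> \<sigma>'. cm_C1_path q \<sigma> \<sigma>' \<and> \<sigma> 0 = (0, 0) \<and> \<sigma> 1 = g}"
  have "cm_length q \<omega> (\<lambda>t. t *\<^sub>R g) (\<lambda>_. g) \<in> ?S"
    using straight_path[OF g] by (intro CollectI exI[of _ "\<lambda>t. t *\<^sub>R g"] exI[of _ "\<lambda>_. g"]) (simp add: zero_prod_def)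
  then have "?S \<noteq> {}" by blast
  then obtain \<sigma> \<sigma>' where p: "cm_C1_path q \<sigma> \<sigma>'" "\<sigma> 0 = (0, 0)" "\<sigma> 1 = g" "cm_length q \<omega> \<sigma> \<sigma>' < L"
    using cInf_lessD[of ?S L] L unfolding cm_dist_def by blast
  obtain xs where xs: "set xs \<subseteq> cm_group q" "heis_list \<omega> xs = gdiff (\<sigma> 0) (\<sigma> 1)"
    "(\<Sum>x\<leftarrow>xs. gnorm x) \<le> cm_length q \<omega> \<sigma> \<sigma>' + (L - cm_length q \<omega> \<sigma> \<sigma>') / 2"
    using path_product[OF p(1), of "(L - cm_length q \<omega> \<sigma> \<sigma>') / 2"] p(4) by auto
  have "gdiff (\<sigma> 0) (\<sigma> 1) = g" using heis_mult_unit(1)[of g] by (simp add: gdiff_def p zero_prod_def)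
  moreover have "(\<Sum>x\<leftarrow>xs. gnorm x) < L" using xs(3) p(4) by argo
  ultimately show ?thesis using xs(1,2) by (intro that[of xs]) simp_all
qed

end

section \<open>The pointwise bound\<close>

theorem theorem6p11:
  fixes \<mu> :: "'w::{complex_normed_vector, banach, second_countable_topology} measure"
    and q :: "('w \<Rightarrow>\<^sub>L real) \<Rightarrow> ('w \<Rightarrow>\<^sub>L real) \<Rightarrow> real"
    and \<omega> :: "'w \<Rightarrow> 'w \<Rightarrow> 'c::fin_dim_complex_inner_space"
    and M :: "'a measure" and b :: "real \<Rightarrow> 'a \<Rightarrow> 'w \<times> 'c"
    and T :: real and f :: "'w \<times> 'c \<Rightarrow> complex"
  assumes "complex_wiener_space \<mu> q"
    and "heis_form \<omega>"
    and "cm_brownian_motion q M b"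
    and "0 < T"
    and "f \<in> hol_L2 q \<omega> M b T"
  shows "\<forall>g \<in> cm_group q.
    cmod (f g) \<le> enn2real (hol_L2_norm q \<omega> M b T f) * exp ((cm_dist q \<omega> (0, 0) g)\<^sup>2 / (2 * T))"
proof
  fix g :: "'w \<times> 'c" assume g: "g \<in> cm_group q"
  interpret wiener_heis \<mu> q \<omega>
    by (intro wiener_heis.intro cwiener.intro heis.intro assms)
  let ?K = "enn2real (hol_L2_norm q \<omega> M b T f)" and ?d = "cm_dist q \<omega> (0, 0) g"
  have bound: "cmod (f g) \<le> ?K * exp (L\<^sup>2 / (2 * T))" if L: "?d < L" for L
  proof -
    obtain xs where xs: "set xs \<subseteq> cm_group q" "heis_list \<omega> xs = g" "(\<Sum>x\<leftarrow>xs. gnorm x) < L"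
      by (rule cm_dist_product[OF g L])
    show ?thesis using pointwise_bound_at_group_product[OF assms(3,5,4) xs(1,3)] unfolding xs(2) .
  qed
  have "((\<lambda>L. ?K * exp (L\<^sup>2 / (2 * T))) \<longlongrightarrow> ?K * exp (?d\<^sup>2 / (2 * T))) (at_right ?d)"
    using assms(4) by (intro tendsto_intros) auto
  then show "cmod (f g) \<le> ?K * exp (?d\<^sup>2 / (2 * T))"
    by (rule tendsto_lowerbound) (auto simp: eventually_at_filter intro!: always_eventually bound)
qed

end
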